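(* Let $m,n\ge 1$. The following closed subgroups are parabolically connected: (i) $\mathrm{SL}(m)\times\mathrm{SL}(n)\subset\mathrm{SL}(m+n)$ for all $m,n$; (ii) $\mathrm{S}(\mathrm{GL}(m)\times\mathrm{GL}(n))\subset\mathrm{SL}(m+n)$ for $m\neq n$; (iii) $\mathrm{Sp}(2n)\subset\mathrm{SL}(2n)$; (iv) $\mathrm{Sp}(2n)\subset\mathrm{SL}(2n+1)$; (v) $\mathrm{Sp}(2n)\times\mathrm{T}^1\subset\mathrm{SL}(2n+1)$. On the other hand, the following subgroups are not parabolically connected: (vi) $\mathrm{SO}(n)\subset\mathrm{SL}(n)$ for $n\ge 2$; (vii) $\mathrm{S}(\mathrm{GL}(n)\times\mathrm{GL}(n))\subset\mathrm{SL}(2n)$.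
   Context: All groups are linear algebraic groups over $\mathbb{C}$ with the Zariski topology. A closed subgroup $H$ of a reductive group $G$ is called parabolically connected if for every parabolic subgroup $P\subseteq G$ the intersection $P\cap H$ is connected. Embeddings: $\mathrm{SL}(m)\times\mathrm{SL}(n)$ and $\mathrm{S}(\mathrm{GL}(m)\times\mathrm{GL}(n))$ denote the subgroups of $\mathrm{SL}(m+n)$ of block-diagonal matrices $\mathrm{diag}(A,B)$ with $A$ of size $m$, $B$ of size $n$, where respectively $\det A=\det B=1$, or $\det A\cdot\det B=1$. $\mathrm{Sp}(2n)\subset\mathrm{SL}(2n)$ is the group preserving a nondegenerate skew-symmetric bilinear form on $\mathbb{C}^{2n}$. $\mathrm{Sp}(2n)\subset\mathrm{SL}(2n+1)$: writing $\mathbb{C}^{2n+1}=U\oplus\langle e_{2n+1}\rangle$ with $\dim U=2n$, it is the group of matrices acting on $U$ as an element of $\mathrm{Sp}(U)$ (for a fixed nondegenerate skew form on $U$) and fixing $e_{2n+1}$. $\mathrm{T}^1=\{t(\lambda)=\mathrm{diag}(\lambda,\dots,\lambda,\lambda^{-2n}):\lambda\in\mathbb{C}^\times\}\subset\mathrm{SL}(2n+1)$ (acting by $\lambda$ on $U$ and by $\lambda^{-2n}$ on $e_{2n+1}$), and $\mathrm{Sp}(2n)\times\mathrm{T}^1$ is the subgroup generated by these two commuting subgroups. $\mathrm{SO}(n)\subset\mathrm{SL}(n)$ is the special orthogonal group of a nondegenerate symmetric bilinear form on $\mathbb{C}^n$. *)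

theory Defs
  imports "Jordan_Normal_Form.Determinant" "HOL-Algebra.Solvable_Groups"
begin

definition mat_grp :: "nat \<Rightarrow> complex mat set \<Rightarrow> complex mat monoid" where
  "mat_grp N H = \<lparr> carrier = H, mult = (\<lambda>A B. A * B), one = 1\<^sub>m N \<rparr>"

definition SL :: "nat \<Rightarrow> complex mat set" where
  "SL N = {A \<in> carrier_mat N N. det A = 1}"

inductive_set poly_fun :: "nat \<Rightarrow> (complex mat \<Rightarrow> complex) set" for N :: nat where
  pf_const: "(\<lambda>A. c) \<in> poly_fun N"
| pf_coord: "i < N \<Longrightarrow> j < N \<Longrightarrow> (\<lambda>A. A $$ (i, j)) \<in> poly_fun N"
| pf_add: "f \<in> poly_fun N \<Longrightarrow> g \<in> poly_fun N \<Longrightarrow> (\<lambda>A. f A + g A) \<in> poly_fun N"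
| pf_mult: "f \<in> poly_fun N \<Longrightarrow> g \<in> poly_fun N \<Longrightarrow> (\<lambda>A. f A * g A) \<in> poly_fun N"

definition zariski_closed :: "nat \<Rightarrow> complex mat set \<Rightarrow> bool" where
  "zariski_closed N S \<longleftrightarrow>
     (\<exists>F \<subseteq> poly_fun N. S = {A \<in> carrier_mat N N. \<forall>f \<in> F. f A = 0})"

definition zariski_connected :: "nat \<Rightarrow> complex mat set \<Rightarrow> bool" where
  "zariski_connected N X \<longleftrightarrow>
     \<not> (\<exists>C D. zariski_closed N C \<and> zariski_closed N D \<and> X \<subseteq> C \<union> D \<and>
             X \<inter> C \<inter> D = {} \<and> X \<inter> C \<noteq> {} \<and> X \<inter> D \<noteq> {})"

definition closed_subgroup :: "nat \<Rightarrow> complex mat set \<Rightarrow> complex mat set \<Rightarrow> bool" where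
  "closed_subgroup N H G \<longleftrightarrow> subgroup H (mat_grp N G) \<and> zariski_closed N H"

definition borel_subgroup :: "nat \<Rightarrow> complex mat set \<Rightarrow> complex mat set \<Rightarrow> bool" where
  "borel_subgroup N G B \<longleftrightarrow>
     closed_subgroup N B G \<and> zariski_connected N B \<and> solvable (mat_grp N B) \<and>
     (\<forall>B'. closed_subgroup N B' G \<and> zariski_connected N B' \<and> solvable (mat_grp N B')
            \<and> B \<subseteq> B' \<longrightarrow> B' = B)"

definition parabolic_subgroup :: "nat \<Rightarrow> complex mat set \<Rightarrow> complex mat set \<Rightarrow> bool" where
  "parabolic_subgroup N G P \<longleftrightarrow>
     closed_subgroup N P G \<and> (\<exists>B. borel_subgroup N G B \<and> B \<subseteq> P)"

definition parabolically_connected :: "nat \<Rightarrow> complex mat set \<Rightarrow> complex mat set \<Rightarrow> bool" where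
  "parabolically_connected N G H \<longleftrightarrow>
     closed_subgroup N H G \<and>
     (\<forall>P. parabolic_subgroup N G P \<longrightarrow> zariski_connected N (P \<inter> H))"

definition blockdiag :: "complex mat \<Rightarrow> complex mat \<Rightarrow> complex mat" where
  "blockdiag A B = four_block_mat A (0\<^sub>m (dim_row A) (dim_col B)) (0\<^sub>m (dim_row B) (dim_col A)) B"

definition SLxSL :: "nat \<Rightarrow> nat \<Rightarrow> complex mat set" where
  "SLxSL m n = {blockdiag A B | A B. A \<in> carrier_mat m m \<and> B \<in> carrier_mat n n \<and>
                                     det A = 1 \<and> det B = 1}"

definition SGLxGL :: "nat \<Rightarrow> nat \<Rightarrow> complex mat set" where
  "SGLxGL m n = {blockdiag A B | A B. A \<in> carrier_mat m m \<and> B \<in> carrier_mat n n \<and>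
                                      det A * det B = 1}"

definition skew_nondeg :: "nat \<Rightarrow> complex mat \<Rightarrow> bool" where
  "skew_nondeg N \<Omega> \<longleftrightarrow> \<Omega> \<in> carrier_mat N N \<and> transpose_mat \<Omega> = - \<Omega> \<and> det \<Omega> \<noteq> 0"

definition sym_nondeg :: "nat \<Rightarrow> complex mat \<Rightarrow> bool" where
  "sym_nondeg N Q \<longleftrightarrow> Q \<in> carrier_mat N N \<and> transpose_mat Q = Q \<and> det Q \<noteq> 0"

definition Sp :: "nat \<Rightarrow> complex mat \<Rightarrow> complex mat set" where
  "Sp N \<Omega> = {A \<in> carrier_mat N N. transpose_mat A * \<Omega> * A = \<Omega>}"

definition Sp_ext :: "nat \<Rightarrow> complex mat \<Rightarrow> complex mat set" where
  "Sp_ext n \<Omega> = {blockdiag A (1\<^sub>m 1) | A. A \<in> Sp (2*n) \<Omega>}"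

definition T1 :: "nat \<Rightarrow> complex mat set" where
  "T1 n = {blockdiag (l \<cdot>\<^sub>m 1\<^sub>m (2*n)) (mat 1 1 (\<lambda>_. inverse l ^ (2*n))) | l. l \<noteq> 0}"

text \<open>Sp(2n) x T^1: generated by the two commuting subgroups, i.e. their product set.\<close>
definition SpxT1 :: "nat \<Rightarrow> complex mat \<Rightarrow> complex mat set" where
  "SpxT1 n \<Omega> = {S * T | S T. S \<in> Sp_ext n \<Omega> \<and> T \<in> T1 n}"

definition SO :: "nat \<Rightarrow> complex mat \<Rightarrow> complex mat set" where
  "SO N Q = {A \<in> carrier_mat N N. transpose_mat A * Q * A = Q \<and> det A = 1}"

end

theory Submission
  imports "HOL-Analysis.Path_Connected" Defs "Jordan_Normal_Form.Schur_Decomposition"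
begin

text \<open>By the Lie-Kolchin theorem the Borel subgroups of \<open>SL(N)\<close> are the stabilizers of complete flags, and
  every element of a parabolic subgroup \<open>P\<close> lies in a Borel subgroup contained in \<open>P\<close>. Hence a closed
  subgroup \<open>H\<close> is parabolically connected as soon as, for each flag, every element of \<open>H\<close> stabilizing
  the flag can be joined to \<open>1\<close> among such elements.

  For isometry groups the joining path is a Cayley path, once the eigenvalue \<open>-1\<close> has been removed by
  a torus. In a basis adapted to the flag, the two blocks of \<open>SL(m) x SL(n)\<close> become the image and the
  kernel of an idempotent \<open>E\<close>, and the segment from \<open>1\<close> to \<open>x\<close> is corrected by triangular tori
  commuting with \<open>E\<close>. Which tori exist depends on the positions at which the flag jumps in the two
  spaces; for \<open>S(GL(m) x GL(n))\<close> one only needs the two sets of positions to differ, which \<open>m \<noteq> n\<close>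
  guarantees. For \<open>Sp(2n) x T\<^sup>1\<close> a triangular torus acting with weight \<open>1\<close> on the fixed line exists by
  duality, and it reduces the claim to \<open>Sp(2n)\<close>.

  In the two negative cases an explicit flag is exhibited whose stabilizer in \<open>H\<close> carries a regular
  function with values \<open>1\<close> and \<open>-1\<close> only, both of which occur.\<close>


unbundle no vec_syntax
no_notation inner (infix "\<bullet>" 70)

section \<open>Regular functions and Zariski links\<close>

text \<open>Connectedness is handled through \<open>zlink\<close>, membership in a common clopen
  piece: such links compose, survive regular maps and enlargement of the set, and come from
  continuous families over a connected subset of the complex plane, because polynomials are
  continuous. The families are rational in the parameter, so finitely many singular parameters must
  be removed; this is harmless in the plane but would cut a real interval. The obstacle is that a
  correcting torus must lie in \<open>H\<close> and at the same time be triangular for the given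
  flag. Tori are therefore built from triangular idempotents: polynomials in a triangular matrix, or
  combinations of rank-one matrices \<open>v f^T\<close> whose supports fit the flag. For
  \<open>Sp(2n)\<close> in \<open>SL(2n+1)\<close> the form is extended by 1 on the fixed line,
  which makes it nondegenerate and leaves it alternating where the eigenvalue -1 has to be removed.
  For \<open>Sp(2n) x T^1\<close> duality yields only an infinitesimal generator. Its spectral
  projections at 1 and -1 are adjoint to each other, and they integrate to a torus with integral
  weights.\<close>

lemma mult_entry:
  assumes "A \<in> carrier_mat n k" "B \<in> carrier_mat k m" "i < n" "j < m"
  shows "(A * B) $$ (i, j) = (\<Sum>l<k. A $$ (i, l) * B $$ (l, j))"
  using assms by (auto simp: scalar_prod_def atLeast0LessThan intro!: sum.cong)

text \<open>Agreement with a polynomial is asked on \<open>N\<close> by \<open>N\<close> matrices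
  only, because \<open>det\<close> and \<open>adj_mat\<close> inspect the dimensions of their
  argument and are polynomial only there.\<close>

definition regular_fun :: "nat \<Rightarrow> (complex mat \<Rightarrow> complex) \<Rightarrow> bool" where
  "regular_fun N f \<longleftrightarrow> (\<exists>p \<in> poly_fun N. \<forall>A \<in> carrier_mat N N. f A = p A)"

definition regular_map :: "nat \<Rightarrow> nat \<Rightarrow> (complex mat \<Rightarrow> complex mat) \<Rightarrow> bool" where
  "regular_map N k F \<longleftrightarrow> (\<forall>A \<in> carrier_mat N N. F A \<in> carrier_mat k k) \<and>
     (\<forall>i<k. \<forall>j<k. regular_fun N (\<lambda>A. F A $$ (i, j)))"

lemma regular_map_carrier: "regular_map N k F \<Longrightarrow> A \<in> carrier_mat N N \<Longrightarrow> F A \<in> carrier_mat k k"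
  by (auto simp: regular_map_def)

lemma regular_map_entry: "regular_map N k F \<Longrightarrow> i < k \<Longrightarrow> j < k \<Longrightarrow> regular_fun N (\<lambda>A. F A $$ (i, j))"
  by (auto simp: regular_map_def)

lemma regular_fun_cong:
  assumes "regular_fun N g" "\<And>A. A \<in> carrier_mat N N \<Longrightarrow> f A = g A"
  shows "regular_fun N f"
  using assms unfolding regular_fun_def by metis

lemma regular_fun_const: "regular_fun N (\<lambda>A. c)"
  unfolding regular_fun_def by (rule bexI[OF _ pf_const[of c]]) simp

lemma regular_fun_coord: "i < N \<Longrightarrow> j < N \<Longrightarrow> regular_fun N (\<lambda>A. A $$ (i, j))"
  unfolding regular_fun_def by (rule bexI[OF _ pf_coord[of i N j]]) simp_all

lemma regular_fun_add:
  assumes "regular_fun N f" "regular_fun N g"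
  shows "regular_fun N (\<lambda>A. f A + g A)"
proof -
  obtain p q where "p \<in> poly_fun N" "q \<in> poly_fun N"
    "\<forall>A \<in> carrier_mat N N. f A = p A" "\<forall>A \<in> carrier_mat N N. g A = q A"
    using assms unfolding regular_fun_def by blast
  then show ?thesis unfolding regular_fun_def
    by (intro bexI[of _ "\<lambda>A. p A + q A"]) (auto intro: pf_add)
qed

lemma regular_fun_mult:
  assumes "regular_fun N f" "regular_fun N g"
  shows "regular_fun N (\<lambda>A. f A * g A)"
proof -
  obtain p q where "p \<in> poly_fun N" "q \<in> poly_fun N"
    "\<forall>A \<in> carrier_mat N N. f A = p A" "\<forall>A \<in> carrier_mat N N. g A = q A"
    using assms unfolding regular_fun_def by blast
  then show ?thesis unfolding regular_fun_def
    by (intro bexI[of _ "\<lambda>A. p A * q A"]) (auto intro: pf_mult)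
qed

lemma regular_fun_uminus: "regular_fun N f \<Longrightarrow> regular_fun N (\<lambda>A. - f A)"
  using regular_fun_mult[OF regular_fun_const[of N "-1"], of f] by simp

lemma regular_fun_diff: "regular_fun N f \<Longrightarrow> regular_fun N g \<Longrightarrow> regular_fun N (\<lambda>A. f A - g A)"
  using regular_fun_add[OF _ regular_fun_uminus, of N f g] by simp

lemma regular_fun_sum:
  "(\<And>i. i \<in> I \<Longrightarrow> regular_fun N (f i)) \<Longrightarrow> regular_fun N (\<lambda>A. \<Sum>i\<in>I. f i A)"
  by (induction I rule: infinite_finite_induct) (simp_all add: regular_fun_add regular_fun_const)

lemma regular_fun_prod:
  "(\<And>i. i \<in> I \<Longrightarrow> regular_fun N (f i)) \<Longrightarrow> regular_fun N (\<lambda>A. \<Prod>i\<in>I. f i A)"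
  by (induction I rule: infinite_finite_induct) (simp_all add: regular_fun_mult regular_fun_const)

lemma poly_fun_comp:
  assumes "regular_map N k F" "f \<in> poly_fun k"
  shows "regular_fun N (\<lambda>A. f (F A))"
  using assms(2)
proof induction
  case (pf_const c)
  show ?case by (rule regular_fun_const)
next
  case (pf_coord i j)
  then show ?case by (rule regular_map_entry[OF assms(1)])
next
  case (pf_add f g)
  then show ?case by (intro regular_fun_add)
next
  case (pf_mult f g)
  then show ?case by (intro regular_fun_mult)
qed

lemma regular_fun_comp:
  assumes "regular_map N k F" "regular_fun k f"
  shows "regular_fun N (\<lambda>A. f (F A))"
proof -
  obtain p where "p \<in> poly_fun k" "\<forall>A \<in> carrier_mat k k. f A = p A"
    using assms(2) unfolding regular_fun_def by blast
  with poly_fun_comp[OF assms(1)] regular_map_carrier[OF assms(1)] show ?thesis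
    by (auto intro: regular_fun_cong)
qed

lemma regular_map_comp:
  "regular_map N k F \<Longrightarrow> regular_map k l G \<Longrightarrow> regular_map N l (\<lambda>A. G (F A))"
  unfolding regular_map_def[of N l] regular_map_def[of k l]
  using regular_fun_comp regular_map_carrier by blast

lemma regular_map_id: "regular_map N N (\<lambda>A. A)"
  by (auto simp: regular_map_def regular_fun_coord)

lemma regular_map_const: "C \<in> carrier_mat k k \<Longrightarrow> regular_map N k (\<lambda>A. C)"
  by (auto simp: regular_map_def regular_fun_const)

lemma regular_map_mult:
  assumes F: "regular_map N k F" and G: "regular_map N k G"
  shows "regular_map N k (\<lambda>A. F A * G A)"
  unfolding regular_map_def
proof (intro conjI ballI allI impI)
  fix i j assume "i < k" "j < k"
  then have "regular_fun N (\<lambda>A. \<Sum>l<k. F A $$ (i, l) * G A $$ (l, j))"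
    by (intro regular_fun_sum regular_fun_mult regular_map_entry[OF F] regular_map_entry[OF G]) auto
  then show "regular_fun N (\<lambda>A. (F A * G A) $$ (i, j))"
    by (rule regular_fun_cong)
      (rule mult_entry[OF regular_map_carrier[OF F] regular_map_carrier[OF G]], use \<open>i < k\<close> \<open>j < k\<close> in auto)
qed (auto intro!: mult_carrier_mat regular_map_carrier[OF F] regular_map_carrier[OF G])

lemma regular_map_add:
  assumes F: "regular_map N k F" and G: "regular_map N k G"
  shows "regular_map N k (\<lambda>A. F A + G A)"
  unfolding regular_map_def
proof (intro conjI ballI allI impI)
  fix i j assume "i < k" "j < k"
  then have "regular_fun N (\<lambda>A. F A $$ (i, j) + G A $$ (i, j))"
    by (intro regular_fun_add regular_map_entry[OF F] regular_map_entry[OF G])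
  then show "regular_fun N (\<lambda>A. (F A + G A) $$ (i, j))"
    by (rule regular_fun_cong)
      (drule regular_map_carrier[OF G], use \<open>i < k\<close> \<open>j < k\<close> in auto)
qed (use regular_map_carrier[OF F] regular_map_carrier[OF G] in auto)

lemma regular_map_smult:
  assumes F: "regular_map N k F" and f: "regular_fun N f"
  shows "regular_map N k (\<lambda>A. f A \<cdot>\<^sub>m F A)"
  unfolding regular_map_def
proof (intro conjI ballI allI impI)
  fix i j assume "i < k" "j < k"
  then have "regular_fun N (\<lambda>A. f A * F A $$ (i, j))"
    by (intro regular_fun_mult regular_map_entry[OF F] f)
  then show "regular_fun N (\<lambda>A. (f A \<cdot>\<^sub>m F A) $$ (i, j))"
    by (rule regular_fun_cong)
      (drule regular_map_carrier[OF F], use \<open>i < k\<close> \<open>j < k\<close> in auto)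
qed (use regular_map_carrier[OF F] in auto)

lemma regular_map_transpose:
  assumes F: "regular_map N k F"
  shows "regular_map N k (\<lambda>A. transpose_mat (F A))"
  unfolding regular_map_def
proof (intro conjI ballI allI impI)
  fix i j assume "i < k" "j < k"
  then have "regular_fun N (\<lambda>A. F A $$ (j, i))"
    by (intro regular_map_entry[OF F])
  then show "regular_fun N (\<lambda>A. transpose_mat (F A) $$ (i, j))"
    by (rule regular_fun_cong)
      (drule regular_map_carrier[OF F], use \<open>i < k\<close> \<open>j < k\<close> in auto)
qed (use regular_map_carrier[OF F] in auto)

lemma regular_map_mat:
  assumes "\<And>i j. i < k \<Longrightarrow> j < k \<Longrightarrow> regular_fun N (\<lambda>A. f A i j)"
  shows "regular_map N k (\<lambda>A. mat k k (\<lambda>(i, j). f A i j))"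
  unfolding regular_map_def
proof (intro conjI ballI allI impI)
  fix i j assume "i < k" "j < k"
  with assms show "regular_fun N (\<lambda>A. mat k k (\<lambda>(i, j). f A i j) $$ (i, j))" by simp
qed simp

lemma regular_fun_det:
  assumes F: "regular_map N k F"
  shows "regular_fun N (\<lambda>A. det (F A))"
proof -
  have "regular_fun N (\<lambda>A. \<Sum>p | p permutes {0..<k}. signof p * (\<Prod>i=0..<k. F A $$ (i, p i)))"
    by (intro regular_fun_sum regular_fun_mult regular_fun_prod regular_fun_const
        regular_map_entry[OF F]) (auto simp: permutes_in_image)
  then show ?thesis
    by (rule regular_fun_cong) (auto simp: det_def'[OF regular_map_carrier[OF F]])
qed

lemma regular_fun_cofactor:
  assumes ij: "i < N" "j < N"
  shows "regular_fun N (\<lambda>A. cofactor A i j)"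
proof -
  have "regular_map N (N - 1) (\<lambda>A. mat (N - 1) (N - 1) (\<lambda>(i', j').
      A $$ (if i' < i then i' else Suc i', if j' < j then j' else Suc j')))"
    by (rule regular_map_mat) (use ij in \<open>auto intro!: regular_fun_coord\<close>)
  from regular_fun_mult[OF regular_fun_const[of N "(-1)^(i+j)"] regular_fun_det[OF this]]
  show ?thesis
    by (rule regular_fun_cong) (auto simp: cofactor_def mat_delete_def)
qed

text \<open>The adjugate is the inverse on \<open>SL N\<close> and polynomial on all matrices, so
  inversion, conjugation and commutators become regular maps without denominators.\<close>

lemma regular_map_adj: "regular_map N N adj_mat"
  unfolding regular_map_def
proof (intro conjI ballI allI impI)
  fix i j assume ij: "i < N" "j < N"
  from regular_fun_cofactor[OF ij(2,1)] show "regular_fun N (\<lambda>A. adj_mat A $$ (i, j))"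
    by (rule regular_fun_cong) (use ij in \<open>auto simp: adj_mat_def\<close>)
qed (simp add: adj_mat)

section \<open>Zariski closed sets and their preimages\<close>

lemma zariski_closed_Collect:
  assumes "\<And>i. i \<in> I \<Longrightarrow> regular_fun N (f i)"
  shows "zariski_closed N {A \<in> carrier_mat N N. \<forall>i\<in>I. f i A = 0}"
proof -
  obtain p where p: "\<And>i. i \<in> I \<Longrightarrow> p i \<in> poly_fun N \<and> (\<forall>A \<in> carrier_mat N N. f i A = p i A)"
    using assms unfolding regular_fun_def by metis
  show ?thesis unfolding zariski_closed_def
    by (intro exI[of _ "p ` I"]) (use p in auto)
qed

lemma zariski_closed_zeros:
  "regular_fun N f \<Longrightarrow> zariski_closed N {A \<in> carrier_mat N N. f A = 0}"
  using zariski_closed_Collect[of "{()}" N "\<lambda>_. f"] by simp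

lemma zariski_closed_mat_eq:
  assumes f: "regular_map N k f" and g: "regular_map N k g"
  shows "zariski_closed N {x \<in> carrier_mat N N. f x = g x}"
proof -
  have "zariski_closed N {x \<in> carrier_mat N N. \<forall>(i, j) \<in> {..<k} \<times> {..<k}. f x $$ (i, j) - g x $$ (i, j) = 0}"
    using zariski_closed_Collect[of "{..<k} \<times> {..<k}" N "\<lambda>(i, j) x. f x $$ (i, j) - g x $$ (i, j)"]
      regular_fun_diff[OF regular_map_entry[OF f] regular_map_entry[OF g]] by (auto simp: case_prod_beta)
  also have "{x \<in> carrier_mat N N. \<forall>(i, j) \<in> {..<k} \<times> {..<k}. f x $$ (i, j) - g x $$ (i, j) = 0} = {x \<in> carrier_mat N N. f x = g x}"
  proof (intro Collect_cong conj_cong refl)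
    fix x :: "complex mat" assume "x \<in> carrier_mat N N"
    then have "f x \<in> carrier_mat k k" "g x \<in> carrier_mat k k" using f g by (auto intro: regular_map_carrier)
    then show "(\<forall>(i, j) \<in> {..<k} \<times> {..<k}. f x $$ (i, j) - g x $$ (i, j) = 0) \<longleftrightarrow> f x = g x"
      by (auto intro!: eq_matI)
  qed
  finally show ?thesis .
qed

lemma zariski_closed_Int:
  assumes "zariski_closed N C" "zariski_closed N D"
  shows "zariski_closed N (C \<inter> D)"
proof -
  obtain F G where "F \<subseteq> poly_fun N" "C = {A \<in> carrier_mat N N. \<forall>f \<in> F. f A = 0}"
    "G \<subseteq> poly_fun N" "D = {A \<in> carrier_mat N N. \<forall>f \<in> G. f A = 0}"
    using assms unfolding zariski_closed_def by auto
  then show ?thesis unfolding zariski_closed_def by (intro exI[of _ "F \<union> G"]) auto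
qed

lemma zariski_closed_preimage:
  assumes F: "regular_map N k F" and C: "zariski_closed k C"
  shows "zariski_closed N {A \<in> carrier_mat N N. F A \<in> C}"
proof -
  obtain S where S: "S \<subseteq> poly_fun k" "C = {A \<in> carrier_mat k k. \<forall>f \<in> S. f A = 0}"
    using C unfolding zariski_closed_def by auto
  have "zariski_closed N {A \<in> carrier_mat N N. \<forall>f\<in>S. f (F A) = 0}"
    by (rule zariski_closed_Collect) (use S poly_fun_comp[OF F] in auto)
  also have "{A \<in> carrier_mat N N. \<forall>f\<in>S. f (F A) = 0} = {A \<in> carrier_mat N N. F A \<in> C}"
    using S regular_map_carrier[OF F] by auto
  finally show ?thesis .
qed

text \<open>The relation of lying in the same quasi-component of \<open>X\<close>. Working with
  pairs of points allows connectedness to be proved by chains of paths and to be transported along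
  maps from other sets.\<close>

definition zlink :: "nat \<Rightarrow> complex mat set \<Rightarrow> complex mat \<Rightarrow> complex mat \<Rightarrow> bool" where
  "zlink N X a b \<longleftrightarrow> a \<in> X \<and> b \<in> X \<and> (\<forall>C D. zariski_closed N C \<longrightarrow> zariski_closed N D \<longrightarrow>
     X \<subseteq> C \<union> D \<longrightarrow> X \<inter> C \<inter> D = {} \<longrightarrow> a \<in> C \<longrightarrow> b \<in> C)"

lemma zlink_trans: "zlink N X a b \<Longrightarrow> zlink N X b c \<Longrightarrow> zlink N X a c"
  unfolding zlink_def by blast

lemma zlink_sym:
  assumes "zlink N X a b" shows "zlink N X b a"
  unfolding zlink_def
proof (intro conjI allI impI)
  fix C D assume CD: "zariski_closed N C" "zariski_closed N D" "X \<subseteq> C \<union> D" "X \<inter> C \<inter> D = {}" "b \<in> C"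
  show "a \<in> C"
  proof (rule ccontr)
    assume "a \<notin> C"
    then have "a \<in> D" using assms CD(3) unfolding zlink_def by blast
    then have "b \<in> D"
      using assms CD(1-4) unfolding zlink_def by blast
    with CD assms show False unfolding zlink_def by blast
  qed
qed (use assms in \<open>auto simp: zlink_def\<close>)

lemma zlink_mono: "zlink N X a b \<Longrightarrow> X \<subseteq> Y \<Longrightarrow> zlink N Y a b"
  unfolding zlink_def by blast

lemma zlink_image:
  assumes l: "zlink N X a b" and X: "X \<subseteq> carrier_mat N N" and F: "regular_map N k F" and FX: "F ` X \<subseteq> Y"
  shows "zlink k Y (F a) (F b)"
  unfolding zlink_def
proof (intro conjI allI impI)
  fix C D assume C: "zariski_closed k C" and D: "zariski_closed k D"
    and "Y \<subseteq> C \<union> D" "Y \<inter> C \<inter> D = {}" "F a \<in> C"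
  then have "X \<subseteq> {A \<in> carrier_mat N N. F A \<in> C} \<union> {A \<in> carrier_mat N N. F A \<in> D}"
    "X \<inter> {A \<in> carrier_mat N N. F A \<in> C} \<inter> {A \<in> carrier_mat N N. F A \<in> D} = {}"
    "a \<in> {A \<in> carrier_mat N N. F A \<in> C}"
    using FX X l by (auto simp: zlink_def)
  with l zariski_closed_preimage[OF F C] zariski_closed_preimage[OF F D]
  show "F b \<in> C" unfolding zlink_def by blast
qed (use l FX in \<open>auto simp: zlink_def\<close>)

lemma zariski_connectedI:
  assumes "\<And>x. x \<in> X \<Longrightarrow> zlink N X a x"
  shows "zariski_connected N X"
  unfolding zariski_connected_def
proof (safe)
  fix C D x y assume CD: "zariski_closed N C" "zariski_closed N D" "X \<subseteq> C \<union> D" "X \<inter> C \<inter> D = {}"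
    and x: "x \<in> X" "x \<in> C" and y: "y \<in> X" "y \<in> D"
  have "zlink N X x y" by (rule zlink_trans[OF zlink_sym[OF assms[OF x(1)]] assms[OF y(1)]])
  then have "y \<in> C" using CD x unfolding zlink_def by blast
  with CD y show "y \<in> {}" by blast
qed

lemma zariski_connected_imp_zlink:
  assumes "zariski_connected N X" "x \<in> X" "y \<in> X"
  shows "zlink N X x y"
  using assms unfolding zariski_connected_def zlink_def by blast

lemma continuous_on_regular:
  assumes f: "regular_fun N f" and p: "\<And>s. s \<in> S \<Longrightarrow> p s \<in> carrier_mat N N"
    and c: "\<And>i j. i < N \<Longrightarrow> j < N \<Longrightarrow> continuous_on S (\<lambda>s. p s $$ (i, j))"
  shows "continuous_on S (\<lambda>s. f (p s))"
proof -
  obtain q where q: "q \<in> poly_fun N" "\<forall>A \<in> carrier_mat N N. f A = q A"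
    using f unfolding regular_fun_def by blast
  from q(1) have "continuous_on S (\<lambda>s. q (p s))"
    by induction (auto intro: continuous_intros c)
  then show ?thesis using q(2) p by (simp cong: continuous_on_cong)
qed

text \<open>A partition of \<open>X\<close> by two Zariski closed sets pulls back to a partition of
  \<open>S\<close> by two relatively closed sets, since polynomials are continuous in the Euclidean
  topology. The family \<open>p\<close> need only be continuous, so inverses may occur in
  it.\<close>

lemma zlink_path:
  fixes S :: "complex set"
  assumes S: "connected S" and pX: "\<And>s. s \<in> S \<Longrightarrow> p s \<in> X" and X: "X \<subseteq> carrier_mat N N"
    and c: "\<And>i j. i < N \<Longrightarrow> j < N \<Longrightarrow> continuous_on S (\<lambda>s. p s $$ (i, j))"
    and s: "s \<in> S" and t: "t \<in> S"
  shows "zlink N X (p s) (p t)"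
  unfolding zlink_def
proof (intro conjI allI impI)
  fix C D assume CD: "zariski_closed N C" "zariski_closed N D" "X \<subseteq> C \<union> D" "X \<inter> C \<inter> D = {}" "p s \<in> C"
  have cl: "closedin (top_of_set S) {s \<in> S. p s \<in> C}" if C: "zariski_closed N C" for C
  proof -
    obtain F where F: "F \<subseteq> poly_fun N" "C = {A \<in> carrier_mat N N. \<forall>f \<in> F. f A = 0}"
      using C unfolding zariski_closed_def by auto
    \<comment> \<open>The zero function is added so that the intersection runs over a nonempty
      family even if \<open>F\<close> is empty.\<close>
    have "{s \<in> S. p s \<in> C} = \<Inter> ((\<lambda>f. {s \<in> S. f (p s) = 0}) ` (insert (\<lambda>A. 0) F))"
      using F pX X by auto
    moreover have "closedin (top_of_set S) {s \<in> S. f (p s) = 0}" if "f \<in> insert (\<lambda>A. 0) F" for f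
    proof -
      have "regular_fun N f" using that F(1) pf_const[of 0 N] unfolding regular_fun_def by auto
      from continuous_on_regular[OF this, of S p] pX X c
      have "continuous_on S (\<lambda>s. f (p s))" by blast
      then show ?thesis by (rule continuous_closedin_preimage_constant)
    qed
    ultimately show ?thesis by (simp only:) (rule closedin_Inter, blast+)
  qed
  show "p t \<in> C"
  proof (rule ccontr)
    assume "p t \<notin> C"
    then have "t \<in> {s \<in> S. p s \<in> D}" using t pX CD(3) by auto
    moreover have "S \<subseteq> {s \<in> S. p s \<in> C} \<union> {s \<in> S. p s \<in> D}" "{s \<in> S. p s \<in> C} \<inter> {s \<in> S. p s \<in> D} = {}"
      using pX CD(3,4) by auto
    ultimately show False
      using S s CD(5) cl[OF CD(1)] cl[OF CD(2)] unfolding connected_closedin by blast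
  qed
qed (use s t pX in auto)

text \<open>Removing finitely many points does not disconnect the plane; rational families can be
  used once their poles are deleted.\<close>

lemma connected_cofinite: "finite T \<Longrightarrow> connected (- T :: complex set)"
  using connected_open_delete_finite[of "UNIV :: complex set" T] by (simp add: Compl_eq_Diff_UNIV connected_UNIV)

text \<open>A level set of \<open>f\<close> is clopen in \<open>X\<close>: the product of
  \<open>f - s\<close> over the remaining values cuts out its complement. This principle serves in
  the Lie-Kolchin theorem, in the proof that symplectic matrices have determinant one, and in both
  negative cases.\<close>

lemma regular_fun_finite_const:
  assumes X: "zlink N X a b" "X \<subseteq> carrier_mat N N" and f: "regular_fun N f"
    and S: "finite S" "f ` X \<subseteq> S"
  shows "f b = f a"
proof -
  let ?C = "{A \<in> carrier_mat N N. f A - f a = 0}"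
  let ?D = "{A \<in> carrier_mat N N. (\<Prod>s\<in>S - {f a}. f A - s) = 0}"
  have "zariski_closed N ?C" "zariski_closed N ?D"
    by (intro zariski_closed_zeros regular_fun_prod regular_fun_diff regular_fun_const f)+
  moreover have "X \<subseteq> ?C \<union> ?D" using S X(2) by (auto simp: prod_zero_iff)
  moreover have "X \<inter> ?C \<inter> ?D = {}" using S by (auto simp: prod_zero_iff)
  moreover have "a \<in> ?C" using X unfolding zlink_def by auto
  ultimately have "b \<in> ?C" using X(1) unfolding zlink_def by blast
  then show ?thesis by simp
qed

section \<open>Bases, triangular matrices, eigenvectors\<close>

lemma mult_vec_entry:
  assumes "A \<in> carrier_mat n k" "v \<in> carrier_vec k" "i < n"
  shows "(A *\<^sub>v v) $ i = (\<Sum>l<k. A $$ (i, l) * v $ l)"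
  using assms by (auto simp: scalar_prod_def atLeast0LessThan intro!: sum.cong)

lemma smult_mat_vec:
  "A \<in> carrier_mat n k \<Longrightarrow> v \<in> carrier_vec k \<Longrightarrow> (c \<cdot>\<^sub>m A) *\<^sub>v v = c \<cdot>\<^sub>v (A *\<^sub>v (v :: complex vec))"
  by (rule eq_vecI) (auto simp: mult_vec_entry[of _ n k] sum_distrib_left mult.assoc simp del: index_mult_mat_vec)

declare minus_carrier_mat [simp]

lemma minus_zero_mat [simp]: "A \<in> carrier_mat n k \<Longrightarrow> A - 0\<^sub>m n k = (A :: complex mat)"
  by (auto intro!: eq_matI)

lemma mult_carrier_sq [simp, intro]:
  "A \<in> carrier_mat n n \<Longrightarrow> B \<in> carrier_mat n n \<Longrightarrow> A * B \<in> carrier_mat n n"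
  by (rule mult_carrier_mat)

lemma mult_zero_vec: "A \<in> carrier_mat n k \<Longrightarrow> A *\<^sub>v 0\<^sub>v k = (0\<^sub>v n :: complex vec)"
  by (intro eq_vecI) auto

text \<open>The inverse is carried along explicitly. For a pair \<open>g\<close>, \<open>h\<close>
  the product \<open>h * x * g\<close> is the matrix of \<open>x\<close> in the basis formed by the
  columns of \<open>g\<close>, and flags are given by such bases.\<close>

definition inv_pair :: "nat \<Rightarrow> complex mat \<Rightarrow> complex mat \<Rightarrow> bool" where
  "inv_pair N g h \<longleftrightarrow> g \<in> carrier_mat N N \<and> h \<in> carrier_mat N N \<and> g * h = 1\<^sub>m N \<and> h * g = 1\<^sub>m N"

lemma inv_pairD:
  assumes "inv_pair N g h"
  shows "g \<in> carrier_mat N N" "h \<in> carrier_mat N N" "g * h = 1\<^sub>m N" "h * g = 1\<^sub>m N"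
  using assms by (auto simp: inv_pair_def)

lemma inv_pair_one: "inv_pair N (1\<^sub>m N) (1\<^sub>m N)"
  by (simp add: inv_pair_def)

lemma inv_pair_sym: "inv_pair N g h \<Longrightarrow> inv_pair N h g"
  by (simp add: inv_pair_def)

lemma inv_pair_cancel:
  assumes p: "inv_pair N g h" and A: "A \<in> carrier_mat N k"
  shows "g * (h * A) = A" "h * (g * A) = A"
  using inv_pairD[OF p] A
  by (simp_all flip: assoc_mult_mat[of _ N N _ N _ k])

lemma inv_pair_cancel_vec:
  assumes p: "inv_pair N g h" and v: "v \<in> carrier_vec N"
  shows "g *\<^sub>v (h *\<^sub>v v) = v" "h *\<^sub>v (g *\<^sub>v v) = v"
  using inv_pairD[OF p] v
  by (simp_all flip: assoc_mult_mat_vec[of _ N N _ N])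

lemma inv_pair_mult:
  assumes p: "inv_pair N g h" and q: "inv_pair N a b"
  shows "inv_pair N (g * a) (b * h)"
proof -
  note c = inv_pairD[OF p] inv_pairD[OF q]
  have "g * a * (b * h) = g * (a * (b * h))" "b * h * (g * a) = b * (h * (g * a))"
    using c by (simp_all add: assoc_mult_mat[of _ N N _ N _ N])
  then show ?thesis
    using c inv_pair_cancel[OF p] inv_pair_cancel[OF q] by (simp add: inv_pair_def)
qed

lemma inv_pair_det:
  assumes "inv_pair N g h" shows "det g * det h = 1" "det g \<noteq> 0"
proof -
  show "det g * det h = 1"
    using inv_pairD[OF assms] det_mult[of g N h] by simp
  then show "det g \<noteq> 0" by auto
qed

lemma inv_pair_adj:
  assumes g: "g \<in> carrier_mat N N" and d: "det g \<noteq> 0"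
  shows "inv_pair N g (inverse (det g) \<cdot>\<^sub>m adj_mat g)"
proof -
  note a = adj_mat[OF g]
  have "inverse (det g) \<cdot>\<^sub>m (det g \<cdot>\<^sub>m 1\<^sub>m N) = 1\<^sub>m N"
    using d by (intro eq_matI) auto
  then show ?thesis
    using g a by (simp add: inv_pair_def mult_smult_distrib[of _ N N _ N] mult_smult_assoc_mat[of _ N N _ N])
qed

lemma inv_pair_unique:
  assumes "inv_pair N g h" "k \<in> carrier_mat N N" "g * k = 1\<^sub>m N \<or> k * g = 1\<^sub>m N"
  shows "k = h"
proof -
  note c = inv_pairD[OF assms(1)]
  have "k = h" if "g * k = 1\<^sub>m N"
    using that c inv_pair_cancel(2)[OF assms(1,2)] by simp
  moreover have "k = h" if "k * g = 1\<^sub>m N"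
  proof -
    have "k = k * (g * h)" using c assms(2) by simp
    also have "\<dots> = k * g * h" using c assms(2) by (simp only: assoc_mult_mat[of _ N N _ N _ N])
    finally show ?thesis using that c by simp
  qed
  ultimately show ?thesis using assms(3) by blast
qed

lemma inv_pair_of_one_sided:
  assumes "g \<in> carrier_mat N N" "h \<in> carrier_mat N N" "g * h = (1\<^sub>m N :: complex mat)"
  shows "inv_pair N g h"
  using mat_mult_left_right_inverse[OF assms] assms by (simp add: inv_pair_def)

lemma det_conj:
  assumes p: "inv_pair N g h" and x: "x \<in> carrier_mat N N"
  shows "det (h * x * g) = det x"
proof -
  note c = inv_pairD[OF p]
  have "det (h * x * g) = det h * det x * det g"
    using c x by (simp add: det_mult[of _ N])
  then show ?thesis using inv_pair_det(1)[OF p] by (simp add: algebra_simps)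
qed

lemma conj_mult:
  assumes p: "inv_pair N g h" and x: "x \<in> carrier_mat N N" and y: "y \<in> carrier_mat N N"
  shows "h * (x * y) * g = (h * x * g) * (h * y * g)"
  using inv_pairD[OF p] x y inv_pair_cancel(1)[OF p, of "y * g" N]
  by (simp add: assoc_mult_mat[of _ N N _ N _ N])

lemma conj_conj:
  assumes p: "inv_pair N g h" and x: "x \<in> carrier_mat N N"
  shows "g * (h * x * g) * h = x"
  using inv_pairD[OF p] x inv_pair_cancel(1)[OF p, of x N]
  by (simp add: assoc_mult_mat[of _ N N _ N _ N])

lemma adj_mat_inv_pair:
  assumes "x \<in> SL N" shows "inv_pair N x (adj_mat x)"
  using assms adj_mat[of x N] by (auto simp: inv_pair_def SL_def)

text \<open>The exchange step of Steinitz: \<open>y\<close> takes the place of the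
  \<open>r\<close>-th unit vector, at the price of an index \<open>i\<close> at which it has a
  nonzero coordinate.\<close>

lemma exists_column_change:
  assumes y: "y \<in> carrier_vec k" and i: "r \<le> i" "i < k" "y $ i \<noteq> (0 :: complex)"
  shows "\<exists>q q'. inv_pair k q q' \<and> col q r = y \<and> (\<forall>l<r. col q l = unit_vec k l)"
proof -
  \<comment> \<open>If \<open>i\<close> differs from \<open>r\<close>, column \<open>i\<close>
    receives the unit vector displaced from column \<open>r\<close>, so no direction is
    lost.\<close>
  define q where "q = mat k k (\<lambda>(a, b). if b = r then y $ a else if b = i then (if a = r then 1 else 0)
    else if a = b then 1 else 0)"
  have q: "q \<in> carrier_mat k k" by (simp add: q_def)
  have "det q \<noteq> 0"
  proof
    assume "det q = 0"
    then obtain v where v: "v \<in> carrier_vec k" "v \<noteq> 0\<^sub>v k" "q *\<^sub>v v = 0\<^sub>v k"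
      using det_0_iff_vec_prod_zero_field[OF q] by auto
    have eq: "(\<Sum>l<k. q $$ (a, l) * v $ l) = 0" if "a < k" for a
      using mult_vec_entry[OF q v(1) that] v(3) that by simp
    have row: "(\<Sum>l<k. q $$ (a, l) * v $ l) = y $ a * v $ r + (if a = r then (if i = r then 0 else v $ i)
        else if a = i then 0 else v $ a)" if a: "a < k" for a
    proof -
      have "(\<Sum>l<k. q $$ (a, l) * v $ l)
          = q $$ (a, r) * v $ r + (\<Sum>l\<in>{..<k} - {r}. q $$ (a, l) * v $ l)"
        using i by (subst sum.remove[of _ r]) auto
      also have "(\<Sum>l\<in>{..<k} - {r}. q $$ (a, l) * v $ l)
          = (\<Sum>l\<in>{..<k} - {r}. if l = (if a = r then i else a) then (if a = i \<and> a \<noteq> r then 0 else v $ l) else 0)"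
        using a i by (intro sum.cong) (auto simp: q_def)
      also have "\<dots> = (if a = r then (if i = r then 0 else v $ i) else if a = i then 0 else v $ a)"
        using a i by (subst sum.delta) auto
      finally show ?thesis using a i by (simp add: q_def)
    qed
    have vr: "v $ r = 0"
      using eq[of i] row[of i] i by (auto split: if_splits)
    have "v $ a = 0" if a: "a < k" for a
      using eq[of a] row[of a] eq[of r] row[of r] a i vr by (cases "a = r"; cases "a = i") (auto split: if_splits)
    then show False using v(1,2) by (auto intro: eq_vecI)
  qed
  from inv_pair_adj[OF q this] obtain q' where "inv_pair k q q'" by blast
  moreover have "col q r = y" using y i by (intro eq_vecI) (auto simp: q_def)
  moreover have "\<forall>l<r. col q l = unit_vec k l"
    using i by (auto intro!: eq_vecI simp: q_def unit_vec_def)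
  ultimately show ?thesis by blast
qed

lemma mult_supported_vec:
  assumes g: "g \<in> carrier_mat k k" and y: "y \<in> carrier_vec k"
    and s: "\<And>i. r \<le> i \<Longrightarrow> i < k \<Longrightarrow> y $ i = 0" and "r \<le> k"
    and M: "0\<^sub>v k \<in> M" "\<And>u v. u \<in> M \<Longrightarrow> v \<in> M \<Longrightarrow> u + v \<in> M" "\<And>c u. u \<in> M \<Longrightarrow> c \<cdot>\<^sub>v u \<in> M"
    and cols: "\<And>j. j < r \<Longrightarrow> col g j \<in> (M :: complex vec set)"
  shows "g *\<^sub>v y \<in> M"
  using y s \<open>r \<le> k\<close> cols
proof (induction r arbitrary: y)
  case 0
  then have "y = 0\<^sub>v k" by (intro eq_vecI) auto
  moreover have "g *\<^sub>v 0\<^sub>v k = 0\<^sub>v k" using g by (intro eq_vecI) auto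
  ultimately show ?case using M(1) by simp
next
  case (Suc r)
  define z where "z = vec k (\<lambda>i. if i < r then y $ i else 0)"
  have "g *\<^sub>v z \<in> M" by (rule Suc.IH) (use Suc.prems in \<open>auto simp: z_def\<close>)
  moreover have "y $ r \<cdot>\<^sub>v col g r \<in> M" using Suc.prems M(3) by simp
  moreover have "g *\<^sub>v y = g *\<^sub>v z + y $ r \<cdot>\<^sub>v col g r"
  proof (rule eq_vecI)
    fix i assume "i < dim_vec (g *\<^sub>v z + y $ r \<cdot>\<^sub>v col g r)"
    then have i: "i < k" using g by simp
    have z: "z \<in> carrier_vec k" by (simp add: z_def)
    have "(\<Sum>l<k. g $$ (i, l) * y $ l) = (\<Sum>l<k. g $$ (i, l) * z $ l + (if l = r then g $$ (i, r) * y $ r else 0))"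
      using Suc.prems by (intro sum.cong) (auto simp: z_def not_less Suc_le_eq)
    also have "\<dots> = (\<Sum>l<k. g $$ (i, l) * z $ l) + g $$ (i, r) * y $ r"
      using Suc.prems by (simp add: sum.distrib)
    finally show "(g *\<^sub>v y) $ i = (g *\<^sub>v z + y $ r \<cdot>\<^sub>v col g r) $ i"
      using i g Suc.prems mult_vec_entry[OF g _ i] z
      by (simp del: index_mult_mat_vec)
  qed (use g in \<open>simp add: z_def\<close>)
  ultimately show ?case using M(2) by simp
qed

text \<open>Take a basis with the largest possible number \<open>r\<close> of initial columns in
  \<open>M\<close>; a member of \<open>M\<close> with a later nonzero coordinate could be exchanged
  in and would increase \<open>r\<close>. This takes the place of dimension counting for
  subspaces.\<close>

lemma adapted_basis:
  assumes sub: "M \<subseteq> carrier_vec k"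
    and M: "0\<^sub>v k \<in> M" "\<And>u v. u \<in> M \<Longrightarrow> v \<in> M \<Longrightarrow> u + v \<in> M" "\<And>c u. u \<in> M \<Longrightarrow> c \<cdot>\<^sub>v u \<in> (M :: complex vec set)"
  obtains g h r where "inv_pair k g h" "r \<le> k"
    "\<And>v. v \<in> carrier_vec k \<Longrightarrow> v \<in> M \<longleftrightarrow> (\<forall>i. r \<le> i \<longrightarrow> i < k \<longrightarrow> (h *\<^sub>v v) $ i = 0)"
proof -
  define P where "P r \<longleftrightarrow> r \<le> k \<and> (\<exists>g h. inv_pair k g h \<and> (\<forall>j<r. col g j \<in> M))" for r
  have "P 0" using inv_pair_one by (auto simp: P_def)
  moreover have "\<forall>r. P r \<longrightarrow> r \<le> k" by (simp add: P_def)
  ultimately obtain r where r: "P r" and max: "\<And>s. P s \<Longrightarrow> s \<le> r"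
    by (metis GreatestI_nat Greatest_le_nat)
  then obtain g h where p: "inv_pair k g h" and cols: "\<And>j. j < r \<Longrightarrow> col g j \<in> M" and rk: "r \<le> k"
    by (auto simp: P_def)
  note c = inv_pairD[OF p]
  have "v \<in> M \<longleftrightarrow> (\<forall>i. r \<le> i \<longrightarrow> i < k \<longrightarrow> (h *\<^sub>v v) $ i = 0)" if v: "v \<in> carrier_vec k" for v
  proof
    assume "v \<in> M"
    show "\<forall>i. r \<le> i \<longrightarrow> i < k \<longrightarrow> (h *\<^sub>v v) $ i = 0"
    proof (rule ccontr)
      assume "\<not> ?thesis"
      then obtain i where i: "r \<le> i" "i < k" "(h *\<^sub>v v) $ i \<noteq> 0" by auto
      have hv: "h *\<^sub>v v \<in> carrier_vec k" using c v by simp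
      obtain q q' where q: "inv_pair k q q'" "col q r = h *\<^sub>v v" "\<forall>l<r. col q l = unit_vec k l"
        using exists_column_change[OF hv i] by blast
      have "col (g * q) j \<in> M" if "j < Suc r" for j
      proof -
        have "col (g * q) j = g *\<^sub>v col q j"
          using c inv_pairD[OF q(1)] i that by (intro col_mult2[of _ k k _ k]) auto
        moreover have "g *\<^sub>v unit_vec k j = col g j" if "j < r"
          using c i that by (intro eq_vecI) auto
        ultimately show ?thesis
          using q that inv_pair_cancel_vec[OF p v] \<open>v \<in> M\<close> cols by (cases "j = r") auto
      qed
      then have "P (Suc r)" using inv_pair_mult[OF p q(1)] i unfolding P_def by force
      then show False using max by fastforce
    qed
  next
    assume "\<forall>i. r \<le> i \<longrightarrow> i < k \<longrightarrow> (h *\<^sub>v v) $ i = 0"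
    then have "g *\<^sub>v (h *\<^sub>v v) \<in> M"
      using c v rk M cols by (intro mult_supported_vec[of g k _ r]) auto
    then show "v \<in> M" using inv_pair_cancel_vec[OF p v] by simp
  qed
  with p rk show ?thesis by (rule that)
qed

text \<open>Triangularity of the first \<open>j\<close> columns only is the state of an induction
  that triangularizes matrices one column at a time.\<close>

definition UTc :: "nat \<Rightarrow> nat \<Rightarrow> complex mat set" where
  "UTc N j = {A \<in> carrier_mat N N. \<forall>l<j. \<forall>i<N. l < i \<longrightarrow> A $$ (i, l) = 0}"

abbreviation UT :: "nat \<Rightarrow> complex mat set" where "UT N \<equiv> UTc N N"

lemma UTc_carrier: "A \<in> UTc N j \<Longrightarrow> A \<in> carrier_mat N N"
  by (simp add: UTc_def)

lemma UTc_zero: "A \<in> UTc N j \<Longrightarrow> l < j \<Longrightarrow> l < i \<Longrightarrow> i < N \<Longrightarrow> A $$ (i, l) = 0"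
  by (simp add: UTc_def)

lemma UTc_mono: "A \<in> UTc N j \<Longrightarrow> l \<le> j \<Longrightarrow> A \<in> UTc N l"
  by (simp add: UTc_def)

lemma UTc_mult:
  assumes A: "A \<in> UTc N j" and B: "B \<in> UTc N j" and "j \<le> N"
  shows "A * B \<in> UTc N j"
  unfolding UTc_def
proof (intro CollectI conjI allI impI)
  note c = UTc_carrier[OF A] UTc_carrier[OF B]
  fix l i assume "l < j" "i < N" "l < i"
  then have "A $$ (i, m) * B $$ (m, l) = 0" if "m < N" for m
    using UTc_zero[OF A, of m i] UTc_zero[OF B, of l m] that by (cases "m \<le> l") auto
  then show "(A * B) $$ (i, l) = 0"
    using mult_entry[OF c] \<open>l < j\<close> \<open>i < N\<close> \<open>j \<le> N\<close> by (auto intro!: sum.neutral)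
qed (use UTc_carrier[OF A] UTc_carrier[OF B] in auto)

lemma UT_mult: "A \<in> UT N \<Longrightarrow> B \<in> UT N \<Longrightarrow> A * B \<in> UT N"
  by (rule UTc_mult) auto

lemma UT_one: "1\<^sub>m N \<in> UTc N j"
  by (auto simp: UTc_def)

lemma UT_add: "A \<in> UT N \<Longrightarrow> B \<in> UT N \<Longrightarrow> A + B \<in> UT N"
  by (auto simp: UTc_def)

lemma UT_diff: "A \<in> UT N \<Longrightarrow> B \<in> UT N \<Longrightarrow> A - B \<in> UT N"
  by (auto simp: UTc_def)

lemma UT_smult: "A \<in> UT N \<Longrightarrow> c \<cdot>\<^sub>m A \<in> UT N"
  by (auto simp: UTc_def)

lemma UT_mult_diag:
  assumes A: "A \<in> UT N" and B: "B \<in> UT N" and i: "i < N"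
  shows "(A * B) $$ (i, i) = A $$ (i, i) * B $$ (i, i)"
proof -
  have "(A * B) $$ (i, i) = (\<Sum>l<N. A $$ (i, l) * B $$ (l, i))"
    using UTc_carrier[OF A] UTc_carrier[OF B] i by (rule mult_entry) fact
  also have "\<dots> = (\<Sum>l<N. if l = i then A $$ (i, i) * B $$ (i, i) else 0)"
  proof (rule sum.cong)
    fix l assume "l \<in> {..<N}"
    then show "A $$ (i, l) * B $$ (l, i) = (if l = i then A $$ (i, i) * B $$ (i, i) else 0)"
      using UTc_zero[OF A, of l i] UTc_zero[OF B, of i l] i by (cases l i rule: linorder_cases) auto
  qed simp
  finally show ?thesis using i by simp
qed

lemma UT_upper_triangular: "A \<in> UT N \<longleftrightarrow> A \<in> carrier_mat N N \<and> upper_triangular A"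
  by (auto simp: UTc_def)

lemma UT_det: "A \<in> UT N \<Longrightarrow> det A = (\<Prod>i<N. A $$ (i, i))"
  by (subst det_upper_triangular[of _ N])
     (auto simp: UT_upper_triangular prod_list_diag_prod atLeast0LessThan)

lemma UT_inverse:
  assumes A: "A \<in> UT N" and p: "inv_pair N A B"
  shows "B \<in> UT N" "\<And>i. i < N \<Longrightarrow> A $$ (i, i) * B $$ (i, i) = 1"
proof -
  note c = inv_pairD[OF p]
  have nz: "A $$ (i, i) \<noteq> 0" if "i < N" for i
    using inv_pair_det(2)[OF p] UT_det[OF A] that by auto
  have "B $$ (i, l) = 0" if "l < N" "i < N" "l < i" for l i
    using that
  \<comment> \<open>Back substitution from the bottom row upwards: in row \<open>i\<close> of
    \<open>A * B = 1\<close> the terms beyond the diagonal vanish by the induction hypothesis, those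
    before it by triangularity of \<open>A\<close>.\<close>
  proof (induction i rule: measure_induct_rule[of "\<lambda>i. N - i"])
    case (less i)
    have "0 = (A * B) $$ (i, l)" using c less.prems by simp
    also have "\<dots> = (\<Sum>m<N. A $$ (i, m) * B $$ (m, l))"
      using c less.prems by (intro mult_entry[of _ N N _ N]) auto
    also have "\<dots> = (\<Sum>m<N. if m = i then A $$ (i, i) * B $$ (i, l) else 0)"
    proof (rule sum.cong)
      fix m assume "m \<in> {..<N}"
      then show "A $$ (i, m) * B $$ (m, l) = (if m = i then A $$ (i, i) * B $$ (i, l) else 0)"
        using UTc_zero[OF A, of m i] less.IH[of m] less.prems by (cases m i rule: linorder_cases) auto
    qed simp
    finally show ?case using nz less.prems by simp
  qed
  then show B: "B \<in> UT N" using c by (simp add: UTc_def)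
  fix i assume i: "i < N"
  have "(A * B) $$ (i, i) = 1" using c i by simp
  then show "A $$ (i, i) * B $$ (i, i) = 1"
    using UT_mult_diag[OF A B i] by simp
qed

text \<open>The filtration of the triangular matrices by superdiagonals: \<open>k\<close> counts the
  vanishing diagonals from the main one on. Products add levels, and level \<open>N\<close> is
  zero.\<close>

definition Lv :: "nat \<Rightarrow> nat \<Rightarrow> complex mat set" where
  "Lv N k = {A \<in> carrier_mat N N. \<forall>i<N. \<forall>j<N. j < i + k \<longrightarrow> A $$ (i, j) = 0}"

lemma Lv_0: "Lv N 0 = UT N"
  by (auto simp: Lv_def UTc_def)

lemma Lv_mono: "A \<in> Lv N k \<Longrightarrow> l \<le> k \<Longrightarrow> A \<in> Lv N l"
  by (simp add: Lv_def)

lemma Lv_mult: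
  assumes A: "A \<in> Lv N a" and B: "B \<in> Lv N b"
  shows "A * B \<in> Lv N (a + b)"
  unfolding Lv_def
proof (intro CollectI conjI allI impI)
  have c: "A \<in> carrier_mat N N" "B \<in> carrier_mat N N" using A B by (auto simp: Lv_def)
  then show "A * B \<in> carrier_mat N N" by simp
  fix i j assume ij: "i < N" "j < N" "j < i + (a + b)"
  then have "A $$ (i, m) * B $$ (m, j) = 0" if "m < N" for m
    using A B that by (cases "m < i + a") (auto simp: Lv_def)
  then show "(A * B) $$ (i, j) = 0" using mult_entry[OF c] ij by (auto intro!: sum.neutral)
qed

lemma Lv_zero: "A \<in> Lv N k \<Longrightarrow> N \<le> k \<Longrightarrow> A = 0\<^sub>m N N"
  by (intro eq_matI) (auto simp: Lv_def)

lemma Lv_pow: "A \<in> Lv N 1 \<Longrightarrow> A ^\<^sub>m k \<in> Lv N k"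
proof (induction k)
  case 0
  then show ?case by (auto simp: Lv_def)
next
  case (Suc k)
  then show ?case using Lv_mult[of "A ^\<^sub>m k" N k A 1] by simp
qed

lemma strict_UT_nilpotent:
  assumes A: "A \<in> UT N" and d: "\<And>i. i < N \<Longrightarrow> A $$ (i, i) = 0"
  shows "A ^\<^sub>m N = 0\<^sub>m N N"
proof (rule Lv_zero)
  have "A \<in> Lv N 1" using A d by (auto simp: Lv_def UTc_def less_Suc_eq)
  then show "A ^\<^sub>m N \<in> Lv N N" by (rule Lv_pow)
qed simp

section \<open>Eigenvectors and triangularization over the complex numbers\<close>

lemma exists_eigenvector:
  assumes A: "A \<in> carrier_mat k k" and k: "k > 0"
  shows "\<exists>v a. v \<in> carrier_vec k \<and> v \<noteq> 0\<^sub>v k \<and> A *\<^sub>v v = (a :: complex) \<cdot>\<^sub>v v"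
proof -
  have "degree (char_poly A) = k" using degree_monic_char_poly[OF A] by simp
  then have "\<not> constant (poly (char_poly A))" using k by (simp add: constant_degree)
  then obtain a where "poly (char_poly A) a = 0"
    using fundamental_theorem_of_algebra by blast
  then have "eigenvalue A a" using eigenvalue_root_char_poly[OF A] by simp
  then show ?thesis using A unfolding eigenvalue_def eigenvector_def by auto
qed

lemma finite_eigenvalues:
  assumes A: "A \<in> carrier_mat k k"
  shows "finite {a :: complex. \<exists>v \<in> carrier_vec k. v \<noteq> 0\<^sub>v k \<and> A *\<^sub>v v = a \<cdot>\<^sub>v v}"
proof -
  have "char_poly A \<noteq> 0" using degree_monic_char_poly[OF A] by auto
  then have "finite {a. poly (char_poly A) a = 0}" by (rule poly_roots_finite)
  moreover have "{a. \<exists>v \<in> carrier_vec k. v \<noteq> 0\<^sub>v k \<and> A *\<^sub>v v = a \<cdot>\<^sub>v v} \<subseteq> {a. poly (char_poly A) a = 0}"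
    using A by (auto simp flip: eigenvalue_root_char_poly[OF A] simp: eigenvalue_def eigenvector_def)
  ultimately show ?thesis by (rule finite_subset[rotated])
qed

lemma exists_triangularization:
  assumes A: "A \<in> carrier_mat n n"
  shows "\<exists>g h. inv_pair n g h \<and> h * A * g \<in> UT n"
proof -
  obtain as where "char_poly A = (\<Prod>a\<leftarrow>as. [:- a, 1:])" using char_poly_factorized[OF A] by auto
  then obtain B where B: "B \<in> carrier_mat n n" "upper_triangular B" "similar_mat A B"
    using schur_decomposition_exists[OF A] by blast
  then obtain P Q where w: "similar_mat_wit A B P Q" unfolding similar_mat_def by blast
  then have pq: "inv_pair n P Q" and "A = P * B * Q"
    using A unfolding similar_mat_wit_def Let_def inv_pair_def by auto
  then have "Q * A * P = B"
    using conj_conj[OF inv_pair_sym[OF pq] B(1)] by simp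
  with pq B show ?thesis by (auto simp: UT_upper_triangular)
qed

text \<open>The first \<open>j\<close> columns of \<open>q\<close> are unit vectors, so
  \<open>q\<close> preserves the first steps of the standard flag. Hence \<open>col q j\<close> need
  be an eigenvector of \<open>y\<close> only modulo the first \<open>j\<close> coordinates, and the
  eigenvalue equation is imposed only from row \<open>j\<close> on.\<close>

lemma triangularize_step:
  assumes y: "y \<in> UTc N j" and j: "j < N" and q: "inv_pair N q q'"
    and qc: "\<And>l. l < j \<Longrightarrow> col q l = unit_vec N l"
    and e: "\<And>i. i < N \<Longrightarrow> j \<le> i \<Longrightarrow> (y *\<^sub>v col q j) $ i = a * col q j $ i"
  shows "q' * y * q \<in> UTc N (Suc j)"
proof -
  note c = inv_pairD[OF q] UTc_carrier[OF y]
  have q'l: "q' *\<^sub>v unit_vec N l = unit_vec N l" if "l < j" for l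
  proof -
    have "col q l = q *\<^sub>v unit_vec N l" using c that j by (intro eq_vecI) auto
    then have "q' *\<^sub>v col q l = unit_vec N l"
      using inv_pair_cancel_vec(2)[OF q, of "unit_vec N l"] by simp
    then show ?thesis using qc[OF that] by simp
  qed
  have q'supp: "(q' *\<^sub>v v) $ i = 0"
    if v: "v \<in> carrier_vec N" "\<And>i. m \<le> i \<Longrightarrow> i < N \<Longrightarrow> v $ i = 0" "m \<le> j" "m \<le> i" "i < N" for v m i
  proof -
    have col: "col q' l = unit_vec N l" if "l < j" for l
    proof -
      have "col q' l = q' *\<^sub>v unit_vec N l" using c j that by (intro eq_vecI) auto
      then show ?thesis using q'l[OF that] by simp
    qed
    have "q' *\<^sub>v v \<in> {v \<in> carrier_vec N. \<forall>i<N. m \<le> i \<longrightarrow> v $ i = 0}"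
      by (rule mult_supported_vec[of q' N v m]) (use c v j col in auto)
    then show ?thesis using that by auto
  qed
  have col: "col (q' * y * q) l = q' *\<^sub>v (y *\<^sub>v col q l)" if "l < N" for l
  proof -
    have "col (q' * y * q) l = (q' * y) *\<^sub>v col q l" using c that by (intro col_mult2[of _ N N _ N]) auto
    then show ?thesis using c that by (simp add: assoc_mult_mat_vec[of _ N N _ N])
  qed
  have "(q' *\<^sub>v (y *\<^sub>v col q l)) $ i = 0" if l: "l < Suc j" "l < i" "i < N" for l i
  proof (cases "l = j")
    case False
    then have "l < j" using l by simp
    then have "(y *\<^sub>v col q l) $ m = 0" if "Suc l \<le> m" "m < N" for m
      using that c l qc[of l] UTc_zero[OF y, of l m] by simp
    then show ?thesis using q'supp[of "y *\<^sub>v col q l" "Suc l" i] c l \<open>l < j\<close> by auto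
  next
    case True
    \<comment> \<open>The defect of the eigenvector equation; it lives in the first \<open>j\<close>
      coordinates, which \<open>q'\<close> preserves.\<close>
    define d where "d = y *\<^sub>v col q j - a \<cdot>\<^sub>v col q j"
    have d: "d \<in> carrier_vec N" by (rule carrier_vecI) (use c in \<open>simp add: d_def\<close>)
    have "d $ m = 0" if "j \<le> m" "m < N" for m
      using e[of m] that c j unfolding d_def by auto
    then have z: "(q' *\<^sub>v d) $ i = 0" using q'supp[of d j i] d l True by auto
    have "y *\<^sub>v col q j = d + a \<cdot>\<^sub>v col q j"
      using c j unfolding d_def by (intro eq_vecI) auto
    then have "q' *\<^sub>v (y *\<^sub>v col q j) = q' *\<^sub>v d + a \<cdot>\<^sub>v (q' *\<^sub>v col q j)"
      using c d j by (simp add: mult_add_distrib_mat_vec[of _ N N] mult_mat_vec[of _ N N])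
    moreover have "q' *\<^sub>v col q j = unit_vec N j"
    proof -
      have "col q j = q *\<^sub>v unit_vec N j" using c j by (intro eq_vecI) auto
      then show ?thesis using inv_pair_cancel_vec(2)[OF q, of "unit_vec N j"] by simp
    qed
    ultimately show ?thesis using z c d l True by simp
  qed
  then have z: "(q' * y * q) $$ (i, l) = 0" if "l < Suc j" "l < i" "i < N" for l i
    using col[of l] that c j index_col[of i "q' * y * q" l] by (simp del: index_mult_mat(1) index_mult_mat_vec)
  have "q' * y * q \<in> carrier_mat N N" using c by simp
  with z show ?thesis by (simp add: UTc_def del: index_mult_mat)
qed

section \<open>The Lie-Kolchin theorem\<close>

text \<open>Subgroups of \<open>SL N\<close> without a group record, with the adjugate as inversion;
  this keeps the group operations visibly regular.\<close>

definition mgroup :: "nat \<Rightarrow> complex mat set \<Rightarrow> bool" where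
  "mgroup N X \<longleftrightarrow> X \<subseteq> SL N \<and> 1\<^sub>m N \<in> X \<and> (\<forall>x\<in>X. \<forall>y\<in>X. x * y \<in> X) \<and> (\<forall>x\<in>X. adj_mat x \<in> X)"

lemma mgroupD:
  assumes "mgroup N X"
  shows "x \<in> X \<Longrightarrow> x \<in> carrier_mat N N" "x \<in> X \<Longrightarrow> det x = 1" "1\<^sub>m N \<in> X"
    "x \<in> X \<Longrightarrow> y \<in> X \<Longrightarrow> x * y \<in> X" "x \<in> X \<Longrightarrow> adj_mat x \<in> X"
    "x \<in> X \<Longrightarrow> inv_pair N x (adj_mat x)"
  using assms adj_mat_inv_pair unfolding mgroup_def by (auto simp: SL_def)

lemma mgroup_SL: "mgroup N (SL N)"
proof -
  have "det (adj_mat x) = 1" if "x \<in> SL N" for x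
    using inv_pair_det(1)[OF adj_mat_inv_pair[OF that]] that by (simp add: SL_def)
  then show ?thesis
    by (auto simp: mgroup_def SL_def adj_mat det_mult[of _ N])
qed

abbreviation SLG :: "nat \<Rightarrow> complex mat monoid" where "SLG N \<equiv> mat_grp N (SL N)"

lemma group_mat_grp:
  assumes X: "mgroup N X" shows "group (mat_grp N X)"
proof (rule groupI)
  fix x y z assume xyz: "x \<in> carrier (mat_grp N X)" "y \<in> carrier (mat_grp N X)" "z \<in> carrier (mat_grp N X)"
  then show "x \<otimes>\<^bsub>mat_grp N X\<^esub> y \<otimes>\<^bsub>mat_grp N X\<^esub> z = x \<otimes>\<^bsub>mat_grp N X\<^esub> (y \<otimes>\<^bsub>mat_grp N X\<^esub> z)"
    using mgroupD(1)[OF X] by (simp add: mat_grp_def assoc_mult_mat[of _ N N _ N _ N])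
next
  fix x assume "x \<in> carrier (mat_grp N X)"
  then show "\<exists>y\<in>carrier (mat_grp N X). y \<otimes>\<^bsub>mat_grp N X\<^esub> x = \<one>\<^bsub>mat_grp N X\<^esub>"
    using mgroupD(5)[OF X] inv_pairD(4)[OF mgroupD(6)[OF X]] by (auto simp: mat_grp_def)
qed (use mgroupD[OF X] in \<open>auto simp: mat_grp_def left_mult_one_mat[of _ N N]\<close>)

lemma mult_mat_grp: "x \<otimes>\<^bsub>mat_grp N X\<^esub> y = x * y"
  by (simp add: mat_grp_def)

lemma inv_mat_grp:
  assumes X: "mgroup N X" and x: "x \<in> X" shows "inv\<^bsub>mat_grp N X\<^esub> x = adj_mat x"
proof -
  interpret group "mat_grp N X" by (rule group_mat_grp[OF X])
  show ?thesis
    by (rule inv_equality)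
      (use x mgroupD(5)[OF X] inv_pairD(4)[OF mgroupD(6)[OF X]] in \<open>auto simp: mat_grp_def\<close>)
qed

lemma subgroup_iff_mgroup:
  assumes G: "mgroup N G"
  shows "subgroup X (mat_grp N G) \<longleftrightarrow> X \<subseteq> G \<and> mgroup N X"
proof
  assume s: "subgroup X (mat_grp N G)"
  note d = subgroup.subset[OF s] subgroup.one_closed[OF s] subgroup.m_closed[OF s] subgroup.m_inv_closed[OF s]
  have "X \<subseteq> G" using d by (simp add: mat_grp_def)
  moreover have "adj_mat x \<in> X" if "x \<in> X" for x
    using d(4)[OF that] inv_mat_grp[OF G] that \<open>X \<subseteq> G\<close> by auto
  ultimately show "X \<subseteq> G \<and> mgroup N X"
    using d G by (auto simp: mgroup_def mat_grp_def)
next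
  assume X: "X \<subseteq> G \<and> mgroup N X"
  show "subgroup X (mat_grp N G)"
    by (rule subgroup.intro)
      (use X mgroupD[of N X] inv_mat_grp[OF G] in \<open>auto simp: mat_grp_def subset_iff\<close>)
qed

section \<open>Commutators and derived groups\<close>

definition comms :: "complex mat set \<Rightarrow> complex mat set" where
  "comms X = {x * y * adj_mat x * adj_mat y |x y. x \<in> X \<and> y \<in> X}"

text \<open>Derived groups are always formed inside the ambient \<open>SL N\<close>, so iterating
  \<open>dgrp\<close> needs no change of the group record.\<close>

definition dgrp :: "nat \<Rightarrow> complex mat set \<Rightarrow> complex mat set" where
  "dgrp N X = derived (SLG N) X"

lemma dgrp_generate:
  assumes X: "mgroup N X"
  shows "dgrp N X = generate (SLG N) (comms X)"
proof -
  have "X \<subseteq> SL N" using X by (simp add: mgroup_def)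
  then have "inv\<^bsub>SLG N\<^esub> x = adj_mat x" if "x \<in> X" for x
    using inv_mat_grp[OF mgroup_SL] that by blast
  then have "derived_set (SLG N) X = (\<Union>x\<in>X. \<Union>y\<in>X. {x * y * adj_mat x * adj_mat y})"
    by (simp add: mult_mat_grp)
  also have "\<dots> = comms X" unfolding comms_def by blast
  finally have "derived_set (SLG N) X = comms X" .
  then show ?thesis by (simp add: dgrp_def derived_def)
qed

lemma dgrp_mgroup:
  assumes X: "mgroup N X"
  shows "mgroup N (dgrp N X)" "dgrp N X \<subseteq> X" "comms X \<subseteq> dgrp N X"
proof -
  interpret group "SLG N" by (rule group_mat_grp[OF mgroup_SL])
  have sX: "subgroup X (SLG N)" using X subgroup_iff_mgroup[OF mgroup_SL] by (simp add: mgroup_def)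
  then have "subgroup (dgrp N X) (SLG N)"
    unfolding dgrp_def by (intro derived_is_subgroup subgroup.subset)
  then show "mgroup N (dgrp N X)" using subgroup_iff_mgroup[OF mgroup_SL] by simp
  show "dgrp N X \<subseteq> X" unfolding dgrp_def by (rule derived_incl[OF _ sX]) simp
  show "comms X \<subseteq> dgrp N X" unfolding dgrp_generate[OF X] using generate.incl by fast
qed

lemma solvable_mat_grp_iff:
  assumes X: "mgroup N X"
  shows "solvable (mat_grp N X) \<longleftrightarrow> (\<exists>d. (dgrp N ^^ d) X = {1\<^sub>m N})"
proof -
  interpret SL: group "SLG N" by (rule group_mat_grp[OF mgroup_SL])
  interpret X: group "mat_grp N X" by (rule group_mat_grp[OF X])
  have sX: "subgroup X (SLG N)" using X subgroup_iff_mgroup[OF mgroup_SL] by (simp add: mgroup_def)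
  have e: "mat_grp N X = SLG N\<lparr>carrier := X\<rparr>" by (simp add: mat_grp_def)
  have "(derived (mat_grp N X) ^^ d) X = (dgrp N ^^ d) X \<and> (dgrp N ^^ d) X \<subseteq> X" for d
  proof (induction d)
    case (Suc d)
    then have "derived (mat_grp N X) ((dgrp N ^^ d) X) = dgrp N ((dgrp N ^^ d) X)"
      "dgrp N ((dgrp N ^^ d) X) \<subseteq> X"
      using SL.derived_consistent[OF _ sX, of "(dgrp N ^^ d) X"] SL.derived_incl[OF _ sX, of "(dgrp N ^^ d) X"]
      unfolding e dgrp_def by blast+
    with Suc show ?case by simp
  qed simp
  then show ?thesis
    using X.solvable_iff_trivial_derived_seq by (simp add: mat_grp_def)
qed

text \<open>For fixed \<open>y\<close> and \<open>b\<close> the regular map from \<open>x\<close> to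
  \<open>y x b x^-1 b^-1\<close> sends the connected group \<open>X\<close> into the derived group
  and 1 to \<open>y\<close>, so multiplication by a commutator is a link. Every element is a finite
  product of commutators, because the inverse of a commutator is one.\<close>

lemma dgrp_connected:
  assumes X: "mgroup N X" and c: "zariski_connected N X"
  shows "zariski_connected N (dgrp N X)"
proof (rule zariski_connectedI)
  note D = dgrp_mgroup[OF X]
  have XN: "X \<subseteq> carrier_mat N N" using mgroupD(1)[OF X] by blast
  have adjc: "adj_mat (a * b * adj_mat a * adj_mat b) = b * a * adj_mat b * adj_mat a" if "a \<in> X" "b \<in> X" for a b
  proof -
    note p = mgroupD(6)[OF X that(1)] mgroupD(6)[OF X that(2)]
    have 1: "inv_pair N (a * b * adj_mat a * adj_mat b) (b * (a * (adj_mat b * adj_mat a)))"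
      using inv_pair_mult[OF inv_pair_mult[OF inv_pair_mult[OF p] inv_pair_sym[OF p(1)]] inv_pair_sym[OF p(2)]] by simp
    have 2: "inv_pair N (a * b * adj_mat a * adj_mat b) (adj_mat (a * b * adj_mat a * adj_mat b))"
      by (intro mgroupD(6)[OF X] mgroupD(4,5)[OF X] that)
    have "adj_mat (a * b * adj_mat a * adj_mat b) = b * (a * (adj_mat b * adj_mat a))"
      using inv_pair_unique[OF 1 inv_pairD(2)[OF 2]] inv_pairD(3)[OF 2] by blast
    also have "\<dots> = b * a * adj_mat b * adj_mat a"
      using inv_pairD(1,2)[OF p(1)] inv_pairD(1,2)[OF p(2)]
      by (simp add: assoc_mult_mat[of _ N N _ N _ N])
    finally show ?thesis .
  qed
  have step: "zlink N (dgrp N X) y (y * (a * b * adj_mat a * adj_mat b))"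
    if y: "y \<in> dgrp N X" and a: "a \<in> X" and b: "b \<in> X" for y a b
  proof -
    have yc: "y \<in> carrier_mat N N" using mgroupD(1)[OF D(1)] y by simp
    have bc: "inv_pair N b (adj_mat b)" using mgroupD(6)[OF X b] .
    note bcD = inv_pairD[OF bc]
    let ?F = "\<lambda>x. y * (x * b * adj_mat x * adj_mat b)"
    have r1: "regular_map N N ?F"
      using yc bcD(1,2) by (intro regular_map_mult regular_map_id regular_map_const regular_map_adj)
    have r2: "?F ` X \<subseteq> dgrp N X"
    proof
      fix z assume "z \<in> ?F ` X"
      then obtain x where x: "x \<in> X" "z = ?F x" by blast
      then have "x * b * adj_mat x * adj_mat b \<in> comms X" using b unfolding comms_def by blast
      then show "z \<in> dgrp N X" using x D(3) mgroupD(4)[OF D(1) y] by blast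
    qed
    have r3: "zlink N X (1\<^sub>m N) a"
      using zariski_connected_imp_zlink[OF c] mgroupD(3)[OF X] a by simp
    have "zlink N (dgrp N X) (?F (1\<^sub>m N)) (?F a)" by (rule zlink_image[OF r3 XN r1 r2])
    moreover have "adj_mat (1\<^sub>m N :: complex mat) = 1\<^sub>m N"
      using inv_pair_unique[OF mgroupD(6)[OF mgroup_SL mgroupD(3)[OF mgroup_SL]], of "1\<^sub>m N"] by simp
    ultimately show ?thesis using yc bcD by simp
  qed
  fix x assume "x \<in> dgrp N X"
  then have "x \<in> generate (SLG N) (comms X)" using dgrp_generate[OF X] by simp
  \<comment> \<open>The base point \<open>y\<close> is kept general so that a product is handled by
    concatenating two links.\<close>
  then have "\<forall>y \<in> dgrp N X. zlink N (dgrp N X) y (y * x)"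
  proof induction
    case one
    then show ?case using mgroupD(1)[OF D(1)] by (auto simp: mat_grp_def zlink_def right_mult_one_mat[of _ N N])
  next
    case (incl h)
    then show ?case using step by (auto simp: comms_def)
  next
    case (inv h)
    then obtain a b where h: "h = a * b * adj_mat a * adj_mat b" "a \<in> X" "b \<in> X" by (auto simp: comms_def)
    then have "h \<in> SL N" using mgroupD(4,5)[OF X] X by (auto simp: mgroup_def subset_iff)
    then have "inv\<^bsub>SLG N\<^esub> h = b * a * adj_mat b * adj_mat a"
      using inv_mat_grp[OF mgroup_SL] h adjc by simp
    then show ?case using step[OF _ h(3,2)] by simp
  next
    case (eng h1 h2)
    have h: "h1 \<in> dgrp N X" "h2 \<in> dgrp N X" using eng dgrp_generate[OF X] by auto
    show ?case
    proof
      fix y assume y: "y \<in> dgrp N X"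
      have "zlink N (dgrp N X) y (y * h1)" "zlink N (dgrp N X) (y * h1) (y * h1 * h2)"
        using eng y h mgroupD(4)[OF D(1)] by auto
      then have "zlink N (dgrp N X) y (y * h1 * h2)" by (rule zlink_trans)
      then show "zlink N (dgrp N X) y (y * (h1 \<otimes>\<^bsub>SLG N\<^esub> h2))"
        using y h mgroupD(1)[OF D(1)] by (simp add: mat_grp_def assoc_mult_mat[of _ N N _ N _ N])
    qed
  qed
  then show "zlink N (dgrp N X) (1\<^sub>m N) x"
    using mgroupD(1,3)[OF D(1)] \<open>x \<in> dgrp N X\<close> by force
qed

text \<open>General regular representations are needed although the goal concerns the matrices
  themselves: the induction passes to invariant subspaces and to quotients of the natural
  representation.\<close>

definition is_rep :: "nat \<Rightarrow> complex mat set \<Rightarrow> nat \<Rightarrow> (complex mat \<Rightarrow> complex mat) \<Rightarrow> bool" where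
  "is_rep N X k \<rho> \<longleftrightarrow> regular_map N k \<rho> \<and> (\<forall>x\<in>X. \<forall>y\<in>X. \<rho> (x * y) = \<rho> x * \<rho> y) \<and> \<rho> (1\<^sub>m N) = 1\<^sub>m k"

lemma is_rep_mono: "is_rep N X k \<rho> \<Longrightarrow> Y \<subseteq> X \<Longrightarrow> is_rep N Y k \<rho>"
  by (auto simp: is_rep_def subset_iff)

lemma is_rep_conj:
  assumes r: "is_rep N X k \<rho>" and p: "inv_pair k g h" and X: "X \<subseteq> carrier_mat N N"
  shows "is_rep N X k (\<lambda>x. h * \<rho> x * g)"
proof -
  note c = inv_pairD[OF p]
  have "regular_map N k (\<lambda>x. h * \<rho> x * g)"
    using r c unfolding is_rep_def by (intro regular_map_mult regular_map_const) auto
  moreover have "\<rho> x \<in> carrier_mat k k" if "x \<in> X" for x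
    using r X that unfolding is_rep_def by (blast intro: regular_map_carrier)
  ultimately show ?thesis
    using r c conj_mult[OF p] unfolding is_rep_def by (simp del: assoc_mult_mat)
qed

text \<open>The subrepresentation on the span of the first \<open>l\<close> basis vectors, whose
  invariance is the vanishing of the lower left block.\<close>

lemma is_rep_upper_block:
  assumes r: "is_rep N X k \<rho>" and X: "X \<subseteq> carrier_mat N N" and l: "l \<le> k"
    and z: "\<And>x i j. x \<in> X \<Longrightarrow> l \<le> i \<Longrightarrow> i < k \<Longrightarrow> j < l \<Longrightarrow> \<rho> x $$ (i, j) = 0"
  shows "is_rep N X l (\<lambda>x. mat l l (\<lambda>(i, j). \<rho> x $$ (i, j)))"
proof -
  have reg: "regular_map N k \<rho>" using r by (simp add: is_rep_def)
  have car: "\<rho> x \<in> carrier_mat k k" if "x \<in> X" for x using X that by (blast intro: regular_map_carrier[OF reg])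
  have "mat l l (\<lambda>(i, j). \<rho> (x * y) $$ (i, j)) =
      mat l l (\<lambda>(i, j). \<rho> x $$ (i, j)) * mat l l (\<lambda>(i, j). \<rho> y $$ (i, j))" (is "?L = ?A * ?B")
    if xy: "x \<in> X" "y \<in> X" for x y
  proof (rule eq_matI)
    fix i j assume "i < dim_row (?A * ?B)" "j < dim_col (?A * ?B)"
    then have ij: "i < l" "j < l" by auto
    have "?L $$ (i, j) = (\<Sum>m<k. \<rho> x $$ (i, m) * \<rho> y $$ (m, j))"
      using ij l r xy mult_entry[OF car[OF xy(1)] car[OF xy(2)]] by (simp add: is_rep_def)
    also have "\<dots> = (\<Sum>m<l. \<rho> x $$ (i, m) * \<rho> y $$ (m, j))"
      by (rule sum.mono_neutral_right) (use l z[OF xy(2)] ij in auto)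
    also have "\<dots> = (?A * ?B) $$ (i, j)"
      using ij by (subst mult_entry[of _ l l _ l]) auto
    finally show "?L $$ (i, j) = (?A * ?B) $$ (i, j)" .
  qed auto
  moreover have "regular_map N l (\<lambda>x. mat l l (\<lambda>(i, j). \<rho> x $$ (i, j)))"
    using l by (intro regular_map_mat regular_map_entry[OF reg]) auto
  moreover have "mat l l (\<lambda>(i, j). \<rho> (1\<^sub>m N) $$ (i, j)) = 1\<^sub>m l"
    using r l by (intro eq_matI) (auto simp: is_rep_def)
  ultimately show ?thesis by (simp add: is_rep_def)
qed

text \<open>The quotient by the span of the first \<open>l\<close> basis vectors; triangularity of
  the leading columns makes that span invariant.\<close>

lemma is_rep_lower_block:
  assumes r: "is_rep N X k \<rho>" and X: "X \<subseteq> carrier_mat N N" and l: "l \<le> k"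
    and z: "\<And>x. x \<in> X \<Longrightarrow> \<rho> x \<in> UTc k l"
  shows "is_rep N X (k - l) (\<lambda>x. mat (k - l) (k - l) (\<lambda>(i, j). \<rho> x $$ (i + l, j + l)))"
proof -
  have reg: "regular_map N k \<rho>" using r by (simp add: is_rep_def)
  have car: "\<rho> x \<in> carrier_mat k k" if "x \<in> X" for x using X that by (blast intro: regular_map_carrier[OF reg])
  let ?b = "\<lambda>x. mat (k - l) (k - l) (\<lambda>(i, j). \<rho> x $$ (i + l, j + l))"
  have "?b (x * y) = ?b x * ?b y" if xy: "x \<in> X" "y \<in> X" for x y
  proof (rule eq_matI)
    fix i j assume "i < dim_row (?b x * ?b y)" "j < dim_col (?b x * ?b y)"
    then have ij: "i < k - l" "j < k - l" by auto
    have "?b (x * y) $$ (i, j) = (\<Sum>m<k. \<rho> x $$ (i + l, m) * \<rho> y $$ (m, j + l))"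
      using ij l r xy mult_entry[OF car[OF xy(1)] car[OF xy(2)]] by (simp add: is_rep_def)
    also have "\<dots> = (\<Sum>m\<in>{l..<k}. \<rho> x $$ (i + l, m) * \<rho> y $$ (m, j + l))"
      by (rule sum.mono_neutral_right) (use l UTc_zero[OF z[OF xy(1)]] ij in auto)
    also have "\<dots> = (\<Sum>m<k - l. \<rho> x $$ (i + l, m + l) * \<rho> y $$ (m + l, j + l))"
      by (rule sum.reindex_bij_witness[of _ "\<lambda>m. m + l" "\<lambda>m. m - l"]) auto
    also have "\<dots> = (?b x * ?b y) $$ (i, j)"
      using ij by (subst mult_entry[of _ "k - l" "k - l" _ "k - l"]) auto
    finally show "?b (x * y) $$ (i, j) = (?b x * ?b y) $$ (i, j)" .
  qed auto
  moreover have "regular_map N (k - l) ?b"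
    using l by (intro regular_map_mat regular_map_entry[OF reg]) auto
  moreover have "?b (1\<^sub>m N) = 1\<^sub>m (k - l)"
    using r l by (intro eq_matI) (auto simp: is_rep_def)
  ultimately show ?thesis by (simp add: is_rep_def)
qed

definition inv_subspace :: "complex mat set \<Rightarrow> nat \<Rightarrow> (complex mat \<Rightarrow> complex mat) \<Rightarrow> complex vec set \<Rightarrow> bool" where
  "inv_subspace X k \<rho> M \<longleftrightarrow> M \<subseteq> carrier_vec k \<and> 0\<^sub>v k \<in> M \<and> (\<forall>u\<in>M. \<forall>v\<in>M. u + v \<in> M) \<and>
     (\<forall>c. \<forall>u\<in>M. c \<cdot>\<^sub>v u \<in> M) \<and> (\<forall>x\<in>X. \<forall>u\<in>M. \<rho> x *\<^sub>v u \<in> M)"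

text \<open>Induction on the derived length and, inside it, on the dimension. If there is a proper
  invariant subspace, restrict to it. Otherwise connectedness is used twice: it makes the character
  of the derived group on a common eigenvector invariant under conjugation, so the derived group
  acts by scalars; and it makes an eigenspace of each element invariant, so all of \<open>X\<close>
  acts by scalars.\<close>

lemma common_eigenvector:
  assumes "mgroup N X" "zariski_connected N X" "(dgrp N ^^ d) X = {1\<^sub>m N}" "is_rep N X k \<rho>" "k > 0"
  shows "\<exists>v \<in> carrier_vec k. v \<noteq> 0\<^sub>v k \<and> (\<forall>x\<in>X. \<exists>c. \<rho> x *\<^sub>v v = c \<cdot>\<^sub>v v)"
  using assms
proof (induction d arbitrary: X k \<rho>)
  case 0
  then have "X = {1\<^sub>m N}" "\<rho> (1\<^sub>m N) = 1\<^sub>m k" by (auto simp: is_rep_def)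
  moreover have "1\<^sub>m k *\<^sub>v unit_vec k 0 = (1 :: complex) \<cdot>\<^sub>v unit_vec k 0" by simp
  moreover have "unit_vec k 0 \<noteq> (0\<^sub>v k :: complex vec)"
    using 0 by (metis index_unit_vec(1) index_zero_vec(1) one_neq_zero)
  ultimately show ?case by (intro bexI[of _ "unit_vec k 0"]) (auto intro!: exI[of _ 1])
next
  case (Suc d)
  note IHd = Suc.IH
  note X = Suc.prems(1) and conn = Suc.prems(2)
  define Y where "Y = dgrp N X"
  note Y = dgrp_mgroup[OF X, folded Y_def]
  have Yconn: "zariski_connected N Y" unfolding Y_def by (rule dgrp_connected[OF X conn])
  have Yd: "(dgrp N ^^ d) Y = {1\<^sub>m N}" using Suc.prems(3) unfolding Y_def by (simp add: funpow_swap1)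
  have XN: "X \<subseteq> carrier_mat N N" using mgroupD(1)[OF X] by blast
  show ?case using Suc.prems(4,5)
  proof (induction k arbitrary: \<rho> rule: less_induct)
    case (less k)
    note rep = less.prems(1) and k = less.prems(2)
    have reg: "regular_map N k \<rho>" using rep by (simp add: is_rep_def)
    have car: "\<rho> x \<in> carrier_mat k k" if "x \<in> X" for x using XN that by (blast intro: regular_map_carrier[OF reg])
    have mul: "\<rho> (x * y) = \<rho> x * \<rho> y" if "x \<in> X" "y \<in> X" for x y using rep that by (simp add: is_rep_def)
    have one: "\<rho> (1\<^sub>m N) = 1\<^sub>m k" using rep by (simp add: is_rep_def)
    have inv: "inv_pair k (\<rho> x) (\<rho> (adj_mat x))" if "x \<in> X" for x
      using mul[of x "adj_mat x"] mul[of "adj_mat x" x] mgroupD(5)[OF X that] inv_pairD[OF mgroupD(6)[OF X that]]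
        car that one by (simp add: inv_pair_def)
    show ?case
    proof (cases "\<exists>M. inv_subspace X k \<rho> M \<and> M \<noteq> {0\<^sub>v k} \<and> M \<noteq> carrier_vec k")
      case True
      then obtain M where "inv_subspace X k \<rho> M" and M67: "M \<noteq> {0\<^sub>v k}" "M \<noteq> carrier_vec k" by blast
      then have M: "M \<subseteq> carrier_vec k" "0\<^sub>v k \<in> M" "\<And>u v. u\<in>M \<Longrightarrow> v\<in>M \<Longrightarrow> u + v \<in> M"
        "\<And>c u. u\<in>M \<Longrightarrow> c \<cdot>\<^sub>v u \<in> M" "\<And>x u. x\<in>X \<Longrightarrow> u\<in>M \<Longrightarrow> \<rho> x *\<^sub>v u \<in> M"
        unfolding inv_subspace_def by simp_all
      obtain g h r where p: "inv_pair k g h" and rk: "r \<le> k" and Mr: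
        "\<And>v. v \<in> carrier_vec k \<Longrightarrow> v \<in> M \<longleftrightarrow> (\<forall>i. r \<le> i \<longrightarrow> i < k \<longrightarrow> (h *\<^sub>v v) $ i = 0)"
        using adapted_basis[OF M(1-4)] by metis
      note c = inv_pairD[OF p]
      have "r \<noteq> k" using Mr M(1) M67(2) by auto
      with rk have rk: "r < k" by simp
      have "r \<noteq> 0"
      proof
        assume r0: "r = 0"
        have "v = 0\<^sub>v k" if "v \<in> M" for v
        proof -
          have v: "v \<in> carrier_vec k" using M(1) that by blast
          have "h *\<^sub>v v = 0\<^sub>v k" using Mr[OF v] that r0 c by (intro eq_vecI) auto
          then have "v = g *\<^sub>v 0\<^sub>v k" using inv_pair_cancel_vec(1)[OF p v] by simp
          also have "\<dots> = 0\<^sub>v k" using c by (intro eq_vecI) auto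
          finally show ?thesis .
        qed
        then show False using M(2) M67(1) by blast
      qed
      define \<rho>' where "\<rho>' x = h * \<rho> x * g" for x
      have rep': "is_rep N X k \<rho>'" unfolding \<rho>'_def by (rule is_rep_conj[OF rep p XN])
      have colM: "col g j \<in> M" if "j < r" for j
      proof -
        have "h *\<^sub>v col g j = col (h * g) j" using c that rk by (intro col_mult2[symmetric, of _ k k _ k]) auto
        then have "(h *\<^sub>v col g j) $ i = 0" if "r \<le> i" "i < k" for i
          using c that \<open>j < r\<close> by (simp del: index_mult_mat_vec)
        then show ?thesis using Mr[of "col g j"] c that rk by auto
      qed
      have z: "\<rho>' x $$ (i, j) = 0" if "x \<in> X" "r \<le> i" "i < k" "j < r" for x i j
      proof -
        have "\<rho>' x $$ (i, j) = col (\<rho>' x) j $ i"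
          using that c car[OF that(1)] rk unfolding \<rho>'_def by (intro index_col[symmetric]) auto
        also have "col (\<rho>' x) j = (h * \<rho> x) *\<^sub>v col g j" unfolding \<rho>'_def
          using that c car[OF that(1)] rk by (intro col_mult2[of _ k k _ k]) auto
        also have "\<dots> = h *\<^sub>v (\<rho> x *\<^sub>v col g j)"
          using that c car[OF that(1)] rk by (intro assoc_mult_mat_vec) auto
        finally show ?thesis
          using Mr[of "\<rho> x *\<^sub>v col g j"] M(5)[OF that(1) colM[OF that(4)]] that M(1) by auto
      qed
      have "is_rep N X r (\<lambda>x. mat r r (\<lambda>(i, j). \<rho>' x $$ (i, j)))"
        by (rule is_rep_upper_block[OF rep' XN]) (use rk z in auto)
      from less.IH[OF rk this] \<open>r \<noteq> 0\<close> obtain w where w: "w \<in> carrier_vec r" "w \<noteq> 0\<^sub>v r"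
        "\<And>x. x \<in> X \<Longrightarrow> \<exists>a. mat r r (\<lambda>(i, j). \<rho>' x $$ (i, j)) *\<^sub>v w = a \<cdot>\<^sub>v w" by auto
      define u where "u = vec k (\<lambda>i. if i < r then w $ i else 0)"
      have u: "u \<in> carrier_vec k" by (simp add: u_def)
      have ev: "\<exists>a. \<rho>' x *\<^sub>v u = a \<cdot>\<^sub>v u" if x: "x \<in> X" for x
      proof -
        obtain a where a: "mat r r (\<lambda>(i, j). \<rho>' x $$ (i, j)) *\<^sub>v w = a \<cdot>\<^sub>v w" using w(3)[OF x] by blast
        have c': "\<rho>' x \<in> carrier_mat k k" using c car[OF x] by (simp add: \<rho>'_def)
        have "(\<rho>' x *\<^sub>v u) $ i = a * u $ i" if i: "i < k" for i
        proof -
          have s: "(\<rho>' x *\<^sub>v u) $ i = (\<Sum>l<r. \<rho>' x $$ (i, l) * w $ l)"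
          proof -
            have "(\<rho>' x *\<^sub>v u) $ i = (\<Sum>l<k. \<rho>' x $$ (i, l) * u $ l)" by (rule mult_vec_entry[OF c' u i])
            also have "\<dots> = (\<Sum>l<r. \<rho>' x $$ (i, l) * u $ l)"
              by (rule sum.mono_neutral_right) (use rk in \<open>auto simp: u_def\<close>)
            also have "\<dots> = (\<Sum>l<r. \<rho>' x $$ (i, l) * w $ l)"
              by (rule sum.cong) (use rk in \<open>auto simp: u_def\<close>)
            finally show ?thesis .
          qed
          show ?thesis
          proof (cases "i < r")
            case True
            have "(\<Sum>l<r. \<rho>' x $$ (i, l) * w $ l) = (mat r r (\<lambda>(i, j). \<rho>' x $$ (i, j)) *\<^sub>v w) $ i"
              using True w(1) by (subst mult_vec_entry[of _ r r]) auto
            also have "\<dots> = a * u $ i" unfolding a using True w(1) i by (simp add: u_def)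
            finally show ?thesis using s by simp
          next
            case False
            then show ?thesis using s z[OF x, of i] i by (simp add: u_def)
          qed
        qed
        then have "\<rho>' x *\<^sub>v u = a \<cdot>\<^sub>v u"
          using c' u by (intro eq_vecI) (auto simp del: index_mult_mat_vec)
        then show ?thesis ..
      qed
      have "\<exists>a. \<rho> x *\<^sub>v (g *\<^sub>v u) = a \<cdot>\<^sub>v (g *\<^sub>v u)" if x: "x \<in> X" for x
      proof -
        obtain a where a: "\<rho>' x *\<^sub>v u = a \<cdot>\<^sub>v u" using ev[OF x] by blast
        have "\<rho> x *\<^sub>v (g *\<^sub>v u) = g *\<^sub>v (h *\<^sub>v (\<rho> x *\<^sub>v (g *\<^sub>v u)))"
          using c car[OF x] u by (intro inv_pair_cancel_vec(1)[OF p, symmetric]) auto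
        also have "h *\<^sub>v (\<rho> x *\<^sub>v (g *\<^sub>v u)) = \<rho>' x *\<^sub>v u"
          using c car[OF x] u unfolding \<rho>'_def by (simp add: assoc_mult_mat_vec[of _ k k _ k])
        also have "g *\<^sub>v (\<rho>' x *\<^sub>v u) = a \<cdot>\<^sub>v (g *\<^sub>v u)"
          using a c u by (simp add: mult_mat_vec[of _ k k])
        finally show ?thesis ..
      qed
      moreover have "g *\<^sub>v u \<noteq> 0\<^sub>v k"
      proof
        assume "g *\<^sub>v u = 0\<^sub>v k"
        then have "u = h *\<^sub>v 0\<^sub>v k" using inv_pair_cancel_vec(2)[OF p u] by simp
        also have "\<dots> = 0\<^sub>v k" using c by (intro eq_vecI) auto
        finally have u0: "u = 0\<^sub>v k" .
        have "w $ i = 0" if "i < r" for i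
        proof -
          have "u $ i = w $ i" using that rk by (simp add: u_def)
          then show ?thesis using that rk by (simp add: u0)
        qed
        then show False using w(1,2) by (auto intro: eq_vecI)
      qed
      ultimately show ?thesis using c u by (intro bexI[of _ "g *\<^sub>v u"]) auto
    next
      case False
      have irr: "M = carrier_vec k" if "M \<subseteq> carrier_vec k" "0\<^sub>v k \<in> M" "\<And>u v. u\<in>M \<Longrightarrow> v\<in>M \<Longrightarrow> u + v \<in> M"
        "\<And>c u. u\<in>M \<Longrightarrow> c \<cdot>\<^sub>v u \<in> M" "\<And>x u. x\<in>X \<Longrightarrow> u\<in>M \<Longrightarrow> \<rho> x *\<^sub>v u \<in> M" "v \<in> M" "v \<noteq> 0\<^sub>v k" for M v
      proof -
        have "inv_subspace X k \<rho> M" unfolding inv_subspace_def using that(1-5) by simp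
        moreover have "M \<noteq> {0\<^sub>v k}" using that(6,7) by blast
        ultimately show ?thesis using False by blast
      qed
      have nz: "\<rho> x *\<^sub>v v \<noteq> 0\<^sub>v k" if "x \<in> X" "v \<in> carrier_vec k" "v \<noteq> 0\<^sub>v k" for x v
      proof
        assume "\<rho> x *\<^sub>v v = 0\<^sub>v k"
        then have "v = \<rho> (adj_mat x) *\<^sub>v 0\<^sub>v k"
          using inv_pair_cancel_vec(2)[OF inv[OF that(1)] that(2)] by simp
        also have "\<dots> = 0\<^sub>v k" using inv_pairD(2)[OF inv[OF that(1)]] by (intro eq_vecI) auto
        finally show False using that by simp
      qed
      obtain v where v: "v \<in> carrier_vec k" "v \<noteq> 0\<^sub>v k" "\<forall>x\<in>Y. \<exists>c. \<rho> x *\<^sub>v v = c \<cdot>\<^sub>v v"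
        using IHd[OF Y(1) Yconn Yd is_rep_mono[OF rep Y(2)] k] by blast
      then obtain \<chi> where \<chi>: "\<And>y. y \<in> Y \<Longrightarrow> \<rho> y *\<^sub>v v = \<chi> y \<cdot>\<^sub>v v" by metis
      \<comment> \<open>A matrix has finitely many eigenvalues, so a regular function with values among them
        is constant on the connected set \<open>X\<close>.\<close>
      have const: "c x = c (1\<^sub>m N)"
        if F: "regular_map N k F" and u: "u \<in> carrier_vec k" "u \<noteq> 0\<^sub>v k" and A: "A \<in> carrier_mat k k"
          and Fu:
          "\<And>x. x \<in> X \<Longrightarrow> F x *\<^sub>v u = c x \<cdot>\<^sub>v u"
          and ev: "\<And>x. x \<in> X \<Longrightarrow> \<exists>w\<in>carrier_vec k. w \<noteq> 0\<^sub>v k \<and> A *\<^sub>v w = c x \<cdot>\<^sub>v w" and x: "x \<in> X" for F u A c x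
      proof -
        obtain a where a: "a < k" "u $ a \<noteq> 0"
          using u by (metis carrier_vecD eq_vecI index_zero_vec(1) index_zero_vec(2))
        have reg: "regular_fun N (\<lambda>x. inverse (u $ a) * (\<Sum>l<k. F x $$ (a, l) * u $ l))"
          using a by (intro regular_fun_mult regular_fun_sum regular_fun_const regular_map_entry[OF F]) auto
        have val: "inverse (u $ a) * (\<Sum>l<k. F y $$ (a, l) * u $ l) = c y" if y: "y \<in> X" for y
        proof -
          have "(\<Sum>l<k. F y $$ (a, l) * u $ l) = (F y *\<^sub>v u) $ a"
            using XN y a u(1) regular_map_carrier[OF F] by (intro mult_vec_entry[of _ k k, symmetric]) auto
          then show ?thesis using Fu[OF y] a u(1) by simp
        qed
        have "zlink N X (1\<^sub>m N) x" using zariski_connected_imp_zlink[OF conn] mgroupD(3)[OF X] x by blast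
        from regular_fun_finite_const[OF this XN reg finite_eigenvalues[OF A]] val ev x
        show ?thesis using mgroupD(3)[OF X] by (auto simp: image_subset_iff)
      qed
      have YX: "y \<in> X" if "y \<in> Y" for y using Y(2) that by blast
      \<comment> \<open>Normality of the derived group: \<open>x^-1 y x y^-1\<close> is a
        commutator.\<close>
      have conjY: "adj_mat x * y * x \<in> Y" if "x \<in> X" "y \<in> Y" for x y
      proof -
        note p = inv_pairD[OF mgroupD(6)[OF X that(1)]] inv_pairD[OF mgroupD(6)[OF X YX[OF that(2)]]]
        have "adj_mat (adj_mat x) = x"
          using inv_pair_unique[OF mgroupD(6)[OF X mgroupD(5)[OF X that(1)]], of x] p by simp
        then have "adj_mat x * y * x * adj_mat y \<in> Y"
          using Y(3) mgroupD(5)[OF X that(1)] YX[OF that(2)] by (force simp: comms_def)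
        then have "adj_mat x * y * x * adj_mat y * y \<in> Y" using mgroupD(4)[OF Y(1)] that by blast
        then show ?thesis using p by (simp add: assoc_mult_mat[of _ N N _ N _ N])
      qed
      have move: "\<rho> y *\<^sub>v (\<rho> x *\<^sub>v u) = \<rho> x *\<^sub>v (\<rho> (adj_mat x * y * x) *\<^sub>v u)"
        if "x \<in> X" "y \<in> Y" "u \<in> carrier_vec k" for x y u
      proof -
        note p = mgroupD(6)[OF X that(1)]
        have "x * (adj_mat x * y * x) = y * x"
          using inv_pairD[OF p] mgroupD(1)[OF X YX[OF that(2)]] inv_pair_cancel(1)[OF p, of "y * x" N]
          by (simp add: assoc_mult_mat[of _ N N _ N _ N])
        then have "\<rho> x * \<rho> (adj_mat x * y * x) = \<rho> y * \<rho> x"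
          using mul[OF that(1) YX[OF conjY[OF that(1,2)]]] mul[OF YX[OF that(2)] that(1)] by simp
        then show ?thesis
          using car[OF that(1)] car[OF YX[OF that(2)]] car[OF YX[OF conjY[OF that(1,2)]]] that(3)
          by (metis assoc_mult_mat_vec)
      qed
      \<comment> \<open>As \<open>x\<close> varies, the value of \<chi> at the conjugate is an
        eigenvalue of the fixed matrix \<open>\<rho> y\<close>, with eigenvector
        \<open>\<rho> x *\<^sub>v v\<close>; finitely many values on a connected group leave only
        one.\<close>
      have inv\<chi>: "\<chi> (adj_mat x * y * x) = \<chi> y" if xy: "x \<in> X" "y \<in> Y" for x y
      proof -
        have yc: "y \<in> carrier_mat N N" using mgroupD(1)[OF X YX[OF xy(2)]] .
        have "\<chi> (adj_mat x * y * x) = \<chi> (adj_mat (1\<^sub>m N) * y * 1\<^sub>m N)"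
        proof (rule const[of "\<lambda>x. \<rho> (adj_mat x * y * x)" v "\<rho> y" "\<lambda>x. \<chi> (adj_mat x * y * x)"])
          show "regular_map N k (\<lambda>x. \<rho> (adj_mat x * y * x))"
            using yc by (intro regular_map_comp[OF _ reg] regular_map_mult regular_map_adj regular_map_const regular_map_id)
          fix z assume z: "z \<in> X"
          show "\<rho> (adj_mat z * y * z) *\<^sub>v v = \<chi> (adj_mat z * y * z) \<cdot>\<^sub>v v"
            using \<chi> conjY[OF z xy(2)] by blast
          then have "\<rho> y *\<^sub>v (\<rho> z *\<^sub>v v) = \<chi> (adj_mat z * y * z) \<cdot>\<^sub>v (\<rho> z *\<^sub>v v)"
            using move[OF z xy(2) v(1)] car[OF z] v(1) by (simp add: mult_mat_vec[of _ k k])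
          then show "\<exists>w\<in>carrier_vec k. w \<noteq> 0\<^sub>v k \<and> \<rho> y *\<^sub>v w = \<chi> (adj_mat z * y * z) \<cdot>\<^sub>v w"
            using nz[OF z v(1,2)] car[OF z] v(1) by (intro bexI[of _ "\<rho> z *\<^sub>v v"]) auto
        qed (use v car YX xy in auto)
        moreover have "adj_mat (1\<^sub>m N :: complex mat) = 1\<^sub>m N"
          using inv_pair_unique[OF mgroupD(6)[OF X mgroupD(3)[OF X]], of "1\<^sub>m N"] by simp
        ultimately show ?thesis using yc by simp
      qed
      have scal: "\<rho> y *\<^sub>v u = \<chi> y \<cdot>\<^sub>v u" if "y \<in> Y" "u \<in> carrier_vec k" for y u
      proof -
        \<comment> \<open>The \<chi>-eigenspace of the derived group is invariant under
          \<open>X\<close> because \<chi> is, so irreducibility makes it the whole space.\<close>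
        define V where "V = {u \<in> carrier_vec k. \<forall>y\<in>Y. \<rho> y *\<^sub>v u = \<chi> y \<cdot>\<^sub>v u}"
        have "V = carrier_vec k"
        proof (rule irr[of V v])
          show "0\<^sub>v k \<in> V" using mult_zero_vec[OF car[OF YX]] unfolding V_def by (auto intro!: eq_vecI)
          show "u + w \<in> V" if "u \<in> V" "w \<in> V" for u w
            using that car[OF YX] unfolding V_def
            by (auto simp: mult_add_distrib_mat_vec[of _ k k] smult_add_distrib_vec[of _ k])
          show "c \<cdot>\<^sub>v u \<in> V" if "u \<in> V" for c u
            using that car[OF YX] unfolding V_def
            by (auto simp: mult_mat_vec[of _ k k] smult_smult_assoc mult.commute)
          show "\<rho> x *\<^sub>v u \<in> V" if x: "x \<in> X" and u: "u \<in> V" for x u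
          proof -
            have "\<rho> y *\<^sub>v (\<rho> x *\<^sub>v u) = \<chi> y \<cdot>\<^sub>v (\<rho> x *\<^sub>v u)" if y: "y \<in> Y" for y
              using move[OF x y] u conjY[OF x y] inv\<chi>[OF x y] car[OF x] unfolding V_def
              by (simp add: mult_mat_vec[of _ k k])
            then show ?thesis using u car[OF x] unfolding V_def by auto
          qed
        qed (use v \<chi> in \<open>auto simp: V_def\<close>)
        then show ?thesis using that unfolding V_def by blast
      qed
      have "\<exists>\<alpha>. \<forall>u \<in> carrier_vec k. \<rho> a *\<^sub>v u = \<alpha> \<cdot>\<^sub>v u" if a: "a \<in> X" for a
      proof -
        obtain y \<alpha> where y: "y \<in> carrier_vec k" "y \<noteq> 0\<^sub>v k" "\<rho> a *\<^sub>v y = \<alpha> \<cdot>\<^sub>v y"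
          using exists_eigenvector[OF car[OF a] k] by blast
        have \<alpha>: "\<alpha> \<noteq> 0"
        proof
          assume "\<alpha> = 0"
          then have "\<rho> a *\<^sub>v y = 0\<^sub>v k" using y by (auto intro!: eq_vecI)
          then show False using nz[OF a y(1,2)] by simp
        qed
        \<comment> \<open>This ordering of the commutator gives
          \<open>b * a * com b = a * b\<close>, so \<open>\<rho> b\<close> maps an
          \<alpha>-eigenvector of \<open>\<rho> a\<close> to one with eigenvalue
          \<open>\<alpha> * \<chi> (com b)\<close>.\<close>
        define com where "com b = adj_mat a * adj_mat b * a * b" for b
        have pa: "inv_pair N a (adj_mat a)" using mgroupD(6)[OF X a] .
        have adj2: "adj_mat (adj_mat x) = x" if "x \<in> X" for x
          using inv_pair_unique[OF mgroupD(6)[OF X mgroupD(5)[OF X that]], of x] inv_pairD[OF mgroupD(6)[OF X that]] by simp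
        have comY: "com b \<in> Y" if "b \<in> X" for b
        proof -
          have "com b = adj_mat a * adj_mat b * adj_mat (adj_mat a) * adj_mat (adj_mat b)"
            using adj2 a that by (simp add: com_def)
          then have "com b \<in> comms X" using mgroupD(5)[OF X] a that unfolding comms_def by blast
          then show ?thesis using Y(3) by blast
        qed
        have swap: "\<rho> a *\<^sub>v (\<rho> b *\<^sub>v u) = \<rho> b *\<^sub>v (\<rho> a *\<^sub>v (\<chi> (com b) \<cdot>\<^sub>v u))"
          if b: "b \<in> X" and u: "u \<in> carrier_vec k" for b u
        proof -
          note p = inv_pairD[OF mgroupD(6)[OF X b]] inv_pairD[OF pa]
          have "b * (a * com b) = a * b"
            using p inv_pair_cancel(1)[OF mgroupD(6)[OF X b], of "a * b" N]
              inv_pair_cancel(1)[OF pa, of "adj_mat b * (a * b)" N]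
            by (simp add: com_def assoc_mult_mat[of _ N N _ N _ N])
          then have "\<rho> a * \<rho> b = \<rho> b * (\<rho> a * \<rho> (com b))"
            using mul[OF a b] mul[OF b mgroupD(4)[OF X a YX[OF comY[OF b]]]] mul[OF a YX[OF comY[OF b]]] by simp
          then have "\<rho> a * \<rho> b *\<^sub>v u = \<rho> b * (\<rho> a * \<rho> (com b)) *\<^sub>v u" by simp
          then show ?thesis
            using car[OF a] car[OF b] car[OF YX[OF comY[OF b]]] u scal[OF comY[OF b] u]
            by (simp add: assoc_mult_mat_vec[of _ k k _ k])
        qed
        have eva: "\<rho> a *\<^sub>v (\<rho> b *\<^sub>v u) = (\<alpha> * \<chi> (com b)) \<cdot>\<^sub>v (\<rho> b *\<^sub>v u)"
          if b: "b \<in> X" and u: "u \<in> carrier_vec k" "\<rho> a *\<^sub>v u = \<alpha> \<cdot>\<^sub>v u" for b u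
          using swap[OF b u(1)] u car[OF a] car[OF b]
          by (simp add: mult_mat_vec[of _ k k] smult_smult_assoc mult.commute)
        \<comment> \<open>The eigenvalue \<open>\<alpha> * \<chi> (com b)\<close> of the fixed
          matrix \<open>\<rho> a\<close> depends regularly on \<open>b\<close>, hence is constant;
          at \<open>b = 1\<close> it is \<alpha>.\<close>
        have triv: "\<alpha> * \<chi> (com b) = \<alpha> * \<chi> (com (1\<^sub>m N))" if b: "b \<in> X" for b
        proof (rule const[of "\<lambda>b. \<alpha> \<cdot>\<^sub>m \<rho> (com b)" y "\<rho> a" "\<lambda>b. \<alpha> * \<chi> (com b)"])
          show "regular_map N k (\<lambda>b. \<alpha> \<cdot>\<^sub>m \<rho> (com b))" unfolding com_def
            using inv_pairD[OF pa]
            by (intro regular_map_smult regular_fun_const regular_map_comp[OF _ reg] regular_map_mult regular_map_adj regular_map_const regular_map_id)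
          fix b assume b: "b \<in> X"
          show "\<alpha> \<cdot>\<^sub>m \<rho> (com b) *\<^sub>v y = (\<alpha> * \<chi> (com b)) \<cdot>\<^sub>v y"
            using scal[OF comY[OF b] y(1)] car[OF YX[OF comY[OF b]]] y(1)
            by (simp add: smult_mat_vec[of _ k k] smult_smult_assoc)
          show "\<exists>w\<in>carrier_vec k. w \<noteq> 0\<^sub>v k \<and> \<rho> a *\<^sub>v w = (\<alpha> * \<chi> (com b)) \<cdot>\<^sub>v w"
            using eva[OF b y(1,3)] nz[OF b y(1,2)] car[OF b] y(1) by (intro bexI[of _ "\<rho> b *\<^sub>v y"]) auto
        qed (use y car a b in auto)
        have "\<alpha> * \<chi> (com (1\<^sub>m N)) = \<alpha>"
        proof -
          have "\<rho> (1\<^sub>m N) *\<^sub>v y = y" using one y by simp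
          then have "\<alpha> \<cdot>\<^sub>v y = (\<alpha> * \<chi> (com (1\<^sub>m N))) \<cdot>\<^sub>v y"
            using eva[OF mgroupD(3)[OF X] y(1,3)] y(3) by simp
          moreover obtain i where "i < k" "y $ i \<noteq> 0"
            using y(1,2) by (metis carrier_vecD eq_vecI index_zero_vec(1) index_zero_vec(2))
          ultimately show ?thesis using y(1) by (metis index_smult_vec(1) carrier_vecD mult_right_cancel)
        qed
        with triv have triv: "\<alpha> * \<chi> (com b) = \<alpha>" if "b \<in> X" for b using that by simp
        define V where "V = {u \<in> carrier_vec k. \<rho> a *\<^sub>v u = \<alpha> \<cdot>\<^sub>v u}"
        have "V = carrier_vec k"
        proof (rule irr[of V y])
          show "0\<^sub>v k \<in> V" using mult_zero_vec[OF car[OF a]] unfolding V_def by (auto intro!: eq_vecI)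
          show "u + w \<in> V" if "u \<in> V" "w \<in> V" for u w
            using that car[OF a] unfolding V_def
            by (auto simp: mult_add_distrib_mat_vec[of _ k k] smult_add_distrib_vec[of _ k])
          show "c \<cdot>\<^sub>v u \<in> V" if "u \<in> V" for c u
            using that car[OF a] unfolding V_def
            by (auto simp: mult_mat_vec[of _ k k] smult_smult_assoc mult.commute)
          show "\<rho> x *\<^sub>v u \<in> V" if x: "x \<in> X" and u: "u \<in> V" for x u
            using eva[OF x, of u] u triv[OF x] car[OF x] unfolding V_def by auto
        qed (use y in \<open>auto simp: V_def\<close>)
        then show ?thesis unfolding V_def by blast
      qed
      then show ?thesis using v(1,2) by blast
    qed
  qed
qed

text \<open>One column at a time: a common eigenvector of the action on the quotient by the first
  \<open>j\<close> basis vectors is lifted and exchanged into position \<open>j\<close>.\<close>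

lemma lie_kolchin:
  assumes X: "mgroup N X" "zariski_connected N X" and s: "solvable (mat_grp N X)"
  shows "\<exists>g h. inv_pair N g h \<and> (\<forall>x\<in>X. h * x * g \<in> UT N)"
proof -
  obtain d where d: "(dgrp N ^^ d) X = {1\<^sub>m N}" using s solvable_mat_grp_iff[OF X(1)] by blast
  have XN: "X \<subseteq> carrier_mat N N" using mgroupD(1)[OF X(1)] by blast
  have "\<exists>g h. inv_pair N g h \<and> (\<forall>x\<in>X. h * x * g \<in> UTc N j)" if "j \<le> N" for j
    using that
  proof (induction j)
    case 0
    then show ?case using inv_pair_one[of N] XN by (intro exI[of _ "1\<^sub>m N"]) (auto simp: UTc_def)
  next
    case (Suc j)
    then obtain g h where p: "inv_pair N g h" and gh: "\<And>x. x \<in> X \<Longrightarrow> h * x * g \<in> UTc N j" by auto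
    note c = inv_pairD[OF p]
    have "is_rep N X N (\<lambda>x. x)" using regular_map_id by (simp add: is_rep_def)
    then have rep: "is_rep N X N (\<lambda>x. h * x * g)" by (rule is_rep_conj[OF _ p XN])
    have j: "j < N" using Suc.prems by simp
    obtain w where w: "w \<in> carrier_vec (N - j)" "w \<noteq> 0\<^sub>v (N - j)" and
      ew: "\<And>x. x \<in> X \<Longrightarrow> \<exists>a. mat (N - j) (N - j) (\<lambda>(i, l). (h * x * g) $$ (i + j, l + j)) *\<^sub>v w = a \<cdot>\<^sub>v w"
      using common_eigenvector[OF X d is_rep_lower_block[OF rep XN _ gh]] j by auto
    define u where "u = vec N (\<lambda>i. if i < j then 0 else w $ (i - j))"
    obtain b where b: "b < N - j" "w $ b \<noteq> 0"
      using w by (metis carrier_vecD eq_vecI index_zero_vec(1) index_zero_vec(2))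
    have "u \<in> carrier_vec N" "u $ (b + j) \<noteq> 0" "b + j < N" using b by (auto simp: u_def)
    then obtain q q' where q: "inv_pair N q q'" "col q j = u" "\<forall>l<j. col q l = unit_vec N l"
      using exists_column_change[of u N j "b + j"] by auto
    have "q' * (h * x * g) * q \<in> UTc N (Suc j)" if x: "x \<in> X" for x
    proof -
      obtain a where a: "mat (N - j) (N - j) (\<lambda>(i, l). (h * x * g) $$ (i + j, l + j)) *\<^sub>v w = a \<cdot>\<^sub>v w"
        using ew[OF x] by blast
      have "(h * x * g *\<^sub>v u) $ i = a * u $ i" if i: "i < N" "j \<le> i" for i
      proof -
        have "(h * x * g *\<^sub>v u) $ i = (\<Sum>l<N. (h * x * g) $$ (i, l) * u $ l)"
          by (rule mult_vec_entry[of _ N N]) (use gh[OF x] i in \<open>auto simp: UTc_def u_def\<close>)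
        also have "\<dots> = (\<Sum>l\<in>{j..<N}. (h * x * g) $$ (i, l) * u $ l)"
          by (rule sum.mono_neutral_right) (auto simp: u_def)
        also have "\<dots> = (\<Sum>l<N - j. (h * x * g) $$ (i, l + j) * w $ l)"
          by (rule sum.reindex_bij_witness[of _ "\<lambda>m. m + j" "\<lambda>m. m - j"]) (auto simp: u_def)
        also have "\<dots> = (mat (N - j) (N - j) (\<lambda>(i, l). (h * x * g) $$ (i + j, l + j)) *\<^sub>v w) $ (i - j)"
          by (subst mult_vec_entry[of _ "N - j" "N - j"]) (use w i in auto)
        finally show ?thesis using a w i by (simp add: u_def)
      qed
      then show ?thesis using triangularize_step[OF gh[OF x] j q(1)] q by blast
    qed
    moreover have "q' * (h * x * g) * q = (q' * h) * x * (g * q)" if x: "x \<in> X" for x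
      using c inv_pairD[OF q(1)] XN x by (auto simp: assoc_mult_mat[of _ N N _ N _ N] subset_iff)
    ultimately show ?case using inv_pair_mult[OF p q(1)] by metis
  qed
  then show ?thesis by blast
qed

section \<open>Borel and parabolic subgroups of SL(N)\<close>

text \<open>The stabilizer in \<open>SL N\<close> of the complete flag spanned by the successive
  columns of \<open>g\<close>, with \<open>h\<close> meant to be the inverse of
  \<open>g\<close>.\<close>

definition Bor :: "nat \<Rightarrow> complex mat \<Rightarrow> complex mat \<Rightarrow> complex mat set" where
  "Bor N g h = {x \<in> SL N. h * x * g \<in> UT N}"

lemma SL_carrier: "x \<in> SL N \<Longrightarrow> x \<in> carrier_mat N N"
  by (simp add: SL_def)

lemma inv_pair_conj:
  assumes p: "inv_pair N g h" and q: "inv_pair N x y"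
  shows "inv_pair N (h * x * g) (h * y * g)"
proof -
  note c = inv_pairD[OF p] inv_pairD[OF q]
  have "h * x * g * (h * y * g) = h * (x * y) * g" "h * y * g * (h * x * g) = h * (y * x) * g"
    by (rule conj_mult[OF p c(5,6), symmetric] conj_mult[OF p c(6,5), symmetric])+
  then show ?thesis using c by (simp add: inv_pair_def del: assoc_mult_mat)
qed

lemma minus_one_mult:
  assumes "X \<in> carrier_mat N N" "Y \<in> carrier_mat N N"
  shows "(X - 1\<^sub>m N) * (Y - 1\<^sub>m N) = (X * Y - X) - (Y - (1\<^sub>m N :: complex mat))"
proof -
  have "(X - 1\<^sub>m N) * (Y - 1\<^sub>m N) = X * (Y - 1\<^sub>m N) - 1\<^sub>m N * (Y - 1\<^sub>m N)"
    using assms by (intro minus_mult_distrib_mat) auto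
  also have "X * (Y - 1\<^sub>m N) = X * Y - X * 1\<^sub>m N"
    using assms by (intro mult_minus_distrib_mat) auto
  finally show ?thesis using assms by simp
qed

lemma Lv_add: "A \<in> Lv N k \<Longrightarrow> B \<in> Lv N k \<Longrightarrow> A + B \<in> Lv N k"
  by (auto simp: Lv_def)

lemma Lv_diff: "A \<in> Lv N k \<Longrightarrow> B \<in> Lv N k \<Longrightarrow> A - B \<in> Lv N k"
  by (auto simp: Lv_def)

lemma Lv_uminus: "A \<in> Lv N k \<Longrightarrow> - A \<in> Lv N k"
  by (auto simp: Lv_def)

lemma UT_iff_Lv: "A \<in> carrier_mat N N \<Longrightarrow> A \<in> UT N \<longleftrightarrow> A - 1\<^sub>m N \<in> Lv N 0"
  by (auto simp: Lv_def UTc_def)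

text \<open>The groups of matrices congruent to the identity up to the \<open>k\<close>-th superdiagonal,
  relative to a basis; the derived series of a Borel subgroup descends along them.\<close>

definition Ser :: "nat \<Rightarrow> complex mat \<Rightarrow> complex mat \<Rightarrow> nat \<Rightarrow> complex mat set" where
  "Ser N g h k = {x \<in> SL N. h * x * g - 1\<^sub>m N \<in> Lv N k}"

lemma Ser_0: "inv_pair N g h \<Longrightarrow> Ser N g h 0 = Bor N g h"
  using UT_iff_Lv inv_pairD(1,2)[of N g h] SL_carrier
  unfolding Ser_def Bor_def by (metis (no_types, lifting) mult_carrier_mat)

lemma Ser_UT:
  assumes p: "inv_pair N g h" and x: "x \<in> Ser N g h k"
  shows "h * x * g \<in> UT N"
  using x Lv_mono[of _ N k 0] UT_iff_Lv[of "h * x * g" N] inv_pairD(1,2)[OF p] SL_carrier[of x N]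
  by (auto simp: Ser_def)

lemma Ser_mgroup:
  assumes p: "inv_pair N g h" shows "mgroup N (Ser N g h k)"
  unfolding mgroup_def
proof (intro conjI ballI)
  note c = inv_pairD[OF p]
  show "Ser N g h k \<subseteq> SL N" by (auto simp: Ser_def)
  have "h * 1\<^sub>m N * g - 1\<^sub>m N = 0\<^sub>m N N" using c by (auto intro!: eq_matI)
  then have "h * 1\<^sub>m N * g - 1\<^sub>m N \<in> Lv N k" by (simp only:) (simp add: Lv_def)
  then show "1\<^sub>m N \<in> Ser N g h k" by (simp add: Ser_def SL_def)
next
  note c = inv_pairD[OF p]
  fix x y assume xy: "x \<in> Ser N g h k" "y \<in> Ser N g h k"
  define X Y where "X = h * x * g" and "Y = h * y * g"
  have XY: "X \<in> carrier_mat N N" "Y \<in> carrier_mat N N"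
    using xy c SL_carrier unfolding X_def Y_def Ser_def by auto
  have "h * (x * y) * g = X * Y" unfolding X_def Y_def
    using xy c SL_carrier by (intro conj_mult[OF p]) (auto simp: Ser_def)
  moreover have "X * Y - 1\<^sub>m N = (X - 1\<^sub>m N) * (Y - 1\<^sub>m N) + ((X - 1\<^sub>m N) + (Y - 1\<^sub>m N))"
    unfolding minus_one_mult[OF XY] using XY by (auto intro!: eq_matI simp del: index_mult_mat(1))
  moreover have "(X - 1\<^sub>m N) * (Y - 1\<^sub>m N) \<in> Lv N k"
    using Lv_mult[of "X - 1\<^sub>m N" N k "Y - 1\<^sub>m N" k] Lv_mono[of _ N "k + k" k] xy
    by (auto simp: X_def Y_def Ser_def)
  ultimately have "h * (x * y) * g - 1\<^sub>m N \<in> Lv N k"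
    using xy by (auto simp: X_def Y_def Ser_def intro!: Lv_add)
  then show "x * y \<in> Ser N g h k"
    using xy mgroupD(4)[OF mgroup_SL] by (auto simp: Ser_def)
next
  note c = inv_pairD[OF p]
  fix x assume x: "x \<in> Ser N g h k"
  then have xSL: "x \<in> SL N" by (simp add: Ser_def)
  define X X' where "X = h * x * g" and "X' = h * adj_mat x * g"
  have q: "inv_pair N X X'" unfolding X_def X'_def
    by (rule inv_pair_conj[OF p adj_mat_inv_pair[OF xSL]])
  note d = inv_pairD[OF q]
  have "X \<in> UT N" unfolding X_def by (rule Ser_UT[OF p x])
  then have "X' \<in> Lv N 0" using UT_inverse(1)[OF _ q] Lv_0 by simp
  moreover have "X - 1\<^sub>m N \<in> Lv N k" using x by (simp add: Ser_def X_def)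
  ultimately have "- ((X - 1\<^sub>m N) * X') \<in> Lv N k" using Lv_mult[of "X - 1\<^sub>m N" N k X' 0] Lv_uminus by simp
  moreover have "- ((X - 1\<^sub>m N) * X') = X' - 1\<^sub>m N"
    using d by (auto intro!: eq_matI simp: minus_mult_distrib_mat[of _ N N _ _ N] simp del: index_mult_mat(1))
  ultimately show "adj_mat x \<in> Ser N g h k"
    using mgroupD(5)[OF mgroup_SL xSL] by (simp add: Ser_def X'_def)
qed

text \<open>The commutator minus 1 is \<open>(X * Y - Y * X) * (X' * Y')\<close>. At level 0 the
  difference \<open>X * Y - Y * X\<close> has zero diagonal; at a positive level \<open>k\<close> it
  is the bracket of \<open>X - 1\<close> and \<open>Y - 1\<close>, which lies at level
  \<open>k + k\<close>.\<close>

lemma comms_Ser: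
  assumes p: "inv_pair N g h"
  shows "comms (Ser N g h k) \<subseteq> Ser N g h (Suc k)"
proof
  fix z assume "z \<in> comms (Ser N g h k)"
  then obtain x y where z: "z = x * y * adj_mat x * adj_mat y" and xy: "x \<in> Ser N g h k" "y \<in> Ser N g h k"
    by (auto simp: comms_def)
  note c = inv_pairD[OF p]
  have SLs: "x \<in> SL N" "y \<in> SL N" using xy by (auto simp: Ser_def)
  note px = adj_mat_inv_pair[OF SLs(1)] and py = adj_mat_inv_pair[OF SLs(2)]
  define X Y X' Y' where defs: "X = h * x * g" "Y = h * y * g" "X' = h * adj_mat x * g" "Y' = h * adj_mat y * g"
  have qX: "inv_pair N X X'" and qY: "inv_pair N Y Y'" unfolding defs by (rule inv_pair_conj[OF p px] inv_pair_conj[OF p py])+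
  note d = inv_pairD(1,2)[OF qX] inv_pairD(1,2)[OF qY]
  have UX: "X \<in> UT N" "Y \<in> UT N" unfolding defs using Ser_UT[OF p] xy by auto
  then have UX': "X' \<in> UT N" "Y' \<in> UT N" using UT_inverse(1)[OF _ qX] UT_inverse(1)[OF _ qY] by auto
  have L: "X - 1\<^sub>m N \<in> Lv N k" "Y - 1\<^sub>m N \<in> Lv N k" using xy by (auto simp: Ser_def defs)
  have "X * Y - Y * X \<in> Lv N (Suc k)"
  proof (cases "k = 0")
    case True
    have "X * Y - Y * X \<in> UT N" using UX UT_diff UT_mult by blast
    moreover have "(X * Y - Y * X) $$ (i, i) = 0" if "i < N" for i
      using UT_mult_diag[OF UX that] UT_mult_diag[OF UX(2,1) that] d that by (simp del: index_mult_mat(1))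
    ultimately show ?thesis using True by (auto simp: Lv_def UTc_def less_Suc_eq)
  next
    case False
    have "X * Y - Y * X = (X - 1\<^sub>m N) * (Y - 1\<^sub>m N) - (Y - 1\<^sub>m N) * (X - 1\<^sub>m N)"
      unfolding minus_one_mult[OF d(1,3)] minus_one_mult[OF d(3,1)]
      using d by (auto intro!: eq_matI simp del: index_mult_mat(1))
    moreover have "(X - 1\<^sub>m N) * (Y - 1\<^sub>m N) \<in> Lv N (k + k)" "(Y - 1\<^sub>m N) * (X - 1\<^sub>m N) \<in> Lv N (k + k)"
      using L Lv_mult by blast+
    ultimately show ?thesis using False Lv_diff Lv_mono[of _ N "k + k" "Suc k"] by simp
  qed
  then have "(X * Y - Y * X) * (X' * Y') \<in> Lv N (Suc k)"
    using Lv_mult[of _ N "Suc k" _ 0] UX' UT_mult Lv_0 by fastforce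
  moreover have "(X * Y - Y * X) * (X' * Y') = h * z * g - 1\<^sub>m N"
  proof -
    have "h * z * g = X * Y * (X' * Y')"
      unfolding z defs using c inv_pairD(1,2)[OF px] inv_pairD(1,2)[OF py]
      by (simp add: conj_mult[OF p, symmetric] del: assoc_mult_mat) (simp add: assoc_mult_mat[of _ N N _ N _ N])
    moreover have "Y * X * (X' * Y') = 1\<^sub>m N"
      using inv_pairD(3)[OF inv_pair_mult[OF qY qX]] .
    ultimately show ?thesis using d by (simp add: minus_mult_distrib_mat[of _ N N _ _ N])
  qed
  moreover have "z \<in> SL N" unfolding z
    using SLs mgroupD(4,5)[OF mgroup_SL] by blast
  ultimately show "z \<in> Ser N g h (Suc k)" by (simp add: Ser_def)
qed

lemma Bor_mgroup: "inv_pair N g h \<Longrightarrow> mgroup N (Bor N g h)"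
  using Ser_mgroup[of N g h 0] Ser_0 by simp

lemma Bor_solvable:
  assumes p: "inv_pair N g h" shows "solvable (mat_grp N (Bor N g h))"
proof -
  interpret SL: group "SLG N" by (rule group_mat_grp[OF mgroup_SL])
  have step: "dgrp N (Ser N g h k) \<subseteq> Ser N g h (Suc k)" for k
  proof -
    have "subgroup (Ser N g h (Suc k)) (SLG N)"
      using subgroup_iff_mgroup[OF mgroup_SL] Ser_mgroup[OF p] by (auto simp: Ser_def)
    then show ?thesis unfolding dgrp_generate[OF Ser_mgroup[OF p]]
      by (intro SL.generate_subgroup_incl comms_Ser[OF p])
  qed
  have sub: "(dgrp N ^^ k) (Bor N g h) \<subseteq> Ser N g h k \<and> mgroup N ((dgrp N ^^ k) (Bor N g h))" for k
  proof (induction k)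
    case 0
    then show ?case using Ser_0[OF p] Bor_mgroup[OF p] by simp
  next
    case (Suc k)
    then have "dgrp N ((dgrp N ^^ k) (Bor N g h)) \<subseteq> dgrp N (Ser N g h k)"
      unfolding dgrp_def by (intro SL.mono_derived) simp
    with Suc step[of k] dgrp_mgroup(1) show ?case by auto
  qed
  have "x = 1\<^sub>m N" if x: "x \<in> Ser N g h N" for x
  proof -
    have xc: "x \<in> carrier_mat N N" using x by (simp add: Ser_def SL_def)
    note c = inv_pairD[OF p]
    have z: "h * x * g - 1\<^sub>m N = 0\<^sub>m N N" using x Lv_zero by (auto simp: Ser_def)
    have "h * x * g = 1\<^sub>m N"
    proof (rule eq_matI)
      fix i j assume "i < dim_row (1\<^sub>m N)" "j < dim_col (1\<^sub>m N)"
      then have ij: "i < N" "j < N" by auto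
      have "(h * x * g - 1\<^sub>m N) $$ (i, j) = 0" using z ij by simp
      then show "(h * x * g) $$ (i, j) = 1\<^sub>m N $$ (i, j)" using ij by (simp del: index_mult_mat(1))
    qed (use c in auto)
    then show ?thesis using conj_conj[OF p xc] c by simp
  qed
  then have "(dgrp N ^^ N) (Bor N g h) = {1\<^sub>m N}"
    using sub[of N] mgroupD(3) by blast
  then show ?thesis using solvable_mat_grp_iff[OF Bor_mgroup[OF p]] by blast
qed

section \<open>Flag stabilizers are closed, connected and maximal solvable\<close>

lemma conj_regular:
  assumes p: "inv_pair N g h" shows "regular_map N N (\<lambda>x. h * x * g)"
  using inv_pairD(1,2)[OF p] by (intro regular_map_mult regular_map_const regular_map_id)

lemma closed_UT_conj:
  assumes p: "inv_pair N g h"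
  shows "zariski_closed N {x \<in> carrier_mat N N. h * x * g \<in> UT N}"
proof -
  have "zariski_closed N {x \<in> carrier_mat N N. \<forall>(i, l) \<in> {(i, l). l < i \<and> i < N}. (h * x * g) $$ (i, l) = 0}"
    using zariski_closed_Collect[of "{(i, l). l < i \<and> i < N}" N "\<lambda>(i, l) x. (h * x * g) $$ (i, l)"]
      regular_map_entry[OF conj_regular[OF p]] by (auto simp: case_prod_beta)
  also have "{x \<in> carrier_mat N N. \<forall>(i, l) \<in> {(i, l). l < i \<and> i < N}. (h * x * g) $$ (i, l) = 0}
      = {x \<in> carrier_mat N N. h * x * g \<in> UT N}"
    using inv_pairD(1,2)[OF p] by (auto simp: UTc_def simp del: index_mult_mat(1))
  finally show ?thesis .
qed

lemma closed_SL: "zariski_closed N (SL N)"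
  using zariski_closed_zeros[OF regular_fun_diff[OF regular_fun_det[OF regular_map_id] regular_fun_const[of N 1]]]
  by (simp add: SL_def)

text \<open>Each factor is an affine function of \<open>s\<close> that is not identically zero.
  Products of such factors are the determinants of triangular pencils, whose zeros have to be
  removed from the parameter plane.\<close>

lemma finite_affine_zeros:
  fixes N :: nat
  assumes nz: "\<And>i. i < N \<Longrightarrow> a i \<noteq> 0 \<or> b i \<noteq> 0"
  shows "finite {s :: complex. \<exists>i<N. (1 - s) * a i + s * b i = 0}"
proof -
  have "finite {s. (1 - s) * a i + s * b i = 0}" if "i < N" for i
  proof -
    have "{s. (1 - s) * a i + s * b i = 0} = {s. poly [:a i, b i - a i:] s = 0}"
      by (auto simp: algebra_simps)
    moreover have "[:a i, b i - a i:] \<noteq> 0" using nz[OF that] by auto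
    ultimately show ?thesis using poly_roots_finite by metis
  qed
  then have "finite (\<Union>i<N. {s. (1 - s) * a i + s * b i = 0})" by (intro finite_UN_I finite_lessThan) auto
  also have "(\<Union>i<N. {s. (1 - s) * a i + s * b i = 0}) = {s. \<exists>i<N. (1 - s) * a i + s * b i = 0}" by blast
  finally show ?thesis .
qed

text \<open>All entries follow the segment from 1 to \<open>y\<close> except the first diagonal one:
  it is the inverse of the product of the other diagonal entries, which keeps the determinant 1. It
  ends at the right value because \<open>det y = 1\<close>.\<close>

lemma zlink_unitriangular:
  assumes y: "y \<in> UT N" "det y = 1"
  shows "zlink N {y \<in> UT N. det y = 1} (1\<^sub>m N) y"
proof (cases "N = 0")
  case True
  then have "y = 1\<^sub>m N" using UTc_carrier[OF y(1)] by (intro eq_matI) auto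
  with y show ?thesis by (auto simp: zlink_def)
next
  case False
  define d where "d i = y $$ (i, i)" for i
  have pd: "(\<Prod>i<N. d i) = 1" using UT_det[OF y(1)] y(2) by (simp add: d_def)
  then have d0: "d i \<noteq> 0" if "i < N" for i using pd that
    by (metis finite_lessThan lessThan_iff prod_zero_iff zero_neq_one)
  define Z where "Z = {s :: complex. \<exists>i<N. (1 - s) * 1 + s * d i = 0}"
  have Z: "finite Z" unfolding Z_def by (rule finite_affine_zeros) simp
  define e where "e s i = (if i = 0 then inverse (\<Prod>l\<in>{1..<N}. 1 - s + s * d l) else 1 - s + s * d i)" for s i
  define p where "p s = mat N N (\<lambda>(i, j). if i = j then e s i else if i < j then s * y $$ (i, j) else 0)" for s
  have nz: "1 - s + s * d i \<noteq> 0" if "s \<in> - Z" "i < N" for s i using that by (auto simp: Z_def)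
  have N: "{..<N} = insert 0 {1..<N}" using False by auto
  have "zlink N {y \<in> UT N. det y = 1} (p 0) (p 1)"
  proof (rule zlink_path[OF connected_cofinite[OF Z]])
    fix s assume s: "s \<in> - Z"
    have "p s \<in> UT N" by (auto simp: p_def UTc_def)
    moreover have "det (p s) = (\<Prod>i<N. e s i)"
      using UT_det[OF \<open>p s \<in> UT N\<close>] by (simp add: p_def)
    moreover have "(\<Prod>i<N. e s i) = 1"
    proof -
      have "(\<Prod>i<N. e s i) = e s 0 * (\<Prod>i\<in>{1..<N}. e s i)" unfolding N by simp
      also have "(\<Prod>i\<in>{1..<N}. e s i) = (\<Prod>l\<in>{1..<N}. 1 - s + s * d l)"
        by (rule prod.cong) (auto simp: e_def)
      finally show ?thesis using nz[OF s] by (simp add: e_def)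
    qed
    ultimately show "p s \<in> {y \<in> UT N. det y = 1}" by simp
  next
    fix i j assume ij: "i < N" "j < N"
    have e: "continuous_on (- Z) (\<lambda>s. e s i)"
    proof (cases "i = 0")
      case True
      have "continuous_on (- Z) (\<lambda>s. inverse (\<Prod>l\<in>{1..<N}. 1 - s + s * d l))"
        by (intro continuous_intros) (use nz in \<open>auto simp: prod_zero_iff\<close>)
      then show ?thesis using True by (simp add: e_def)
    next
      case False
      have "continuous_on (- Z) (\<lambda>s. 1 - s + s * d i)" by (intro continuous_intros)
      then show ?thesis using False by (simp add: e_def)
    qed
    have "continuous_on (- Z) (\<lambda>s. s * y $$ (i, j))" by (intro continuous_intros)
    with e show "continuous_on (- Z) (\<lambda>s. p s $$ (i, j))"
      using ij by (cases "i = j"; cases "i < j") (simp_all add: p_def)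
  next
    show "0 \<in> - Z" "1 \<in> - Z" using d0 by (auto simp: Z_def)
  qed (auto simp: UTc_def)
  moreover have "p 0 = 1\<^sub>m N" by (auto simp: p_def e_def intro!: eq_matI)
  moreover have "p 1 = y"
  proof (rule eq_matI)
    fix i j assume "i < dim_row y" "j < dim_col y"
    then have ij: "i < N" "j < N" using UTc_carrier[OF y(1)] by auto
    have "d 0 * (\<Prod>l\<in>{1..<N}. d l) = 1" using pd unfolding N by simp
    then have "inverse (\<Prod>l\<in>{1..<N}. d l) = d 0"
      by (metis inverse_unique mult.commute)
    then show "p 1 $$ (i, j) = y $$ (i, j)"
      using ij UTc_zero[OF y(1), of j i] by (auto simp: p_def e_def d_def)
  qed (use UTc_carrier[OF y(1)] in \<open>auto simp: p_def\<close>)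
  ultimately show ?thesis by simp
qed

lemma Bor_connected:
  assumes p: "inv_pair N g h" shows "zariski_connected N (Bor N g h)"
proof (rule zariski_connectedI[of _ _ "1\<^sub>m N"])
  fix x assume x: "x \<in> Bor N g h"
  note c = inv_pairD[OF p]
  have xc: "x \<in> carrier_mat N N" using x by (simp add: Bor_def SL_def)
  have "zlink N {y \<in> UT N. det y = 1} (1\<^sub>m N) (h * x * g)"
    by (rule zlink_unitriangular) (use x xc det_conj[OF p] in \<open>auto simp: Bor_def SL_def\<close>)
  then have "zlink N (Bor N g h) (g * 1\<^sub>m N * h) (g * (h * x * g) * h)"
  proof (rule zlink_image)
    show "(\<lambda>y. g * y * h) ` {y \<in> UT N. det y = 1} \<subseteq> Bor N g h"
    proof
      fix z assume "z \<in> (\<lambda>y. g * y * h) ` {y \<in> UT N. det y = 1}"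
      then obtain y where y: "z = g * y * h" "y \<in> UT N" "det y = 1" by blast
      have yc: "y \<in> carrier_mat N N" by (rule UTc_carrier[OF y(2)])
      have "h * z * g = y" "det z = 1" "z \<in> carrier_mat N N"
        using conj_conj[OF inv_pair_sym[OF p] yc] det_conj[OF inv_pair_sym[OF p] yc] c yc y
        by (simp_all del: assoc_mult_mat)
      then show "z \<in> Bor N g h" using y by (simp add: Bor_def SL_def)
    qed
  qed (use conj_regular[OF inv_pair_sym[OF p]] UTc_carrier in auto)
  then show "zlink N (Bor N g h) (1\<^sub>m N) x" using c conj_conj[OF p xc] by simp
qed

text \<open>The single Jordan block with eigenvalue 1 stabilizes only one complete flag, so a basis
  in which it is still triangular spans the standard flag.\<close>

lemma regular_unipotent_normalizer:
  assumes q: "inv_pair N q q'"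
    and u: "q' * mat N N (\<lambda>(i, j). if i = j \<or> j = Suc i then 1 else 0) * q \<in> UT N"
  shows "q \<in> UT N"
proof -
  note c = inv_pairD[OF q]
  define U where "U = mat N N (\<lambda>(i, j). if i = j \<or> j = Suc i then 1 else 0 :: complex)"
  have U: "U \<in> carrier_mat N N" "upper_triangular U" by (auto simp: U_def)
  define M where "M = q' * U * q"
  have M: "M \<in> UT N" using u by (simp add: M_def U_def)
  have "U = q * M * q'" unfolding M_def using conj_conj[OF q U(1)] by simp
  then have "similar_mat_wit U M q q'"
    unfolding similar_mat_wit_def Let_def using c U UTc_carrier[OF M] by auto
  then have "similar_mat U M" unfolding similar_mat_def by blast
  then have "char_poly M = char_poly U" by (simp add: char_poly_similar)
  then have cp: "(\<Prod>a\<leftarrow>diag_mat M. [:- a, 1:]) = (\<Prod>a\<leftarrow>diag_mat U. [:- a, 1:])"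
    using M U by (simp add: char_poly_upper_triangular[of _ N] UT_upper_triangular)
  have diag: "M $$ (i, i) = 1" if i: "i < N" for i
  proof -
    have "M $$ (i, i) \<in> set (diag_mat M)" using i UTc_carrier[OF M] by (auto simp: diag_mat_def)
    then have "poly (\<Prod>a\<leftarrow>diag_mat M. [:- a, 1:]) (M $$ (i, i)) = 0"
      by (auto simp: poly_prod_list prod_list_zero_iff image_iff)
    then have "\<exists>a \<in> set (diag_mat U). M $$ (i, i) = a"
      unfolding cp by (auto simp: poly_prod_list prod_list_zero_iff)
    then show ?thesis by (auto simp: diag_mat_def U_def)
  qed
  \<comment> \<open>Entry \<open>(i, j)\<close> of \<open>U * q = q * M\<close>. Once the columns of
    \<open>q\<close> before \<open>j\<close> are triangular and \<open>M\<close> has unit diagonal,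
    it gives \<open>q $$ (Suc i, j) = 0\<close> for \<open>i\<close> at least
    \<open>j\<close>.\<close>
  have rel: "q $$ (i, j) + (if Suc i < N then q $$ (Suc i, j) else 0) = (\<Sum>l<N. q $$ (i, l) * M $$ (l, j))"
    if "i < N" "j < N" for i j
  proof -
    have "U * q = q * M" unfolding M_def using c U inv_pair_cancel(1)[OF q, of "U * q" N]
      by (simp add: assoc_mult_mat[of _ N N _ N _ N])
    then have "(U * q) $$ (i, j) = (\<Sum>l<N. q $$ (i, l) * M $$ (l, j))"
      using mult_entry[OF c(1) UTc_carrier[OF M] that] by simp
    moreover have "(U * q) $$ (i, j) = (\<Sum>l<N. (if l = i then q $$ (i, j) else 0) + (if l = Suc i then q $$ (Suc i, j) else 0))"
      unfolding mult_entry[OF U(1) c(1) that] using that by (intro sum.cong) (auto simp: U_def)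
    ultimately show ?thesis using that by (simp add: sum.distrib)
  qed
  have "q \<in> UTc N j" if "j \<le> N" for j
    using that
  proof (induction j)
    case 0
    then show ?case using c by (simp add: UTc_def)
  next
    case (Suc j)
    then have IH: "q \<in> UTc N j" and j: "j < N" by auto
    have "q $$ (Suc i, j) = 0" if i: "j \<le> i" "Suc i < N" for i
    proof -
      have "(\<Sum>l<N. q $$ (i, l) * M $$ (l, j)) = (\<Sum>l<N. if l = j then q $$ (i, j) else 0)"
      proof (rule sum.cong)
        fix l assume "l \<in> {..<N}"
        then show "q $$ (i, l) * M $$ (l, j) = (if l = j then q $$ (i, j) else 0)"
          using diag[OF j] UTc_zero[OF IH, of l i] UTc_zero[OF M, of j l] i j
          by (cases l j rule: linorder_cases) auto
      qed simp
      then show ?thesis using rel[of i j] i j by simp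
    qed
    then have "q $$ (i, j) = 0" if "j < i" "i < N" for i using that by (cases i) auto
    with IH show ?case by (auto simp: UTc_def less_Suc_eq)
  qed
  then show ?thesis by simp
qed

text \<open>Lie-Kolchin triangularizes the larger group in some basis \<open>a\<close>; the regular
  unipotent element of \<open>Bor N g h\<close> forces that basis to span the same flag as
  \<open>g\<close>.\<close>

lemma Bor_maximal:
  assumes p: "inv_pair N g h" and X: "mgroup N X" "zariski_connected N X" "solvable (mat_grp N X)"
    and sub: "Bor N g h \<subseteq> X"
  shows "X = Bor N g h"
proof -
  obtain a b where ab: "inv_pair N a b" "\<And>x. x \<in> X \<Longrightarrow> b * x * a \<in> UT N" using lie_kolchin[OF X] by blast
  note c = inv_pairD(1,2)[OF p] inv_pairD(1,2)[OF ab(1)]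
  define U where "U = mat N N (\<lambda>(i, j). if i = j \<or> j = Suc i then 1 else 0 :: complex)"
  have U: "U \<in> UT N" by (auto simp: UTc_def U_def)
  have dU: "det U = 1" using UT_det[OF U] by (simp add: U_def)
  have q: "inv_pair N (h * a) (b * g)" by (rule inv_pair_mult[OF inv_pair_sym[OF p] ab(1)])
  have "g * U * h \<in> Bor N g h"
    using c U dU UTc_carrier[OF U] conj_conj[OF inv_pair_sym[OF p] UTc_carrier[OF U]]
      det_conj[OF inv_pair_sym[OF p] UTc_carrier[OF U]]
    by (auto simp: Bor_def SL_def)
  then have "b * (g * U * h) * a \<in> UT N" using sub ab(2) by blast
  moreover have "b * (g * U * h) * a = (b * g) * U * (h * a)"
    using c UTc_carrier[OF U] by (simp add: assoc_mult_mat[of _ N N _ N _ N])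
  ultimately have qU: "h * a \<in> UT N" using regular_unipotent_normalizer[OF q] by (simp add: U_def)
  have q'U: "b * g \<in> UT N" by (rule UT_inverse(1)[OF qU q])
  have "x \<in> Bor N g h" if x: "x \<in> X" for x
  proof -
    have xc: "x \<in> carrier_mat N N" using mgroupD(1)[OF X(1) x] .
    have "h * x * g = h * (a * (b * x * a) * b) * g" using conj_conj[OF ab(1) xc] by simp
    also have "\<dots> = (h * a) * (b * x * a) * (b * g)"
      using c xc by (simp add: assoc_mult_mat[of _ N N _ N _ N])
    finally have "h * x * g \<in> UT N" using UT_mult qU q'U ab(2)[OF x] by metis
    then show ?thesis using x X(1) by (auto simp: Bor_def mgroup_def)
  qed
  with sub show ?thesis by blast
qed

lemma closed_subgroup_iff:
  "closed_subgroup N X (SL N) \<longleftrightarrow> mgroup N X \<and> zariski_closed N X"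
  using subgroup_iff_mgroup[OF mgroup_SL] by (auto simp: closed_subgroup_def mgroup_def)

lemma Bor_closed_subgroup:
  assumes p: "inv_pair N g h" shows "closed_subgroup N (Bor N g h) (SL N)"
proof -
  have "Bor N g h = SL N \<inter> {x \<in> carrier_mat N N. h * x * g \<in> UT N}"
    by (auto simp: Bor_def SL_def)
  then have "zariski_closed N (Bor N g h)"
    using zariski_closed_Int[OF closed_SL closed_UT_conj[OF p]] by simp
  then show ?thesis using Bor_mgroup[OF p] closed_subgroup_iff by blast
qed

lemma borel_subgroup_Bor:
  assumes p: "inv_pair N g h" shows "borel_subgroup N (SL N) (Bor N g h)"
  using Bor_closed_subgroup[OF p] Bor_connected[OF p] Bor_solvable[OF p] Bor_maximal[OF p]
  unfolding borel_subgroup_def closed_subgroup_iff by blast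

lemma borel_subgroupE:
  assumes B: "borel_subgroup N (SL N) B"
  obtains g h where "inv_pair N g h" "B = Bor N g h"
proof -
  have B': "mgroup N B" "zariski_connected N B" "solvable (mat_grp N B)"
    using B unfolding borel_subgroup_def closed_subgroup_iff by auto
  obtain g h where p: "inv_pair N g h" "\<forall>x\<in>B. h * x * g \<in> UT N" using lie_kolchin[OF B'] by blast
  then have "B \<subseteq> Bor N g h" using B'(1) by (auto simp: Bor_def mgroup_def)
  then have "Bor N g h = B"
    using B Bor_closed_subgroup[OF p(1)] Bor_connected[OF p(1)] Bor_solvable[OF p(1)]
    unfolding borel_subgroup_def by blast
  with p(1) that show ?thesis by blast
qed

text \<open>The matrix \<open>1 + u e_j^T\<close>: for \<open>u j = 0\<close> a transvection, and
  composition of such matrices adds the vectors \<open>u\<close>.\<close>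

definition trans_mat :: "nat \<Rightarrow> nat \<Rightarrow> (nat \<Rightarrow> complex) \<Rightarrow> complex mat" where
  "trans_mat N j u = mat N N (\<lambda>(a, b). (if a = b then 1 else 0) + (if b = j then u a else 0))"

lemma trans_mat_carrier: "trans_mat N j u \<in> carrier_mat N N"
  by (simp add: trans_mat_def)

lemma trans_mat_mult:
  assumes "v j = 0" "j < N"
  shows "trans_mat N j u * trans_mat N j v = trans_mat N j (\<lambda>a. u a + v a)"
proof (rule eq_matI)
  fix a b assume "a < dim_row (trans_mat N j (\<lambda>a. u a + v a))" "b < dim_col (trans_mat N j (\<lambda>a. u a + v a))"
  then have ab: "a < N" "b < N" by (auto simp: trans_mat_def)
  have "(trans_mat N j u * trans_mat N j v) $$ (a, b) =
      (\<Sum>l<N. trans_mat N j u $$ (a, l) * trans_mat N j v $$ (l, b))"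
    using ab by (intro mult_entry[of _ N N _ N] trans_mat_carrier)
  also have "\<dots> = (\<Sum>l<N. (if l = a then trans_mat N j v $$ (a, b) else 0) +
      (if l = j then u a * trans_mat N j v $$ (j, b) else 0))"
    using ab assms by (intro sum.cong) (auto simp: trans_mat_def)
  also have "\<dots> = trans_mat N j v $$ (a, b) + u a * trans_mat N j v $$ (j, b)"
    using ab assms by (simp add: sum.distrib)
  also have "\<dots> = trans_mat N j (\<lambda>a. u a + v a) $$ (a, b)"
    using ab assms by (auto simp: trans_mat_def)
  finally show "(trans_mat N j u * trans_mat N j v) $$ (a, b) = trans_mat N j (\<lambda>a. u a + v a) $$ (a, b)" .
qed (auto simp: trans_mat_def)

lemma trans_mat_inverse:
  assumes "u j = 0" "j < N"
  shows "inv_pair N (trans_mat N j u) (trans_mat N j (\<lambda>a. - u a))"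
proof -
  have "trans_mat N j (\<lambda>a. 0) = 1\<^sub>m N" by (auto simp: trans_mat_def intro!: eq_matI)
  then show ?thesis
    using trans_mat_mult[of "\<lambda>a. - u a" j N u] trans_mat_mult[of u j N "\<lambda>a. - u a"] assms
    by (simp add: inv_pair_def trans_mat_carrier)
qed

lemma trans_mat_UT:
  assumes "\<And>a. j \<le> a \<Longrightarrow> a < N \<Longrightarrow> u a = 0"
  shows "trans_mat N j u \<in> UT N" "det (trans_mat N j u) = 1"
proof -
  show U: "trans_mat N j u \<in> UT N" using assms by (auto simp: trans_mat_def UTc_def)
  show "det (trans_mat N j u) = 1"
    unfolding UT_det[OF U] by (rule prod.neutral) (use assms in \<open>auto simp: trans_mat_def\<close>)
qed

lemma trans_mat_UTc: "trans_mat N j u \<in> UTc N j"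
  by (auto simp: trans_mat_def UTc_def)

text \<open>A group containing the standard Borel subgroup is transitive enough to triangularize each of
  its elements from within. Let \<open>k\<close> be the lowest position reached in column \<open>j\<close> by group
  elements whose first \<open>j\<close> columns are triangular. Conjugating an upper unitriangular
  transvection by such an element yields the transvections \<open>1 + u e\<^sub>j\<^sup>T\<close> with \<open>u\<close> supported
  in \<open>{j<..k}\<close>, and these move \<open>e\<^sub>j\<close> to an eigenvector of the diagonal block on \<open>{j..k}\<close>.\<close>

lemma parabolic_triangularize:
  assumes P: "mgroup N P" and B: "{y \<in> UT N. det y = 1} \<subseteq> P" and x: "x \<in> P"
  shows "\<exists>q q'. q \<in> P \<and> inv_pair N q q' \<and> q' * x * q \<in> UT N"
proof -
  have "\<exists>q q'. q \<in> P \<and> inv_pair N q q' \<and> q' * x * q \<in> UTc N j" if "j \<le> N" for j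
    using that
  proof (induction j)
    case 0
    then show ?case using inv_pair_one[of N] mgroupD(1)[OF P x] mgroupD(3)[OF P]
      by (intro exI[of _ "1\<^sub>m N"]) (simp add: UTc_def)
  next
    case (Suc j)
    then have j: "j < N" by simp
    obtain q q' where q: "q \<in> P" "inv_pair N q q'" "q' * x * q \<in> UTc N j" using Suc by auto
    define y where "y = q' * x * q"
    have q'P: "q' \<in> P"
      using mgroupD(5)[OF P q(1)] inv_pair_unique[OF q(2), of "adj_mat q"] inv_pairD[OF mgroupD(6)[OF P q(1)]] by simp
    have yP: "y \<in> P" unfolding y_def by (intro mgroupD(4)[OF P] q q'P x)
    have yU: "y \<in> UTc N j" using q by (simp add: y_def)
    show ?case
    proof (cases "y \<in> UTc N (Suc j)")
      case True
      then show ?thesis using q y_def by blast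
    next
      case False
      define S where "S = {k. k < N \<and> (\<exists>p \<in> P \<inter> UTc N j. p $$ (k, j) \<noteq> 0)}"
      obtain i0 where i0: "j < i0" "i0 < N" "y $$ (i0, j) \<noteq> 0"
        using False yU by (auto simp: UTc_def less_Suc_eq)
      have fS: "finite S" by (rule finite_subset[of _ "{..<N}"]) (auto simp: S_def)
      have i0S: "i0 \<in> S" using i0 yP yU by (auto simp: S_def)
      define k where "k = Max S"
      have kS: "k \<in> S" unfolding k_def using fS i0S by (intro Max_in) auto
      have jk: "j < k" "k < N" using Max_ge[OF fS i0S] i0 kS by (auto simp: k_def S_def)
      have maxk: "p $$ (i, j) = 0" if "p \<in> P" "p \<in> UTc N j" "k < i" "i < N" for p i
      proof (rule ccontr)
        assume "p $$ (i, j) \<noteq> 0"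
        then have "i \<in> S" using that by (auto simp: S_def)
        then show False using Max_ge[OF fS] that by (fastforce simp: k_def)
      qed
      obtain p where p: "p \<in> P" "p \<in> UTc N j" "p $$ (k, j) \<noteq> 0" using kS by (auto simp: S_def)
      have pc: "p \<in> carrier_mat N N" using mgroupD(1)[OF P p(1)] .
      have tr1: "trans_mat N j u \<in> P" if u: "u k \<noteq> 0" "\<And>a. a \<le> j \<Longrightarrow> u a = 0" "\<And>a. k < a \<Longrightarrow> a < N \<Longrightarrow> u a = 0" for u
      proof -
        define c where "c = u k / p $$ (k, j)"
        have c0: "c \<noteq> 0" using u(1) p(3) by (simp add: c_def)
        \<comment> \<open>An upper triangular transvection that uses the nonzero entry
          \<open>p $$ (k, j)\<close> as pivot to give column \<open>j\<close> of
          \<open>b * p\<close> the prescribed direction \<open>u\<close>.\<close>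
        define b where "b = trans_mat N k (\<lambda>a. if a < k then (u a / c - p $$ (a, j)) / p $$ (k, j) else 0)"
        have bU: "b \<in> UT N" "det b = 1" unfolding b_def by (rule trans_mat_UT, simp)+
        have bc: "b \<in> carrier_mat N N" by (simp add: b_def trans_mat_carrier)
        define r where "r = b * p"
        have rP: "r \<in> P" unfolding r_def using B bU p mgroupD(4)[OF P] by blast
        have rU: "r \<in> UTc N j" unfolding r_def using UTc_mult[OF UTc_mono[OF bU(1)] p(2)] j by simp
        have rc: "r \<in> carrier_mat N N" using mgroupD(1)[OF P rP] .
        have rj: "r $$ (a, j) = u a / c" if a: "a < N" for a
        proof -
          have "r $$ (a, j) = (\<Sum>l<N. b $$ (a, l) * p $$ (l, j))"
            unfolding r_def by (rule mult_entry[OF bc pc a j])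
          also have "\<dots> = (\<Sum>l<N. (if l = a then p $$ (a, j) else 0) + (if l = k then
              (if a < k then (u a / c - p $$ (a, j)) / p $$ (k, j) else 0) * p $$ (k, j) else 0))"
            using a jk by (intro sum.cong) (auto simp: b_def trans_mat_def)
          also have "\<dots> = p $$ (a, j) + (if a < k then u a / c - p $$ (a, j) else 0)"
            using a jk p(3) by (simp add: sum.distrib)
          also have "\<dots> = u a / c"
          proof (cases a k rule: linorder_cases)
            case equal
            then show ?thesis using u(1) p(3) by (simp add: c_def)
          next
            case greater
            then show ?thesis using maxk[OF p(1,2)] u(3)[of a] a by simp
          qed simp
          finally show ?thesis .
        qed
        \<comment> \<open>With \<open>r_j\<close> for row \<open>j\<close> of \<open>r\<close>, this
          is \<open>1 + c e_j r_j\<close>, unitriangular because \<open>r_j\<close> vanishes up to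
          position \<open>j\<close>. As \<open>r\<close> sends \<open>c e_j\<close> to
          \<open>u\<close>, conjugation by \<open>r\<close> turns it into
          \<open>1 + u e_j^T\<close>.\<close>
        define n where "n = mat N N (\<lambda>(a, l). (if a = l then 1 else 0) + (if a = j then c * r $$ (j, l) else 0))"
        have rz: "r $$ (j, l) = 0" if "l \<le> j" for l
          using that rj[OF j] u(2)[of j] UTc_zero[OF rU, of l j] j by (cases "l = j") auto
        have nU: "n \<in> UT N" using rz by (auto simp: n_def UTc_def)
        moreover have "det n = 1"
          unfolding UT_det[OF nU] by (rule prod.neutral) (use rz in \<open>auto simp: n_def\<close>)
        ultimately have nP: "n \<in> P" using B by blast
        have nc: "n \<in> carrier_mat N N" by (simp add: n_def)
        have key: "r * n = trans_mat N j u * r"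
        proof (rule eq_matI)
          fix a l assume "a < dim_row (trans_mat N j u * r)" "l < dim_col (trans_mat N j u * r)"
          then have al: "a < N" "l < N" using rc by (auto simp: trans_mat_def)
          have "(r * n) $$ (a, l) = (\<Sum>m<N. r $$ (a, m) * n $$ (m, l))" by (rule mult_entry[OF rc nc al])
          also have "\<dots> = (\<Sum>m<N. (if m = l then r $$ (a, l) else 0) + (if m = j then r $$ (a, j) * c * r $$ (j, l) else 0))"
            using al by (intro sum.cong) (auto simp: n_def algebra_simps)
          also have "\<dots> = r $$ (a, l) + u a * r $$ (j, l)"
            using al j rj[OF al(1)] c0 by (simp add: sum.distrib)
          finally have L: "(r * n) $$ (a, l) = r $$ (a, l) + u a * r $$ (j, l)" .
          have "(trans_mat N j u * r) $$ (a, l) = (\<Sum>m<N. trans_mat N j u $$ (a, m) * r $$ (m, l))"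
            by (rule mult_entry[OF trans_mat_carrier rc al])
          also have "\<dots> = (\<Sum>m<N. (if m = a then r $$ (a, l) else 0) + (if m = j then u a * r $$ (j, l) else 0))"
            using al by (intro sum.cong) (auto simp: trans_mat_def algebra_simps)
          also have "\<dots> = r $$ (a, l) + u a * r $$ (j, l)"
            using al j by (simp add: sum.distrib)
          finally show "(r * n) $$ (a, l) = (trans_mat N j u * r) $$ (a, l)" using L by simp
        qed (use rc nc in \<open>auto simp: trans_mat_def\<close>)
        have "r * n * adj_mat r = trans_mat N j u"
          unfolding key using inv_pairD[OF mgroupD(6)[OF P rP]] trans_mat_carrier[of N j u]
          by (simp add: assoc_mult_mat[of _ N N _ N _ N])
        then show ?thesis using mgroupD(4,5)[OF P] rP nP by metis
      qed
      have tr: "trans_mat N j u \<in> P" if u: "\<And>a. a \<le> j \<Longrightarrow> u a = 0" "\<And>a. k < a \<Longrightarrow> a < N \<Longrightarrow> u a = 0" for u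
      proof (cases "u k = 0")
        case False
        then show ?thesis using tr1 u by blast
      next
        case True
        \<comment> \<open>A vector with \<open>u k = 0\<close> is the sum of two vectors with
          nonzero coordinate \<open>k\<close>.\<close>
        let ?e = "\<lambda>a. if a = k then 1 else 0 :: complex"
        have "trans_mat N j (\<lambda>a. u a + ?e a) \<in> P" "trans_mat N j (\<lambda>a. - ?e a) \<in> P"
          by (rule tr1; use True u jk in simp)+
        then have "trans_mat N j (\<lambda>a. u a + ?e a) * trans_mat N j (\<lambda>a. - ?e a) \<in> P" by (rule mgroupD(4)[OF P])
        then show ?thesis using trans_mat_mult[of "\<lambda>a. - ?e a" j N "\<lambda>a. u a + ?e a"] jk j by simp
      qed
      have yc: "y \<in> carrier_mat N N" using mgroupD(1)[OF P yP] .
      \<comment> \<open>A nonzero entry here could be carried into column \<open>j\<close> by a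
        transvection from the group, against the maximality of \<open>k\<close>. So positions
        \<open>j\<close> to \<open>k\<close> form a diagonal block that \<open>y\<close> preserves
        modulo the earlier coordinates.\<close>
      have yz: "y $$ (l, i) = 0" if "j \<le> i" "i \<le> k" "k < l" "l < N" for i l
      proof (cases "i = j")
        case True
        then show ?thesis using maxk[OF yP yU] that by simp
      next
        case False
        let ?t = "trans_mat N j (\<lambda>a. if a = i then 1 else 0)"
        have "y * ?t \<in> P" by (intro mgroupD(4)[OF P yP] tr) (use that False in auto)
        moreover have "y * ?t \<in> UTc N j" using UTc_mult[OF yU trans_mat_UTc] j by simp
        ultimately have "(y * ?t) $$ (l, j) = 0" using maxk that by blast
        moreover have "(y * ?t) $$ (l, j) = (\<Sum>m<N. y $$ (l, m) * ?t $$ (m, j))"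
          by (rule mult_entry[OF yc trans_mat_carrier]) (use that j in auto)
        moreover have "\<dots> = (\<Sum>m<N. (if m = j then y $$ (l, j) else 0) + (if m = i then y $$ (l, i) else 0))"
          using that j False by (intro sum.cong) (auto simp: trans_mat_def)
        ultimately show ?thesis using maxk[OF yP yU] that j by (simp add: sum.distrib)
      qed
      define s where "s = Suc k - j"
      obtain w a where w: "w \<in> carrier_vec s" "w \<noteq> 0\<^sub>v s"
        "mat s s (\<lambda>(i, l). y $$ (i + j, l + j)) *\<^sub>v w = a \<cdot>\<^sub>v w"
        using exists_eigenvector[of "mat s s (\<lambda>(i, l). y $$ (i + j, l + j))" s] jk by (auto simp: s_def)
      \<comment> \<open>An eigenvector of the diagonal block on positions \<open>j\<close> to
        \<open>k\<close>, extended by zero; it satisfies the eigenvalue equation of \<open>y\<close>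
        in all rows from \<open>j\<close> on.\<close>
      define v where "v i = (if j \<le> i \<and> i \<le> k then w $ (i - j) else 0)" for i
      obtain b where b: "b < s" "w $ b \<noteq> 0"
        using w by (metis carrier_vecD eq_vecI index_zero_vec(1) index_zero_vec(2))
      have vb: "v (b + j) \<noteq> 0" "b + j \<le> k" using b by (auto simp: v_def s_def)
      have ev: "(\<Sum>l<N. y $$ (i, l) * v l) = a * v i" if i: "i < N" "j \<le> i" for i
      proof (cases "i \<le> k")
        case True
        have "(\<Sum>l<N. y $$ (i, l) * v l) = (\<Sum>l\<in>{j..k}. y $$ (i, l) * v l)"
          by (rule sum.mono_neutral_right) (use jk in \<open>auto simp: v_def\<close>)
        also have "\<dots> = (\<Sum>l<s. y $$ (i, l + j) * w $ l)"
          by (rule sum.reindex_bij_witness[of _ "\<lambda>m. m + j" "\<lambda>m. m - j"]) (auto simp: v_def s_def)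
        also have "\<dots> = (mat s s (\<lambda>(i, l). y $$ (i + j, l + j)) *\<^sub>v w) $ (i - j)"
          using w(1) True i by (subst mult_vec_entry[of _ s s]) (auto simp: s_def)
        also have "\<dots> = a * v i" unfolding w(3) using w(1) True i by (simp add: v_def s_def)
        finally show ?thesis .
      next
        case False
        then have "(\<Sum>l<N. y $$ (i, l) * v l) = 0"
          using yz i by (intro sum.neutral) (auto simp: v_def)
        then show ?thesis using False by (simp add: v_def)
      qed
      have "\<exists>z z' d. z \<in> P \<and> inv_pair N z z' \<and> (\<forall>l<j. col z l = unit_vec N l) \<and>
          col z j = vec N (\<lambda>i. d * v i)"
      proof (cases "v j = 0")
        case False
        let ?z = "trans_mat N j (\<lambda>i. if i \<le> j then 0 else v i / v j)"
        have "?z \<in> P" by (rule tr) (auto simp: v_def)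
        moreover have "inv_pair N ?z (trans_mat N j (\<lambda>a. - (if a \<le> j then 0 else v a / v j)))"
          by (rule trans_mat_inverse) (use j in auto)
        moreover have "\<forall>l<j. col ?z l = unit_vec N l"
          using j by (auto intro!: eq_vecI simp: trans_mat_def unit_vec_def)
        moreover have "col ?z j = vec N (\<lambda>i. inverse (v j) * v i)"
          using j False by (auto intro!: eq_vecI simp: trans_mat_def v_def field_simps)
        ultimately show ?thesis by blast
      next
        case True
        define i where "i = b + j"
        have i: "j < i" "i \<le> k" "v i \<noteq> 0" "i < N" using vb True jk by (auto simp: i_def intro!: Nat.gr0I)
        \<comment> \<open>For \<open>v j = 0\<close> no matrix \<open>1 + u e_j^T\<close> with
          \<open>u j = 0\<close> sends \<open>e_j\<close> to a multiple of \<open>v\<close>.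
          Normalizing coordinate \<open>i\<close> to 1 and subtracting row \<open>i\<close> from row
          \<open>j\<close> removes the unwanted \<open>e_j\<close>.\<close>
        let ?m = "trans_mat N i (\<lambda>a. if a = j then -1 else 0)"
        let ?t = "trans_mat N j (\<lambda>a. if a \<le> j then 0 else v a / v i)"
        have "det ?m = 1" "?m \<in> UT N" by (rule trans_mat_UT; use i in simp)+
        then have mP: "?m \<in> P" using B by blast
        have tP: "?t \<in> P" by (rule tr) (auto simp: v_def)
        have col: "col (?m * ?t) l = vec N (\<lambda>a. ?t $$ (a, l) - (if a = j then ?t $$ (i, l) else 0))" if l: "l < N" for l
        proof (rule eq_vecI)
          fix a assume "a < dim_vec (vec N (\<lambda>a. ?t $$ (a, l) - (if a = j then ?t $$ (i, l) else 0)))"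
          then have a: "a < N" by simp
          have "(?m * ?t) $$ (a, l) = (\<Sum>m<N. ?m $$ (a, m) * ?t $$ (m, l))"
            by (rule mult_entry[OF trans_mat_carrier trans_mat_carrier a l])
          also have "\<dots> = (\<Sum>m<N. (if m = a then ?t $$ (a, l) else 0) + (if m = i then (if a = j then - ?t $$ (i, l) else 0) else 0))"
            using a i by (intro sum.cong) (auto simp: trans_mat_def)
          also have "\<dots> = ?t $$ (a, l) - (if a = j then ?t $$ (i, l) else 0)"
            using a i by (simp add: sum.distrib)
          finally show "col (?m * ?t) l $ a = vec N (\<lambda>a. ?t $$ (a, l) - (if a = j then ?t $$ (i, l) else 0)) $ a"
            using a l index_col[of a "?m * ?t" l] by (simp add: trans_mat_def del: index_mult_mat(1))
        qed (simp add: trans_mat_def)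
        have "?m * ?t \<in> P" by (rule mgroupD(4)[OF P mP tP])
        moreover have "inv_pair N (?m * ?t) (adj_mat (?m * ?t))" by (rule mgroupD(6)[OF P calculation])
        moreover have "\<forall>l<j. col (?m * ?t) l = unit_vec N l"
        proof (intro allI impI)
          fix l assume "l < j"
          then show "col (?m * ?t) l = unit_vec N l"
            using col[of l] j i by (auto intro!: eq_vecI simp: trans_mat_def unit_vec_def)
        qed
        moreover have "col (?m * ?t) j = vec N (\<lambda>a. inverse (v i) * v a)"
          using col[of j] j i True by (auto intro!: eq_vecI simp: trans_mat_def v_def field_simps)
        ultimately show ?thesis by blast
      qed
      then obtain z z' d where z: "z \<in> P" "inv_pair N z z'" "\<And>l. l < j \<Longrightarrow> col z l = unit_vec N l"
        "col z j = vec N (\<lambda>i. d * v i)" by blast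
      have "z' * y * z \<in> UTc N (Suc j)"
      proof (rule triangularize_step[OF yU j z(2,3), of a])
        fix i assume i: "i < N" "j \<le> i"
        have "(y *\<^sub>v col z j) $ i = (\<Sum>l<N. y $$ (i, l) * (col z j) $ l)"
          by (rule mult_vec_entry[OF yc _ i(1)]) (use z(4) in simp)
        also have "\<dots> = (\<Sum>l<N. y $$ (i, l) * (d * v l))"
          by (rule sum.cong) (auto simp: z(4))
        also have "\<dots> = d * (\<Sum>l<N. y $$ (i, l) * v l)" by (simp add: sum_distrib_left algebra_simps)
        finally show "(y *\<^sub>v col z j) $ i = a * col z j $ i"
          unfolding z(4) ev[OF i] using i by simp
      qed auto
      moreover have "z' * y * z = (z' * q') * x * (q * z)"
        unfolding y_def using inv_pairD[OF z(2)] inv_pairD[OF q(2)] mgroupD(1)[OF P x]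
        by (simp add: assoc_mult_mat[of _ N N _ N _ N])
      moreover have "q * z \<in> P" using mgroupD(4)[OF P q(1) z(1)] .
      ultimately show ?thesis using inv_pair_mult[OF q(2) z(2)] by metis
    qed
  qed
  then show ?thesis by simp
qed

text \<open>Conjugation by \<open>g\<close> makes the given Borel subgroup the standard one. The
  triangularizing \<open>q\<close> then belongs to the conjugated group itself, so the Borel
  subgroup that it defines stays inside \<open>P\<close>.\<close>

lemma parabolic_union_of_borels:
  assumes P: "mgroup N P" and p: "inv_pair N g h" and B: "Bor N g h \<subseteq> P" and x: "x \<in> P"
  shows "\<exists>g' h'. inv_pair N g' h' \<and> x \<in> Bor N g' h' \<and> Bor N g' h' \<subseteq> P"
proof -
  note c = inv_pairD[OF p]
  define Q where "Q = {y \<in> carrier_mat N N. g * y * h \<in> P}"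
  note p' = inv_pair_sym[OF p]
  have detQ: "det y = 1" if "y \<in> Q" for y
    using that det_conj[OF p', of y] mgroupD(2)[OF P] by (simp add: Q_def)
  have Q: "mgroup N Q" unfolding mgroup_def
  proof (intro conjI ballI)
    show "Q \<subseteq> SL N" using detQ by (auto simp: SL_def Q_def)
    show "1\<^sub>m N \<in> Q" using mgroupD(3)[OF P] c by (simp add: Q_def)
    show "y * z \<in> Q" if "y \<in> Q" "z \<in> Q" for y z
      using that mgroupD(4)[OF P] conj_mult[OF p', of y z] by (auto simp: Q_def simp del: assoc_mult_mat)
    show "adj_mat y \<in> Q" if y: "y \<in> Q" for y
    proof -
      have "y \<in> SL N" using y detQ by (auto simp: SL_def Q_def)
      then have iy: "inv_pair N y (adj_mat y)" by (rule adj_mat_inv_pair)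
      have gy: "g * y * h \<in> P" using y by (simp add: Q_def)
      have "inv_pair N (g * y * h) (g * adj_mat y * h)" by (rule inv_pair_conj[OF p' iy])
      then have "adj_mat (g * y * h) = g * adj_mat y * h"
        using inv_pair_unique[of N "g * y * h" "g * adj_mat y * h" "adj_mat (g * y * h)"]
          inv_pairD[OF mgroupD(6)[OF P gy]] by simp
      then show ?thesis using mgroupD(5)[OF P gy] inv_pairD[OF iy] by (simp add: Q_def)
    qed
  qed
  have BQ: "{y \<in> UT N. det y = 1} \<subseteq> Q"
  proof
    fix y assume y: "y \<in> {y \<in> UT N. det y = 1}"
    then have yc: "y \<in> carrier_mat N N" by (simp add: UTc_def)
    then have "g * y * h \<in> Bor N g h"
      using y c conj_conj[OF p' yc] det_conj[OF p' yc] by (simp add: Bor_def SL_def)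
    then show "y \<in> Q" using B yc by (auto simp: Q_def)
  qed
  have xc: "x \<in> carrier_mat N N" using mgroupD(1)[OF P x] .
  have xQ: "h * x * g \<in> Q" using x xc c conj_conj[OF p xc] by (simp add: Q_def)
  obtain q q' where q: "q \<in> Q" "inv_pair N q q'" "q' * (h * x * g) * q \<in> UT N"
    using parabolic_triangularize[OF Q BQ xQ] by blast
  note d = inv_pairD[OF q(2)]
  have pq: "inv_pair N (g * q) (q' * h)" by (rule inv_pair_mult[OF p q(2)])
  have cj: "q' * (h * z * g) * q = q' * h * z * (g * q)" if "z \<in> carrier_mat N N" for z
    using that c d by (simp add: assoc_mult_mat[of _ N N _ N _ N])
  have "x \<in> Bor N (g * q) (q' * h)"
    using q(3) cj[OF xc] x P by (auto simp: Bor_def mgroup_def)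
  moreover have "Bor N (g * q) (q' * h) \<subseteq> P"
  proof
    fix z assume z: "z \<in> Bor N (g * q) (q' * h)"
    then have zc: "z \<in> carrier_mat N N" by (simp add: Bor_def SL_def)
    have hz: "h * z * g \<in> carrier_mat N N" using c zc by simp
    define y where "y = q' * (h * z * g) * q"
    have "y \<in> UT N" "det y = 1"
      using z cj[OF zc] det_conj[OF q(2) hz] det_conj[OF p zc] by (auto simp: Bor_def SL_def y_def)
    then have "y \<in> Q" using BQ by blast
    then have "q * y * adj_mat q \<in> Q" using q(1) mgroupD(4,5)[OF Q] by blast
    moreover have "adj_mat q = q'"
      using inv_pair_unique[OF q(2), of "adj_mat q"] inv_pairD[OF mgroupD(6)[OF Q q(1)]] by simp
    ultimately have "h * z * g \<in> Q" using conj_conj[OF q(2) hz] by (simp add: y_def)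
    then show "z \<in> P" using conj_conj[OF p zc] by (simp add: Q_def)
  qed
  ultimately show ?thesis using pq by blast
qed

text \<open>An element of the intersection lies in a Borel subgroup contained in \<open>P\<close>,
  so a link inside the stabilizer of one flag is already a link in the intersection, and only flags
  remain to be considered.\<close>

lemma parabolically_connectedI:
  assumes H: "closed_subgroup N H (SL N)"
    and link: "\<And>g h x. inv_pair N g h \<Longrightarrow> x \<in> H \<Longrightarrow> h * x * g \<in> UT N \<Longrightarrow>
      zlink N {x \<in> H. h * x * g \<in> UT N} (1\<^sub>m N) x"
  shows "parabolically_connected N (SL N) H"
  unfolding parabolically_connected_def
proof (intro conjI H allI impI zariski_connectedI[of _ _ "1\<^sub>m N"])
  fix P x assume P: "parabolic_subgroup N (SL N) P" and x: "x \<in> P \<inter> H"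
  obtain B where PB: "mgroup N P" "borel_subgroup N (SL N) B" "B \<subseteq> P"
    using P unfolding parabolic_subgroup_def closed_subgroup_iff by blast
  obtain g h where gh: "inv_pair N g h" "B = Bor N g h" using borel_subgroupE[OF PB(2)] by blast
  then obtain g' h' where p: "inv_pair N g' h'" "x \<in> Bor N g' h'" "Bor N g' h' \<subseteq> P"
    using parabolic_union_of_borels[OF PB(1) gh(1), of x] PB(3) x by blast
  have "H \<subseteq> SL N" using H unfolding closed_subgroup_iff mgroup_def by blast
  then have "{x \<in> H. h' * x * g' \<in> UT N} \<subseteq> P \<inter> H" using p(3) by (auto simp: Bor_def)
  moreover have "zlink N {x \<in> H. h' * x * g' \<in> UT N} (1\<^sub>m N) x"
    using link[OF p(1)] x p(2) by (simp add: Bor_def)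
  ultimately show "zlink N (P \<inter> H) (1\<^sub>m N) x" by (rule zlink_mono[rotated])
qed

lemma not_parabolically_connectedI:
  assumes p: "inv_pair N g h" and d: "\<not> zariski_connected N (Bor N g h \<inter> H)"
  shows "\<not> parabolically_connected N (SL N) H"
  using Bor_closed_subgroup[OF p] borel_subgroup_Bor[OF p] d
  unfolding parabolically_connected_def parabolic_subgroup_def by blast

section \<open>Polynomials in a matrix and spectral idempotents\<close>

text \<open>Evaluation of a polynomial at a matrix by Horner's scheme. Polynomials in a matrix keep
  triangularity, commutation and adjointness, which makes spectral idempotents compatible with flag
  and form.\<close>

definition mpe :: "nat \<Rightarrow> complex poly \<Rightarrow> complex mat \<Rightarrow> complex mat" where
  "mpe N p A = fold_coeffs (\<lambda>a B. a \<cdot>\<^sub>m 1\<^sub>m N + A * B) p (0\<^sub>m N N)"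

lemma mpe_0: "mpe N 0 A = 0\<^sub>m N N"
  by (simp add: mpe_def)

lemma mpe_pCons:
  assumes "A \<in> carrier_mat N N"
  shows "mpe N (pCons a p) A = a \<cdot>\<^sub>m 1\<^sub>m N + A * mpe N p A"
proof (cases "a = 0 \<and> p = 0")
  case True
  then show ?thesis using assms by (auto simp: mpe_def intro!: eq_matI)
next
  case False
  then show ?thesis by (auto simp: mpe_def fold_coeffs_pCons_not_0_0_eq fold_coeffs_pCons_coeff_not_0_eq)
qed

lemma mpe_carrier [simp]: "A \<in> carrier_mat N N \<Longrightarrow> mpe N p A \<in> carrier_mat N N"
  by (induction p) (auto simp: mpe_0 mpe_pCons)

lemma mpe_dim [simp]:
  assumes "A \<in> carrier_mat N N"
  shows "dim_row (mpe N p A) = N" "dim_col (mpe N p A) = N"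
  using mpe_carrier[OF assms, of p] by auto

lemma mpe_add:
  assumes A: "A \<in> carrier_mat N N"
  shows "mpe N (p + q) A = mpe N p A + mpe N q A"
proof (induction p q rule: poly_induct2)
  case 0
  then show ?case by (auto simp: mpe_0)
next
  case (pCons a p b q)
  then have "mpe N (pCons a p + pCons b q) A = (a + b) \<cdot>\<^sub>m 1\<^sub>m N + (A * mpe N p A + A * mpe N q A)"
    using A by (simp add: mpe_pCons mult_add_distrib_mat[of _ N N _ N])
  also have "\<dots> = mpe N (pCons a p) A + mpe N (pCons b q) A"
    using A by (auto simp: mpe_pCons algebra_simps intro!: eq_matI simp del: index_mult_mat(1))
  finally show ?case .
qed

lemma mpe_smult:
  assumes A: "A \<in> carrier_mat N N"
  shows "mpe N (smult c p) A = c \<cdot>\<^sub>m mpe N p A"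
proof (induction p)
  case 0
  then show ?case by (auto simp: mpe_0 intro!: eq_matI)
next
  case (pCons a p)
  then have "mpe N (smult c (pCons a p)) A = (c * a) \<cdot>\<^sub>m 1\<^sub>m N + c \<cdot>\<^sub>m (A * mpe N p A)"
    using A by (simp add: mpe_pCons mult_smult_distrib[of _ N N _ N] right_mult_one_mat[of _ N N])
  also have "\<dots> = c \<cdot>\<^sub>m mpe N (pCons a p) A"
    using A by (auto simp: mpe_pCons algebra_simps intro!: eq_matI simp del: index_mult_mat(1))
  finally show ?case .
qed

lemma mpe_mult:
  assumes A: "A \<in> carrier_mat N N"
  shows "mpe N (p * q) A = mpe N p A * mpe N q A"
proof (induction p)
  case 0
  then show ?case using A by (simp add: mpe_0 left_mult_zero_mat[of _ N N])
next
  case (pCons a p)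
  have "mpe N (pCons a p * q) A = a \<cdot>\<^sub>m mpe N q A + (0 \<cdot>\<^sub>m 1\<^sub>m N + A * (mpe N p A * mpe N q A))"
    using A pCons by (simp add: mpe_add mpe_smult mpe_pCons)
  also have "0 \<cdot>\<^sub>m 1\<^sub>m N + A * (mpe N p A * mpe N q A) = A * (mpe N p A * mpe N q A)"
    using A by (auto intro!: eq_matI simp del: index_mult_mat(1))
  also have "a \<cdot>\<^sub>m mpe N q A + A * (mpe N p A * mpe N q A) = mpe N (pCons a p) A * mpe N q A"
    using A by (simp add: mpe_pCons add_mult_distrib_mat[of _ N N _ _ N] mult_smult_assoc_mat[of _ N N _ N] left_mult_one_mat[of _ N N]
      assoc_mult_mat[of _ N N _ N _ N])
  finally show ?case .
qed

lemma mpe_1: "A \<in> carrier_mat N N \<Longrightarrow> mpe N 1 A = 1\<^sub>m N"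
  using mpe_pCons[of A N 1 0] by (auto simp: mpe_0 one_pCons intro!: eq_matI)

lemma mpe_power: "A \<in> carrier_mat N N \<Longrightarrow> mpe N (p ^ k) A = mpe N p A ^\<^sub>m k"
  by (induction k) (simp_all add: mpe_1 mpe_mult mpe_carrier power_Suc2 del: power_Suc)

lemma mpe_right_eigen:
  assumes A: "A \<in> carrier_mat N N" and F: "F \<in> carrier_mat N N" "A * F = c \<cdot>\<^sub>m F"
  shows "mpe N p A * F = poly p c \<cdot>\<^sub>m F"
proof (induction p)
  case 0
  then show ?case using F by (auto simp: mpe_0 intro!: eq_matI)
next
  case (pCons a p)
  have "mpe N (pCons a p) A * F = a \<cdot>\<^sub>m F + A * (mpe N p A * F)"
    using A F(1) by (simp add: mpe_pCons add_mult_distrib_mat[of _ N N _ _ N] mult_smult_assoc_mat[of _ N N _ N] left_mult_one_mat[of _ N N]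
      assoc_mult_mat[of _ N N _ N _ N])
  also have "\<dots> = a \<cdot>\<^sub>m F + poly p c \<cdot>\<^sub>m (c \<cdot>\<^sub>m F)"
    unfolding pCons using A F by (simp add: mult_smult_distrib[of _ N N _ N] right_mult_one_mat[of _ N N])
  also have "\<dots> = poly (pCons a p) c \<cdot>\<^sub>m F"
    using F(1) by (auto simp: algebra_simps intro!: eq_matI)
  finally show ?case .
qed

lemma mpe_commute:
  assumes A: "A \<in> carrier_mat N N" and B: "B \<in> carrier_mat N N" "A * B = B * A"
  shows "mpe N p A * B = B * mpe N p A"
proof (induction p)
  case 0
  then show ?case using B by (auto simp: mpe_0)
next
  case (pCons a p)
  have "mpe N (pCons a p) A * B = a \<cdot>\<^sub>m B + A * (mpe N p A * B)"
    using A B(1) by (simp add: mpe_pCons add_mult_distrib_mat[of _ N N _ _ N] mult_smult_assoc_mat[of _ N N _ N] left_mult_one_mat[of _ N N]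
      assoc_mult_mat[of _ N N _ N _ N])
  also have "A * (mpe N p A * B) = A * B * mpe N p A"
    unfolding pCons using A B(1) by (simp add: assoc_mult_mat[of _ N N _ N _ N])
  also have "\<dots> = B * (A * mpe N p A)"
    unfolding B(2) using A B(1) by (simp add: assoc_mult_mat[of _ N N _ N _ N])
  also have "a \<cdot>\<^sub>m B + B * (A * mpe N p A) = B * mpe N (pCons a p) A"
    using A B(1) by (simp add: mpe_pCons mult_add_distrib_mat[of _ N N _ N] mult_smult_distrib[of _ N N _ N] right_mult_one_mat[of _ N N])
  finally show ?case .
qed

lemma mpe_left_eigen:
  assumes A: "A \<in> carrier_mat N N" and F: "F \<in> carrier_mat N N" "F * A = c \<cdot>\<^sub>m F"
  shows "F * mpe N p A = poly p c \<cdot>\<^sub>m F"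
proof (induction p)
  case 0
  then show ?case using F by (auto simp: mpe_0 intro!: eq_matI)
next
  case (pCons a p)
  have "F * mpe N (pCons a p) A = a \<cdot>\<^sub>m F + F * A * mpe N p A"
    using A F(1) by (simp add: mpe_pCons mult_add_distrib_mat[of _ N N _ N] mult_smult_distrib[of _ N N _ N] right_mult_one_mat[of _ N N]
      assoc_mult_mat[of _ N N _ N _ N])
  also have "F * A * mpe N p A = c \<cdot>\<^sub>m (poly p c \<cdot>\<^sub>m F)"
    unfolding F(2) using A F(1) pCons by (simp add: mult_smult_assoc_mat[of _ N N _ N] left_mult_one_mat[of _ N N])
  also have "a \<cdot>\<^sub>m F + c \<cdot>\<^sub>m (poly p c \<cdot>\<^sub>m F) = poly (pCons a p) c \<cdot>\<^sub>m F"
    using F(1) by (auto simp: algebra_simps intro!: eq_matI)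
  finally show ?case .
qed

lemma mpe_UT:
  assumes A: "A \<in> UT N"
  shows "mpe N p A \<in> UT N" "i < N \<Longrightarrow> mpe N p A $$ (i, i) = poly p (A $$ (i, i))"
proof -
  note c = UTc_carrier[OF A]
  have "mpe N p A \<in> UT N \<and> (\<forall>i<N. mpe N p A $$ (i, i) = poly p (A $$ (i, i)))"
  proof (induction p)
    case 0
    then show ?case by (auto simp: mpe_0 UTc_def)
  next
    case (pCons a p)
    have "A * mpe N p A \<in> UT N" using A pCons UT_mult by blast
    then have "mpe N (pCons a p) A \<in> UT N"
      unfolding mpe_pCons[OF c] by (intro UT_add UT_smult UT_one)
    moreover have "mpe N (pCons a p) A $$ (i, i) = poly (pCons a p) (A $$ (i, i))" if "i < N" for i
      using UT_mult_diag[OF A _ that, of "mpe N p A"] pCons that c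
      by (simp add: mpe_pCons del: index_mult_mat(1))
    ultimately show ?case by blast
  qed
  then show "mpe N p A \<in> UT N" "i < N \<Longrightarrow> mpe N p A $$ (i, i) = poly p (A $$ (i, i))" by auto
qed

text \<open>The hypothesis says that \<open>B\<close> is adjoint to \<open>A\<close> for the form
  \<open>F\<close>; adjunction reverses products, which is harmless for powers of one
  matrix.\<close>

lemma mpe_adjoint:
  assumes A: "A \<in> carrier_mat N N" and B: "B \<in> carrier_mat N N" and F: "F \<in> carrier_mat N N"
    and r: "transpose_mat A * F = F * B"
  shows "transpose_mat (mpe N p A) * F = F * mpe N p B"
proof (induction p)
  case 0
  then show ?case using F by (simp add: mpe_0)
next
  case (pCons a p)
  have "A * mpe N p A = mpe N p A * A" by (rule mpe_commute[OF A A refl, symmetric])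
  then have "transpose_mat (mpe N (pCons a p) A) = a \<cdot>\<^sub>m 1\<^sub>m N + transpose_mat A * transpose_mat (mpe N p A)"
  proof -
    have "transpose_mat (mpe N (pCons a p) A) = transpose_mat (a \<cdot>\<^sub>m 1\<^sub>m N) + transpose_mat (A * mpe N p A)"
      unfolding mpe_pCons[OF A] using A by (intro transpose_add[of _ N N]) auto
    also have "transpose_mat (a \<cdot>\<^sub>m 1\<^sub>m N) = a \<cdot>\<^sub>m 1\<^sub>m N" by (auto intro!: eq_matI)
    also have "transpose_mat (A * mpe N p A) = transpose_mat A * transpose_mat (mpe N p A)"
      unfolding \<open>A * mpe N p A = mpe N p A * A\<close> using A by (intro transpose_mult[of _ N N _ N]) auto
    finally show ?thesis .
  qed
  then have "transpose_mat (mpe N (pCons a p) A) * F = a \<cdot>\<^sub>m F + transpose_mat A * (transpose_mat (mpe N p A) * F)"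
    using A F by (simp add: add_mult_distrib_mat[of _ N N _ _ N] mult_smult_assoc_mat[of _ N N _ N] left_mult_one_mat[of _ N N]
      assoc_mult_mat[of _ N N _ N _ N])
  also have "transpose_mat A * (transpose_mat (mpe N p A) * F) = transpose_mat A * F * mpe N p B"
    unfolding pCons using A B F by (simp add: assoc_mult_mat[of _ N N _ N _ N])
  also have "\<dots> = F * (B * mpe N p B)"
    unfolding r using A B F by (simp add: assoc_mult_mat[of _ N N _ N _ N])
  also have "a \<cdot>\<^sub>m F + F * (B * mpe N p B) = F * mpe N (pCons a p) B"
    using B F by (simp add: mpe_pCons mult_add_distrib_mat[of _ N N _ N] mult_smult_distrib[of _ N N _ N] right_mult_one_mat[of _ N N])
  finally show ?case .
qed

section \<open>Coprime polynomials and spectral idempotents\<close>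

definition comaximal :: "complex poly \<Rightarrow> complex poly \<Rightarrow> bool" where
  "comaximal a b \<longleftrightarrow> (\<exists>u v. u * a + v * b = 1)"

lemma comaximal_sym: "comaximal a b \<Longrightarrow> comaximal b a"
  unfolding comaximal_def by (metis add.commute)

lemma comaximal_1: "comaximal a 1"
  unfolding comaximal_def by (rule exI[of _ 0], rule exI[of _ 1]) simp

lemma comaximal_mult:
  assumes "comaximal a b" "comaximal a c"
  shows "comaximal a (b * c)"
proof -
  obtain u v where uv: "u * a + v * b = 1" using assms(1) unfolding comaximal_def by blast
  obtain x y where xy: "x * a + y * c = 1" using assms(2) unfolding comaximal_def by blast
  have "(u * x * a + u * y * c + v * b * x) * a + (v * y) * (b * c) = (u * a + v * b) * (x * a + y * c)"
    by (simp add: algebra_simps)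
  then show ?thesis unfolding comaximal_def uv xy by (metis mult_1)
qed

lemma comaximal_power: "comaximal a b \<Longrightarrow> comaximal a (b ^ k)"
  by (induction k) (auto intro: comaximal_1 comaximal_mult)

lemma comaximal_prod: "(\<And>s. s \<in> S \<Longrightarrow> comaximal a (f s)) \<Longrightarrow> comaximal a (\<Prod>s\<in>S. f s)"
  by (induction S rule: infinite_finite_induct) (auto intro: comaximal_mult comaximal_1)

text \<open>The projection onto the generalized eigenspace of \<open>c\<close> as a polynomial. With
  \<open>a = X - c\<close>, \<open>b\<close> the product of all \<open>X - s\<close>, and a Bezout
  relation \<open>u a^(N+1) + v b^(N+1) = 1\<close>, the choice \<open>p = v b^(N+1)\<close> gives
  \<open>p - p^2 = u v (a b)^(N+1)\<close>; at \<open>y\<close> the product \<open>a b\<close> is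
  strictly triangular, hence nilpotent. One \<open>p\<close> serves every \<open>y\<close> with
  diagonal in the given set.\<close>

lemma spectral_poly:
  assumes S: "finite S" "c \<notin> S"
  shows "\<exists>p :: complex poly. poly p c = 1 \<and> (\<forall>s\<in>S. poly p s = 0) \<and>
    (\<forall>y \<in> UT N. (\<forall>i<N. y $$ (i, i) = c \<or> y $$ (i, i) \<in> S) \<longrightarrow> mpe N p y * mpe N p y = mpe N p y)"
proof -
  define a where "a = [:- c, 1:]"
  define b where "b = (\<Prod>s\<in>S. [:- s, 1:])"
  have "comaximal a [:- s, 1:]" if "s \<in> S" for s
  proof -
    have cs: "s \<noteq> c" using that S(2) by auto
    have "[:inverse (s - c):] * a + [:- inverse (s - c):] * [:- s, 1:] = [:inverse (s - c) * (s - c):]"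
      by (simp add: a_def algebra_simps)
    also have "\<dots> = 1" using cs by (simp add: one_pCons)
    finally show ?thesis unfolding comaximal_def by blast
  qed
  then have "comaximal a b" unfolding b_def by (rule comaximal_prod)
  then have "comaximal (a ^ Suc N) (b ^ Suc N)" by (metis comaximal_power comaximal_sym)
  then obtain u v where uv: "u * a ^ Suc N + v * b ^ Suc N = 1" unfolding comaximal_def by blast
  \<comment> \<open>The exponent \<open>Suc N\<close> is positive even for \<open>N = 0\<close>, so
    that \<open>p\<close> vanishes on \<open>S\<close>.\<close>
  define p where "p = v * b ^ Suc N"
  have "poly (u * a ^ Suc N + v * b ^ Suc N) c = 1" unfolding uv by simp
  then have "poly p c = 1" by (simp add: p_def a_def)
  moreover have "poly p s = 0" if "s \<in> S" for s
    using that S(1) by (auto simp: p_def b_def poly_prod prod_zero_iff)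
  moreover have "mpe N p y * mpe N p y = mpe N p y"
    if y: "y \<in> UT N" and d: "\<And>i. i < N \<Longrightarrow> y $$ (i, i) = c \<or> y $$ (i, i) \<in> S" for y
  proof -
    note yc = UTc_carrier[OF y]
    have "p = p * 1" by simp
    also have "\<dots> = p * p + u * v * (a * b) ^ Suc N"
      unfolding uv[symmetric] by (simp add: p_def algebra_simps power_mult_distrib)
    finally have "mpe N p y = mpe N p y * mpe N p y + mpe N (u * v) y * mpe N ((a * b) ^ Suc N) y"
      using yc by (metis mpe_add mpe_mult)
    moreover have "mpe N (a * b) y ^\<^sub>m N = 0\<^sub>m N N"
    proof (rule strict_UT_nilpotent[OF mpe_UT(1)[OF y]])
      fix i assume "i < N"
      then show "mpe N (a * b) y $$ (i, i) = 0"
        using mpe_UT(2)[OF y, of i "a * b"] d[of i] S(1)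
        by (auto simp: a_def b_def poly_prod prod_zero_iff)
    qed
    then have "mpe N ((a * b) ^ N) y * mpe N (a * b) y = 0\<^sub>m N N"
      using yc by (simp add: mpe_power left_mult_zero_mat[of _ N N])
    then have "mpe N ((a * b) ^ Suc N) y = 0\<^sub>m N N" by (simp only: power_Suc2 mpe_mult[OF yc])
    ultimately show ?thesis using yc by simp
  qed
  ultimately show ?thesis by blast
qed

lemma idempotent_UT_diag:
  assumes "A \<in> UT N" "A * A = A" "i < N" shows "A $$ (i, i) = 0 \<or> A $$ (i, i) = 1"
proof -
  have "A $$ (i, i) * A $$ (i, i) = A $$ (i, i)" using UT_mult_diag[OF assms(1,1,3)] assms(2) by simp
  then show ?thesis by simp
qed

section \<open>Splitting into isotropic idempotents\<close>

definition outer :: "nat \<Rightarrow> complex vec \<Rightarrow> complex vec \<Rightarrow> complex mat" where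
  "outer N v w = mat N N (\<lambda>(i, j). v $ i * w $ j)"

lemma outer_carrier [simp]: "outer N v w \<in> carrier_mat N N"
  by (simp add: outer_def)

lemma mult_outer:
  assumes A: "A \<in> carrier_mat N N" and v: "v \<in> carrier_vec N"
  shows "A * outer N v w = outer N (A *\<^sub>v v) w"
proof (rule eq_matI)
  fix i j assume "i < dim_row (outer N (A *\<^sub>v v) w)" "j < dim_col (outer N (A *\<^sub>v v) w)"
  then have ij: "i < N" "j < N" by (auto simp: outer_def)
  have "(A * outer N v w) $$ (i, j) = (\<Sum>l<N. A $$ (i, l) * outer N v w $$ (l, j))"
    by (rule mult_entry[OF A outer_carrier ij])
  also have "\<dots> = (\<Sum>l<N. A $$ (i, l) * v $ l) * w $ j"
    unfolding sum_distrib_right by (rule sum.cong) (use ij in \<open>auto simp: outer_def\<close>)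
  also have "\<dots> = outer N (A *\<^sub>v v) w $$ (i, j)"
    using ij by (simp add: outer_def mult_vec_entry[OF A v ij(1)] del: index_mult_mat_vec)
  finally show "(A * outer N v w) $$ (i, j) = outer N (A *\<^sub>v v) w $$ (i, j)" .
qed (use A in \<open>auto simp: outer_def\<close>)

lemma transpose_outer: "transpose_mat (outer N v w) = outer N w v"
  by (auto simp: outer_def intro!: eq_matI)

lemma outer_mult:
  assumes A: "A \<in> carrier_mat N N" and w: "w \<in> carrier_vec N"
  shows "outer N v w * A = outer N v (transpose_mat A *\<^sub>v w)"
proof -
  have "transpose_mat (outer N v w * A) = transpose_mat A * outer N w v"
    using A by (simp add: transpose_mult[of _ N N _ N] transpose_outer)
  also have "\<dots> = outer N (transpose_mat A *\<^sub>v w) v" using A w by (intro mult_outer) auto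
  finally have "transpose_mat (outer N v w * A) = transpose_mat (outer N v (transpose_mat A *\<^sub>v w))"
    by (simp add: transpose_outer)
  then show ?thesis by simp
qed

lemma scalar_prod_sum: "w \<in> carrier_vec N \<Longrightarrow> v \<bullet> w = (\<Sum>l<N. v $ l * w $ l)"
  by (auto simp: scalar_prod_def atLeast0LessThan)

lemma outer_outer:
  assumes "a \<in> carrier_vec N"
  shows "outer N v w * outer N a b = (w \<bullet> a) \<cdot>\<^sub>m outer N v b"
proof (rule eq_matI)
  fix i j assume "i < dim_row ((w \<bullet> a) \<cdot>\<^sub>m outer N v b)" "j < dim_col ((w \<bullet> a) \<cdot>\<^sub>m outer N v b)"
  then have ij: "i < N" "j < N" by (auto simp: outer_def)
  have "(outer N v w * outer N a b) $$ (i, j) = (\<Sum>l<N. outer N v w $$ (i, l) * outer N a b $$ (l, j))"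
    by (rule mult_entry[OF outer_carrier outer_carrier ij])
  also have "\<dots> = (\<Sum>l<N. w $ l * a $ l) * (v $ i * b $ j)"
    unfolding sum_distrib_right by (rule sum.cong) (use ij in \<open>auto simp: outer_def\<close>)
  finally show "(outer N v w * outer N a b) $$ (i, j) = ((w \<bullet> a) \<cdot>\<^sub>m outer N v b) $$ (i, j)"
    using ij scalar_prod_sum[OF assms] by (simp add: outer_def)
qed (auto simp: outer_def)

lemma idempotent_diff:
  assumes c: "P \<in> carrier_mat N N" "E \<in> carrier_mat N N"
    and r: "P * P = P" "E * E = E" "P * E = E" "E * P = (E :: complex mat)"
  shows "(P - E) * (P - E) = P - E" "E * (P - E) = 0\<^sub>m N N" "(P - E) * E = 0\<^sub>m N N"
  using c r
  by (auto simp: minus_mult_distrib_mat[of _ N N _ _ N] mult_minus_distrib_mat[of _ N N _ N] intro!: eq_matI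
    simp del: index_mult_mat(1))

lemma mult_zero_via:
  assumes c: "a \<in> carrier_mat N N" "e \<in> carrier_mat N N" "p \<in> carrier_mat N N" "b \<in> carrier_mat N N"
    and "a * e = a" "p * b = b" "e * p = 0\<^sub>m N N"
  shows "a * b = (0\<^sub>m N N :: complex mat)"
proof -
  have "a * b = (a * e) * (p * b)" using assms by simp
  also have "\<dots> = a * ((e * p) * b)" using c by (simp only: assoc_mult_mat[of _ N N _ N _ N] mult_carrier_sq)
  finally show ?thesis using assms by simp
qed

lemma UT_idempotent_zero:
  assumes A: "A \<in> UT N" "A * A = A" and d: "\<And>i. i < N \<Longrightarrow> A $$ (i, i) = 0"
  shows "A = 0\<^sub>m N N"
proof -
  have "A ^\<^sub>m Suc k = A" for k using A UTc_carrier[OF A(1)] by (induction k) auto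
  moreover have "A ^\<^sub>m Suc N = 0\<^sub>m N N"
    using strict_UT_nilpotent[OF A(1) d] UTc_carrier[OF A(1)] by simp
  ultimately show ?thesis by simp
qed

text \<open>A triangular idempotent that is self-adjoint for a form which is alternating on its image
  splits into two triangular idempotents adjoint to each other: take the first nonzero column
  \<open>v\<close> of \<open>P\<close>, pair it with the first column \<open>w\<close> of \<open>P\<close> not orthogonal to \<open>v\<close>,
  and split off the hyperbolic plane spanned by \<open>v\<close> and \<open>w\<close>.\<close>

lemma isotropic_splitting:
  assumes \<Phi>: "inv_pair N \<Phi> \<Psi>"
  shows "P \<in> UT N \<Longrightarrow> P * P = P \<Longrightarrow> transpose_mat P * \<Phi> = \<Phi> * P \<Longrightarrow>
    transpose_mat (\<Phi> * P) = - (\<Phi> * P) \<Longrightarrow>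
    \<exists>A B. A \<in> UT N \<and> B \<in> UT N \<and> A * A = A \<and> B * B = B \<and> A * B = 0\<^sub>m N N \<and> B * A = 0\<^sub>m N N \<and>
      A + B = P \<and> transpose_mat A * \<Phi> = \<Phi> * B \<and> transpose_mat B * \<Phi> = \<Phi> * A"
proof (induction "card {i. i < N \<and> P $$ (i, i) = 1}" arbitrary: P rule: less_induct)
  case less
  note PU = less.prems(1) and PP = less.prems(2) and sa = less.prems(3) and sk = less.prems(4)
  note c = inv_pairD(1,2)[OF \<Phi>] UTc_carrier[OF PU]
  show ?case
  proof (cases "P = 0\<^sub>m N N")
    case True
    have "0\<^sub>m N N \<in> UT N" by (auto simp: UTc_def)
    then show ?thesis using True c by (intro exI[of _ "0\<^sub>m N N"]) simp
  next
    case False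
    have tP: "transpose_mat P \<in> carrier_mat N N" "transpose_mat \<Phi> \<in> carrier_mat N N" using c by auto
    have "transpose_mat \<Phi> * P = transpose_mat (transpose_mat P * \<Phi>)"
      using c by (simp add: transpose_mult[of _ N N _ N])
    then have T1: "transpose_mat \<Phi> * P = - (\<Phi> * P)" using sa sk by simp
    \<comment> \<open>The form \<Phi> is assumed skew only on the image of \<open>P\<close>, where
      \<open>v\<close> and \<open>w\<close> will be taken.\<close>
    have anti: "transpose_mat \<Phi> *\<^sub>v u = - (\<Phi> *\<^sub>v u)" if u: "u \<in> carrier_vec N" "P *\<^sub>v u = u" for u
    proof -
      have "transpose_mat \<Phi> *\<^sub>v u = transpose_mat \<Phi> *\<^sub>v (P *\<^sub>v u)" using u by simp
      also have "\<dots> = (transpose_mat \<Phi> * P) *\<^sub>v u"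
        using c u tP by (intro assoc_mult_mat_vec[symmetric]) auto
      also have "\<dots> = - (\<Phi> *\<^sub>v (P *\<^sub>v u))"
        unfolding T1 using c u(1) by (simp add: assoc_mult_mat_vec[of _ N N _ N])
      finally show ?thesis using u by simp
    qed
    have adjP: "transpose_mat P *\<^sub>v (\<Phi> *\<^sub>v u) = \<Phi> *\<^sub>v u" if u: "u \<in> carrier_vec N" "P *\<^sub>v u = u" for u
    proof -
      have "transpose_mat P *\<^sub>v (\<Phi> *\<^sub>v u) = (transpose_mat P * \<Phi>) *\<^sub>v u"
        using c u(1) tP by (simp add: assoc_mult_mat_vec[of _ N N _ N])
      also have "\<dots> = \<Phi> *\<^sub>v (P *\<^sub>v u)" unfolding sa using c u(1) by (simp add: assoc_mult_mat_vec[of _ N N _ N])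
      finally show ?thesis using u by simp
    qed
    have isot: "u \<bullet> (\<Phi> *\<^sub>v u) = 0" if u: "u \<in> carrier_vec N" "P *\<^sub>v u = u" for u
    proof -
      have "u \<bullet> (\<Phi> *\<^sub>v u) = (transpose_mat \<Phi> *\<^sub>v u) \<bullet> u"
        by (rule transpose_vec_mult_scalar[OF c(1) u(1) u(1), symmetric])
      also have "\<dots> = - ((\<Phi> *\<^sub>v u) \<bullet> u)" unfolding anti[OF u] using c u(1) by simp
      also have "(\<Phi> *\<^sub>v u) \<bullet> u = u \<bullet> (\<Phi> *\<^sub>v u)" using c u(1) by (intro comm_scalar_prod[of _ N]) auto
      finally show ?thesis by simp
    qed
    have colP: "P *\<^sub>v col P j = col P j" if "j < N" for j
      using col_mult2[OF c(3) c(3) that] PP by simp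
    obtain i where i: "i < N" "col P i \<noteq> 0\<^sub>v N" and imin: "\<And>j. j < i \<Longrightarrow> col P j = 0\<^sub>v N"
    proof -
      have "\<exists>i. i < N \<and> col P i \<noteq> 0\<^sub>v N"
      proof (rule ccontr)
        assume "\<not> ?thesis"
        then have "P $$ (a, b) = 0" if "a < N" "b < N" for a b
          using that index_col[of a P b] c by simp
        then show False using False c by (auto intro!: eq_matI)
      qed
      then show ?thesis using that[of "LEAST i. i < N \<and> col P i \<noteq> 0\<^sub>v N"]
        by (smt (verit) LeastI_ex not_less_Least order.strict_trans)
    qed
    define v where "v = col P i"
    have v: "v \<in> carrier_vec N" "P *\<^sub>v v = v" "v \<noteq> 0\<^sub>v N" using i c colP by (auto simp: v_def)
    \<comment> \<open>The functional that pairs \<open>v\<close> from the left with its argument; it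
      is nonzero because \<Phi> is nondegenerate.\<close>
    define f where "f = transpose_mat \<Phi> *\<^sub>v v"
    have f: "f \<in> carrier_vec N" using tP(2) v by (simp add: f_def)
    have fneg: "f = - (\<Phi> *\<^sub>v v)" unfolding f_def by (rule anti[OF v(1,2)])
    have f0: "f \<noteq> 0\<^sub>v N"
    proof
      assume "f = 0\<^sub>v N"
      then have "\<Phi> *\<^sub>v v = - (0\<^sub>v N)" using fneg c v by (metis uminus_uminus_vec)
      then have "\<Phi> *\<^sub>v v = 0\<^sub>v N" by simp
      then have "v = 0\<^sub>v N" using inv_pair_cancel_vec(2)[OF \<Phi> v(1)] mult_zero_vec[OF c(2)] by simp
      then show False using v by simp
    qed
    have Pf: "transpose_mat P *\<^sub>v f = f"
    proof -
      have "transpose_mat P *\<^sub>v f = - (transpose_mat P *\<^sub>v (\<Phi> *\<^sub>v v))"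
        unfolding fneg using c tP v(1) by (intro eq_vecI) auto
      then show ?thesis using adjP[OF v(1,2)] fneg by simp
    qed
    \<comment> \<open>As \<open>f\<close> is fixed by the transpose of \<open>P\<close>, its
      coordinates are the pairings of \<open>v\<close> with the columns of \<open>P\<close>; the
      first nonzero one selects the partner column.\<close>
    have colf: "col P j \<bullet> f = f $ j" if "j < N" for j
    proof -
      have "(transpose_mat P *\<^sub>v f) $ j = col P j \<bullet> f" using c that by simp
      then show ?thesis using Pf by simp
    qed
    obtain b where b: "b < N" "f $ b \<noteq> 0" and bmin: "\<And>j. j < b \<Longrightarrow> f $ j = 0"
    proof -
      have "\<exists>b. b < N \<and> f $ b \<noteq> 0" using f f0 by (metis carrier_vecD eq_vecI index_zero_vec(1,2))
      then show ?thesis using that[of "LEAST b. b < N \<and> f $ b \<noteq> 0"]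
        by (smt (verit) LeastI_ex not_less_Least order.strict_trans)
    qed
    define w where "w = inverse (f $ b) \<cdot>\<^sub>v col P b"
    have w: "w \<in> carrier_vec N" "P *\<^sub>v w = w"
      using b c colP[OF b(1)] by (auto simp: w_def mult_mat_vec[of _ N N])
    define w' where "w' = \<Phi> *\<^sub>v w"
    have w': "w' \<in> carrier_vec N" using c w by (simp add: w'_def)
    have Pw': "transpose_mat P *\<^sub>v w' = w'" unfolding w'_def by (rule adjP[OF w])
    have tw: "transpose_mat \<Phi> *\<^sub>v w = - w'" unfolding w'_def by (rule anti[OF w])
    have fw: "f \<bullet> w = 1"
    proof -
      have "f \<bullet> w = w \<bullet> f" using f w by (intro comm_scalar_prod) auto
      also have "\<dots> = inverse (f $ b) * (col P b \<bullet> f)" unfolding w_def using f c b by simp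
      finally show ?thesis using colf[OF b(1)] b by simp
    qed
    have w'v: "w' \<bullet> v = 1"
    proof -
      have "w' \<bullet> v = v \<bullet> (\<Phi> *\<^sub>v w)" unfolding w'_def using c v w by (intro comm_scalar_prod[of _ N]) auto
      also have "\<dots> = f \<bullet> w" unfolding f_def by (rule transpose_vec_mult_scalar[OF c(1) w(1) v(1), symmetric])
      finally show ?thesis using fw by simp
    qed
    have w'w: "w' \<bullet> w = 0"
      using isot[OF w] comm_scalar_prod[OF w' w(1)] by (simp add: w'_def)
    have fv: "f \<bullet> v = 0"
    proof -
      have "f \<bullet> v = v \<bullet> (\<Phi> *\<^sub>v v)" unfolding f_def by (rule transpose_vec_mult_scalar[OF c(1) v(1) v(1)])
      then show ?thesis using isot[OF v(1,2)] by simp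
    qed
    have w'z: "w' $ j = 0" if "j < i" for j
    proof -
      have "w' $ j = (transpose_mat P *\<^sub>v w') $ j" using Pw' by simp
      also have "\<dots> = col P j \<bullet> w'" using c that i by simp
      finally show ?thesis using imin[OF that] w' by simp
    qed
    have vz: "v $ a = 0" if "i < a" "a < N" for a
      using UTc_zero[OF PU, of i a] that c i by (simp add: v_def)
    have wz: "w $ a = 0" if "b < a" "a < N" for a
      using UTc_zero[OF PU, of b a] that c b by (simp add: w_def)
    \<comment> \<open>The projections onto the lines of \<open>v\<close> and \<open>w\<close> in
      their hyperbolic plane. They are triangular: \<open>v\<close> ends at position
      \<open>i\<close> and \<open>w'\<close> starts no earlier; \<open>w\<close> ends at
      \<open>b\<close> and \<open>f\<close> starts there.\<close>
    define A1 B1 where "A1 = outer N v w'" and "B1 = outer N w f"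
    have AU: "A1 \<in> UT N"
    proof -
      have "v $ a * w' $ j = 0" if "j < a" "a < N" for j a
        using vz[of a] w'z[of j] that by (cases "i < a") auto
      then show ?thesis by (auto simp: A1_def outer_def UTc_def)
    qed
    have BU: "B1 \<in> UT N"
    proof -
      have "w $ a * f $ j = 0" if "j < a" "a < N" for j a
        using wz[of a] bmin[of j] that by (cases "b < a") auto
      then show ?thesis by (auto simp: B1_def outer_def UTc_def)
    qed
    have c1: "A1 \<in> carrier_mat N N" "B1 \<in> carrier_mat N N" by (simp_all add: A1_def B1_def)
    have one_smult: "1 \<cdot>\<^sub>m X = X" "0 \<cdot>\<^sub>m outer N x y = 0\<^sub>m N N" for X :: "complex mat" and x y
      by (auto intro!: eq_matI simp: outer_def)
    have prods: "A1 * A1 = A1" "B1 * B1 = B1" "A1 * B1 = 0\<^sub>m N N" "B1 * A1 = 0\<^sub>m N N"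
      using v w by (simp_all add: A1_def B1_def outer_outer w'v fw w'w fv one_smult)
    have Pprods: "P * A1 = A1" "A1 * P = A1" "P * B1 = B1" "B1 * P = B1"
      unfolding A1_def B1_def using c v w w' f Pw' Pf by (simp_all add: mult_outer outer_mult)
    have adj1: "transpose_mat A1 * \<Phi> = \<Phi> * B1"
      using c v w by (simp add: A1_def B1_def transpose_outer outer_mult mult_outer f_def w'_def)
    have \<Phi>v: "\<Phi> *\<^sub>v v = - f" using fneg c v(1) by simp
    have adj2: "transpose_mat B1 * \<Phi> = \<Phi> * A1"
    proof -
      have "outer N f (- w') = outer N (- f) w'" using f w' by (auto simp: outer_def intro!: eq_matI)
      then show ?thesis
        using c v w by (simp add: A1_def B1_def transpose_outer outer_mult mult_outer tw \<Phi>v)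
    qed
    define E where "E = A1 + B1"
    have Ec: "E \<in> carrier_mat N N" using c1 by (simp add: E_def)
    have EE: "E * E = E" "A1 * E = A1" "E * A1 = A1" "B1 * E = B1" "E * B1 = B1"
      unfolding E_def using c1 prods
      by (simp_all add: add_mult_distrib_mat[of _ N N _ _ N] mult_add_distrib_mat[of _ N N _ N])
    have PE: "P * E = E" "E * P = E"
      unfolding E_def using c c1 Pprods
      by (simp_all add: add_mult_distrib_mat[of _ N N _ _ N] mult_add_distrib_mat[of _ N N _ N])
    define Q where "Q = P - E"
    have QU: "Q \<in> UT N" unfolding Q_def E_def by (intro UT_diff UT_add PU AU BU)
    note Qc = UTc_carrier[OF QU]
    note QQ = idempotent_diff[OF c(3) Ec PP EE(1) PE, folded Q_def]
    have tE: "transpose_mat E * \<Phi> = \<Phi> * E"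
      unfolding E_def using c c1 adj1 adj2
      by (simp add: transpose_add[of _ N N] add_mult_distrib_mat[of _ N N _ _ N] mult_add_distrib_mat[of _ N N _ N]
        comm_add_mat[of _ N N])
    have saQ: "transpose_mat Q * \<Phi> = \<Phi> * Q"
      unfolding Q_def using c Ec sa tE
      by (simp add: transpose_minus[of _ N N] minus_mult_distrib_mat[of _ N N _ _ N] mult_minus_distrib_mat[of _ N N _ N])
    have \<Phi>E: "transpose_mat (\<Phi> * E) = - (\<Phi> * E)"
    proof -
      have "\<Phi> * E = outer N (- f) w' + outer N w' f"
        unfolding E_def A1_def B1_def using c v w
        by (simp add: mult_add_distrib_mat[of _ N N _ N] mult_outer \<Phi>v w'_def)
      then show ?thesis using f w' by (auto simp: outer_def intro!: eq_matI)
    qed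
    have skQ: "transpose_mat (\<Phi> * Q) = - (\<Phi> * Q)"
    proof -
      have "\<Phi> * Q = \<Phi> * P - \<Phi> * E" unfolding Q_def using c Ec by (simp add: mult_minus_distrib_mat[of _ N N _ N])
      moreover have "transpose_mat (\<Phi> * P - \<Phi> * E) = - (\<Phi> * P) - (- (\<Phi> * E))"
        using c Ec sk \<Phi>E by (subst transpose_minus[of _ N N]) auto
      ultimately show ?thesis using c Ec by (auto intro!: eq_matI simp del: index_mult_mat(1))
    qed
    \<comment> \<open>The trace of a triangular idempotent counts its unit diagonal entries;
      removing two rank-one projections lowers the induction measure by 2.\<close>
    have cnt: "(\<Sum>l<N. A $$ (l, l)) = of_nat (card {l. l < N \<and> A $$ (l, l) = 1})" if "A \<in> UT N" "A * A = A" for A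
    proof -
      have "(\<Sum>l<N. A $$ (l, l)) = (\<Sum>l<N. if A $$ (l, l) = 1 then 1 else 0)"
        using idempotent_UT_diag[OF that] by (intro sum.cong) auto
      also have "\<dots> = of_nat (card {l. l < N \<and> A $$ (l, l) = 1})"
        by (simp add: sum.If_cases Collect_conj_eq lessThan_def)
      finally show ?thesis .
    qed
    have "(\<Sum>l<N. Q $$ (l, l)) = (\<Sum>l<N. P $$ (l, l)) - ((\<Sum>l<N. A1 $$ (l, l)) + (\<Sum>l<N. B1 $$ (l, l)))"
      unfolding sum.distrib[symmetric] sum_subtractf[symmetric] Q_def E_def
      by (rule sum.cong) (use c c1 in auto)
    moreover have "(\<Sum>l<N. A1 $$ (l, l)) = w' \<bullet> v" "(\<Sum>l<N. B1 $$ (l, l)) = f \<bullet> w"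
      unfolding scalar_prod_sum[OF v(1)] scalar_prod_sum[OF w(1)]
      by (auto simp: A1_def B1_def outer_def intro!: sum.cong)
    ultimately have "of_nat (card {l. l < N \<and> Q $$ (l, l) = 1}) + (2 :: complex) = of_nat (card {l. l < N \<and> P $$ (l, l) = 1})"
      using cnt[OF QU QQ(1)] cnt[OF PU PP] w'v fw by simp
    then have "of_nat (card {l. l < N \<and> Q $$ (l, l) = 1} + 2) = (of_nat (card {l. l < N \<and> P $$ (l, l) = 1}) :: complex)"
      by (simp add: add.commute)
    then have "card {l. l < N \<and> Q $$ (l, l) = 1} < card {l. l < N \<and> P $$ (l, l) = 1}"
      unfolding of_nat_eq_iff by simp
    from less.hyps[OF this QU QQ(1) saQ skQ]
    obtain A2 B2 where h: "A2 \<in> UT N" "B2 \<in> UT N" "A2 * A2 = A2" "B2 * B2 = B2" "A2 * B2 = 0\<^sub>m N N"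
      "B2 * A2 = 0\<^sub>m N N" "A2 + B2 = Q" "transpose_mat A2 * \<Phi> = \<Phi> * B2" "transpose_mat B2 * \<Phi> = \<Phi> * A2" by blast
    note c2 = UTc_carrier[OF h(1)] UTc_carrier[OF h(2)]
    have Qprods: "Q * A2 = A2" "A2 * Q = A2" "Q * B2 = B2" "B2 * Q = B2"
      unfolding h(7)[symmetric] using c2 h(3-6)
      by (simp_all add: add_mult_distrib_mat[of _ N N _ _ N] mult_add_distrib_mat[of _ N N _ N])
    have z: "A1 * A2 = 0\<^sub>m N N" "A1 * B2 = 0\<^sub>m N N" "B1 * A2 = 0\<^sub>m N N" "B1 * B2 = 0\<^sub>m N N"
      "A2 * A1 = 0\<^sub>m N N" "A2 * B1 = 0\<^sub>m N N" "B2 * A1 = 0\<^sub>m N N" "B2 * B1 = 0\<^sub>m N N"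
      using mult_zero_via[OF c1(1) Ec Qc c2(1) EE(2) Qprods(1) QQ(2)]
        mult_zero_via[OF c1(1) Ec Qc c2(2) EE(2) Qprods(3) QQ(2)]
        mult_zero_via[OF c1(2) Ec Qc c2(1) EE(4) Qprods(1) QQ(2)]
        mult_zero_via[OF c1(2) Ec Qc c2(2) EE(4) Qprods(3) QQ(2)]
        mult_zero_via[OF c2(1) Qc Ec c1(1) Qprods(2) EE(3) QQ(3)]
        mult_zero_via[OF c2(1) Qc Ec c1(2) Qprods(2) EE(5) QQ(3)]
        mult_zero_via[OF c2(2) Qc Ec c1(1) Qprods(4) EE(3) QQ(3)]
        mult_zero_via[OF c2(2) Qc Ec c1(2) Qprods(4) EE(5) QQ(3)] by auto
    show ?thesis
    proof (rule exI[of _ "A1 + A2"], rule exI[of _ "B1 + B2"], intro conjI)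
      show "A1 + A2 \<in> UT N" "B1 + B2 \<in> UT N" using AU BU h UT_add by auto
      show "(A1 + A2) * (A1 + A2) = A1 + A2" "(B1 + B2) * (B1 + B2) = B1 + B2"
        "(A1 + A2) * (B1 + B2) = 0\<^sub>m N N" "(B1 + B2) * (A1 + A2) = 0\<^sub>m N N"
        using c1 c2 prods h(3-6) z
        by (simp_all add: add_mult_distrib_mat[of _ N N _ _ N] mult_add_distrib_mat[of _ N N _ N])
      have "A1 + A2 + (B1 + B2) = E + Q" unfolding E_def h(7)[symmetric] using c1 c2
        by (auto intro!: eq_matI)
      also have "\<dots> = P" unfolding Q_def using c Ec by (auto intro!: eq_matI)
      finally show "A1 + A2 + (B1 + B2) = P" .
      show "transpose_mat (A1 + A2) * \<Phi> = \<Phi> * (B1 + B2)" "transpose_mat (B1 + B2) * \<Phi> = \<Phi> * (A1 + A2)"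
        using c c1 c2 adj1 adj2 h(8,9)
        by (simp_all add: transpose_add[of _ N N] add_mult_distrib_mat[of _ N N _ _ N] mult_add_distrib_mat[of _ N N _ N])
    qed
  qed
qed

section \<open>Triangular isometries are connected\<close>

text \<open>The conditions on \<open>F\<close> let one definition cover both embeddings:
  \<open>F\<close> is 0 for the full isometry group, and the projection onto the fixed line in the
  odd case, where they say that the line is fixed and its complement preserved.\<close>

definition isom_UT :: "nat \<Rightarrow> complex mat \<Rightarrow> complex mat \<Rightarrow> complex mat set" where
  "isom_UT N \<Phi> F = {x \<in> UT N. transpose_mat x * \<Phi> * x = \<Phi> \<and> x * F = F \<and> F * x = F}"

lemma isom_UT_mult:
  assumes c: "\<Phi> \<in> carrier_mat N N" "F \<in> carrier_mat N N"
    and x: "x \<in> isom_UT N \<Phi> F" and y: "y \<in> isom_UT N \<Phi> F"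
  shows "x * y \<in> isom_UT N \<Phi> F"
proof -
  have xc: "x \<in> carrier_mat N N" "y \<in> carrier_mat N N" using x y UTc_carrier by (auto simp: isom_UT_def)
  have "transpose_mat (x * y) * \<Phi> * (x * y) = transpose_mat y * (transpose_mat x * \<Phi> * x) * y"
    using c xc by (simp add: transpose_mult[of _ N N _ N] assoc_mult_mat[of _ N N _ N _ N])
  then have "transpose_mat (x * y) * \<Phi> * (x * y) = \<Phi>" using x y by (simp add: isom_UT_def)
  moreover have "x * y * F = F" using c xc x y by (simp add: isom_UT_def assoc_mult_mat[of _ N N _ N _ N])
  moreover have "F * (x * y) = F * x * y" using c xc by (simp add: assoc_mult_mat[of _ N N _ N _ N])
  then have "F * (x * y) = F" using x y by (simp add: isom_UT_def)
  ultimately show ?thesis using x y UT_mult by (auto simp: isom_UT_def simp del: assoc_mult_mat)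
qed

lemma smult_smult_mat: "a \<cdot>\<^sub>m (b \<cdot>\<^sub>m A) = (a * b) \<cdot>\<^sub>m (A :: complex mat)"
  by (rule eq_matI) auto

text \<open>The right-hand side is symmetric in \<open>a\<close> and \<open>b\<close>. Numerator and
  denominator of the Cayley path are pencils with \<open>a\<close> and \<open>b\<close> exchanged,
  so they pull the form back to the same form and their quotient is an isometry.\<close>

lemma isom_pencil:
  assumes c: "\<Phi> \<in> carrier_mat N N" "x \<in> carrier_mat N N" and x: "transpose_mat x * \<Phi> * x = \<Phi>"
  shows "transpose_mat (a \<cdot>\<^sub>m 1\<^sub>m N + b \<cdot>\<^sub>m x) * \<Phi> * (a \<cdot>\<^sub>m 1\<^sub>m N + b \<cdot>\<^sub>m x) =
    (a * a + b * b) \<cdot>\<^sub>m \<Phi> + (a * b) \<cdot>\<^sub>m (transpose_mat x * \<Phi> + \<Phi> * (x :: complex mat))"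
proof -
  define L where "L = transpose_mat x * \<Phi>"
  have Lc: "L \<in> carrier_mat N N" using c by (simp add: L_def)
  have xt: "transpose_mat x \<in> carrier_mat N N" using c by simp
  have Lx: "L * x = \<Phi>" using x by (simp add: L_def)
  have "transpose_mat (a \<cdot>\<^sub>m 1\<^sub>m N + b \<cdot>\<^sub>m x) = a \<cdot>\<^sub>m 1\<^sub>m N + b \<cdot>\<^sub>m transpose_mat x"
    using c by (auto intro!: eq_matI)
  then have t1: "transpose_mat (a \<cdot>\<^sub>m 1\<^sub>m N + b \<cdot>\<^sub>m x) * \<Phi> = a \<cdot>\<^sub>m \<Phi> + b \<cdot>\<^sub>m L"
    unfolding L_def using c xt
    by (simp add: add_mult_distrib_mat[of _ N N _ _ N] mult_smult_assoc_mat[of _ N N _ N] left_mult_one_mat[of _ N N])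
  have "transpose_mat (a \<cdot>\<^sub>m 1\<^sub>m N + b \<cdot>\<^sub>m x) * \<Phi> * (a \<cdot>\<^sub>m 1\<^sub>m N + b \<cdot>\<^sub>m x) = a \<cdot>\<^sub>m (a \<cdot>\<^sub>m \<Phi> + b \<cdot>\<^sub>m L) + b \<cdot>\<^sub>m (a \<cdot>\<^sub>m (\<Phi> * x) + b \<cdot>\<^sub>m (L * x))"
    unfolding t1 using c Lc by (simp add: add_mult_distrib_mat[of _ N N _ _ N] mult_add_distrib_mat[of _ N N _ N]
      mult_smult_assoc_mat[of _ N N _ N] mult_smult_distrib[of _ N N _ N] right_mult_one_mat[of _ N N])
  also have "\<dots> = (a * a + b * b) \<cdot>\<^sub>m \<Phi> + (a * b) \<cdot>\<^sub>m (L + \<Phi> * x)"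
    unfolding Lx using c Lc by (auto intro!: eq_matI simp: algebra_simps simp del: index_mult_mat(1))
  finally show ?thesis by (simp add: L_def)
qed

text \<open>The Cayley path \<open>((1 - s) + (1 + s) x) ((1 + s) + (1 - s) x)\<^sup>-\<^sup>1\<close> joins \<open>1\<close> to \<open>x\<close>.\<close>

lemma cayley_link:
  assumes c: "\<Phi> \<in> carrier_mat N N" "F \<in> carrier_mat N N" and x: "x \<in> isom_UT N \<Phi> F"
    and ev: "\<And>i. i < N \<Longrightarrow> x $$ (i, i) \<noteq> -1"
  shows "zlink N (isom_UT N \<Phi> F) (1\<^sub>m N) x"
proof -
  have xU: "x \<in> UT N" and xi: "transpose_mat x * \<Phi> * x = \<Phi>" and xF: "x * F = F" "F * x = F"
    using x by (auto simp: isom_UT_def)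
  note xc = UTc_carrier[OF xU]
  define A B where "A s = (1 - s) \<cdot>\<^sub>m 1\<^sub>m N + (1 + s) \<cdot>\<^sub>m x" and "B s = (1 + s) \<cdot>\<^sub>m 1\<^sub>m N + (1 - s) \<cdot>\<^sub>m x" for s
  have ev': "1 + x $$ (i, i) \<noteq> 0" if "i < N" for i using ev[OF that] by (simp add: add_eq_0_iff)
  \<comment> \<open>The parameters at which a diagonal entry of \<open>B s\<close> vanishes. At
    \<open>s = 0\<close> the entries are \<open>1 + x $$ (i, i)\<close>, nonzero by the assumption
    on eigenvalues; at \<open>s = 1\<close> they are 2.\<close>
  define T where "T = {s :: complex. \<exists>i<N. (1 - s) * (1 + x $$ (i, i)) + s * 2 = 0}"
  have T: "finite T" unfolding T_def by (rule finite_affine_zeros) simp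
  have ABU: "A s \<in> UT N" "B s \<in> UT N" for s
    unfolding A_def B_def by (intro UT_add UT_smult UT_one xU)+
  have ABc: "A s \<in> carrier_mat N N" "B s \<in> carrier_mat N N" for s
    by (rule UTc_carrier[OF ABU(1)] UTc_carrier[OF ABU(2)])+
  define R where "R s = inverse (det (B s)) \<cdot>\<^sub>m adj_mat (B s)" for s
  have Bd: "det (B s) \<noteq> 0" if "s \<in> - T" for s
  proof -
    have "B s $$ (i, i) \<noteq> 0" if "i < N" for i
    proof -
      have "B s $$ (i, i) = (1 - s) * (1 + x $$ (i, i)) + s * 2"
        using that xc by (simp add: B_def algebra_simps)
      then show ?thesis using \<open>s \<in> - T\<close> that unfolding T_def by auto
    qed
    then show ?thesis using UT_det[OF ABU(2)] by simp
  qed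
  have BR: "inv_pair N (B s) (R s)" if "s \<in> - T" for s
    unfolding R_def by (rule inv_pair_adj[OF ABc(2) Bd[OF that]])
  define p where "p s = A s * R s" for s
  \<comment> \<open>As \<open>x\<close> fixes \<open>F\<close>, numerator and denominator both
    multiply \<open>F\<close> by 2, so their quotient fixes it.\<close>
  have AF: "A s * F = 2 \<cdot>\<^sub>m F" "B s * F = 2 \<cdot>\<^sub>m F" "F * A s = 2 \<cdot>\<^sub>m F" "F * B s = 2 \<cdot>\<^sub>m F" for s
  proof -
    have e: "(1 - s) \<cdot>\<^sub>m F + (1 + s) \<cdot>\<^sub>m F = 2 \<cdot>\<^sub>m F" "(1 + s) \<cdot>\<^sub>m F + (1 - s) \<cdot>\<^sub>m F = 2 \<cdot>\<^sub>m F"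
      using c by (auto intro!: eq_matI simp: algebra_simps)
    show "A s * F = 2 \<cdot>\<^sub>m F" "B s * F = 2 \<cdot>\<^sub>m F" "F * A s = 2 \<cdot>\<^sub>m F" "F * B s = 2 \<cdot>\<^sub>m F"
      unfolding A_def B_def using c xc xF e
      by (simp_all add: add_mult_distrib_mat[of _ N N _ _ N] mult_add_distrib_mat[of _ N N _ N]
        mult_smult_assoc_mat[of _ N N _ N] mult_smult_distrib[of _ N N _ N] left_mult_one_mat[of _ N N] right_mult_one_mat[of _ N N])
  qed
  have pK: "p s \<in> isom_UT N \<Phi> F" if s: "s \<in> - T" for s
  proof -
    note d = inv_pairD[OF BR[OF s]]
    have RU: "R s \<in> UT N" by (rule UT_inverse(1)[OF ABU(2) BR[OF s]])
    have iso: "transpose_mat (p s) * \<Phi> * p s = \<Phi>"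
    proof -
      have "transpose_mat (p s) * \<Phi> * p s = transpose_mat (R s) * (transpose_mat (A s) * \<Phi> * A s) * R s"
        unfolding p_def using c d ABc by (simp add: transpose_mult[of _ N N _ N] assoc_mult_mat[of _ N N _ N _ N])
      also have "transpose_mat (A s) * \<Phi> * A s = transpose_mat (B s) * \<Phi> * B s"
        unfolding A_def B_def isom_pencil[OF c(1) xc xi] by (simp add: algebra_simps)
      also have "transpose_mat (R s) * (transpose_mat (B s) * \<Phi> * B s) * R s
          = transpose_mat (B s * R s) * \<Phi> * (B s * R s)"
        using c d(1,2) ABc by (simp add: transpose_mult[of _ N N _ N] assoc_mult_mat[of _ N N _ N _ N])
      finally show ?thesis using d c by simp
    qed
    have "R s * (2 \<cdot>\<^sub>m F) = F" using inv_pair_cancel(2)[OF BR[OF s] c(2)] AF by simp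
    then have RF: "2 \<cdot>\<^sub>m (R s * F) = F" using c d by (simp add: mult_smult_distrib[of _ N N _ N])
    have "2 \<cdot>\<^sub>m (p s * F) = A s * (2 \<cdot>\<^sub>m (R s * F))"
      unfolding p_def using c d ABc by (simp add: mult_smult_distrib[of _ N N _ N] assoc_mult_mat[of _ N N _ N _ N])
    then have pF2: "2 \<cdot>\<^sub>m (p s * F) = 2 \<cdot>\<^sub>m F" using RF AF by simp
    have pF: "p s * F = F"
    proof (rule eq_matI)
      fix i j assume "i < dim_row F" "j < dim_col F"
      then have ij: "i < N" "j < N" using c by auto
      have "p s \<in> carrier_mat N N" using ABc d by (simp add: p_def)
      then have "(2 \<cdot>\<^sub>m (p s * F)) $$ (i, j) = 2 * (p s * F) $$ (i, j)"
        using ij c by (simp del: index_mult_mat(1))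
      moreover have "(2 \<cdot>\<^sub>m F) $$ (i, j) = 2 * F $$ (i, j)" using ij c by simp
      ultimately show "(p s * F) $$ (i, j) = F $$ (i, j)" using pF2 by simp
    qed (use c ABc d in \<open>auto simp: p_def\<close>)
    have "F * p s = F * B s * R s"
    proof -
      have "F * p s = F * A s * R s" unfolding p_def using c d ABc by (simp add: assoc_mult_mat[of _ N N _ N _ N])
      then show ?thesis by (simp add: AF)
    qed
    also have "\<dots> = F" using c d ABc by (simp add: assoc_mult_mat[of _ N N _ N _ N])
    finally show ?thesis
      using iso pF UT_mult[OF ABU(1) RU] by (simp add: isom_UT_def p_def)
  qed
  have "zlink N (isom_UT N \<Phi> F) (p 0) (p 1)"
  proof (rule zlink_path[OF connected_cofinite[OF T] pK])
    show "isom_UT N \<Phi> F \<subseteq> carrier_mat N N" using UTc_carrier by (auto simp: isom_UT_def)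
    show "0 \<in> - T" "1 \<in> - T" using ev' by (auto simp: T_def)
    fix i j assume ij: "i < N" "j < N"
    have Bent: "continuous_on (- T) (\<lambda>s. B s $$ (a, b))" if ab: "a < N" "b < N" for a b
    proof -
      have "continuous_on (- T) (\<lambda>s. (1 + s) * 1\<^sub>m N $$ (a, b) + (1 - s) * x $$ (a, b))" by (intro continuous_intros)
      then show ?thesis using ab xc by (simp add: B_def)
    qed
    have Aent: "continuous_on (- T) (\<lambda>s. A s $$ (a, b))" if ab: "a < N" "b < N" for a b
    proof -
      have "continuous_on (- T) (\<lambda>s. (1 - s) * 1\<^sub>m N $$ (a, b) + (1 + s) * x $$ (a, b))" by (intro continuous_intros)
      then show ?thesis using ab xc by (simp add: A_def)
    qed
    have Rent: "continuous_on (- T) (\<lambda>s. R s $$ (a, b))" if ab: "a < N" "b < N" for a b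
    proof -
      have "continuous_on (- T) (\<lambda>s. inverse (det (B s)) * adj_mat (B s) $$ (a, b))"
        by (intro continuous_intros continuous_on_regular[OF regular_fun_det[OF regular_map_id]]
          continuous_on_regular[OF regular_map_entry[OF regular_map_adj ab]] Bent)
          (use ABc Bd in auto)
      then show ?thesis
      proof (rule continuous_on_eq)
        fix s :: complex
        show "inverse (det (B s)) * adj_mat (B s) $$ (a, b) = R s $$ (a, b)"
          using ab adj_mat(1)[OF ABc(2), of s] by (simp add: R_def)
      qed
    qed
    have "continuous_on (- T) (\<lambda>s. \<Sum>l<N. A s $$ (i, l) * R s $$ (l, j))"
      by (intro continuous_intros Aent Rent) (use ij in auto)
    then show "continuous_on (- T) (\<lambda>s. p s $$ (i, j))"
    proof (rule continuous_on_eq)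
      fix s assume "s \<in> - T"
      then show "(\<Sum>l<N. A s $$ (i, l) * R s $$ (l, j)) = p s $$ (i, j)"
        unfolding p_def using mult_entry[OF ABc(1) inv_pairD(2)[OF BR] ij] by simp
    qed
  qed
  moreover have "p 0 = 1\<^sub>m N"
  proof -
    have "0 \<in> - T" using ev' by (auto simp: T_def)
    moreover have "A 0 = B 0" by (simp add: A_def B_def)
    ultimately show ?thesis using inv_pairD(3)[OF BR] by (simp add: p_def)
  qed
  moreover have "p 1 = x"
  proof -
    have 1: "1 \<in> - T" by (auto simp: T_def)
    note d = inv_pairD[OF BR[OF 1]]
    have "B 1 = 2 \<cdot>\<^sub>m 1\<^sub>m N" "A 1 = 2 \<cdot>\<^sub>m x" using xc by (auto simp: A_def B_def intro!: eq_matI)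
    then have "A 1 = x * B 1" using xc by (simp add: mult_smult_distrib[of _ N N _ N] right_mult_one_mat[of _ N N])
    then have "p 1 = x * (B 1 * R 1)" unfolding p_def using d ABc xc by (simp add: assoc_mult_mat[of _ N N _ N _ N])
    then show ?thesis using d xc by simp
  qed
  ultimately show ?thesis by simp
qed

text \<open>Eigenvalues \<open>-1\<close> are first moved away: on the corresponding generalized eigenspace, where the
  form is alternating, the isotropic splitting gives a one-parameter torus.\<close>

lemma isom_UT_link:
  assumes \<Phi>: "inv_pair N \<Phi> \<Psi>" and F: "F \<in> carrier_mat N N"
    and alt: "transpose_mat (transpose_mat (1\<^sub>m N - F) * \<Phi> * (1\<^sub>m N - F)) =
      - (transpose_mat (1\<^sub>m N - F) * \<Phi> * (1\<^sub>m N - F))"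
    and x: "x \<in> isom_UT N \<Phi> F"
  shows "zlink N (isom_UT N \<Phi> F) (1\<^sub>m N) x"
proof -
  note c = inv_pairD(1,2)[OF \<Phi>]
  have xU: "x \<in> UT N" and xi: "transpose_mat x * \<Phi> * x = \<Phi>" and xF: "x * F = F" "F * x = F"
    using x by (auto simp: isom_UT_def)
  note xc = UTc_carrier[OF xU]
  have "det x * det \<Phi> * det x = det \<Phi>"
    using arg_cong[OF xi, of det] xc c by (simp add: det_mult[of _ N] det_transpose[of _ N])
  then have "det x \<noteq> 0" using inv_pair_det(2)[OF \<Phi>] by auto
  from inv_pair_adj[OF xc this] obtain x' where xx: "inv_pair N x x'" by blast
  note d = inv_pairD[OF xx]
  have x'U: "x' \<in> UT N" by (rule UT_inverse(1)[OF xU xx])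
  have x'F: "x' * F = F" using inv_pair_cancel(2)[OF xx F] xF(1) by simp
  have "F * x' = F * x * x'" using xF(2) by simp
  also have "\<dots> = F * (x * x')" using d(1,2) F by (simp only: assoc_mult_mat[of _ N N _ N _ N])
  finally have Fx': "F * x' = F" using d F by simp
  \<comment> \<open>As \<open>x'\<close> is the adjoint of \<open>x\<close>, the sum is
    self-adjoint, and so are polynomials in it. Its diagonal entry is -2 exactly where that of
    \<open>x\<close> is -1, because \<open>t + 1/t = -2\<close> means
    \<open>(t + 1)^2 = 0\<close>.\<close>
  define y where "y = x + x'"
  have yU: "y \<in> UT N" unfolding y_def by (rule UT_add[OF xU x'U])
  note yc = UTc_carrier[OF yU]
  have xadj: "transpose_mat x * \<Phi> = \<Phi> * x'"
  proof -
    have "transpose_mat x * \<Phi> = transpose_mat x * \<Phi> * x * x'"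
      using c d by (simp add: assoc_mult_mat[of _ N N _ N _ N])
    then show ?thesis using xi by simp
  qed
  have x'adj: "transpose_mat x' * \<Phi> = \<Phi> * x"
  proof -
    have "transpose_mat x' * transpose_mat x = 1\<^sub>m N"
      using transpose_mult[of x N N x' N] d by simp
    then have "\<Phi> * x = transpose_mat x' * transpose_mat x * (\<Phi> * x)" using c d by simp
    also have "\<dots> = transpose_mat x' * (transpose_mat x * \<Phi> * x)"
      using c d(1,2) by (simp add: assoc_mult_mat[of _ N N _ N _ N])
    finally show ?thesis using xi by simp
  qed
  have yadj: "transpose_mat y * \<Phi> = \<Phi> * y"
    unfolding y_def using c d(1,2) xadj x'adj
    by (simp add: transpose_add[of _ N N] add_mult_distrib_mat[of _ N N _ _ N] mult_add_distrib_mat[of _ N N _ N]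
      comm_add_mat[of _ N N])
  have FF: "F + F = 2 \<cdot>\<^sub>m F" using F by (auto intro!: eq_matI)
  have yF: "y * F = 2 \<cdot>\<^sub>m F" "F * y = 2 \<cdot>\<^sub>m F"
    unfolding y_def using F d(1,2) xF x'F Fx' FF
    by (simp_all add: add_mult_distrib_mat[of _ N N _ _ N] mult_add_distrib_mat[of _ N N _ N])
  \<comment> \<open>The value 2, by which \<open>y\<close> acts on \<open>F\<close>, is put among
    the roots so that the projection \<open>P\<close> annihilates \<open>F\<close>; on the image of
    \<open>P\<close> the form is then alternating.\<close>
  define S where "S = insert 2 {y $$ (i, i) |i. i < N \<and> y $$ (i, i) \<noteq> - 2}"
  have "finite S" "- 2 \<notin> S" by (auto simp: S_def)
  from spectral_poly[OF this, of N] obtain p where p: "poly p (- 2) = 1" "\<And>s. s \<in> S \<Longrightarrow> poly p s = 0"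
    and pid: "\<And>y. y \<in> UT N \<Longrightarrow> (\<And>i. i < N \<Longrightarrow> y $$ (i, i) = - 2 \<or> y $$ (i, i) \<in> S) \<Longrightarrow>
      mpe N p y * mpe N p y = mpe N p y" by blast
  define P where "P = mpe N p y"
  have PU: "P \<in> UT N" unfolding P_def by (rule mpe_UT(1)[OF yU])
  note Pc = UTc_carrier[OF PU]
  have PP: "P * P = P" unfolding P_def by (rule pid[OF yU]) (auto simp: S_def)
  have Psa: "transpose_mat P * \<Phi> = \<Phi> * P" unfolding P_def by (rule mpe_adjoint[OF yc yc c(1) yadj])
  have p2: "poly p 2 = 0" using p(2)[of 2] by (simp add: S_def)
  have zF: "0 \<cdot>\<^sub>m F = 0\<^sub>m N N" using F by (auto intro!: eq_matI)
  have PF: "P * F = 0\<^sub>m N N" "F * P = 0\<^sub>m N N"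
    unfolding P_def using mpe_right_eigen[OF yc F yF(1)] mpe_left_eigen[OF yc F yF(2)] p2 zF by simp_all
  have Pd: "P $$ (i, i) = (if x $$ (i, i) = - 1 then 1 else 0)" if i: "i < N" for i
  proof -
    have xi: "x $$ (i, i) * x' $$ (i, i) = 1" by (rule UT_inverse(2)[OF xU xx i])
    have yi: "y $$ (i, i) = x $$ (i, i) + x' $$ (i, i)" using d i by (simp add: y_def)
    have "y $$ (i, i) = - 2 \<longleftrightarrow> x $$ (i, i) = - 1"
    proof
      assume "y $$ (i, i) = - 2"
      then have "x $$ (i, i) * (- 2 - x $$ (i, i)) = 1" using xi yi by (metis add_diff_cancel_left')
      moreover have "(x $$ (i, i) + 1) ^ 2 = 1 - x $$ (i, i) * (- 2 - x $$ (i, i))"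
        by (simp add: power2_eq_square algebra_simps)
      ultimately have "(x $$ (i, i) + 1) ^ 2 = 0" by simp
      then show "x $$ (i, i) = - 1" by (simp add: add_eq_0_iff2)
    next
      assume x1: "x $$ (i, i) = - 1"
      then have "x' $$ (i, i) = - 1" using xi by (simp add: minus_equation_iff)
      then show "y $$ (i, i) = - 2" using yi x1 by simp
    qed
    moreover have "P $$ (i, i) = poly p (y $$ (i, i))" unfolding P_def by (rule mpe_UT(2)[OF yU i])
    moreover have "y $$ (i, i) \<noteq> - 2 \<Longrightarrow> y $$ (i, i) \<in> S" using i by (auto simp: S_def)
    ultimately show ?thesis using p by auto
  qed
  define E where "E = 1\<^sub>m N - F"
  have Ec: "E \<in> carrier_mat N N" using F by (simp add: E_def)
  have "E * P = P - 0\<^sub>m N N"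
    unfolding E_def using F Pc PF by (simp add: minus_mult_distrib_mat[of _ N N _ _ N] left_mult_one_mat[of _ N N])
  then have EP: "E * P = P" using Pc by (auto intro!: eq_matI)
  have Psk: "transpose_mat (\<Phi> * P) = - (\<Phi> * P)"
  proof -
    define K where "K = transpose_mat E * \<Phi> * E"
    have Kc: "K \<in> carrier_mat N N" using Ec c by (simp add: K_def)
    have Kt: "transpose_mat K = - K" using alt by (simp add: K_def E_def)
    have "\<Phi> * P = \<Phi> * P * P" using PP c Pc by (simp add: assoc_mult_mat[of _ N N _ N _ N])
    also have "\<dots> = transpose_mat P * \<Phi> * P" using Psa by simp
    also have "\<dots> = transpose_mat (E * P) * \<Phi> * (E * P)" using EP by simp
    also have "\<dots> = transpose_mat P * K * P"
      unfolding K_def using Ec c Pc by (simp add: transpose_mult[of _ N N _ N] assoc_mult_mat[of _ N N _ N _ N])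
    finally have e: "\<Phi> * P = transpose_mat P * K * P" .
    have "transpose_mat (transpose_mat P * K * P) = transpose_mat P * (transpose_mat K * P)"
      using Pc Kc by (simp add: transpose_mult[of _ N N _ N] assoc_mult_mat[of _ N N _ N _ N])
    also have "\<dots> = - (transpose_mat P * K * P)" unfolding Kt using Pc Kc by (simp add: assoc_mult_mat[of _ N N _ N _ N])
    finally show ?thesis using e by simp
  qed
  obtain A B where AB: "A \<in> UT N" "B \<in> UT N" "A * A = A" "B * B = B" "A * B = 0\<^sub>m N N" "B * A = 0\<^sub>m N N"
    "A + B = P" "transpose_mat A * \<Phi> = \<Phi> * B" "transpose_mat B * \<Phi> = \<Phi> * A"
    using isotropic_splitting[OF \<Phi> PU PP Psa Psk] by blast
  note ABc = UTc_carrier[OF AB(1)] UTc_carrier[OF AB(2)]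
  have ABP: "A * P = A" "P * A = A" "B * P = B" "P * B = B"
    unfolding AB(7)[symmetric] using ABc AB(3-6)
    by (simp_all add: add_mult_distrib_mat[of _ N N _ _ N] mult_add_distrib_mat[of _ N N _ N])
  \<comment> \<open>The torus acting by \<open>s\<close> on the image of \<open>A\<close>, by its
    inverse on that of \<open>B\<close> and trivially on the kernel of \<open>P\<close>; the
    adjointness of \<open>A\<close> and \<open>B\<close> makes it isometric.\<close>
  define C where "C s = (1\<^sub>m N - P) + (s \<cdot>\<^sub>m A + inverse s \<cdot>\<^sub>m B)" for s :: complex
  have Cc: "C s \<in> carrier_mat N N" for s using ABc Pc by (simp add: C_def)
  have CU: "C s \<in> UT N" for s unfolding C_def by (intro UT_add UT_diff UT_smult UT_one PU AB)
  have CC: "C (inverse s) * C s = 1\<^sub>m N" if "s \<noteq> 0" for s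
  proof -
    define Q where "Q = 1\<^sub>m N - P"
    have Qc: "Q \<in> carrier_mat N N" using Pc by (simp add: Q_def)
    have Q: "Q * Q = Q" "Q * A = 0\<^sub>m N N" "Q * B = 0\<^sub>m N N" "A * Q = 0\<^sub>m N N" "B * Q = 0\<^sub>m N N"
      unfolding Q_def using idempotent_diff(1)[of "1\<^sub>m N" N P] Pc PP ABc ABP
      by (simp_all add: minus_mult_distrib_mat[of _ N N _ _ N] mult_minus_distrib_mat[of _ N N _ N]
        left_mult_one_mat[of _ N N] right_mult_one_mat[of _ N N])
    have z: "t \<cdot>\<^sub>m 0\<^sub>m N N = (0\<^sub>m N N :: complex mat)" for t by simp
    have "C (inverse s) * C s = Q + ((s * inverse s) \<cdot>\<^sub>m A + (inverse s * s) \<cdot>\<^sub>m B)"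
      unfolding C_def Q_def[symmetric] using Qc ABc Q AB(3-6)
      by (simp add: add_mult_distrib_mat[of _ N N _ _ N] mult_add_distrib_mat[of _ N N _ N]
        mult_smult_assoc_mat[of _ N N _ N] mult_smult_distrib[of _ N N _ N] smult_smult_mat)
    also have "\<dots> = Q + (A + B)" using that ABc by (auto intro!: eq_matI simp: Q_def)
    also have "\<dots> = 1\<^sub>m N" unfolding AB(7) Q_def using Pc by (auto intro!: eq_matI)
    finally show ?thesis .
  qed
  have Cadj: "transpose_mat (C s) * \<Phi> = \<Phi> * C (inverse s)" for s
  proof -
    have "transpose_mat (C s) = 1\<^sub>m N - transpose_mat P + (s \<cdot>\<^sub>m transpose_mat A + inverse s \<cdot>\<^sub>m transpose_mat B)"
      unfolding C_def using Pc ABc by (auto intro!: eq_matI)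
    then show ?thesis unfolding C_def using c Pc ABc AB(8,9) Psa
      by (simp add: add_mult_distrib_mat[of _ N N _ _ N] mult_add_distrib_mat[of _ N N _ N]
        minus_mult_distrib_mat[of _ N N _ _ N] mult_minus_distrib_mat[of _ N N _ N]
        mult_smult_assoc_mat[of _ N N _ N] mult_smult_distrib[of _ N N _ N]
        left_mult_one_mat[of _ N N] right_mult_one_mat[of _ N N] comm_add_mat[of _ N N])
  qed
  have ABF: "A * F = 0\<^sub>m N N" "B * F = 0\<^sub>m N N" "F * A = 0\<^sub>m N N" "F * B = 0\<^sub>m N N"
  proof -
    have "A * P * F = A * (P * F)" "B * P * F = B * (P * F)" "F * (P * A) = F * P * A" "F * (P * B) = F * P * B"
      using ABc Pc F by (simp_all only: assoc_mult_mat[of _ N N _ N _ N])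
    then show "A * F = 0\<^sub>m N N" "B * F = 0\<^sub>m N N" "F * A = 0\<^sub>m N N" "F * B = 0\<^sub>m N N"
      unfolding ABP PF using ABc by simp_all
  qed
  have CK: "C s \<in> isom_UT N \<Phi> F" if s: "s \<noteq> 0" for s
  proof -
    have "transpose_mat (C s) * \<Phi> * C s = \<Phi> * (C (inverse s) * C s)"
      unfolding Cadj using c Cc by (simp add: assoc_mult_mat[of _ N N _ N _ N])
    moreover have "C s * F = F" "F * C s = F"
      unfolding C_def using F Pc ABc PF ABF
      by (simp_all add: add_mult_distrib_mat[of _ N N _ _ N] mult_add_distrib_mat[of _ N N _ N]
        minus_mult_distrib_mat[of _ N N _ _ N] mult_minus_distrib_mat[of _ N N _ N]
        mult_smult_assoc_mat[of _ N N _ N] mult_smult_distrib[of _ N N _ N]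
        left_mult_one_mat[of _ N N] right_mult_one_mat[of _ N N])
    ultimately show ?thesis using CC[OF s] c CU by (simp add: isom_UT_def)
  qed
  have C1: "C 1 = 1\<^sub>m N"
    unfolding C_def AB(7)[symmetric] using ABc by (auto intro!: eq_matI)
  have CxK: "C s * x \<in> isom_UT N \<Phi> F" if "s \<noteq> 0" for s
    by (rule isom_UT_mult[OF c(1) F CK[OF that] x])
  have "zlink N (isom_UT N \<Phi> F) (C 1 * x) (C 2 * x)"
  proof (rule zlink_path[of "- {0}"])
    show "connected (- {0 :: complex})" by (rule connected_cofinite) simp
    show "isom_UT N \<Phi> F \<subseteq> carrier_mat N N" using UTc_carrier by (auto simp: isom_UT_def)
    fix i j assume ij: "i < N" "j < N"
    have "continuous_on (- {0}) (\<lambda>s. \<Sum>l<N. ((1\<^sub>m N - P) $$ (i, l) + (s * A $$ (i, l) + inverse s * B $$ (i, l))) * x $$ (l, j))"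
      by (intro continuous_intros) auto
    then show "continuous_on (- {0}) (\<lambda>s. (C s * x) $$ (i, j))"
    proof (rule continuous_on_eq)
      fix s :: complex assume "s \<in> - {0}"
      show "(\<Sum>l<N. ((1\<^sub>m N - P) $$ (i, l) + (s * A $$ (i, l) + inverse s * B $$ (i, l))) * x $$ (l, j)) = (C s * x) $$ (i, j)"
        unfolding mult_entry[OF Cc xc ij] by (rule sum.cong) (use ij ABc Pc in \<open>auto simp: C_def\<close>)
    qed
  qed (use CxK in auto)
  then have 1: "zlink N (isom_UT N \<Phi> F) x (C 2 * x)" using C1 xc by simp
  have 2: "zlink N (isom_UT N \<Phi> F) (1\<^sub>m N) (C 2 * x)"
  \<comment> \<open>Multiplied by 2 or 1/2, a diagonal entry -1 of \<open>x\<close> becomes -2 or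
    -1/2, while the other diagonal entries are unchanged; so the Cayley path applies.\<close>
  proof (rule cayley_link[OF c(1) F CxK])
    fix i assume i: "i < N"
    have "(C 2 * x) $$ (i, i) = C 2 $$ (i, i) * x $$ (i, i)" by (rule UT_mult_diag[OF CU xU i])
    moreover have "C 2 $$ (i, i) = 1 - P $$ (i, i) + (2 * A $$ (i, i) + inverse 2 * B $$ (i, i))"
      using i Pc ABc by (simp add: C_def)
    moreover have "P $$ (i, i) = A $$ (i, i) + B $$ (i, i)" unfolding AB(7)[symmetric] using i ABc by simp
    moreover have "A $$ (i, i) = 0 \<or> A $$ (i, i) = 1" "B $$ (i, i) = 0 \<or> B $$ (i, i) = 1"
      using idempotent_UT_diag[OF AB(1,3) i] idempotent_UT_diag[OF AB(2,4) i] by auto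
    ultimately show "(C 2 * x) $$ (i, i) \<noteq> - 1"
      using Pd[OF i] by (auto split: if_splits)
  qed simp
  show ?thesis using zlink_trans[OF 2 zlink_sym[OF 1]] .
qed

section \<open>Isometry groups\<close>

definition isom_grp :: "nat \<Rightarrow> complex mat \<Rightarrow> complex mat \<Rightarrow> complex mat set" where
  "isom_grp N \<Omega> D = {x \<in> carrier_mat N N. transpose_mat x * \<Omega> * x = \<Omega> \<and> x * D = D \<and> D * x = D}"

text \<open>In the basis \<open>g\<close> both the form and \<open>D\<close> are transformed, and
  all hypotheses survive the change; this reduces an arbitrary flag to the standard one.\<close>

lemma isom_grp_link:
  assumes c: "\<Omega> \<in> carrier_mat N N" "D \<in> carrier_mat N N" and d: "det \<Omega> \<noteq> 0"
    and alt: "transpose_mat (transpose_mat (1\<^sub>m N - D) * \<Omega> * (1\<^sub>m N - D)) =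
      - (transpose_mat (1\<^sub>m N - D) * \<Omega> * (1\<^sub>m N - D))"
    and p: "inv_pair N g h" and x: "x \<in> isom_grp N \<Omega> D" and xU: "h * x * g \<in> UT N"
  shows "zlink N {x \<in> isom_grp N \<Omega> D. h * x * g \<in> UT N} (1\<^sub>m N) x"
proof -
  note gh = inv_pairD[OF p]
  have xc: "x \<in> carrier_mat N N" using x by (simp add: isom_grp_def)
  define \<Phi> F where "\<Phi> = transpose_mat g * \<Omega> * g" and "F = h * D * g"
  have Fc: "\<Phi> \<in> carrier_mat N N" "F \<in> carrier_mat N N" using gh c by (simp_all add: \<Phi>_def F_def)
  have tgh: "transpose_mat h * transpose_mat g = 1\<^sub>m N"
    using transpose_mult[of g N N h N] gh by simp
  have "det \<Phi> \<noteq> 0" unfolding \<Phi>_def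
    using gh c d inv_pair_det(2)[OF p] by (simp add: det_mult[of _ N] det_transpose[of _ N])
  from inv_pair_adj[OF Fc(1) this] obtain \<Psi> where \<Phi>: "inv_pair N \<Phi> \<Psi>" by blast
  define E where "E = 1\<^sub>m N - D"
  have Ec: "E \<in> carrier_mat N N" using c by (simp add: E_def)
  define K where "K = transpose_mat E * \<Omega> * E"
  have Kc: "K \<in> carrier_mat N N" using Ec c by (simp add: K_def)
  have Kt: "transpose_mat K = - K" using alt by (simp add: K_def E_def)
  have cancel: "transpose_mat h * (transpose_mat g * X) = X" if "X \<in> carrier_mat N N" for X
  proof -
    have "transpose_mat h * (transpose_mat g * X) = transpose_mat h * transpose_mat g * X"
      using gh that by (simp add: assoc_mult_mat[of _ N N _ N _ N])
    then show ?thesis using tgh that by simp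
  qed
  have F1: "1\<^sub>m N - F = h * E * g"
    unfolding F_def E_def using gh c
    by (simp add: minus_mult_distrib_mat[of _ N N _ _ N] mult_minus_distrib_mat[of _ N N _ N]
      right_mult_one_mat[of _ N N])
  have iso: "transpose_mat (h * y * g) * \<Phi> * (h * z * g) = transpose_mat g * (transpose_mat y * \<Omega> * z) * g"
    if "y \<in> carrier_mat N N" "z \<in> carrier_mat N N" for y z
    unfolding \<Phi>_def using gh(1,2) c that cancel inv_pair_cancel(1)[OF p, of _ N]
    by (simp add: transpose_mult[of _ N N _ N] assoc_mult_mat[of _ N N _ N _ N])
  have "transpose_mat (1\<^sub>m N - F) * \<Phi> * (1\<^sub>m N - F) = transpose_mat g * K * g"
    unfolding F1 K_def by (rule iso[OF Ec Ec])
  moreover have "transpose_mat (transpose_mat g * K * g) = transpose_mat g * (transpose_mat K * g)"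
    using gh Kc by (simp add: transpose_mult[of _ N N _ N] assoc_mult_mat[of _ N N _ N _ N])
  moreover have "transpose_mat g * (transpose_mat K * g) = - (transpose_mat g * K * g)"
    unfolding Kt using gh Kc by (simp add: assoc_mult_mat[of _ N N _ N _ N])
  ultimately have altF: "transpose_mat (transpose_mat (1\<^sub>m N - F) * \<Phi> * (1\<^sub>m N - F)) =
      - (transpose_mat (1\<^sub>m N - F) * \<Phi> * (1\<^sub>m N - F))" by simp
  have "h * x * g \<in> isom_UT N \<Phi> F"
    unfolding isom_UT_def
  proof (intro CollectI conjI xU)
    show "transpose_mat (h * x * g) * \<Phi> * (h * x * g) = \<Phi>"
      unfolding iso[OF xc xc] using x by (simp add: isom_grp_def \<Phi>_def)
    show "h * x * g * F = F" "F * (h * x * g) = F"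
      unfolding F_def using conj_mult[OF p xc c(2)] conj_mult[OF p c(2) xc] x by (simp_all add: isom_grp_def del: assoc_mult_mat)
  qed
  then have "zlink N (isom_UT N \<Phi> F) (1\<^sub>m N) (h * x * g)"
    by (rule isom_UT_link[OF \<Phi> Fc(2) altF])
  then have "zlink N {x \<in> isom_grp N \<Omega> D. h * x * g \<in> UT N} (g * 1\<^sub>m N * h) (g * (h * x * g) * h)"
  proof (rule zlink_image)
    show "isom_UT N \<Phi> F \<subseteq> carrier_mat N N" using UTc_carrier by (auto simp: isom_UT_def)
    show "regular_map N N (\<lambda>y. g * y * h)" by (rule conj_regular[OF inv_pair_sym[OF p]])
    show "(\<lambda>y. g * y * h) ` isom_UT N \<Phi> F \<subseteq> {x \<in> isom_grp N \<Omega> D. h * x * g \<in> UT N}"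
    proof
      fix z assume "z \<in> (\<lambda>y. g * y * h) ` isom_UT N \<Phi> F"
      then obtain y where y: "z = g * y * h" "y \<in> UT N" "transpose_mat y * \<Phi> * y = \<Phi>" "y * F = F" "F * y = F"
        by (auto simp: isom_UT_def)
      note yc = UTc_carrier[OF y(2)]
      have zc: "z \<in> carrier_mat N N" using y yc gh by simp
      have hz: "h * z * g = y" unfolding y(1) by (rule conj_conj[OF inv_pair_sym[OF p] yc])
      have "transpose_mat g * (transpose_mat z * \<Omega> * z) * g = transpose_mat g * \<Omega> * g"
        using iso[OF zc zc] y(3) unfolding hz by (simp add: \<Phi>_def)
      then have "transpose_mat h * (transpose_mat g * (transpose_mat z * \<Omega> * z) * g) * h
          = transpose_mat h * (transpose_mat g * \<Omega> * g) * h" by simp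
      then have "transpose_mat z * \<Omega> * z = \<Omega>"
        using gh zc c cancel by (simp add: assoc_mult_mat[of _ N N _ N _ N])
      moreover have DF: "D = g * F * h" unfolding F_def by (rule conj_conj[OF p c(2), symmetric])
      have "z * D = D" "D * z = D"
        unfolding DF y(1) using conj_mult[OF inv_pair_sym[OF p] yc Fc(2)] conj_mult[OF inv_pair_sym[OF p] Fc(2) yc] y(4,5)
        by (simp_all del: assoc_mult_mat)
      ultimately show "z \<in> {x \<in> isom_grp N \<Omega> D. h * x * g \<in> UT N}"
        using zc hz y(2) by (simp add: isom_grp_def del: assoc_mult_mat)
    qed
  qed
  then show ?thesis using gh conj_conj[OF p xc] by simp
qed

lemma mgroupI:
  assumes "X \<subseteq> SL N" "1\<^sub>m N \<in> X" "\<And>x y. x \<in> X \<Longrightarrow> y \<in> X \<Longrightarrow> x * y \<in> X"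
    "\<And>x. x \<in> X \<Longrightarrow> \<exists>y \<in> X. x * y = 1\<^sub>m N"
  shows "mgroup N X"
  unfolding mgroup_def
proof (intro conjI ballI assms)
  fix x assume x: "x \<in> X"
  obtain y where y: "y \<in> X" "x * y = 1\<^sub>m N" using assms(4)[OF x] by blast
  have "inv_pair N x (adj_mat x)" using x assms(1) by (intro adj_mat_inv_pair) blast
  then have "y = adj_mat x" using y assms(1) SL_carrier by (intro inv_pair_unique) auto
  then show "adj_mat x \<in> X" using y by simp
qed

text \<open>The determinant takes only the values 1 and -1, and each element, being triangular in
  some basis, is linked to 1. This yields determinant one for symplectic matrices without the
  Pfaffian.\<close>

lemma isom_grp_det:
  assumes c: "\<Omega> \<in> carrier_mat N N" "D \<in> carrier_mat N N" and d: "det \<Omega> \<noteq> 0"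
    and alt: "transpose_mat (transpose_mat (1\<^sub>m N - D) * \<Omega> * (1\<^sub>m N - D)) =
      - (transpose_mat (1\<^sub>m N - D) * \<Omega> * (1\<^sub>m N - D))"
    and x: "x \<in> isom_grp N \<Omega> D"
  shows "det x = 1"
proof -
  have xc: "x \<in> carrier_mat N N" using x by (simp add: isom_grp_def)
  obtain g h where gh: "inv_pair N g h" "h * x * g \<in> UT N" using exists_triangularization[OF xc] by blast
  have l: "zlink N (isom_grp N \<Omega> D) (1\<^sub>m N) x"
    using isom_grp_link[OF c d alt gh(1) x gh(2)] by (rule zlink_mono) auto
  have "det x = det (1\<^sub>m N)"
  proof (rule regular_fun_finite_const[OF l])
    show "isom_grp N \<Omega> D \<subseteq> carrier_mat N N" by (auto simp: isom_grp_def)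
    show "regular_fun N det" by (rule regular_fun_det[OF regular_map_id])
    show "finite {1, -1 :: complex}" by simp
    show "det ` isom_grp N \<Omega> D \<subseteq> {1, -1}"
    proof
      fix z assume "z \<in> det ` isom_grp N \<Omega> D"
      then obtain y where y: "z = det y" "y \<in> carrier_mat N N" "transpose_mat y * \<Omega> * y = \<Omega>"
        by (auto simp: isom_grp_def)
      have "det y * det \<Omega> * det y = det \<Omega>"
        using arg_cong[OF y(3), of det] y(2) c by (simp add: det_mult[of _ N] det_transpose[of _ N])
      then have "det y * det y = 1" using d by (simp add: algebra_simps)
      then show "z \<in> {1, -1}" using y(1) by (simp add: square_eq_1_iff)
    qed
  qed
  then show ?thesis by simp
qed

lemma isom_grp_parabolically_connected:
  assumes c: "\<Omega> \<in> carrier_mat N N" "D \<in> carrier_mat N N" and d: "det \<Omega> \<noteq> 0"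
    and alt: "transpose_mat (transpose_mat (1\<^sub>m N - D) * \<Omega> * (1\<^sub>m N - D)) =
      - (transpose_mat (1\<^sub>m N - D) * \<Omega> * (1\<^sub>m N - D))"
  shows "mgroup N (isom_grp N \<Omega> D)" "parabolically_connected N (SL N) (isom_grp N \<Omega> D)"
proof -
  show g: "mgroup N (isom_grp N \<Omega> D)"
  proof (rule mgroupI)
    show "isom_grp N \<Omega> D \<subseteq> SL N" using isom_grp_det[OF c d alt] by (auto simp: SL_def isom_grp_def)
    show "1\<^sub>m N \<in> isom_grp N \<Omega> D" using c by (simp add: isom_grp_def)
  next
    fix x y assume xy: "x \<in> isom_grp N \<Omega> D" "y \<in> isom_grp N \<Omega> D"
    then have k: "x \<in> carrier_mat N N" "y \<in> carrier_mat N N" by (auto simp: isom_grp_def)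
    have "transpose_mat (x * y) * \<Omega> * (x * y) = transpose_mat y * (transpose_mat x * \<Omega> * x) * y"
      using c k by (simp add: transpose_mult[of _ N N _ N] assoc_mult_mat[of _ N N _ N _ N])
    moreover have "x * y * D = x * (y * D)" "D * (x * y) = D * x * y"
      using c k by (simp_all add: assoc_mult_mat[of _ N N _ N _ N])
    ultimately show "x * y \<in> isom_grp N \<Omega> D" using xy k by (simp add: isom_grp_def del: assoc_mult_mat)
  next
    fix x assume x: "x \<in> isom_grp N \<Omega> D"
    then have xc: "x \<in> carrier_mat N N" by (simp add: isom_grp_def)
    have "x \<in> SL N" using isom_grp_det[OF c d alt x] xc by (simp add: SL_def)
    then have p: "inv_pair N x (adj_mat x)" by (rule adj_mat_inv_pair)
    define y where "y = adj_mat x"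
    note k = inv_pairD[OF p, folded y_def]
    have xe: "transpose_mat x * \<Omega> * x = \<Omega>" "x * D = D" "D * x = D" using x by (auto simp: isom_grp_def)
    have tt: "transpose_mat y * transpose_mat x = 1\<^sub>m N" using transpose_mult[of x N N y N] k by simp
    have "transpose_mat y * \<Omega> * y = transpose_mat y * (transpose_mat x * \<Omega> * x) * y" using xe by simp
    also have "\<dots> = (transpose_mat y * transpose_mat x) * \<Omega> * (x * y)"
      using c k(1,2) by (simp add: assoc_mult_mat[of _ N N _ N _ N])
    also have "\<dots> = \<Omega>" unfolding tt k(3) using c by simp
    finally have 1: "transpose_mat y * \<Omega> * y = \<Omega>" .
    have "y * D = y * (x * D)" "D * y = D * x * y" using xe by simp_all
    then have "y * D = D" "D * y = D"
      using inv_pair_cancel(2)[OF p c(2)] k c by (simp_all add: y_def assoc_mult_mat[of _ N N _ N _ N])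
    with 1 k show "\<exists>y \<in> isom_grp N \<Omega> D. x * y = 1\<^sub>m N" by (intro bexI[of _ y]) (simp_all add: isom_grp_def)
  qed
  have e1: "regular_map N N (\<lambda>x. transpose_mat x * \<Omega> * x)"
    by (intro regular_map_mult regular_map_const regular_map_id regular_map_transpose c)
  have e2: "regular_map N N (\<lambda>x. x * D)" by (intro regular_map_mult regular_map_const regular_map_id c)
  have e3: "regular_map N N (\<lambda>x. D * x)" by (intro regular_map_mult regular_map_const regular_map_id c)
  have "isom_grp N \<Omega> D = {x \<in> carrier_mat N N. transpose_mat x * \<Omega> * x = \<Omega>} \<inter>
      ({x \<in> carrier_mat N N. x * D = D} \<inter> {x \<in> carrier_mat N N. D * x = D})"
    by (auto simp: isom_grp_def)
  then have "zariski_closed N (isom_grp N \<Omega> D)"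
    using zariski_closed_mat_eq[OF e1 regular_map_const[OF c(1)]] zariski_closed_mat_eq[OF e2 regular_map_const[OF c(2)]]
      zariski_closed_mat_eq[OF e3 regular_map_const[OF c(2)]] by (simp add: zariski_closed_Int)
  with g have "closed_subgroup N (isom_grp N \<Omega> D) (SL N)" by (simp add: closed_subgroup_iff)
  then show "parabolically_connected N (SL N) (isom_grp N \<Omega> D)"
    by (rule parabolically_connectedI) (rule isom_grp_link[OF c d alt])
qed

section \<open>Block diagonal matrices\<close>

lemma blockdiag_carrier [simp]:
  "A \<in> carrier_mat m m \<Longrightarrow> B \<in> carrier_mat n n \<Longrightarrow> blockdiag A B \<in> carrier_mat (m + n) (m + n)"
  by (simp add: blockdiag_def)

lemma blockdiag_carrier_Suc [simp]:
  "A \<in> carrier_mat m m \<Longrightarrow> B \<in> carrier_mat (Suc 0) (Suc 0) \<Longrightarrow> blockdiag A B \<in> carrier_mat (Suc m) (Suc m)"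
  using blockdiag_carrier[of A m B 1] by simp

lemma blockdiag_index:
  assumes "A \<in> carrier_mat m m" "B \<in> carrier_mat n n" "i < m + n" "j < m + n"
  shows "blockdiag A B $$ (i, j) = (if i < m then if j < m then A $$ (i, j) else 0
    else if j < m then 0 else B $$ (i - m, j - m))"
  using assms by (auto simp: blockdiag_def)

lemma blockdiag_mult:
  assumes "A \<in> carrier_mat m m" "B \<in> carrier_mat n n" "C \<in> carrier_mat m m" "D \<in> carrier_mat n n"
  shows "blockdiag A B * blockdiag C D = blockdiag (A * C) (B * D)"
  using assms unfolding blockdiag_def
  by (simp add: mult_four_block_mat[of _ m m _ n _ n _ _ m _ n])

lemma blockdiag_transpose:
  assumes "A \<in> carrier_mat m m" "B \<in> carrier_mat n n"
  shows "transpose_mat (blockdiag A B) = blockdiag (transpose_mat A) (transpose_mat B)"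
  using assms unfolding blockdiag_def by (simp add: transpose_four_block_mat[of _ m m _ n _ n])

lemma blockdiag_det:
  assumes "A \<in> carrier_mat m m" "B \<in> carrier_mat n n"
  shows "det (blockdiag A B) = det A * det B"
  using assms unfolding blockdiag_def by (simp add: det_four_block_mat_lower_left_zero[of _ m _ n])

lemma blockdiag_one: "blockdiag (1\<^sub>m m) (1\<^sub>m n) = 1\<^sub>m (m + n)"
  by (auto simp: blockdiag_def intro!: eq_matI)

lemma blockdiag_inject:
  assumes "A \<in> carrier_mat m m" "B \<in> carrier_mat n n" "C \<in> carrier_mat m m" "D \<in> carrier_mat n n"
    and e: "blockdiag A B = blockdiag C D"
  shows "A = C" "B = D"
proof -
  have i: "blockdiag A B $$ (i, j) = blockdiag C D $$ (i, j)" for i j using e by simp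
  show "A = C"
  proof (rule eq_matI)
    fix i j assume "i < dim_row C" "j < dim_col C"
    then show "A $$ (i, j) = C $$ (i, j)" using i[of i j] assms(1-4) by (simp add: blockdiag_index)
  qed (use assms in auto)
  show "B = D"
  proof (rule eq_matI)
    fix a b assume "a < dim_row D" "b < dim_col D"
    then show "B $$ (a, b) = D $$ (a, b)" using i[of "a + m" "b + m"] assms(1-4) by (simp add: blockdiag_index)
  qed (use assms in auto)
qed

definition ul :: "nat \<Rightarrow> complex mat \<Rightarrow> complex mat" where
  "ul m x = mat m m (\<lambda>(i, j). x $$ (i, j))"

definition lr :: "nat \<Rightarrow> nat \<Rightarrow> complex mat \<Rightarrow> complex mat" where
  "lr m n x = mat n n (\<lambda>(i, j). x $$ (i + m, j + m))"

lemma ul_lr_dim [simp]: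
  "dim_row (ul m x) = m" "dim_col (ul m x) = m" "dim_row (lr m n x) = n" "dim_col (lr m n x) = n"
  by (simp_all add: ul_def lr_def)

lemma ul_lr_carrier [simp]: "ul m x \<in> carrier_mat m m" "lr m n x \<in> carrier_mat n n"
  by (simp_all add: ul_def lr_def)

lemma blockdiag_decompose:
  assumes x: "x \<in> carrier_mat (m + n) (m + n)"
    and z: "\<And>i j. i < m \<Longrightarrow> j < n \<Longrightarrow> x $$ (i, j + m) = 0 \<and> x $$ (j + m, i) = 0"
  shows "x = blockdiag (ul m x) (lr m n x)"
proof (rule eq_matI)
  fix i j assume "i < dim_row (blockdiag (ul m x) (lr m n x))" "j < dim_col (blockdiag (ul m x) (lr m n x))"
  then have ij: "i < m + n" "j < m + n" by (auto simp: blockdiag_def)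
  then show "x $$ (i, j) = blockdiag (ul m x) (lr m n x) $$ (i, j)"
    using z[of i "j - m"] z[of j "i - m"] by (auto simp: blockdiag_index[of _ m _ n] ul_def lr_def)
qed (use x in \<open>auto simp: blockdiag_def\<close>)

lemma ul_lr_blockdiag:
  assumes "A \<in> carrier_mat m m" "B \<in> carrier_mat n n"
  shows "ul m (blockdiag A B) = A" "lr m n (blockdiag A B) = B"
  using assms by (auto simp: ul_def lr_def blockdiag_index[of _ m _ n] intro!: eq_matI)

section \<open>Symplectic groups\<close>

lemma skew_nondegD:
  assumes "skew_nondeg N \<Omega>"
  shows "\<Omega> \<in> carrier_mat N N" "transpose_mat \<Omega> = - \<Omega>" "det \<Omega> \<noteq> 0"
  using assms by (auto simp: skew_nondeg_def)

lemma Sp_isom: "Sp N \<Omega> = isom_grp N \<Omega> (0\<^sub>m N N)"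
  by (auto simp: Sp_def isom_grp_def)

lemma Sp_alt:
  assumes "skew_nondeg N \<Omega>"
  shows "transpose_mat (transpose_mat (1\<^sub>m N - 0\<^sub>m N N) * \<Omega> * (1\<^sub>m N - 0\<^sub>m N N)) =
      - (transpose_mat (1\<^sub>m N - 0\<^sub>m N N) * \<Omega> * (1\<^sub>m N - 0\<^sub>m N N))"
proof -
  have "1\<^sub>m N - 0\<^sub>m N N = (1\<^sub>m N :: complex mat)" by (auto intro!: eq_matI)
  then show ?thesis using skew_nondegD[OF assms] by simp
qed

lemma Sp_parabolically_connected:
  assumes \<Omega>: "skew_nondeg N \<Omega>" shows "parabolically_connected N (SL N) (Sp N \<Omega>)" "mgroup N (Sp N \<Omega>)"
  unfolding Sp_isom
  using isom_grp_parabolically_connected[OF skew_nondegD(1)[OF \<Omega>] zero_carrier_mat skew_nondegD(3)[OF \<Omega>] Sp_alt[OF \<Omega>]]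
  by auto

lemma Sp_det: "skew_nondeg N \<Omega> \<Longrightarrow> A \<in> Sp N \<Omega> \<Longrightarrow> det A = 1"
  using mgroupD(2)[OF Sp_parabolically_connected(2)] by blast

text \<open>With the form extended by 1 on the last line and \<open>D\<close> the projection onto
  that line, the embedded group becomes an isometry group of a nondegenerate form that is
  alternating on the kernel of \<open>D\<close>.\<close>

lemma Sp_ext_isom:
  assumes \<Omega>: "skew_nondeg (2 * n) \<Omega>"
  shows "Sp_ext n \<Omega> = isom_grp (2 * n + 1) (blockdiag \<Omega> (1\<^sub>m 1)) (blockdiag (0\<^sub>m (2 * n) (2 * n)) (1\<^sub>m 1))"
    (is "_ = isom_grp ?N ?\<Omega> ?D")
proof -
  note o = skew_nondegD[OF \<Omega>]
  have k: "blockdiag A (1\<^sub>m 1) \<in> isom_grp ?N ?\<Omega> ?D \<longleftrightarrow> transpose_mat A * \<Omega> * A = \<Omega>" if A: "A \<in> carrier_mat (2 * n) (2 * n)" for A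
  proof -
    have "transpose_mat (blockdiag A (1\<^sub>m 1)) * ?\<Omega> * blockdiag A (1\<^sub>m 1) = blockdiag (transpose_mat A * \<Omega> * A) (1\<^sub>m 1)"
      using A o by (simp add: blockdiag_transpose[of _ "2 * n" _ 1] blockdiag_mult[of _ "2 * n" _ 1])
    moreover have "blockdiag A (1\<^sub>m 1) * ?D = ?D" "?D * blockdiag A (1\<^sub>m 1) = ?D"
      using A by (simp_all add: blockdiag_mult[of _ "2 * n" _ 1])
    moreover have "blockdiag (transpose_mat A * \<Omega> * A) (1\<^sub>m 1) = ?\<Omega> \<longleftrightarrow> transpose_mat A * \<Omega> * A = \<Omega>"
      using A o blockdiag_inject(1)[of "transpose_mat A * \<Omega> * A" "2 * n" "1\<^sub>m 1" 1 \<Omega> "1\<^sub>m 1"] by auto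
    ultimately show ?thesis using A by (simp add: isom_grp_def)
  qed
  show ?thesis
  proof (intro equalityI subsetI)
    fix x assume "x \<in> Sp_ext n \<Omega>"
    then show "x \<in> isom_grp ?N ?\<Omega> ?D" using k by (auto simp: Sp_ext_def Sp_def)
  next
    fix x assume x: "x \<in> isom_grp ?N ?\<Omega> ?D"
    then have xc: "x \<in> carrier_mat (2 * n + 1) (2 * n + 1)" and xD: "x * ?D = ?D" "?D * x = ?D" by (auto simp: isom_grp_def)
    have Dc: "?D \<in> carrier_mat (2 * n + 1) (2 * n + 1)" by simp
    have col: "x $$ (i, 2 * n) = ?D $$ (i, 2 * n)" if "i < 2 * n + 1" for i
    proof -
      have "(x * ?D) $$ (i, 2 * n) = (\<Sum>l<2 * n + 1. x $$ (i, l) * ?D $$ (l, 2 * n))"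
        by (rule mult_entry[OF xc Dc that]) simp
      also have "\<dots> = (\<Sum>l<2 * n + 1. if l = 2 * n then x $$ (i, l) else 0)"
        by (rule sum.cong) (auto simp: blockdiag_index[of _ "2 * n" _ 1])
      finally show ?thesis using xD by simp
    qed
    have row: "x $$ (2 * n, i) = ?D $$ (2 * n, i)" if "i < 2 * n + 1" for i
    proof -
      have "(?D * x) $$ (2 * n, i) = (\<Sum>l<2 * n + 1. ?D $$ (2 * n, l) * x $$ (l, i))"
        by (rule mult_entry[OF Dc xc _ that]) simp
      also have "\<dots> = (\<Sum>l<2 * n + 1. if l = 2 * n then x $$ (l, i) else 0)"
        by (rule sum.cong) (auto simp: blockdiag_index[of _ "2 * n" _ 1])
      finally show ?thesis using xD by simp
    qed
    have "x = blockdiag (ul (2 * n) x) (lr (2 * n) 1 x)"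
      by (rule blockdiag_decompose[OF xc]) (use col row in \<open>auto simp: blockdiag_index[of _ "2 * n" _ 1]\<close>)
    moreover have "lr (2 * n) 1 x = 1\<^sub>m 1"
      using col[of "2 * n"] by (auto simp: lr_def blockdiag_index[of _ "2 * n" _ 1] intro!: eq_matI)
    ultimately have xe: "x = blockdiag (ul (2 * n) x) (1\<^sub>m 1)" by simp
    then have "transpose_mat (ul (2 * n) x) * \<Omega> * ul (2 * n) x = \<Omega>" using k[of "ul (2 * n) x"] x by simp
    then have "ul (2 * n) x \<in> Sp (2 * n) \<Omega>" by (simp add: Sp_def)
    then show "x \<in> Sp_ext n \<Omega>" unfolding Sp_ext_def using xe by (intro CollectI exI[of _ "ul (2 * n) x"] conjI)
  qed
qed

lemma Sp_ext_parabolically_connected: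
  assumes \<Omega>: "skew_nondeg (2 * n) \<Omega>"
  shows "parabolically_connected (2 * n + 1) (SL (2 * n + 1)) (Sp_ext n \<Omega>)" "mgroup (2 * n + 1) (Sp_ext n \<Omega>)"
proof -
  note o = skew_nondegD[OF \<Omega>]
  let ?\<Omega> = "blockdiag \<Omega> (1\<^sub>m 1)" and ?D = "blockdiag (0\<^sub>m (2 * n) (2 * n)) (1\<^sub>m 1)"
  have E: "1\<^sub>m (2 * n + 1) - ?D = blockdiag (1\<^sub>m (2 * n)) (0\<^sub>m 1 1)"
    by (auto simp: blockdiag_def intro!: eq_matI)
  have "transpose_mat (1\<^sub>m (2 * n + 1) - ?D) * ?\<Omega> * (1\<^sub>m (2 * n + 1) - ?D) = blockdiag \<Omega> (0\<^sub>m 1 1)"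
    unfolding E using o by (simp add: blockdiag_transpose[of _ "2 * n" _ 1] blockdiag_mult[of _ "2 * n" _ 1])
  moreover have "transpose_mat (blockdiag \<Omega> (0\<^sub>m 1 1)) = - blockdiag \<Omega> (0\<^sub>m 1 1)"
    using o by (auto simp: blockdiag_transpose[of _ "2 * n" _ 1]) (auto simp: blockdiag_def intro!: eq_matI)
  ultimately have alt: "transpose_mat (transpose_mat (1\<^sub>m (2 * n + 1) - ?D) * ?\<Omega> * (1\<^sub>m (2 * n + 1) - ?D)) =
      - (transpose_mat (1\<^sub>m (2 * n + 1) - ?D) * ?\<Omega> * (1\<^sub>m (2 * n + 1) - ?D))" by simp
  have d: "det ?\<Omega> \<noteq> 0" using o by (simp add: blockdiag_det[of _ "2 * n" _ 1])
  have k: "?\<Omega> \<in> carrier_mat (2 * n + 1) (2 * n + 1)" "?D \<in> carrier_mat (2 * n + 1) (2 * n + 1)" using o by simp_all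
  show "parabolically_connected (2 * n + 1) (SL (2 * n + 1)) (Sp_ext n \<Omega>)"
    unfolding Sp_ext_isom[OF \<Omega>] by (rule isom_grp_parabolically_connected(2)[OF k d alt])
  show "mgroup (2 * n + 1) (Sp_ext n \<Omega>)"
    unfolding Sp_ext_isom[OF \<Omega>] by (rule isom_grp_parabolically_connected(1)[OF k d alt])
qed

section \<open>Triangular matrices commuting with an idempotent\<close>

text \<open>For \<open>x\<close> commuting with the idempotent \<open>E\<close> this is the determinant of \<open>x\<close> on the image of \<open>E\<close>.\<close>

definition detE :: "nat \<Rightarrow> complex mat \<Rightarrow> complex mat \<Rightarrow> complex" where
  "detE N E x = det (x * E + (1\<^sub>m N - E))"

lemma idem_compl:
  assumes "E \<in> carrier_mat N N" "E * E = (E :: complex mat)"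
  shows "(1\<^sub>m N - E) * (1\<^sub>m N - E) = 1\<^sub>m N - E" "E * (1\<^sub>m N - E) = 0\<^sub>m N N" "(1\<^sub>m N - E) * E = 0\<^sub>m N N"
    "1\<^sub>m N - (1\<^sub>m N - E) = E"
  using idempotent_diff[of "1\<^sub>m N" N E] assms
  by (auto simp: left_mult_one_mat[of _ N N] right_mult_one_mat[of _ N N] intro!: eq_matI)

lemma compl_commute:
  assumes "E \<in> carrier_mat N N" "x \<in> carrier_mat N N" "x * E = E * (x :: complex mat)"
  shows "x * (1\<^sub>m N - E) = (1\<^sub>m N - E) * x"
  using assms by (simp add: minus_mult_distrib_mat[of _ N N _ _ N] mult_minus_distrib_mat[of _ N N _ N]
    left_mult_one_mat[of _ N N] right_mult_one_mat[of _ N N])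

lemma commute_mult:
  assumes "E \<in> carrier_mat N N" "x \<in> carrier_mat N N" "y \<in> carrier_mat N N"
    "x * E = E * x" "y * E = E * (y :: complex mat)"
  shows "x * y * E = E * (x * y)"
proof -
  have "x * y * E = x * (y * E)" by (rule assoc_mult_mat[OF assms(2,3,1)])
  also have "\<dots> = x * E * y" unfolding assms(5) by (rule assoc_mult_mat[OF assms(2,1,3), symmetric])
  also have "\<dots> = E * (x * y)" unfolding assms(4) by (rule assoc_mult_mat[OF assms(1,2,3)])
  finally show ?thesis .
qed

lemma detE_mult:
  assumes E: "E \<in> carrier_mat N N" "E * E = E" and x: "x \<in> carrier_mat N N" and y: "y \<in> carrier_mat N N" "y * E = E * y"
  shows "detE N E (x * y) = detE N E x * detE N E y"
proof -
  note ic = idem_compl[OF E]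
  define Q where "Q = 1\<^sub>m N - E"
  have Q: "Q \<in> carrier_mat N N" "Q * Q = Q" "E * Q = 0\<^sub>m N N" "Q * E = 0\<^sub>m N N" using E ic by (auto simp: Q_def)
  have "x * E * (y * E) = x * y * E"
  proof -
    have "x * E * (y * E) = x * (E * y) * E" using E(1) x y(1) by (simp add: assoc_mult_mat[of _ N N _ N _ N])
    also have "\<dots> = x * y * (E * E)" unfolding y(2)[symmetric] using E(1) x y(1) by (simp add: assoc_mult_mat[of _ N N _ N _ N])
    finally show ?thesis using E by simp
  qed
  moreover have "x * E * Q = 0\<^sub>m N N" using E x Q by (simp add: assoc_mult_mat[of _ N N _ N _ N])
  moreover have "Q * (y * E) = 0\<^sub>m N N"
  proof -
    have "Q * (y * E) = Q * E * y" unfolding y(2) by (rule assoc_mult_mat[OF Q(1) E(1) y(1), symmetric])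
    then show ?thesis using Q y by simp
  qed
  ultimately have "(x * E + Q) * (y * E + Q) = x * y * E + Q"
    using E x y Q by (simp add: add_mult_distrib_mat[of _ N N _ _ N] mult_add_distrib_mat[of _ N N _ N] del: assoc_mult_mat)
  then have "detE N E (x * y) = det ((x * E + Q) * (y * E + Q))" by (simp add: detE_def Q_def del: assoc_mult_mat)
  also have "\<dots> = det (x * E + Q) * det (y * E + Q)" using E x y Q by (intro det_mult) auto
  finally show ?thesis by (simp add: detE_def Q_def)
qed

text \<open>\<open>x\<close> is the product of its parts on the image and on the kernel of
  \<open>E\<close>, each extended by the identity.\<close>

lemma detE_compl:
  assumes E: "E \<in> carrier_mat N N" "E * E = E" and x: "x \<in> carrier_mat N N" "x * E = E * x"
  shows "detE N E x * detE N (1\<^sub>m N - E) x = det x"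
proof -
  define Q where "Q = 1\<^sub>m N - E"
  have Q: "Q \<in> carrier_mat N N" "Q * Q = Q" "E * Q = 0\<^sub>m N N" "Q * E = 0\<^sub>m N N" using E idem_compl[OF E] by (auto simp: Q_def)
  have xQ: "x * Q = Q * x" unfolding Q_def by (rule compl_commute[OF E(1) x])
  have "x * E * (x * Q) = 0\<^sub>m N N"
  proof -
    have "x * E * (x * Q) = x * (E * Q) * x" unfolding xQ using E(1) x(1) Q(1) by (simp add: assoc_mult_mat[of _ N N _ N _ N])
    then show ?thesis using Q x by simp
  qed
  moreover have "x * E * E = x * E" using assoc_mult_mat[OF x(1) E(1) E(1)] E(2) by metis
  moreover have "Q * (x * Q) = x * Q"
  proof -
    have "Q * (x * Q) = Q * x * Q" by (rule assoc_mult_mat[OF Q(1) x(1) Q(1), symmetric])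
    also have "\<dots> = x * Q * Q" by (simp only: xQ)
    also have "\<dots> = x * (Q * Q)" by (rule assoc_mult_mat[OF x(1) Q(1) Q(1)])
    finally show ?thesis using Q by simp
  qed
  ultimately have "(x * E + Q) * (x * Q + E) = x * E + x * Q"
    using E x Q by (simp add: add_mult_distrib_mat[of _ N N _ _ N] mult_add_distrib_mat[of _ N N _ N] comm_add_mat[of _ N N]
      del: assoc_mult_mat)
  also have "\<dots> = x" unfolding Q_def using E x
    by (auto simp: mult_minus_distrib_mat[of _ N N _ N] right_mult_one_mat[of _ N N] intro!: eq_matI simp del: index_mult_mat(1))
  finally have "det x = det (x * E + Q) * det (x * Q + E)" using E x Q det_mult[of "x * E + Q" N "x * Q + E"] by simp
  then show ?thesis using idem_compl(4)[OF E] by (simp add: detE_def Q_def)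
qed

text \<open>The matrix determinant lemma: moving \<open>v\<close> to the first unit vector makes the
  matrix triangular with a single nontrivial diagonal entry.\<close>

lemma det_one_plus_outer:
  assumes v: "v \<in> carrier_vec N" "v \<noteq> 0\<^sub>v N" and f: "f \<in> carrier_vec N"
  shows "det (1\<^sub>m N + c \<cdot>\<^sub>m outer N v f) = 1 + c * (f \<bullet> v)"
proof -
  obtain i where i: "i < N" "v $ i \<noteq> 0" using v by (metis carrier_vecD eq_vecI index_zero_vec(1,2))
  obtain q q' where q: "inv_pair N q q'" "col q 0 = v"
    using exists_column_change[OF v(1), of 0 i] i by blast
  note d = inv_pairD[OF q(1)]
  have N: "N > 0" using i by simp
  have "v = q *\<^sub>v unit_vec N 0" using d N q(2) by (intro eq_vecI) auto
  then have q'v: "q' *\<^sub>v v = unit_vec N 0" using inv_pair_cancel_vec(2)[OF q(1), of "unit_vec N 0"] by simp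
  define r where "r = transpose_mat q *\<^sub>v f"
  have r: "r \<in> carrier_vec N" using mult_mat_vec_carrier[of "transpose_mat q" N N f] d f by (simp add: r_def)
  have "q' * (1\<^sub>m N + c \<cdot>\<^sub>m outer N v f) * q = 1\<^sub>m N + c \<cdot>\<^sub>m outer N (unit_vec N 0) r"
  proof -
    have "q' * (1\<^sub>m N + c \<cdot>\<^sub>m outer N v f) * q = q' * q + c \<cdot>\<^sub>m (q' * outer N v f * q)"
      using d(1,2) by (simp add: add_mult_distrib_mat[of _ N N _ _ N] mult_add_distrib_mat[of _ N N _ N]
        mult_smult_assoc_mat[of _ N N _ N] mult_smult_distrib[of _ N N _ N] left_mult_one_mat[of _ N N] right_mult_one_mat[of _ N N])
    also have "q' * outer N v f * q = outer N (unit_vec N 0) r"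
      using d v f q'v by (simp add: mult_outer outer_mult r_def)
    finally show ?thesis using d by simp
  qed
  then have "det (1\<^sub>m N + c \<cdot>\<^sub>m outer N v f) = det (1\<^sub>m N + c \<cdot>\<^sub>m outer N (unit_vec N 0) r)" (is "_ = det ?M")
    using det_conj[OF q(1), of "1\<^sub>m N + c \<cdot>\<^sub>m outer N v f"] by simp
  also have MU: "?M \<in> UT N" by (auto simp: UTc_def outer_def unit_vec_def)
  have "det ?M = (\<Prod>i<N. if i = 0 then 1 + c * r $ 0 else 1)"
    unfolding UT_det[OF MU] by (rule prod.cong) (auto simp: outer_def unit_vec_def)
  also have "\<dots> = 1 + c * r $ 0" using N by (simp add: prod.If_cases)
  also have "r $ 0 = f \<bullet> v"
  proof -
    have "r $ 0 = col q 0 \<bullet> f" using d N by (simp add: r_def)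
    then show ?thesis using q(2) v f by (simp add: comm_scalar_prod[of _ N])
  qed
  finally show ?thesis .
qed

section \<open>Subspaces, functionals and the position of an idempotent relative to the standard
  flag\<close>

definition lin_sub :: "nat \<Rightarrow> complex vec set \<Rightarrow> bool" where
  "lin_sub N S \<longleftrightarrow> S \<subseteq> carrier_vec N \<and> 0\<^sub>v N \<in> S \<and> (\<forall>u\<in>S. \<forall>v\<in>S. u + v \<in> S) \<and> (\<forall>c. \<forall>u\<in>S. c \<cdot>\<^sub>v u \<in> S)"

text \<open>For \<open>j \<le> N\<close>, the step of dimension \<open>j\<close> in the standard
  flag.\<close>

definition coord_sub :: "nat \<Rightarrow> nat \<Rightarrow> complex vec set" where
  "coord_sub N j = {f \<in> carrier_vec N. \<forall>i. j \<le> i \<longrightarrow> i < N \<longrightarrow> f $ i = 0}"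

lemma lin_subD:
  assumes "lin_sub N S"
  shows "u \<in> S \<Longrightarrow> u \<in> carrier_vec N" "0\<^sub>v N \<in> S" "u \<in> S \<Longrightarrow> v \<in> S \<Longrightarrow> u + v \<in> S" "u \<in> S \<Longrightarrow> c \<cdot>\<^sub>v u \<in> S"
  using assms by (auto simp: lin_sub_def)

lemma lin_sub_coord: "lin_sub N (coord_sub N j)"
  by (auto simp: lin_sub_def coord_sub_def)

lemma lin_sub_fix:
  assumes A: "A \<in> carrier_mat N N" shows "lin_sub N {w \<in> carrier_vec N. A *\<^sub>v w = w}"
  using mult_zero_vec[OF A] A unfolding lin_sub_def
  by (auto simp: mult_add_distrib_mat_vec[of _ N N] mult_mat_vec[of _ N N])

lemma lin_sub_image:
  assumes A: "A \<in> carrier_mat N N" and S: "lin_sub N S" shows "lin_sub N ((*\<^sub>v) A ` S)"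
  unfolding lin_sub_def
proof (intro conjI ballI allI)
  note d = lin_subD[OF S]
  show "(*\<^sub>v) A ` S \<subseteq> carrier_vec N" using A d(1) by (auto intro!: mult_mat_vec_carrier)
  show "0\<^sub>v N \<in> (*\<^sub>v) A ` S" using d(2) mult_zero_vec[OF A] by (intro image_eqI[of _ _ "0\<^sub>v N"]) auto
  fix u v assume "u \<in> (*\<^sub>v) A ` S" "v \<in> (*\<^sub>v) A ` S"
  then obtain x y where "u = A *\<^sub>v x" "x \<in> S" "v = A *\<^sub>v y" "y \<in> S" by blast
  then show "u + v \<in> (*\<^sub>v) A ` S"
    using A d by (intro image_eqI[of _ _ "x + y"]) (auto simp: mult_add_distrib_mat_vec[of _ N N])
next
  note d = lin_subD[OF S]
  fix c u assume "u \<in> (*\<^sub>v) A ` S"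
  then obtain x where "u = A *\<^sub>v x" "x \<in> S" by blast
  then show "c \<cdot>\<^sub>v u \<in> (*\<^sub>v) A ` S"
    using A d by (intro image_eqI[of _ _ "c \<cdot>\<^sub>v x"]) (auto simp: mult_mat_vec[of _ N N])
qed

lemma lin_sub_sum:
  assumes S: "lin_sub N S" and T: "lin_sub N T" shows "lin_sub N {u + v |u v. u \<in> S \<and> v \<in> T}"
  unfolding lin_sub_def
proof (intro conjI ballI allI)
  note d = lin_subD[OF S] lin_subD[OF T]
  show "{u + v |u v. u \<in> S \<and> v \<in> T} \<subseteq> carrier_vec N" using d by auto
  have "0\<^sub>v N = 0\<^sub>v N + (0\<^sub>v N :: complex vec)" by simp
  then show "0\<^sub>v N \<in> {u + v |u v. u \<in> S \<and> v \<in> T}" using d(2,6) by blast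
  fix x y assume "x \<in> {u + v |u v. u \<in> S \<and> v \<in> T}" "y \<in> {u + v |u v. u \<in> S \<and> v \<in> T}"
  then obtain u v u' v' where k: "x = u + v" "u \<in> S" "v \<in> T" "y = u' + v'" "u' \<in> S" "v' \<in> T" by blast
  then have "u \<in> carrier_vec N" "v \<in> carrier_vec N" "u' \<in> carrier_vec N" "v' \<in> carrier_vec N" using d(1,5) by blast+
  then have "x + y = (u + u') + (v + v')" unfolding k by (intro eq_vecI) auto
  then show "x + y \<in> {u + v |u v. u \<in> S \<and> v \<in> T}" using d(3,7) k by blast
next
  note d = lin_subD[OF S] lin_subD[OF T]
  fix c x assume "x \<in> {u + v |u v. u \<in> S \<and> v \<in> T}"
  then obtain u v where k: "x = u + v" "u \<in> S" "v \<in> T" by blast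
  then have "u \<in> carrier_vec N" "v \<in> carrier_vec N" using d(1,5) by blast+
  then have "c \<cdot>\<^sub>v x = c \<cdot>\<^sub>v u + c \<cdot>\<^sub>v v" unfolding k by (rule smult_add_distrib_vec)
  then show "c \<cdot>\<^sub>v x \<in> {u + v |u v. u \<in> S \<and> v \<in> T}" using d(4,8) k by blast
qed

text \<open>In a basis adapted to \<open>M\<close>, a coordinate beyond the first \<open>r\<close>
  that is nonzero at \<open>v\<close> serves as functional after scaling.\<close>

lemma separating_functional:
  assumes M: "lin_sub N M" and v: "v \<in> carrier_vec N" "v \<notin> M"
  obtains f where "f \<in> carrier_vec N" "f \<bullet> v = 1" "\<And>u. u \<in> M \<Longrightarrow> f \<bullet> u = 0"
proof -
  note d = lin_subD[OF M]
  obtain g h r where p: "inv_pair N g h" and Mr: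
    "\<And>v. v \<in> carrier_vec N \<Longrightarrow> v \<in> M \<longleftrightarrow> (\<forall>i. r \<le> i \<longrightarrow> i < N \<longrightarrow> (h *\<^sub>v v) $ i = 0)"
    using adapted_basis[of M N] d by (metis subsetI)
  note d' = inv_pairD[OF p]
  obtain i where i: "r \<le> i" "i < N" "(h *\<^sub>v v) $ i \<noteq> 0" using Mr[OF v(1)] v(2) by blast
  define f where "f = inverse ((h *\<^sub>v v) $ i) \<cdot>\<^sub>v row h i"
  have f: "f \<in> carrier_vec N" using d' i by (simp add: f_def)
  have fu: "f \<bullet> u = inverse ((h *\<^sub>v v) $ i) * (h *\<^sub>v u) $ i" if "u \<in> carrier_vec N" for u
    unfolding f_def using d' i that by simp
  show ?thesis
  proof (rule that[OF f])
    show "f \<bullet> v = 1" using fu[OF v(1)] i by (simp del: index_mult_mat_vec)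
    fix u assume u: "u \<in> M"
    then show "f \<bullet> u = 0" using fu[OF d(1)[OF u]] Mr[OF d(1)[OF u]] i by (simp del: index_mult_mat_vec)
  qed
qed

text \<open>For idempotent \<open>E\<close>, the positions at which the intersection of the image of
  \<open>E\<close> with the standard flag grows; \<open>j\<close> refers to the step from
  \<open>coord_sub N j\<close> to \<open>coord_sub N (Suc j)\<close>.\<close>

definition jumps :: "nat \<Rightarrow> complex mat \<Rightarrow> nat set" where
  "jumps N E = {j. j < N \<and> (\<exists>v \<in> carrier_vec N. E *\<^sub>v v = v \<and> v $ j \<noteq> 0 \<and> (\<forall>i. j < i \<longrightarrow> i < N \<longrightarrow> v $ i = 0))}"

lemma exists_level:
  assumes "v \<in> carrier_vec N" "v \<noteq> (0\<^sub>v N :: complex vec)"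
  shows "\<exists>j<N. v $ j \<noteq> 0 \<and> (\<forall>i. j < i \<longrightarrow> i < N \<longrightarrow> v $ i = 0)"
proof -
  define S where "S = {j. j < N \<and> v $ j \<noteq> 0}"
  have fin: "finite S" by (simp add: S_def)
  have "\<exists>j<N. v $ j \<noteq> 0"
  proof (rule ccontr)
    assume "\<not> ?thesis"
    then have "v = 0\<^sub>v N" using assms(1) by (intro eq_vecI) auto
    then show False using assms(2) by simp
  qed
  then have "S \<noteq> {}" by (auto simp: S_def)
  then have "Max S \<in> S" using fin by (rule Max_in[rotated])
  moreover have "v $ i = 0" if "Max S < i" "i < N" for i
  proof (rule ccontr)
    assume "v $ i \<noteq> 0"
    then have "i \<in> S" using that by (simp add: S_def)
    then show False using Max_ge[OF fin, of i] that by simp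
  qed
  ultimately show ?thesis unfolding S_def by blast
qed

lemma jumps_nonempty:
  assumes E: "E \<in> carrier_mat N N" "E * E = E" "E \<noteq> 0\<^sub>m N N"
  shows "jumps N E \<noteq> {}"
proof -
  have "\<exists>j<N. col E j \<noteq> 0\<^sub>v N"
  proof (rule ccontr)
    assume "\<not> ?thesis"
    then have "E $$ (a, b) = 0" if "a < N" "b < N" for a b using that index_col[of a E b] E(1) by simp
    then show False using E by (auto intro!: eq_matI)
  qed
  then obtain j where j: "j < N" "col E j \<noteq> 0\<^sub>v N" by blast
  have "E *\<^sub>v col E j = col E j" using col_mult2[OF E(1) E(1) j(1)] E(2) by simp
  moreover have "col E j \<in> carrier_vec N" using E j by simp
  ultimately show ?thesis using exists_level[of "col E j" N] j unfolding jumps_def by blast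
qed

text \<open>For idempotent \<open>e\<close> the family \<open>1 + (s - 1) e\<close> is a
  one-dimensional torus. Recorded are its compatibility with the flag and with \<open>E\<close>, and
  its weights on the determinants of the image and the kernel of \<open>E\<close>.\<close>

definition torus_type :: "nat \<Rightarrow> complex mat \<Rightarrow> complex mat \<Rightarrow> nat \<Rightarrow> nat \<Rightarrow> bool" where
  "torus_type N E e a b \<longleftrightarrow> e \<in> UT N \<and> e * E = E * e \<and>
     (\<forall>s. detE N E (1\<^sub>m N + (s - 1) \<cdot>\<^sub>m e) = s ^ a \<and> detE N (1\<^sub>m N - E) (1\<^sub>m N + (s - 1) \<cdot>\<^sub>m e) = s ^ b)"

lemma detE_torus:
  assumes E: "E \<in> carrier_mat N N" and e: "e \<in> carrier_mat N N"
  shows "detE N E (1\<^sub>m N + c \<cdot>\<^sub>m e) = det (1\<^sub>m N + c \<cdot>\<^sub>m (e * E))"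
proof -
  have "(1\<^sub>m N + c \<cdot>\<^sub>m e) * E + (1\<^sub>m N - E) = 1\<^sub>m N + c \<cdot>\<^sub>m (e * E)"
    using E e by (auto simp: add_mult_distrib_mat[of _ N N _ _ N] mult_smult_assoc_mat[of _ N N _ N]
      left_mult_one_mat[of _ N N] intro!: eq_matI simp del: index_mult_mat(1))
  then show ?thesis by (simp add: detE_def)
qed

text \<open>Choose \<open>v\<close> of level \<open>j\<close> in the image of \<open>E\<close>. It
  lies outside the sum of the kernel of \<open>E\<close> and \<open>coord_sub N j\<close>, since
  otherwise \<open>j\<close> would be a jump of the kernel. A functional \<open>f\<close> separating
  it from this sum makes \<open>v f^T\<close> triangular and commuting with
  \<open>E\<close>.\<close>

lemma torus_single:
  assumes E: "E \<in> carrier_mat N N" "E * E = E" and j: "j \<in> jumps N E" "j \<notin> jumps N (1\<^sub>m N - E)"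
  shows "\<exists>e. torus_type N E e 1 0"
proof -
  obtain v where v: "v \<in> carrier_vec N" "E *\<^sub>v v = v" "v $ j \<noteq> 0" "\<And>i. j < i \<Longrightarrow> i < N \<Longrightarrow> v $ i = 0" and jN: "j < N"
    using j(1) by (auto simp: jumps_def)
  have v0: "v \<noteq> 0\<^sub>v N" using v(3) jN by auto
  define Q where "Q = 1\<^sub>m N - E"
  have Q: "Q \<in> carrier_mat N N" "Q * Q = Q" "E * Q = 0\<^sub>m N N" "Q * E = 0\<^sub>m N N" using E idem_compl[OF E] by (auto simp: Q_def)
  have Qv: "Q *\<^sub>v u = u - E *\<^sub>v u" if "u \<in> carrier_vec N" for u
    unfolding Q_def using E that by (simp add: minus_mult_distrib_mat_vec[of _ N N])
  define W where "W = {w \<in> carrier_vec N. Q *\<^sub>v w = w}"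
  define M where "M = {w + f |w f. w \<in> W \<and> f \<in> coord_sub N j}"
  have lW: "lin_sub N W" unfolding W_def by (rule lin_sub_fix[OF Q(1)])
  have lM: "lin_sub N M" unfolding M_def by (rule lin_sub_sum[OF lW lin_sub_coord])
  have vM: "v \<notin> M"
  proof
    assume "v \<in> M"
    then obtain w f where w: "v = w + f" "w \<in> carrier_vec N" "Q *\<^sub>v w = w" "f \<in> carrier_vec N"
      "\<And>i. j \<le> i \<Longrightarrow> i < N \<Longrightarrow> f $ i = 0" unfolding M_def W_def coord_sub_def by auto
    have "w $ i = v $ i" if "j \<le> i" "i < N" for i using w that by simp
    then have "j \<in> jumps N Q" using w v jN unfolding jumps_def by (intro CollectI conjI bexI[of _ w]) auto
    then show False using j(2) by (simp add: Q_def)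
  qed
  have WM: "w \<in> M" if "w \<in> W" for w
  proof -
    have "w = w + 0\<^sub>v N" using lin_subD(1)[OF lW that] by simp
    then show ?thesis unfolding M_def using that lin_subD(2)[OF lin_sub_coord] by blast
  qed
  have CM: "u \<in> M" if "u \<in> coord_sub N j" for u
  proof -
    have "u = 0\<^sub>v N + u" using lin_subD(1)[OF lin_sub_coord that] by simp
    then show ?thesis unfolding M_def using that lin_subD(2)[OF lW] by blast
  qed
  obtain f where f: "f \<in> carrier_vec N" "f \<bullet> v = 1" "\<And>u. u \<in> M \<Longrightarrow> f \<bullet> u = 0"
    using separating_functional[OF lM v(1) vM] by blast
  have fQ: "f \<bullet> (Q *\<^sub>v u) = 0" if "u \<in> carrier_vec N" for u
  proof (intro f(3) WM)
    have "Q *\<^sub>v (Q *\<^sub>v u) = Q * Q *\<^sub>v u" using Q(1) that by (intro assoc_mult_mat_vec[symmetric]) auto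
    then show "Q *\<^sub>v u \<in> W" unfolding W_def using Q that by (auto intro!: mult_mat_vec_carrier)
  qed
  have fk: "f $ k = 0" if "k < j" for k
  proof -
    have "unit_vec N k \<in> coord_sub N j" using that jN by (auto simp: coord_sub_def)
    then have "f \<bullet> unit_vec N k = 0" using f(3) CM by blast
    then show ?thesis using f(1) that jN by simp
  qed
  have tE: "transpose_mat E *\<^sub>v f = f"
  proof (rule eq_vecI)
    fix i assume "i < dim_vec f"
    then have i: "i < N" using f by simp
    have "f \<bullet> (Q *\<^sub>v unit_vec N i) = 0" using fQ by simp
    moreover have "Q *\<^sub>v unit_vec N i = unit_vec N i - col E i" using Qv[of "unit_vec N i"] E i
      by (auto intro!: eq_vecI)
    moreover have "f \<bullet> (unit_vec N i - col E i) = f $ i - f \<bullet> col E i"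
      using f i E by (simp add: scalar_prod_minus_distrib[of _ N])
    moreover have "(transpose_mat E *\<^sub>v f) $ i = f \<bullet> col E i"
      using E i f by (simp add: comm_scalar_prod[of _ N])
    ultimately show "(transpose_mat E *\<^sub>v f) $ i = f $ i" by simp
  qed (use E f in auto)
  define e where "e = outer N v f"
  have ec: "e \<in> carrier_mat N N" by (simp add: e_def)
  have "v $ a * f $ k = 0" if "k < a" "a < N" for a k
    using v(4)[of a] fk[of k] that by (cases "j < a") auto
  then have eU: "e \<in> UT N" by (auto simp: e_def outer_def UTc_def)
  have eE: "e * E = e" "E * e = e" unfolding e_def using E f v tE by (simp_all add: outer_mult mult_outer)
  have eQ: "e * Q = 0\<^sub>m N N"
    unfolding Q_def using ec E eE by (simp add: mult_minus_distrib_mat[of _ N N _ N] right_mult_one_mat[of _ N N])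
  have "detE N E (1\<^sub>m N + (s - 1) \<cdot>\<^sub>m e) = s" for s
  proof -
    have "det (1\<^sub>m N + (s - 1) \<cdot>\<^sub>m e) = s"
      unfolding e_def det_one_plus_outer[OF v(1) v0 f(1)] f(2) by simp
    then show ?thesis using detE_torus[OF E(1) ec, of "s - 1"] eE(1) by simp
  qed
  moreover have "detE N Q (1\<^sub>m N + (s - 1) \<cdot>\<^sub>m e) = 1" for s
    unfolding detE_torus[OF Q(1) ec] eQ by simp
  ultimately show ?thesis using eU eE unfolding torus_type_def Q_def by (intro exI[of _ e]) simp
qed

text \<open>If \<open>b\<close> is a jump of both \<open>im E\<close> and \<open>ker E\<close>, choose \<open>v\<close> and \<open>w\<close> of level \<open>b\<close> in
  the two spaces with \<open>v + w\<close> as low in the flag as possible; minimality is what makes the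
  projection onto the span of \<open>v\<close> and \<open>w\<close> triangular.\<close>

lemma torus_pair:
  assumes E: "E \<in> carrier_mat N N" "E * E = E" and b: "b \<in> jumps N E" "b \<in> jumps N (1\<^sub>m N - E)"
  shows "\<exists>e. torus_type N E e 1 1"
proof -
  define Q where "Q = 1\<^sub>m N - E"
  have Q: "Q \<in> carrier_mat N N" "Q * Q = Q" "E * Q = 0\<^sub>m N N" "Q * E = 0\<^sub>m N N" using E idem_compl[OF E] by (auto simp: Q_def)
  have Qv: "Q *\<^sub>v u = u - E *\<^sub>v u" if "u \<in> carrier_vec N" for u
    unfolding Q_def using E that by (simp add: minus_mult_distrib_mat_vec[of _ N N])
  have QE: "E *\<^sub>v u = 0\<^sub>v N" if "u \<in> carrier_vec N" "Q *\<^sub>v u = u" for u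
  proof -
    have "E *\<^sub>v u = E *\<^sub>v (Q *\<^sub>v u)" using that by simp
    also have "\<dots> = E * Q *\<^sub>v u" using E Q that by (intro assoc_mult_mat_vec[symmetric]) auto
    finally show ?thesis using Q that by (auto intro!: eq_vecI)
  qed
  have EQ0: "Q *\<^sub>v u = 0\<^sub>v N" if "u \<in> carrier_vec N" "E *\<^sub>v u = u" for u
    using Qv[OF that(1)] that by (auto intro!: eq_vecI)
  \<comment> \<open>The number \<open>a\<close> measures how far the sum of the two vectors has
    dropped in the flag; the value \<open>b\<close> is attained by scaling \<open>w0\<close> so that
    the leading coordinates cancel.\<close>
  define good where "good a v w \<longleftrightarrow> v \<in> carrier_vec N \<and> w \<in> carrier_vec N \<and> E *\<^sub>v v = v \<and> Q *\<^sub>v w = w \<and>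
    v $ b \<noteq> 0 \<and> (\<forall>i. b < i \<longrightarrow> i < N \<longrightarrow> v $ i = 0 \<and> w $ i = 0) \<and> v + w \<in> coord_sub N a" for a v w
  obtain v0 where v0: "v0 \<in> carrier_vec N" "E *\<^sub>v v0 = v0" "v0 $ b \<noteq> 0" "\<And>i. b < i \<Longrightarrow> i < N \<Longrightarrow> v0 $ i = 0" and bN: "b < N"
    using b(1) by (auto simp: jumps_def)
  obtain w0 where w0: "w0 \<in> carrier_vec N" "Q *\<^sub>v w0 = w0" "w0 $ b \<noteq> 0" "\<And>i. b < i \<Longrightarrow> i < N \<Longrightarrow> w0 $ i = 0"
    using b(2) by (auto simp: jumps_def Q_def)
  have "good b v0 ((- (v0 $ b) / w0 $ b) \<cdot>\<^sub>v w0)"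
  proof -
    have "(v0 + (- (v0 $ b) / w0 $ b) \<cdot>\<^sub>v w0) $ i = 0" if "b \<le> i" "i < N" for i
      using v0 w0 that by (cases "i = b") auto
    moreover have "Q *\<^sub>v ((- (v0 $ b) / w0 $ b) \<cdot>\<^sub>v w0) = (- (v0 $ b) / w0 $ b) \<cdot>\<^sub>v w0"
      using mult_mat_vec[OF Q(1) w0(1)] w0(2) by simp
    moreover have "((- (v0 $ b) / w0 $ b) \<cdot>\<^sub>v w0) $ i = 0" if "b < i" "i < N" for i using w0(1,4) that by simp
    ultimately show ?thesis unfolding good_def coord_sub_def using v0 w0(1)
      by (intro conjI CollectI allI impI) (assumption | simp del: index_smult_vec index_add_vec)+
  qed
  then have ex: "\<exists>a v w. good a v w" by blast
  define a where "a = (LEAST a. \<exists>v w. good a v w)"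
  have "\<exists>v w. good a v w" unfolding a_def using ex by (rule LeastI_ex)
  then obtain v w where "good a v w" by blast
  then have v: "v \<in> carrier_vec N" "E *\<^sub>v v = v" "v $ b \<noteq> 0" "\<And>i. b < i \<Longrightarrow> i < N \<Longrightarrow> v $ i = 0"
    and w: "w \<in> carrier_vec N" "Q *\<^sub>v w = w" "\<And>i. b < i \<Longrightarrow> i < N \<Longrightarrow> w $ i = 0"
    and vw: "\<And>i. a \<le> i \<Longrightarrow> i < N \<Longrightarrow> v $ i + w $ i = 0"
    by (auto simp: good_def coord_sub_def)
  have amin: "a \<le> a'" if "good a' v' w'" for a' v' w'
    unfolding a_def by (rule Least_le) (use that in blast)
  have ab: "a \<le> b" using amin[OF \<open>good b v0 ((- (v0 $ b) / w0 $ b) \<cdot>\<^sub>v w0)\<close>] .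
  have v0': "v \<noteq> 0\<^sub>v N" using v(3) bN by auto
  have Ew: "E *\<^sub>v w = 0\<^sub>v N" by (rule QE[OF w(1,2)])
  have Qv0: "Q *\<^sub>v v = 0\<^sub>v N" by (rule EQ0[OF v(1,2)])
  have a0: "a > 0"
  proof (rule ccontr)
    assume "\<not> a > 0"
    then have "v + w = 0\<^sub>v N" using vw v(1) w(1) by (auto intro!: eq_vecI)
    moreover have "E *\<^sub>v (v + w) = v + 0\<^sub>v N" using E v w Ew by (simp add: mult_add_distrib_mat_vec[of _ N N])
    ultimately show False using v0' v(1) mult_zero_vec[OF E(1)] by simp
  qed
  \<comment> \<open>The functional has to vanish on the flag below \<open>b\<close> and, composed
    with \<open>E\<close>, on the flag below \<open>a - 1\<close>. If \<open>v\<close> lay in this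
    subspace, splitting the vector \<open>f'\<close> by \<open>E\<close> and \<open>Q\<close> would
    give a good pair for \<open>a - 1\<close>.\<close>
  define M where "M = {x + y |x y. x \<in> coord_sub N b \<and> y \<in> (*\<^sub>v) E ` coord_sub N (a - 1)}"
  have lI: "lin_sub N ((*\<^sub>v) E ` coord_sub N (a - 1))" by (rule lin_sub_image[OF E(1) lin_sub_coord])
  have lM: "lin_sub N M" unfolding M_def by (rule lin_sub_sum[OF lin_sub_coord lI])
  have CM: "u \<in> M" if "u \<in> coord_sub N b" for u
  proof -
    have "u = u + 0\<^sub>v N" using lin_subD(1)[OF lin_sub_coord that] by simp
    then show ?thesis unfolding M_def using that lin_subD(2)[OF lI] by blast
  qed
  have EM: "E *\<^sub>v u \<in> M" if "u \<in> coord_sub N (a - 1)" for u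
  proof -
    have "E *\<^sub>v u = 0\<^sub>v N + E *\<^sub>v u"
      using lin_subD(1)[OF lin_sub_coord that] E by (simp add: mult_mat_vec_carrier[of _ N N])
    then show ?thesis unfolding M_def using that lin_subD(2)[OF lin_sub_coord] by blast
  qed
  have vM: "v \<notin> M"
  proof
    assume "v \<in> M"
    then obtain f f' where f: "v = f + E *\<^sub>v f'" "f \<in> coord_sub N b" "f' \<in> coord_sub N (a - 1)" unfolding M_def by blast
    have fc: "f \<in> carrier_vec N" "f' \<in> carrier_vec N" using f(2,3) by (auto simp: coord_sub_def)
    have fz: "\<And>i. b \<le> i \<Longrightarrow> i < N \<Longrightarrow> f $ i = 0" "\<And>i. a - 1 \<le> i \<Longrightarrow> i < N \<Longrightarrow> f' $ i = 0"
      using f(2,3) by (auto simp: coord_sub_def)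
    define v' where "v' = E *\<^sub>v f'"
    define w' where "w' = Q *\<^sub>v f'"
    have c': "v' \<in> carrier_vec N" "w' \<in> carrier_vec N"
      unfolding v'_def w'_def using E Q fc by (auto intro!: mult_mat_vec_carrier)
    have "E *\<^sub>v v' = E * E *\<^sub>v f'" "Q *\<^sub>v w' = Q * Q *\<^sub>v f'"
      unfolding v'_def w'_def using E(1) Q(1) fc by (auto intro!: assoc_mult_mat_vec[symmetric])
    then have r: "E *\<^sub>v v' = v'" "Q *\<^sub>v w' = w'" using E Q by (simp_all add: v'_def w'_def)
    have v'i: "v' $ i = v $ i" if "b \<le> i" "i < N" for i
      using f(1) fz(1)[OF that] that c' fc by (simp add: v'_def[symmetric])
    have s: "v' $ i + w' $ i = f' $ i" if "i < N" for i
    proof -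
      have "w' $ i = f' $ i - v' $ i" unfolding w'_def v'_def Qv[OF fc(2)] using that fc E by simp
      then show ?thesis by simp
    qed
    have "good (a - 1) v' w'"
      unfolding good_def coord_sub_def
    proof (intro conjI CollectI allI impI)
      show "v' $ b \<noteq> 0" using v'i[of b] bN v(3) by simp
      show "v' + w' \<in> carrier_vec N" using c' by simp
      fix i assume i: "b < i" "i < N"
      show "v' $ i = 0" using v'i[of i] i v(4) by simp
      then show "w' $ i = 0" using s[of i] fz(2)[of i] i ab by simp
    next
      fix i assume "a - 1 \<le> i" "i < N"
      then show "(v' + w') $ i = 0" using s fz(2) c' by simp
    qed (use c' r in auto)
    from amin[OF this] show False using a0 by simp
  qed
  obtain t where t: "t \<in> carrier_vec N" "t \<bullet> v = 1" "\<And>u. u \<in> M \<Longrightarrow> t \<bullet> u = 0"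
    using separating_functional[OF lM v(1) vM] by blast
  \<comment> \<open>This and \<open>k\<close> are the parts of \<open>t\<close> on the image and the
    kernel of \<open>E\<close>, with the sign that gives \<open>k\<close> the value 1 on
    \<open>w\<close>. Their difference is \<open>t\<close>, so they agree in positions below
    \<open>b\<close>.\<close>
  define f where "f = transpose_mat E *\<^sub>v t"
  define k where "k = - (transpose_mat Q *\<^sub>v t)"
  have tc: "transpose_mat E \<in> carrier_mat N N" "transpose_mat Q \<in> carrier_mat N N" using E Q by auto
  have fc: "f \<in> carrier_vec N" "k \<in> carrier_vec N"
    unfolding f_def k_def using tc t(1) by (auto intro!: mult_mat_vec_carrier uminus_carrier_vec[THEN iffD2])
  have f: "f \<bullet> u = t \<bullet> (E *\<^sub>v u)" if "u \<in> carrier_vec N" for u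
    unfolding f_def by (rule transpose_vec_mult_scalar[OF E(1) that t(1)])
  have k: "k \<bullet> u = - (t \<bullet> (Q *\<^sub>v u))" if "u \<in> carrier_vec N" for u
    unfolding k_def using transpose_vec_mult_scalar[OF Q(1) that t(1)] tc t(1) that by simp
  have "t \<bullet> (v + w) = 0"
  proof (intro t(3) CM)
    show "v + w \<in> coord_sub N b" using v(1) w(1) vw ab by (auto simp: coord_sub_def)
  qed
  then have tw: "t \<bullet> w = - 1"
    using t(1,2) v(1) w(1) by (simp add: scalar_prod_add_distrib[of _ N] add_eq_0_iff)
  have sc: "f \<bullet> v = 1" "f \<bullet> w = 0" "k \<bullet> v = 0" "k \<bullet> w = 1"
    using f[OF v(1)] f[OF w(1)] k[OF v(1)] k[OF w(1)] v(2) w(2) Ew Qv0 t(1,2) tw by simp_all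
  have fl: "f $ l - k $ l = t $ l" if "l < N" for l
  proof -
    have u: "unit_vec N l \<in> carrier_vec N" by simp
    have "f $ l = t \<bullet> (E *\<^sub>v unit_vec N l)" using f[OF u] fc that by simp
    moreover have "k $ l = - (t \<bullet> (unit_vec N l - E *\<^sub>v unit_vec N l))" using k[OF u] Qv[OF u] fc that by simp
    moreover have "t \<bullet> (unit_vec N l - E *\<^sub>v unit_vec N l) = t \<bullet> unit_vec N l - t \<bullet> (E *\<^sub>v unit_vec N l)"
      using t(1) E by (intro scalar_prod_minus_distrib[of _ N]) (auto intro!: mult_mat_vec_carrier)
    ultimately show ?thesis using t(1) that by simp
  qed
  have tl: "t $ l = 0" if "l < b" for l
  proof -
    have "unit_vec N l \<in> coord_sub N b" using that bN by (auto simp: coord_sub_def)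
    then have "t \<bullet> unit_vec N l = 0" using t(3) CM by blast
    then show ?thesis using t(1) that bN by simp
  qed
  have fla: "f $ l = 0" if "l < a - 1" for l
  proof -
    have l: "l < N" using that ab bN by simp
    have "unit_vec N l \<in> coord_sub N (a - 1)" using that l by (auto simp: coord_sub_def)
    then have "t \<bullet> (E *\<^sub>v unit_vec N l) = 0" using t(3) EM by blast
    then show ?thesis using f[of "unit_vec N l"] fc l by simp
  qed
  define e where "e = outer N v f + outer N w k"
  have ec: "e \<in> carrier_mat N N" by (simp add: e_def)
  have eU: "e \<in> UT N"
  proof -
    \<comment> \<open>Three ranges of rows: beyond \<open>b\<close> both vectors vanish; from
      \<open>a\<close> to \<open>b\<close> the functionals agree to the left of the diagonal and
      \<open>v + w\<close> vanishes; before \<open>a\<close> the functionals vanish to the left of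
      the diagonal.\<close>
    have "v $ i * f $ l + w $ i * k $ l = 0" if il: "l < i" "i < N" for i l
    proof (cases "b < i")
      case True
      then show ?thesis using v(4) w(3) il by simp
    next
      case False
      then have kl: "k $ l = f $ l" using fl[of l] tl[of l] il by simp
      show ?thesis
      proof (cases "a \<le> i")
        case True
        have "v $ i * f $ l + w $ i * k $ l = (v $ i + w $ i) * f $ l" unfolding kl by (simp add: algebra_simps)
        then show ?thesis using vw[OF True il(2)] by simp
      next
        case False
        then have "f $ l = 0" using fla[of l] il by simp
        then show ?thesis using kl by simp
      qed
    qed
    then show ?thesis by (auto simp: e_def outer_def UTc_def)
  qed
  have tEf: "transpose_mat E *\<^sub>v f = f"
  proof -
    have "transpose_mat E *\<^sub>v f = transpose_mat (E * E) *\<^sub>v t"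
      unfolding f_def using E(1) tc t(1) by (simp add: transpose_mult[of _ N N _ N] assoc_mult_mat_vec[of _ N N _ N])
    then show ?thesis using E by (simp add: f_def)
  qed
  have tEk: "transpose_mat E *\<^sub>v k = 0\<^sub>v N"
  proof (rule eq_vecI)
    fix i assume "i < dim_vec (0\<^sub>v N :: complex vec)"
    then have i: "i < N" by simp
    have Ei: "E *\<^sub>v unit_vec N i \<in> carrier_vec N" using E by (auto intro!: mult_mat_vec_carrier)
    have "E *\<^sub>v (E *\<^sub>v unit_vec N i) = E * E *\<^sub>v unit_vec N i" using E(1) by (intro assoc_mult_mat_vec[symmetric]) auto
    then have "Q *\<^sub>v (E *\<^sub>v unit_vec N i) = 0\<^sub>v N" using EQ0[OF Ei] E by simp
    then have "k \<bullet> (E *\<^sub>v unit_vec N i) = 0" using k[OF Ei] t(1) by simp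
    moreover have "(transpose_mat E *\<^sub>v k) \<bullet> unit_vec N i = k \<bullet> (E *\<^sub>v unit_vec N i)"
      by (rule transpose_vec_mult_scalar[OF E(1) _ fc(2)]) simp
    moreover have "transpose_mat E *\<^sub>v k \<in> carrier_vec N" using tc fc by (auto intro!: mult_mat_vec_carrier)
    ultimately show "(transpose_mat E *\<^sub>v k) $ i = 0\<^sub>v N $ i" using i by (simp del: index_mult_mat_vec)
  qed (use E in simp)
  have z: "outer N w (0\<^sub>v N) = 0\<^sub>m N N" "outer N (0\<^sub>v N) k = 0\<^sub>m N N" by (auto simp: outer_def intro!: eq_matI)
  have eE: "e * E = outer N v f" "E * e = outer N v f"
    unfolding e_def using E fc v w tEf tEk Ew z
    by (simp_all add: add_mult_distrib_mat[of _ N N _ _ N] mult_add_distrib_mat[of _ N N _ N] outer_mult mult_outer)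
  have eQ: "e * Q = outer N w k"
  proof -
    have "e * Q = e - outer N v f"
      unfolding Q_def using E ec eE by (simp add: mult_minus_distrib_mat[of _ N N _ N] right_mult_one_mat[of _ N N])
    also have "\<dots> = outer N w k" unfolding e_def by (auto simp: outer_def intro!: eq_matI)
    finally show ?thesis .
  qed
  have w0': "w \<noteq> 0\<^sub>v N" using sc(4) fc by auto
  have "detE N E (1\<^sub>m N + (s - 1) \<cdot>\<^sub>m e) = s" for s
    using detE_torus[OF E(1) ec, of "s - 1"] det_one_plus_outer[OF v(1) v0' fc(1), of "s - 1"] eE(1) sc by simp
  moreover have "detE N Q (1\<^sub>m N + (s - 1) \<cdot>\<^sub>m e) = s" for s
    using detE_torus[OF Q(1) ec, of "s - 1"] det_one_plus_outer[OF w(1) w0' fc(2), of "s - 1"] eQ sc by simp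
  ultimately show ?thesis using eU eE unfolding torus_type_def Q_def by (intro exI[of _ e]) simp
qed

text \<open>Rows outside \<open>J\<close> are diagonal, so a permutation with nonzero term fixes
  every index outside \<open>J\<close> and maps \<open>J\<close> to itself; by triangularity there
  it never decreases an index, so it is the identity.\<close>

lemma det_quasi_triangular:
  assumes Y: "Y \<in> carrier_mat N N"
    and 1: "\<And>i j. i < N \<Longrightarrow> j < N \<Longrightarrow> i \<notin> J \<Longrightarrow> j \<noteq> i \<Longrightarrow> Y $$ (i, j) = 0"
    and 2: "\<And>i j. i < N \<Longrightarrow> j < i \<Longrightarrow> i \<in> J \<Longrightarrow> j \<in> J \<Longrightarrow> Y $$ (i, j) = (0 :: complex)"
  shows "det Y = (\<Prod>i<N. Y $$ (i, i))"
proof -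
  let ?t = "\<lambda>p. signof p * (\<Prod>i=0..<N. Y $$ (i, p i))"
  have z: "?t p = 0" if p: "p permutes {0..<N}" "p \<noteq> id" for p
  proof (rule ccontr)
    assume "?t p \<noteq> 0"
    then have nz: "Y $$ (i, p i) \<noteq> 0" if "i < N" for i using that by auto
    have pN: "p i < N" if "i < N" for i using permutes_in_image[OF p(1), of i] that by simp
    have fixd: "p i = i" if "i < N" "i \<notin> J" for i using 1[OF that(1) pN[OF that(1)] that(2)] nz[OF that(1)] by blast
    have "p i \<ge> i" if i: "i < N" for i
    proof (cases "i \<in> J")
      case True
      have "p i \<in> J"
      proof (rule ccontr)
        assume "p i \<notin> J"
        then have "p (p i) = p i" using fixd pN i by blast
        then have "p i = i" using permutes_inj[OF p(1)] by (auto dest: injD)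
        then show False using True \<open>p i \<notin> J\<close> by simp
      qed
      then show ?thesis using 2[OF i _ True, of "p i"] nz[OF i] by (meson not_le)
    qed (use fixd i in simp)
    then have "p = id" using permutes_natset_ge[OF p(1)] by auto
    then show False using p by simp
  qed
  have "det Y = (\<Sum>p | p permutes {0..<N}. ?t p)" by (rule det_def'[OF Y])
  also have "\<dots> = (\<Sum>p\<in>{id}. ?t p)"
    by (rule sum.mono_neutral_right) (use z in \<open>auto simp: finite_permutations permutes_id\<close>)
  finally show ?thesis by (simp add: atLeast0LessThan)
qed

text \<open>Take as basis one vector of the image of \<open>E\<close> for each jump and unit vectors
  elsewhere. There \<open>x\<close>, replaced by the identity on the kernel of \<open>E\<close>, is
  triangular on the jumps and has rows of the identity off them. Equal jump sets thus force equal
  determinants on image and kernel.\<close>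

lemma detE_jumps:
  assumes E: "E \<in> carrier_mat N N" "E * E = E" and x: "x \<in> UT N" "x * E = E * x"
  shows "detE N E x = (\<Prod>j\<in>jumps N E. x $$ (j, j))"
proof -
  note xc = UTc_carrier[OF x(1)]
  have "\<forall>j \<in> jumps N E. \<exists>v \<in> carrier_vec N. E *\<^sub>v v = v \<and> v $ j \<noteq> 0 \<and> (\<forall>i. j < i \<longrightarrow> i < N \<longrightarrow> v $ i = 0)"
    by (auto simp: jumps_def)
  then obtain u where u: "\<And>j. j \<in> jumps N E \<Longrightarrow> u j \<in> carrier_vec N \<and> E *\<^sub>v u j = u j \<and> u j $ j \<noteq> 0 \<and>
      (\<forall>i. j < i \<longrightarrow> i < N \<longrightarrow> u j $ i = 0)" by metis
  have JN: "j < N" if "j \<in> jumps N E" for j using that by (simp add: jumps_def)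
  define g where "g = mat N N (\<lambda>(i, j). if j \<in> jumps N E then u j $ i else if i = j then 1 else 0)"
  have gc: "g \<in> carrier_mat N N" by (simp add: g_def)
  have gU: "g \<in> UT N" using u by (auto simp: UTc_def g_def)
  have "det g \<noteq> 0" unfolding UT_det[OF gU] using u by (auto simp: g_def)
  from inv_pair_adj[OF gc this] obtain h where p: "inv_pair N g h" by blast
  note d = inv_pairD[OF p]
  have hU: "h \<in> UT N" by (rule UT_inverse(1)[OF gU p])
  have gcol: "col g j = u j" if "j \<in> jumps N E" for j
    using u[OF that] JN[OF that] that by (intro eq_vecI) (auto simp: g_def)
  have gcol': "col g j = unit_vec N j" if "j \<notin> jumps N E" "j < N" for j
    using that by (intro eq_vecI) (auto simp: g_def unit_vec_def)
  \<comment> \<open>A vector of the image of \<open>E\<close> has no component along the added unit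
    vectors: that component would itself lie in the image of \<open>E\<close>, and its level would
    be a jump.\<close>
  have low: "(h *\<^sub>v y) $ i = 0" if y: "y \<in> carrier_vec N" "E *\<^sub>v y = y" and i: "i < N" "i \<notin> jumps N E" for y i
  proof (rule ccontr)
    assume nz: "(h *\<^sub>v y) $ i \<noteq> 0"
    define c where "c = h *\<^sub>v y"
    have c: "c \<in> carrier_vec N" using d y by (auto simp: c_def intro!: mult_mat_vec_carrier)
    define c1 where "c1 = vec N (\<lambda>i. if i \<in> jumps N E then c $ i else 0)"
    define c2 where "c2 = vec N (\<lambda>i. if i \<in> jumps N E then 0 else c $ i)"
    have cc: "c1 \<in> carrier_vec N" "c2 \<in> carrier_vec N" "c = c1 + c2" using c by (auto simp: c1_def c2_def intro!: eq_vecI)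
    have gc2: "g *\<^sub>v c2 = c2"
    proof (rule eq_vecI)
      fix i assume "i < dim_vec c2"
      then have i: "i < N" using cc by simp
      have "(g *\<^sub>v c2) $ i = (\<Sum>l<N. g $$ (i, l) * c2 $ l)" by (rule mult_vec_entry[OF gc cc(2) i])
      also have "\<dots> = (\<Sum>l<N. if l = i then c2 $ i else 0)"
        by (rule sum.cong) (use i in \<open>auto simp: g_def c2_def\<close>)
      finally show "(g *\<^sub>v c2) $ i = c2 $ i" using i by simp
    qed (use gc cc in simp)
    have Egc1: "E *\<^sub>v (g *\<^sub>v c1) = g *\<^sub>v c1"
    proof (rule eq_vecI)
      fix i assume "i < dim_vec (g *\<^sub>v c1)"
      then have i: "i < N" using gc by simp
      have Egl: "(E * g) $$ (i, l) = g $$ (i, l)" if "l \<in> jumps N E" for l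
      proof -
        have "col (E * g) l = E *\<^sub>v col g l" using E gc JN[OF that] by (intro col_mult2[of _ N N _ N]) auto
        also have "\<dots> = col g l" using gcol[OF that] u[OF that] by simp
        finally have "col (E * g) l $ i = col g l $ i" by simp
        then show ?thesis using i JN[OF that] E gc index_col[of i "E * g" l] by (simp del: index_mult_mat(1))
      qed
      have "(E *\<^sub>v (g *\<^sub>v c1)) $ i = (E * g *\<^sub>v c1) $ i" using E gc cc by (simp add: assoc_mult_mat_vec[of _ N N _ N])
      also have "\<dots> = (\<Sum>l<N. (E * g) $$ (i, l) * c1 $ l)" using E gc cc i by (intro mult_vec_entry[of _ N N]) auto
      also have "\<dots> = (\<Sum>l<N. g $$ (i, l) * c1 $ l)"
        by (rule sum.cong) (use Egl in \<open>auto simp: c1_def simp del: index_mult_mat(1)\<close>)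
      also have "\<dots> = (g *\<^sub>v c1) $ i" by (rule mult_vec_entry[OF gc cc(1) i, symmetric])
      finally show "(E *\<^sub>v (g *\<^sub>v c1)) $ i = (g *\<^sub>v c1) $ i" .
    qed (use E gc in simp)
    have g1: "g *\<^sub>v c1 \<in> carrier_vec N" using gc cc by (auto intro!: mult_mat_vec_carrier)
    have "y = g *\<^sub>v c" using inv_pair_cancel_vec(1)[OF p y(1)] by (simp add: c_def)
    also have "\<dots> = g *\<^sub>v c1 + c2" unfolding cc(3) using gc cc(1,2) gc2 by (simp add: mult_add_distrib_mat_vec[of _ N N])
    finally have yy: "y = g *\<^sub>v c1 + c2" .
    have "g *\<^sub>v c1 + E *\<^sub>v c2 = g *\<^sub>v c1 + c2"
      using y(2) unfolding yy using E g1 cc Egc1 by (simp add: mult_add_distrib_mat_vec[of _ N N])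
    then have eq: "(g *\<^sub>v c1 + E *\<^sub>v c2) $ i = (g *\<^sub>v c1 + c2) $ i" for i by simp
    have Ec2c: "E *\<^sub>v c2 \<in> carrier_vec N" using E(1) cc(2) by (rule mult_mat_vec_carrier)
    have Ec2: "E *\<^sub>v c2 = c2"
    proof (rule eq_vecI)
      fix i assume "i < dim_vec c2"
      then show "(E *\<^sub>v c2) $ i = c2 $ i" using eq[of i] E(1) gc cc(1,2) by (simp del: index_mult_mat_vec)
    qed (use carrier_vecD[OF Ec2c] carrier_vecD[OF cc(2)] in simp)
    have "c2 $ i \<noteq> 0" using nz i by (simp add: c2_def c_def)
    then have "c2 \<noteq> 0\<^sub>v N" using i by auto
    then obtain j where j: "j < N" "c2 $ j \<noteq> 0" "\<forall>i. j < i \<longrightarrow> i < N \<longrightarrow> c2 $ i = 0" using exists_level[OF cc(2)] by blast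
    then have "j \<in> jumps N E" unfolding jumps_def using cc(2) Ec2 by blast
    then show False using j by (simp add: c2_def)
  qed
  define y where "y = x * E + (1\<^sub>m N - E)"
  have yc: "y \<in> carrier_mat N N" using xc E by (simp add: y_def)
  define Y where "Y = h * y * g"
  have Yc: "Y \<in> carrier_mat N N" using d yc by (simp add: Y_def)
  have Ycol: "col Y j = h *\<^sub>v (y *\<^sub>v col g j)" if "j < N" for j
  proof -
    have "col Y j = (h * y) *\<^sub>v col g j" unfolding Y_def using d yc that by (intro col_mult2[of _ N N _ N]) auto
    then show ?thesis using d yc that by (simp add: assoc_mult_mat_vec[of _ N N _ N])
  qed
  have Yent: "Y $$ (i, j) = (h *\<^sub>v (y *\<^sub>v col g j)) $ i" if "i < N" "j < N" for i j
    using Ycol[OF that(2)] index_col[of i Y j] Yc that by simp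
  have xE: "E *\<^sub>v (x *\<^sub>v z) = x *\<^sub>v (E *\<^sub>v z)" if "z \<in> carrier_vec N" for z
    using assoc_mult_mat_vec[OF E(1) xc that] assoc_mult_mat_vec[OF xc E(1) that] x(2) by simp
  have yz: "y *\<^sub>v z = x *\<^sub>v (E *\<^sub>v z) + (z - E *\<^sub>v z)" if "z \<in> carrier_vec N" for z
    unfolding y_def using E xc that
    by (simp add: add_mult_distrib_mat_vec[of _ N N] minus_mult_distrib_mat_vec[of _ N N] assoc_mult_mat_vec[of _ N N _ N])
  have mc: "A *\<^sub>v z \<in> carrier_vec N" if "A \<in> carrier_mat N N" "z \<in> carrier_vec N" for A z
    using that by (rule mult_mat_vec_carrier)
  have YJ: "Y $$ (i, j) = (h * x * g) $$ (i, j)" "i \<notin> jumps N E \<Longrightarrow> Y $$ (i, j) = 0" if ij: "i < N" "j \<in> jumps N E" for i j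
  proof -
    note jN = JN[OF ij(2)]
    have uj: "u j \<in> carrier_vec N" "E *\<^sub>v u j = u j" using u[OF ij(2)] by auto
    have yu: "y *\<^sub>v u j = x *\<^sub>v u j" using yz[OF uj(1)] uj mc[OF xc uj(1)] by simp
    have "(h * x * g) $$ (i, j) = col (h * x * g) j $ i"
      using d xc ij jN by (intro index_col[symmetric]) auto
    also have "col (h * x * g) j = (h * x) *\<^sub>v col g j" using d xc jN by (intro col_mult2[of _ N N _ N]) auto
    also have "\<dots> = h *\<^sub>v (x *\<^sub>v u j)" using gcol[OF ij(2)] d xc uj by (simp add: assoc_mult_mat_vec[of _ N N _ N])
    finally show "Y $$ (i, j) = (h * x * g) $$ (i, j)" using Yent[OF ij(1) jN] gcol[OF ij(2)] yu by simp
    have "E *\<^sub>v (x *\<^sub>v u j) = x *\<^sub>v u j" using xE[OF uj(1)] uj by simp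
    then show "Y $$ (i, j) = 0" if "i \<notin> jumps N E"
      using low[OF mc[OF xc uj(1)] _ ij(1) that] Yent[OF ij(1) jN] gcol[OF ij(2)] yu by simp
  qed
  have YJ': "Y $$ (i, j) = (if i = j then 1 else 0)" if ij: "i < N" "i \<notin> jumps N E" "j < N" "j \<notin> jumps N E" for i j
  proof -
    let ?e = "unit_vec N j :: complex vec"
    have ec: "?e \<in> carrier_vec N" by simp
    define s where "s = x *\<^sub>v (E *\<^sub>v ?e) - E *\<^sub>v ?e"
    have Ee: "E *\<^sub>v ?e \<in> carrier_vec N" "x *\<^sub>v (E *\<^sub>v ?e) \<in> carrier_vec N" using mc E xc ec by blast+
    have sc: "s \<in> carrier_vec N" using Ee by (simp add: s_def)
    have EE: "E *\<^sub>v (E *\<^sub>v ?e) = E *\<^sub>v ?e" using E assoc_mult_mat_vec[OF E(1) E(1) ec] by simp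
    have Es: "E *\<^sub>v s = s"
      unfolding s_def using E Ee EE xE[OF Ee(1)] by (simp add: mult_minus_distrib_mat_vec[of _ N N])
    have "y *\<^sub>v ?e = ?e + s" unfolding yz[OF ec] s_def using Ee by (intro eq_vecI) auto
    then have "h *\<^sub>v (y *\<^sub>v ?e) = h *\<^sub>v ?e + h *\<^sub>v s" using d sc by (simp add: mult_add_distrib_mat_vec[of _ N N])
    also have "h *\<^sub>v ?e = ?e"
    proof -
      have "g *\<^sub>v ?e = col g j" using gc ij by (intro eq_vecI) auto
      then show ?thesis using gcol'[OF ij(4,3)] inv_pair_cancel_vec(2)[OF p ec] by simp
    qed
    finally have "h *\<^sub>v (y *\<^sub>v ?e) = ?e + h *\<^sub>v s" .
    then have "Y $$ (i, j) = ?e $ i + (h *\<^sub>v s) $ i"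
      using Yent[OF ij(1,3)] gcol'[OF ij(4,3)] ij d(2) by (simp del: index_mult_mat_vec index_unit_vec)
    then show ?thesis using low[OF sc Es ij(1,2)] ij by (simp add: unit_vec_def)
  qed
  have hxg: "h * x * g \<in> UT N" using UT_mult hU gU x by blast
  have "det Y = (\<Prod>i<N. Y $$ (i, i))"
  proof (rule det_quasi_triangular[OF Yc, of "jumps N E"])
    fix i j assume "i < N" "j < N" "i \<notin> jumps N E" "j \<noteq> i"
    then show "Y $$ (i, j) = 0" using YJ(2)[of i j] YJ'[of i j] by (cases "j \<in> jumps N E") auto
  next
    fix i j assume "i < N" "j < i" "i \<in> jumps N E" "j \<in> jumps N E"
    then show "Y $$ (i, j) = 0" using YJ(1)[of i j] UTc_zero[OF hxg, of j i] by simp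
  qed
  also have "\<dots> = (\<Prod>i<N. if i \<in> jumps N E then x $$ (i, i) else 1)"
  proof (rule prod.cong)
    fix i assume "i \<in> {..<N}"
    then have i: "i < N" by simp
    show "Y $$ (i, i) = (if i \<in> jumps N E then x $$ (i, i) else 1)"
    proof (cases "i \<in> jumps N E")
      case True
      have "(h * x * g) $$ (i, i) = h $$ (i, i) * x $$ (i, i) * g $$ (i, i)"
        using UT_mult_diag[OF UT_mult[OF hU x(1)] gU i] UT_mult_diag[OF hU x(1) i] by simp
      also have "\<dots> = (g $$ (i, i) * h $$ (i, i)) * x $$ (i, i)" by simp
      also have "\<dots> = x $$ (i, i)" using UT_inverse(2)[OF gU p i] by simp
      finally show ?thesis using YJ(1)[OF i True] True by simp
    qed (use YJ'[of i i] i in simp)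
  qed simp
  also have "\<dots> = (\<Prod>j\<in>jumps N E. x $$ (j, j))"
    by (rule prod.mono_neutral_cong_right) (use JN in auto)
  finally have "det Y = (\<Prod>j\<in>jumps N E. x $$ (j, j))" .
  moreover have "det Y = det y" unfolding Y_def by (rule det_conj[OF p yc])
  ultimately show ?thesis by (simp add: detE_def y_def)
qed

section \<open>Levi subgroups\<close>

lemma continuous_on_mat_mult:
  assumes "\<And>s. s \<in> S \<Longrightarrow> p s \<in> carrier_mat N N" "\<And>s. s \<in> S \<Longrightarrow> q s \<in> carrier_mat N N"
    and "\<And>i j. i < N \<Longrightarrow> j < N \<Longrightarrow> continuous_on S (\<lambda>s. p s $$ (i, j))"
    and "\<And>i j. i < N \<Longrightarrow> j < N \<Longrightarrow> continuous_on S (\<lambda>s. q s $$ (i, j) :: complex)"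
    and ij: "i < N" "j < N"
  shows "continuous_on S (\<lambda>s. (p s * q s) $$ (i, j))"
proof -
  have "continuous_on S (\<lambda>s. \<Sum>l<N. p s $$ (i, l) * q s $$ (l, j))"
    using assms by (intro continuous_on_sum continuous_on_mult) auto
  moreover have "(p s * q s) $$ (i, j) = (\<Sum>l<N. p s $$ (i, l) * q s $$ (l, j))" if "s \<in> S" for s
    using assms(1,2)[OF that] ij by (rule mult_entry)
  ultimately show ?thesis by (subst continuous_on_cong[OF refl]) auto
qed

lemma detE_regular:
  assumes "E \<in> carrier_mat N N" shows "regular_fun N (detE N E)"
proof -
  have "regular_map N N (\<lambda>x. x * E + (1\<^sub>m N - E))"
    using assms by (intro regular_map_add regular_map_mult regular_map_const regular_map_id) auto
  then show ?thesis unfolding detE_def by (rule regular_fun_det)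
qed

lemma detE_one: "E \<in> carrier_mat N N \<Longrightarrow> detE N E (1\<^sub>m N) = 1"
proof -
  assume E: "E \<in> carrier_mat N N"
  then have "1\<^sub>m N * E + (1\<^sub>m N - E) = 1\<^sub>m N" by (auto simp: left_mult_one_mat[of _ N N] intro!: eq_matI)
  then show ?thesis by (simp add: detE_def)
qed

lemma torus_type_compl:
  assumes E: "E \<in> carrier_mat N N" "E * E = E" and t: "torus_type N (1\<^sub>m N - E) e a b"
  shows "torus_type N E e b a"
proof -
  have "e \<in> carrier_mat N N" "e * (1\<^sub>m N - E) = (1\<^sub>m N - E) * e" using t UTc_carrier by (auto simp: torus_type_def)
  then have "e * E = E * e" using compl_commute[of "1\<^sub>m N - E" N e] idem_compl(4)[OF E] E by simp
  then show ?thesis using t idem_compl(4)[OF E] by (simp add: torus_type_def)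
qed

text \<open>The segment from \<open>1\<close> to \<open>x\<close> leaves the group, and is pushed back into it by
  multiplication with elements of two one-dimensional tori.\<close>

lemma levi_path:
  assumes E: "E \<in> carrier_mat N N" "E * E = E"
    and x: "x \<in> UT N" "x * E = E * x" "det x \<noteq> 0"
    and e: "torus_type N E e a b" and e': "torus_type N E e' a' b'"
    and P: "P 1 1" "P (detE N E x) (detE N (1\<^sub>m N - E) x)"
    and R: "\<And>y. y \<in> UT N \<Longrightarrow> y * E = E * y \<Longrightarrow> R (detE N E y) (detE N (1\<^sub>m N - E) y)"
    and F: "\<And>\<alpha> \<beta>. \<alpha> \<noteq> 0 \<Longrightarrow> \<beta> \<noteq> 0 \<Longrightarrow> P \<alpha> \<beta> \<Longrightarrow> F (\<alpha>, \<beta>) = 1 \<and> K (\<alpha>, \<beta>) = 1"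
    and FK: "\<And>\<alpha> \<beta>. \<alpha> \<noteq> 0 \<Longrightarrow> \<beta> \<noteq> 0 \<Longrightarrow> R \<alpha> \<beta> \<Longrightarrow>
      P (\<alpha> * F (\<alpha>, \<beta>) ^ a * K (\<alpha>, \<beta>) ^ a') (\<beta> * F (\<alpha>, \<beta>) ^ b * K (\<alpha>, \<beta>) ^ b')"
    and cF: "continuous_on {z. fst z \<noteq> 0 \<and> snd z \<noteq> 0} F" "continuous_on {z. fst z \<noteq> 0 \<and> snd z \<noteq> 0} K"
  shows "zlink N {y \<in> UT N. y * E = E * y \<and> P (detE N E y) (detE N (1\<^sub>m N - E) y)} (1\<^sub>m N) x" (is "zlink N ?X _ _")
proof -
  define Q where "Q = 1\<^sub>m N - E"
  have Q: "Q \<in> carrier_mat N N" "Q * Q = Q" using E idem_compl[OF E] by (auto simp: Q_def)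
  have xc: "x \<in> carrier_mat N N" using x UTc_carrier by blast
  have ec: "e \<in> UT N" "e * E = E * e" "e' \<in> UT N" "e' * E = E * e'" using e e' by (auto simp: torus_type_def)
  have ec': "e \<in> carrier_mat N N" "e' \<in> carrier_mat N N" using ec UTc_carrier by blast+
  define T where "T = {s :: complex. \<exists>i<N. (1 - s) * 1 + s * x $$ (i, i) = 0}"
  have T: "finite T" unfolding T_def by (rule finite_affine_zeros) simp
  define z where "z s = (1 - s) \<cdot>\<^sub>m 1\<^sub>m N + s \<cdot>\<^sub>m x" for s :: complex
  have zU: "z s \<in> UT N" for s unfolding z_def by (intro UT_add UT_smult UT_one x)
  have zc: "z s \<in> carrier_mat N N" for s using zU UTc_carrier by blast
  have zE: "z s * E = E * z s" for s
    unfolding z_def using E(1) xc x(2) by (simp add: add_mult_distrib_mat[of _ N N _ _ N] mult_add_distrib_mat[of _ N N _ N]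
      mult_smult_assoc_mat[of _ N N _ N] mult_smult_distrib[of _ N N _ N] left_mult_one_mat[of _ N N] right_mult_one_mat[of _ N N])
  have "det (z s) = (\<Prod>i<N. (1 - s) * 1 + s * x $$ (i, i))" for s
    unfolding UT_det[OF zU] using xc by (intro prod.cong) (auto simp: z_def)
  then have zd: "det (z s) \<noteq> 0" if "s \<notin> T" for s using that by (auto simp: T_def)
  define \<alpha> \<beta> where "\<alpha> s = detE N E (z s)" and "\<beta> s = detE N Q (z s)" for s
  have "\<alpha> s * \<beta> s = det (z s)" for s unfolding \<alpha>_def \<beta>_def Q_def by (rule detE_compl[OF E zc zE])
  then have ab0: "\<alpha> s \<noteq> 0" "\<beta> s \<noteq> 0" if "s \<notin> T" for s using zd[OF that] by (metis mult_eq_0_iff)+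
  have cz: "continuous_on S (\<lambda>s. z s $$ (i, j))" if "i < N" "j < N" for S i j
    using that xc by (cases "i = j") (auto simp: z_def intro!: continuous_intros)
  have "continuous_on (- T) \<alpha>" "continuous_on (- T) \<beta>"
    unfolding \<alpha>_def[abs_def] \<beta>_def[abs_def]
    by (rule continuous_on_regular[OF detE_regular[OF E(1)] zc cz], assumption+)
       (rule continuous_on_regular[OF detE_regular[OF Q(1)] zc cz], assumption+)
  then have cab: "continuous_on (- T) (\<lambda>s. (\<alpha> s, \<beta> s))" by (rule continuous_on_Pair)
  have sub: "(\<lambda>s. (\<alpha> s, \<beta> s)) ` (- T) \<subseteq> {z. fst z \<noteq> 0 \<and> snd z \<noteq> 0}" using ab0 by auto
  have cFK: "continuous_on (- T) (\<lambda>s. F (\<alpha> s, \<beta> s))" "continuous_on (- T) (\<lambda>s. K (\<alpha> s, \<beta> s))"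
    using continuous_on_compose2[OF cF(1) cab sub] continuous_on_compose2[OF cF(2) cab sub] by simp_all
  \<comment> \<open>\<open>F\<close> and \<open>K\<close> give the parameters of the two correcting
    tori as functions of the determinants on image and kernel.\<close>
  define f k where "f s = 1\<^sub>m N + (F (\<alpha> s, \<beta> s) - 1) \<cdot>\<^sub>m e" and "k s = 1\<^sub>m N + (K (\<alpha> s, \<beta> s) - 1) \<cdot>\<^sub>m e'" for s
  have fkU: "f s \<in> UT N" "k s \<in> UT N" for s unfolding f_def k_def by (intro UT_add UT_smult UT_one ec)+
  have fkc: "f s \<in> carrier_mat N N" "k s \<in> carrier_mat N N" for s using fkU UTc_carrier by blast+
  have fkE: "f s * E = E * f s" "k s * E = E * k s" for s
    unfolding f_def k_def using E(1) ec' ec(2,4)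
    by (simp_all add: add_mult_distrib_mat[of _ N N _ _ N] mult_add_distrib_mat[of _ N N _ N]
      mult_smult_assoc_mat[of _ N N _ N] mult_smult_distrib[of _ N N _ N] left_mult_one_mat[of _ N N] right_mult_one_mat[of _ N N])
  have cfk: "continuous_on (- T) (\<lambda>s. f s $$ (i, j))" "continuous_on (- T) (\<lambda>s. k s $$ (i, j))" if "i < N" "j < N" for i j
    unfolding f_def k_def using that ec' by (cases "i = j"; auto intro!: continuous_intros cFK)+
  define p where "p s = z s * f s * k s" for s
  have pX: "p s \<in> ?X" if s: "s \<in> - T" for s
  proof -
    have zf: "z s * f s \<in> carrier_mat N N" using zc fkc by simp
    have zfE: "z s * f s * E = E * (z s * f s)" by (rule commute_mult[OF E(1) zc fkc(1) zE fkE(1)])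
    have pE: "p s * E = E * p s" unfolding p_def by (rule commute_mult[OF E(1) zf fkc(2) zfE fkE(2)])
    have pU: "p s \<in> UT N" unfolding p_def by (intro UT_mult zU fkU)
    have det1: "detE N E (p s) = \<alpha> s * F (\<alpha> s, \<beta> s) ^ a * K (\<alpha> s, \<beta> s) ^ a'"
      unfolding p_def detE_mult[OF E zf fkc(2) fkE(2)] detE_mult[OF E zc fkc(1) fkE(1)]
      using e e' by (simp add: torus_type_def f_def k_def \<alpha>_def)
    have fkQ: "f s * Q = Q * f s" "k s * Q = Q * k s" unfolding Q_def using compl_commute[OF E(1)] fkc fkE by blast+
    have det2: "detE N Q (p s) = \<beta> s * F (\<alpha> s, \<beta> s) ^ b * K (\<alpha> s, \<beta> s) ^ b'"
      unfolding p_def detE_mult[OF Q zf fkc(2) fkQ(2)] detE_mult[OF Q zc fkc(1) fkQ(1)]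
      using e e' by (simp add: torus_type_def f_def k_def \<beta>_def Q_def)
    have "R (\<alpha> s) (\<beta> s)" unfolding \<alpha>_def \<beta>_def Q_def by (rule R[OF zU zE])
    then have "P (detE N E (p s)) (detE N Q (p s))" unfolding det1 det2 using s by (intro FK ab0) auto
    then show ?thesis using pU pE by (simp add: Q_def)
  qed
  \<comment> \<open>Where the target condition \<open>P\<close> already holds both corrections are
    trivial, so the endpoints of the segment are not moved.\<close>
  have p1: "p s = z s" if "P (\<alpha> s) (\<beta> s)" "s \<notin> T" for s
  proof -
    have "f s = 1\<^sub>m N" "k s = 1\<^sub>m N" using F[OF ab0[OF that(2)] that(1)] ec' by (auto simp: f_def k_def intro!: eq_matI)
    then show ?thesis using zc[of s] by (simp add: p_def right_mult_one_mat[of _ N N])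
  qed
  have z01: "z 0 = 1\<^sub>m N" "z 1 = x" using xc by (auto simp: z_def intro!: eq_matI)
  have "x $$ (i, i) \<noteq> 0" if "i < N" for i using x(3) that unfolding UT_det[OF x(1)] by auto
  then have T01: "0 \<notin> T" "1 \<notin> T" by (auto simp: T_def)
  have "p 0 = 1\<^sub>m N" using p1[OF _ T01(1)] P(1) detE_one[OF E(1)] detE_one[OF Q(1)] by (simp add: \<alpha>_def \<beta>_def z01)
  moreover have "p 1 = x" using p1[OF _ T01(2)] P(2) by (simp add: \<alpha>_def \<beta>_def z01 Q_def)
  moreover have "zlink N ?X (p 0) (p 1)"
  proof (rule zlink_path[OF connected_cofinite[OF T]])
    show "continuous_on (- T) (\<lambda>s. p s $$ (i, j))" if "i < N" "j < N" for i j
      unfolding p_def by (intro continuous_on_mat_mult[of _ _ N] cz cfk fkc zc mult_carrier_sq that)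
  qed (use pX T01 UTc_carrier in auto)
  ultimately show ?thesis by simp
qed

text \<open>Two determinants have to be normalized. A jump of only one of the two spaces yields a
  torus moving one determinant, a common jump a torus moving both equally. If the jump sets
  coincide, the two determinants agree by \<open>detE_jumps\<close> and one torus suffices.\<close>

lemma levi_SL_link:
  assumes E: "E \<in> carrier_mat N N" "E * E = E" "E \<noteq> 0\<^sub>m N N" "1\<^sub>m N - E \<noteq> 0\<^sub>m N N"
    and x: "x \<in> UT N" "x * E = E * x" "detE N E x = 1" "detE N (1\<^sub>m N - E) x = 1"
  shows "zlink N {y \<in> UT N. y * E = E * y \<and> detE N E y = 1 \<and> detE N (1\<^sub>m N - E) y = 1} (1\<^sub>m N) x"
proof -
  define Q where "Q = 1\<^sub>m N - E"
  have Q: "Q \<in> carrier_mat N N" "Q * Q = Q" "1\<^sub>m N - Q = E" using E idem_compl[OF E(1,2)] by (auto simp: Q_def)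
  have xc: "x \<in> carrier_mat N N" using x UTc_carrier by blast
  have dx: "det x \<noteq> 0" using detE_compl[OF E(1,2) xc x(2)] x(3,4) by simp
  note path = levi_path[OF E(1,2) x(1,2) dx, where P = "\<lambda>\<alpha> \<beta>. \<alpha> = 1 \<and> \<beta> = 1"]
  have t10: "\<exists>e. torus_type N E e 1 0" if "\<not> jumps N E \<subseteq> jumps N Q"
    using that torus_single[OF E(1,2)] by (auto simp: Q_def)
  have t01: "\<exists>e. torus_type N E e 0 1" if "\<not> jumps N Q \<subseteq> jumps N E"
  proof -
    from that obtain j where "j \<in> jumps N Q" "j \<notin> jumps N E" by blast
    then show ?thesis using torus_single[OF Q(1,2), of j, unfolded Q(3)] torus_type_compl[OF E(1,2)] unfolding Q_def by blast
  qed
  have t11: "\<exists>e. torus_type N E e 1 1" if "jumps N E \<inter> jumps N Q \<noteq> {}"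
    using that torus_pair[OF E(1,2)] by (auto simp: Q_def)
  have ne: "jumps N E \<noteq> {}" "jumps N Q \<noteq> {}"
    using jumps_nonempty[OF E(1-3)] jumps_nonempty[OF Q(1,2)] E(4) by (auto simp: Q_def)
  have c: "continuous_on {z :: complex \<times> complex. fst z \<noteq> 0 \<and> snd z \<noteq> 0} (\<lambda>z. 1 / fst z)"
    "continuous_on {z :: complex \<times> complex. fst z \<noteq> 0 \<and> snd z \<noteq> 0} (\<lambda>z. 1 / snd z)"
    "continuous_on {z :: complex \<times> complex. fst z \<noteq> 0 \<and> snd z \<noteq> 0} (\<lambda>z. fst z / snd z)"
    "continuous_on {z :: complex \<times> complex. fst z \<noteq> 0 \<and> snd z \<noteq> 0} (\<lambda>z. snd z / fst z)"
    "continuous_on {z :: complex \<times> complex. fst z \<noteq> 0 \<and> snd z \<noteq> 0} (\<lambda>z. 1 :: complex)"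
    by (auto intro!: continuous_intros)
  consider (a) "\<not> jumps N E \<subseteq> jumps N Q" "\<not> jumps N Q \<subseteq> jumps N E"
    | (b) "\<not> jumps N E \<subseteq> jumps N Q" "jumps N Q \<subseteq> jumps N E"
    | (c) "jumps N E \<subseteq> jumps N Q" "\<not> jumps N Q \<subseteq> jumps N E"
    | (d) "jumps N E = jumps N Q" by blast
  then show ?thesis
  proof cases
    case a
    then obtain e e' where e: "torus_type N E e 1 0" "torus_type N E e' 0 1" using t10 t01 by blast
    show ?thesis
      by (rule path[OF e, where R = "\<lambda>_ _. True" and F = "\<lambda>z. 1 / fst z" and K = "\<lambda>z. 1 / snd z"])
        (use x c in auto)
  next
    case b
    then obtain e e' where e: "torus_type N E e 1 0" "torus_type N E e' 1 1" using t10 t11 ne by blast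
    \<comment> \<open>The torus of weights (1, 0) makes the two determinants equal; the one of
      weights (1, 1) then makes both 1.\<close>
    show ?thesis
      by (rule path[OF e, where R = "\<lambda>_ _. True" and F = "\<lambda>z. snd z / fst z" and K = "\<lambda>z. 1 / snd z"])
        (use x c in auto)
  next
    case c'': c
    then obtain e e' where e: "torus_type N E e 0 1" "torus_type N E e' 1 1" using t01 t11 ne by blast
    show ?thesis
      by (rule path[OF e, where R = "\<lambda>_ _. True" and F = "\<lambda>z. fst z / snd z" and K = "\<lambda>z. 1 / fst z"])
        (use x c in auto)
  next
    case d
    then obtain e where e: "torus_type N E e 1 1" using t11 ne by blast
    have "detE N E y = detE N (1\<^sub>m N - E) y" if y: "y \<in> UT N" "y * E = E * y" for y
    proof -
      have "y * Q = Q * y" unfolding Q_def by (rule compl_commute[OF E(1) UTc_carrier[OF y(1)] y(2)])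
      then show ?thesis using detE_jumps[OF E(1,2) y] detE_jumps[OF Q(1,2) y(1)] d by (simp add: Q_def)
    qed
    then show ?thesis
      by (intro path[OF e e, where R = "\<lambda>\<alpha> \<beta>. \<alpha> = \<beta>" and F = "\<lambda>z. 1 / fst z" and K = "\<lambda>z. 1"])
        (use x c in auto)
  qed
qed

text \<open>Only the product of the determinants matters, so a torus moving one of them suffices; it
  exists as soon as the jump sets differ.\<close>

lemma levi_GL_link:
  assumes E: "E \<in> carrier_mat N N" "E * E = E" and J: "jumps N E \<noteq> jumps N (1\<^sub>m N - E)"
    and x: "x \<in> UT N" "x * E = E * x" "detE N E x * detE N (1\<^sub>m N - E) x = 1"
  shows "zlink N {y \<in> UT N. y * E = E * y \<and> detE N E y * detE N (1\<^sub>m N - E) y = 1} (1\<^sub>m N) x"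
proof -
  define Q where "Q = 1\<^sub>m N - E"
  have Q: "Q \<in> carrier_mat N N" "Q * Q = Q" "1\<^sub>m N - Q = E" using E idem_compl[OF E(1,2)] by (auto simp: Q_def)
  have xc: "x \<in> carrier_mat N N" using x UTc_carrier by blast
  have dx: "det x \<noteq> 0" using detE_compl[OF E(1,2) xc x(2)] x(3) by simp
  note path = levi_path[OF E(1,2) x(1,2) dx, where P = "\<lambda>\<alpha> \<beta>. \<alpha> * \<beta> = 1"]
  have "\<exists>e. torus_type N E e 1 0 \<or> torus_type N E e 0 1"
  proof (cases "jumps N E \<subseteq> jumps N Q")
    case False
    then show ?thesis using torus_single[OF E(1,2)] by (auto simp: Q_def)
  next
    case True
    then obtain j where "j \<in> jumps N Q" "j \<notin> jumps N E" using J by (auto simp: Q_def)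
    then show ?thesis using torus_single[OF Q(1,2), of j, unfolded Q(3)] torus_type_compl[OF E(1,2)] unfolding Q_def by blast
  qed
  then obtain e where e: "torus_type N E e 1 0 \<or> torus_type N E e 0 1" by blast
  have c: "continuous_on {z :: complex \<times> complex. fst z \<noteq> 0 \<and> snd z \<noteq> 0} (\<lambda>z. 1 / (fst z * snd z))"
    "continuous_on {z :: complex \<times> complex. fst z \<noteq> 0 \<and> snd z \<noteq> 0} (\<lambda>z. 1 :: complex)"
    by (auto intro!: continuous_intros)
  from e show ?thesis
  proof
    assume e: "torus_type N E e 1 0"
    show ?thesis
      by (rule path[OF e e, where R = "\<lambda>_ _. True" and F = "\<lambda>z. 1 / (fst z * snd z)" and K = "\<lambda>z. 1"])
        (use x c in auto)
  next
    assume e: "torus_type N E e 0 1"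
    show ?thesis
      by (rule path[OF e e, where R = "\<lambda>_ _. True" and F = "\<lambda>z. 1 / (fst z * snd z)" and K = "\<lambda>z. 1"])
        (use x c in auto)
  qed
qed

text \<open>For a projection \<open>D\<close>, the centralizer of \<open>D\<close> with a condition
  on the two determinants. It is used with both equal to 1, with product 1, and without restriction,
  the last giving all block-diagonal matrices.\<close>

definition levi :: "nat \<Rightarrow> complex mat \<Rightarrow> (complex \<Rightarrow> complex \<Rightarrow> bool) \<Rightarrow> complex mat set" where
  "levi N D P = {x \<in> carrier_mat N N. x * D = D * x \<and> P (detE N D x) (detE N (1\<^sub>m N - D) x)}"

lemma levi_closed_subgroup:
  assumes D: "D \<in> carrier_mat N N" "D * D = D"
    and P: "P 1 1" "\<And>a b c d. P a b \<Longrightarrow> P c d \<Longrightarrow> P (a * c) (b * d)" "\<And>a b. P a b \<Longrightarrow> a * b = 1"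
      "\<And>a b c d. P a b \<Longrightarrow> a * c = 1 \<Longrightarrow> b * d = 1 \<Longrightarrow> P c d"
    and cl: "zariski_closed N {x \<in> carrier_mat N N. P (detE N D x) (detE N (1\<^sub>m N - D) x)}"
  shows "closed_subgroup N (levi N D P) (SL N)"
proof -
  define Q where "Q = 1\<^sub>m N - D"
  have Q: "Q \<in> carrier_mat N N" "Q * Q = Q" using D idem_compl[OF D] by (auto simp: Q_def)
  have mult: "detE N D (x * y) = detE N D x * detE N D y" "detE N Q (x * y) = detE N Q x * detE N Q y"
    if "x \<in> carrier_mat N N" "y \<in> carrier_mat N N" "y * D = D * y" for x y
    using detE_mult[OF D that] detE_mult[OF Q that(1,2)] compl_commute[OF D(1) that(2,3)] by (simp_all add: Q_def)
  have "mgroup N (levi N D P)"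
  proof (rule mgroupI)
    show "levi N D P \<subseteq> SL N"
    proof
      fix x assume "x \<in> levi N D P"
      then have "x \<in> carrier_mat N N" "x * D = D * x" "P (detE N D x) (detE N (1\<^sub>m N - D) x)" by (auto simp: levi_def)
      then show "x \<in> SL N" using detE_compl[OF D, of x] P(3) by (simp add: SL_def)
    qed
    show "1\<^sub>m N \<in> levi N D P"
      using D Q P(1) detE_one[OF D(1)] detE_one[OF Q(1)]
      by (simp add: levi_def Q_def left_mult_one_mat[of _ N N] right_mult_one_mat[of _ N N])
  next
    fix x y assume "x \<in> levi N D P" "y \<in> levi N D P"
    then show "x * y \<in> levi N D P"
      using mult[of x y] commute_mult[OF D(1), of x y] P(2) by (simp add: levi_def Q_def del: assoc_mult_mat)
  next
    fix x assume x: "x \<in> levi N D P"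
    then have xx: "x \<in> carrier_mat N N" "x * D = D * x" "P (detE N D x) (detE N Q x)" by (auto simp: levi_def Q_def)
    have "x \<in> SL N" using detE_compl[OF D xx(1,2)] P(3)[OF xx(3)] xx(1) by (simp add: SL_def Q_def)
    then have p: "inv_pair N x (adj_mat x)" by (rule adj_mat_inv_pair)
    define y where "y = adj_mat x"
    note k = inv_pairD[OF p, folded y_def]
    have "y * D = y * (D * x) * y"
      using k(1,2) D(1) k(3) by (simp add: assoc_mult_mat[of _ N N _ N _ N] right_mult_one_mat[of _ N N])
    also have "\<dots> = y * (x * D) * y" using xx(2) by simp
    also have "\<dots> = y * x * (D * y)" using k(1,2) D(1) by (simp add: assoc_mult_mat[of _ N N _ N _ N])
    also have "\<dots> = D * y" unfolding k(4) using k D by (simp add: left_mult_one_mat[of _ N N])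
    finally have yD: "y * D = D * y" .
    have "detE N D x * detE N D y = 1" "detE N Q x * detE N Q y = 1"
      using mult[OF xx(1) k(2) yD] detE_one[OF D(1)] detE_one[OF Q(1)] k(3) by simp_all
    then have "P (detE N D y) (detE N Q y)" by (rule P(4)[OF xx(3)])
    then show "\<exists>y \<in> levi N D P. x * y = 1\<^sub>m N" using k yD by (intro bexI[of _ y]) (simp_all add: levi_def Q_def)
  qed
  moreover have "levi N D P = {x \<in> carrier_mat N N. x * D = D * x} \<inter>
      {x \<in> carrier_mat N N. P (detE N D x) (detE N (1\<^sub>m N - D) x)}" by (auto simp: levi_def)
  moreover have "zariski_closed N {x \<in> carrier_mat N N. x * D = D * x}"
    by (intro zariski_closed_mat_eq[of N N] regular_map_mult regular_map_id regular_map_const D)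
  ultimately show ?thesis using cl by (simp add: closed_subgroup_iff zariski_closed_Int)
qed

lemma detE_conj:
  assumes p: "inv_pair N g h" and D: "D \<in> carrier_mat N N" and x: "x \<in> carrier_mat N N"
  shows "detE N (h * D * g) (h * x * g) = detE N D x"
proof -
  note d = inv_pairD[OF p]
  have "h * (x * D + (1\<^sub>m N - D)) * g = h * (x * D) * g + (h * g - h * D * g)"
    using d(1,2) D x by (simp add: add_mult_distrib_mat[of _ N N _ _ N] mult_add_distrib_mat[of _ N N _ N]
      minus_mult_distrib_mat[of _ N N _ _ N] mult_minus_distrib_mat[of _ N N _ N] right_mult_one_mat[of _ N N] del: assoc_mult_mat)
  also have "\<dots> = h * x * g * (h * D * g) + (1\<^sub>m N - h * D * g)"
    unfolding conj_mult[OF p x D] d(4) ..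
  finally have "det (h * x * g * (h * D * g) + (1\<^sub>m N - h * D * g)) = det (h * (x * D + (1\<^sub>m N - D)) * g)" by simp
  also have "\<dots> = det (x * D + (1\<^sub>m N - D))" by (rule det_conj[OF p]) (use D x in simp)
  finally show ?thesis by (simp add: detE_def)
qed

lemma conj_one_minus:
  assumes p: "inv_pair N g h" and D: "D \<in> carrier_mat N N"
  shows "h * (1\<^sub>m N - D) * g = 1\<^sub>m N - h * D * g"
  using inv_pairD[OF p] D by (simp add: minus_mult_distrib_mat[of _ N N _ _ N] mult_minus_distrib_mat[of _ N N _ N] right_mult_one_mat[of _ N N])

text \<open>Conjugation moves the flag to the standard one and \<open>D\<close> to an idempotent
  that need no longer be diagonal, on which the link lemmas operate.\<close>

lemma levi_parabolically_connected:
  assumes D: "D \<in> carrier_mat N N" "D * D = D" and H: "closed_subgroup N (levi N D P) (SL N)"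
    and link: "\<And>g h x. inv_pair N g h \<Longrightarrow> x \<in> UT N \<Longrightarrow> x * (h * D * g) = h * D * g * x \<Longrightarrow>
      P (detE N (h * D * g) x) (detE N (1\<^sub>m N - h * D * g) x) \<Longrightarrow>
      zlink N {y \<in> UT N. y * (h * D * g) = h * D * g * y \<and> P (detE N (h * D * g) y) (detE N (1\<^sub>m N - h * D * g) y)} (1\<^sub>m N) x"
  shows "parabolically_connected N (SL N) (levi N D P)"
proof (rule parabolically_connectedI[OF H])
  fix g h x assume p: "inv_pair N g h" and x: "x \<in> levi N D P" and xU: "h * x * g \<in> UT N"
  define E where "E = h * D * g"
  note d = inv_pairD[OF p]
  have Ec: "E \<in> carrier_mat N N" using d D by (simp add: E_def)
  have Dc: "1\<^sub>m N - D \<in> carrier_mat N N" using D by simp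
  have ED: "g * E * h = D" unfolding E_def by (rule conj_conj[OF p D(1)])
  have iff: "h * z * g * E = E * (h * z * g) \<and> P (detE N E (h * z * g)) (detE N (1\<^sub>m N - E) (h * z * g)) \<longleftrightarrow> z \<in> levi N D P"
    if z: "z \<in> carrier_mat N N" for z
  proof -
    have "h * z * g * E = h * (z * D) * g" "E * (h * z * g) = h * (D * z) * g"
      unfolding E_def using conj_mult[OF p z D(1)] conj_mult[OF p D(1) z] by simp_all
    moreover have "h * (z * D) * g = h * (D * z) * g \<longleftrightarrow> z * D = D * z"
      using conj_conj[OF p, of "z * D"] conj_conj[OF p, of "D * z"] z D by (metis mult_carrier_sq)
    moreover have "detE N E (h * z * g) = detE N D z" unfolding E_def by (rule detE_conj[OF p D(1) z])
    moreover have "detE N (1\<^sub>m N - E) (h * z * g) = detE N (1\<^sub>m N - D) z"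
      unfolding E_def conj_one_minus[OF p D(1), symmetric] by (rule detE_conj[OF p Dc z])
    ultimately show ?thesis using z by (simp add: levi_def)
  qed
  let ?X = "{y \<in> UT N. y * E = E * y \<and> P (detE N E y) (detE N (1\<^sub>m N - E) y)}"
  have xc: "x \<in> carrier_mat N N" using x by (simp add: levi_def)
  have "zlink N ?X (1\<^sub>m N) (h * x * g)"
    using link[OF p xU] iff[OF xc] x by (simp add: E_def del: assoc_mult_mat)
  then have "zlink N {x \<in> levi N D P. h * x * g \<in> UT N} (g * 1\<^sub>m N * h) (g * (h * x * g) * h)"
  proof (rule zlink_image)
    show "?X \<subseteq> carrier_mat N N" using UTc_carrier by blast
    show "regular_map N N (\<lambda>y. g * y * h)" by (rule conj_regular[OF inv_pair_sym[OF p]])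
    show "(\<lambda>y. g * y * h) ` ?X \<subseteq> {x \<in> levi N D P. h * x * g \<in> UT N}"
    proof
      fix w assume "w \<in> (\<lambda>y. g * y * h) ` ?X"
      then obtain y where y: "w = g * y * h" "y \<in> ?X" by blast
      have yc: "y \<in> carrier_mat N N" using y UTc_carrier by blast
      have "h * w * g = y" unfolding y(1) by (rule conj_conj[OF inv_pair_sym[OF p] yc])
      moreover have "w \<in> carrier_mat N N" using y(1) yc d by simp
      ultimately show "w \<in> {x \<in> levi N D P. h * x * g \<in> UT N}" using iff[of w] y(2) by simp
    qed
  qed
  then show "zlink N {x \<in> levi N D P. h * x * g \<in> UT N} (1\<^sub>m N) x"
    using conj_conj[OF p xc] d by (simp add: right_mult_one_mat[of _ N N] del: assoc_mult_mat)
qed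

section \<open>Block-diagonal subgroups as centralizers of a coordinate projection\<close>

context
  fixes m n N :: nat and D :: "complex mat"
  defines "N \<equiv> m + n" and "D \<equiv> blockdiag (1\<^sub>m m) (0\<^sub>m n n)"
begin

lemma bD: "D \<in> carrier_mat N N" "D * D = D" "1\<^sub>m N - D = blockdiag (0\<^sub>m m m) (1\<^sub>m n)"
  unfolding D_def N_def
  by (auto simp: blockdiag_mult[of _ m _ n]) (auto simp: blockdiag_def intro!: eq_matI)

lemma bD_detE:
  assumes "A \<in> carrier_mat m m" "B \<in> carrier_mat n n"
  shows "detE N D (blockdiag A B) = det A" "detE N (1\<^sub>m N - D) (blockdiag A B) = det B"
proof -
  have "1\<^sub>m N - blockdiag (0\<^sub>m m m) (1\<^sub>m n) = D"
    unfolding D_def N_def by (auto simp: blockdiag_def intro!: eq_matI)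
  moreover have "blockdiag A B * D + blockdiag (0\<^sub>m m m) (1\<^sub>m n) = blockdiag A (1\<^sub>m n)"
    "blockdiag A B * blockdiag (0\<^sub>m m m) (1\<^sub>m n) + D = blockdiag (1\<^sub>m m) B"
    using assms by (simp_all add: D_def blockdiag_mult[of _ m _ n]) (auto simp: blockdiag_def intro!: eq_matI)
  ultimately show "detE N D (blockdiag A B) = det A" "detE N (1\<^sub>m N - D) (blockdiag A B) = det B"
    using assms by (simp_all add: detE_def bD(3) blockdiag_det[of _ m _ n] del: assoc_mult_mat)
qed

lemma levi_blockdiag:
  "levi N D P = {blockdiag A B |A B. A \<in> carrier_mat m m \<and> B \<in> carrier_mat n n \<and> P (det A) (det B)}"
proof (intro equalityI subsetI)
  fix x assume "x \<in> levi N D P"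
  then have x: "x \<in> carrier_mat N N" "x * D = D * x" "P (detE N D x) (detE N (1\<^sub>m N - D) x)" by (auto simp: levi_def)
  have xD: "(x * D) $$ (i, j) = (if j < m then x $$ (i, j) else 0)" if ij: "i < N" "j < N" for i j
  proof -
    have "(x * D) $$ (i, j) = (\<Sum>l<N. x $$ (i, l) * D $$ (l, j))" by (rule mult_entry[OF x(1) bD(1) ij])
    also have "\<dots> = (\<Sum>l<N. if l = j then if j < m then x $$ (i, j) else 0 else 0)"
      by (rule sum.cong) (use ij in \<open>auto simp: D_def N_def blockdiag_index[of _ m _ n]\<close>)
    finally show ?thesis using ij by simp
  qed
  have Dx: "(D * x) $$ (i, j) = (if i < m then x $$ (i, j) else 0)" if ij: "i < N" "j < N" for i j
  proof -
    have "(D * x) $$ (i, j) = (\<Sum>l<N. D $$ (i, l) * x $$ (l, j))" by (rule mult_entry[OF bD(1) x(1) ij])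
    also have "\<dots> = (\<Sum>l<N. if l = i then if i < m then x $$ (i, j) else 0 else 0)"
      by (rule sum.cong) (use ij in \<open>auto simp: D_def N_def blockdiag_index[of _ m _ n]\<close>)
    finally show ?thesis using ij by simp
  qed
  have xe: "x = blockdiag (ul m x) (lr m n x)"
  proof (rule blockdiag_decompose)
    fix i j assume "i < m" "j < n"
    then show "x $$ (i, j + m) = 0 \<and> x $$ (j + m, i) = 0"
      using xD[of i "j + m"] Dx[of i "j + m"] xD[of "j + m" i] Dx[of "j + m" i] x(2) by (simp add: N_def del: index_mult_mat(1))
  qed (use x N_def in simp)
  have "P (det (ul m x)) (det (lr m n x))"
    using x(3) bD_detE[of "ul m x" "lr m n x"] xe by simp
  then show "x \<in> {blockdiag A B |A B. A \<in> carrier_mat m m \<and> B \<in> carrier_mat n n \<and> P (det A) (det B)}"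
    using xe ul_lr_carrier by blast
next
  fix x assume "x \<in> {blockdiag A B |A B. A \<in> carrier_mat m m \<and> B \<in> carrier_mat n n \<and> P (det A) (det B)}"
  then obtain A B where k: "x = blockdiag A B" "A \<in> carrier_mat m m" "B \<in> carrier_mat n n" "P (det A) (det B)" by blast
  have "x * D = D * x" unfolding k(1) D_def using k(2,3)
    by (simp add: blockdiag_mult[of _ m _ n] left_mult_one_mat[of _ m m] right_mult_one_mat[of _ m m])
  then show "x \<in> levi N D P" using k bD_detE[OF k(2,3)] by (simp add: levi_def N_def)
qed

lemma conj_idem:
  assumes p: "inv_pair N g h" shows "h * D * g \<in> carrier_mat N N" "h * D * g * (h * D * g) = h * D * g"
  using conj_mult[OF p bD(1) bD(1)] inv_pairD[OF p] bD by (simp_all del: assoc_mult_mat)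

lemma SLxSL_parabolically_connected:
  assumes mn: "m \<ge> 1" "n \<ge> 1"
  shows "parabolically_connected N (SL N) (SLxSL m n)"
proof -
  let ?P = "\<lambda>a b. a = 1 \<and> b = (1 :: complex)"
  have "SLxSL m n = levi N D ?P" unfolding levi_blockdiag SLxSL_def by simp
  moreover have "parabolically_connected N (SL N) (levi N D ?P)"
  proof (rule levi_parabolically_connected[OF bD(1,2)])
    have r: "regular_fun N (\<lambda>x. detE N D x - 1)" "regular_fun N (\<lambda>x. detE N (1\<^sub>m N - D) x - 1)"
      using bD(1) by (auto intro!: regular_fun_diff detE_regular regular_fun_const)
    have "{x \<in> carrier_mat N N. ?P (detE N D x) (detE N (1\<^sub>m N - D) x)} =
      {x \<in> carrier_mat N N. detE N D x - 1 = 0} \<inter> {x \<in> carrier_mat N N. detE N (1\<^sub>m N - D) x - 1 = 0}" by auto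
    then have "zariski_closed N {x \<in> carrier_mat N N. ?P (detE N D x) (detE N (1\<^sub>m N - D) x)}"
      using zariski_closed_Int[OF zariski_closed_zeros[OF r(1)] zariski_closed_zeros[OF r(2)]] by simp
    then show "closed_subgroup N (levi N D ?P) (SL N)" by (intro levi_closed_subgroup[OF bD(1,2)]) auto
  next
    fix g h x assume p: "inv_pair N g h" and x: "x \<in> UT N" "x * (h * D * g) = h * D * g * x"
      "?P (detE N (h * D * g) x) (detE N (1\<^sub>m N - h * D * g) x)"
    note d = inv_pairD[OF p]
    have z: "g * 0\<^sub>m N N * h = 0\<^sub>m N N" using d by simp
    have "g * (h * D * g) * h = D" by (rule conj_conj[OF p bD(1)])
    moreover have "D $$ (0, 0) = 1" using mn by (simp add: D_def blockdiag_index[of _ m _ n])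
    ultimately have 1: "h * D * g \<noteq> 0\<^sub>m N N" using z mn by (auto simp: N_def)
    have "g * (1\<^sub>m N - h * D * g) * h = 1\<^sub>m N - D"
      using conj_conj[OF p, of "1\<^sub>m N - D"] conj_one_minus[OF p bD(1)] bD(1) by simp
    moreover have "(1\<^sub>m N - D) $$ (m, m) \<noteq> 0\<^sub>m N N $$ (m, m)" using mn unfolding bD(3) by (simp add: blockdiag_index[of _ m _ n] N_def)
    ultimately have 2: "1\<^sub>m N - h * D * g \<noteq> 0\<^sub>m N N" using z by metis
    from levi_SL_link[OF conj_idem[OF p] 1 2 x(1,2)] x(3)
    show "zlink N {y \<in> UT N. y * (h * D * g) = h * D * g * y \<and> ?P (detE N (h * D * g) y) (detE N (1\<^sub>m N - h * D * g) y)} (1\<^sub>m N) x"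
      by blast
  qed
  ultimately show ?thesis by simp
qed

lemma SGLxGL_closed_subgroup: "closed_subgroup N (SGLxGL m n) (SL N)"
  and SGLxGL_levi: "SGLxGL m n = levi N D (\<lambda>a b. a * b = 1)"
proof -
  let ?P = "\<lambda>a b. a * b = (1 :: complex)"
  show *: "SGLxGL m n = levi N D ?P" unfolding levi_blockdiag SGLxGL_def by simp
  have r: "regular_fun N (\<lambda>x. detE N D x * detE N (1\<^sub>m N - D) x - 1)"
    using bD(1) by (auto intro!: regular_fun_diff regular_fun_mult detE_regular regular_fun_const)
  have "{x \<in> carrier_mat N N. ?P (detE N D x) (detE N (1\<^sub>m N - D) x)} =
    {x \<in> carrier_mat N N. detE N D x * detE N (1\<^sub>m N - D) x - 1 = 0}" by auto
  then have "zariski_closed N {x \<in> carrier_mat N N. ?P (detE N D x) (detE N (1\<^sub>m N - D) x)}"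
    using zariski_closed_zeros[OF r] by simp
  then have "closed_subgroup N (levi N D ?P) (SL N)"
  proof (intro levi_closed_subgroup[OF bD(1,2)])
    fix a b c d :: complex assume "a * b = 1" "a * c = 1" "b * d = 1"
    then have "(a * b) * (c * d) = 1" by (metis mult.assoc mult.left_commute mult_1_right)
    then show "c * d = 1" using \<open>a * b = 1\<close> by simp
  next
    fix a b c d :: complex assume "a * b = 1" "c * d = 1"
    then show "a * c * (b * d) = 1" by (metis mult.assoc mult.left_commute mult_1_right)
  qed auto
  then show "closed_subgroup N (SGLxGL m n) (SL N)" using * by simp
qed

lemma SGLxGL_parabolically_connected:
  assumes mn: "m \<noteq> n"
  shows "parabolically_connected N (SL N) (SGLxGL m n)"
  unfolding SGLxGL_levi
proof (rule levi_parabolically_connected[OF bD(1,2)])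
  show "closed_subgroup N (levi N D (\<lambda>a b. a * b = 1)) (SL N)" using SGLxGL_closed_subgroup SGLxGL_levi by simp
next
  fix g h x assume p: "inv_pair N g h" and x: "x \<in> UT N" "x * (h * D * g) = h * D * g * x"
    "detE N (h * D * g) x * detE N (1\<^sub>m N - h * D * g) x = 1"
  note d = inv_pairD[OF p]
  define E where "E = h * D * g"
  have E: "E \<in> carrier_mat N N" "E * E = E" unfolding E_def using conj_idem[OF p] by auto
  have "jumps N E \<noteq> jumps N (1\<^sub>m N - E)"
  proof
    assume J: "jumps N E = jumps N (1\<^sub>m N - E)"
    \<comment> \<open>The scalar 2 is triangular and commutes with everything; equal jump sets would
      give it equal determinants on the two spaces, that is \<open>2^m = 2^n\<close>.\<close>
    let ?x = "2 \<cdot>\<^sub>m 1\<^sub>m N :: complex mat"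
    have xU: "?x \<in> UT N" by (intro UT_smult UT_one)
    have comm: "?x * A = A * ?x" if "A \<in> carrier_mat N N" for A
      using that by (simp add: mult_smult_assoc_mat[of _ N N _ N] mult_smult_distrib[of _ N N _ N] left_mult_one_mat[of _ N N] right_mult_one_mat[of _ N N])
    have "detE N E ?x = detE N (1\<^sub>m N - E) ?x"
      using detE_jumps[OF E xU comm[OF E(1)]] detE_jumps[OF _ idem_compl(1)[OF E] xU comm] J E(1) by simp
    moreover have hx: "h * ?x * g = ?x"
      using d by (simp add: mult_smult_assoc_mat[of _ N N _ N] mult_smult_distrib[of _ N N _ N] right_mult_one_mat[of _ N N])
    moreover have "detE N E (h * ?x * g) = detE N D ?x" unfolding E_def by (rule detE_conj[OF p bD(1)]) simp
    moreover have "detE N (1\<^sub>m N - E) (h * ?x * g) = detE N (1\<^sub>m N - D) ?x"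
      unfolding E_def conj_one_minus[OF p bD(1), symmetric] by (rule detE_conj[OF p]) (use bD(1) in simp_all)
    ultimately have "detE N D ?x = detE N (1\<^sub>m N - D) ?x" by simp
    moreover have "?x = blockdiag (2 \<cdot>\<^sub>m 1\<^sub>m m) (2 \<cdot>\<^sub>m 1\<^sub>m n)" unfolding N_def by (auto simp: blockdiag_def intro!: eq_matI)
    ultimately have "det (2 \<cdot>\<^sub>m 1\<^sub>m m :: complex mat) = det (2 \<cdot>\<^sub>m 1\<^sub>m n :: complex mat)"
      using bD_detE[of "2 \<cdot>\<^sub>m 1\<^sub>m m" "2 \<cdot>\<^sub>m 1\<^sub>m n"] by simp
    then have "(2 :: complex) ^ m = 2 ^ n" by simp
    then have "norm ((2 :: complex) ^ m) = norm ((2 :: complex) ^ n)" by simp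
    then have "(2 :: real) ^ m = 2 ^ n" unfolding norm_power by simp
    then show False using mn by simp
  qed
  from levi_GL_link[OF E this] x
  show "zlink N {y \<in> UT N. y * (h * D * g) = h * D * g * y \<and> detE N (h * D * g) y * detE N (1\<^sub>m N - h * D * g) y = 1} (1\<^sub>m N) x"
    by (simp add: E_def del: assoc_mult_mat)
qed

end

section \<open>Infinitesimal symplectic transformations in a Borel subalgebra\<close>

lemma skew_odd_det:
  assumes K: "K \<in> carrier_mat N N" "transpose_mat K = - (K :: complex mat)" and N: "odd N"
  shows "det K = 0"
proof -
  have "det K = det (transpose_mat K)" using K(1) by (rule det_transpose[symmetric])
  also have "\<dots> = det ((- 1) \<cdot>\<^sub>m K)" unfolding K(2) by (rule arg_cong[of _ _ det]) (auto intro!: eq_matI)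
  also have "\<dots> = - det K" using K(1) N by simp
  finally show ?thesis by simp
qed

text \<open>The kernel of a singular skew matrix of even size has dimension at least 2 and so meets
  the hyperplane of \<open>q\<close>. To see it, border \<open>K\<close> by \<open>q\<close> to a
  skew matrix of odd size, singular by \<open>skew_odd_det\<close>: its kernel vector gives
  \<open>y\<close>, or, if its last coordinate is nonzero, shows that \<open>q\<close> vanishes on
  the kernel of \<open>K\<close>.\<close>

lemma skew_kernel:
  assumes K: "K \<in> carrier_mat M M" "transpose_mat K = - (K :: complex mat)" and M: "even M"
    and d: "det K = 0" and q: "q \<in> carrier_vec M"
  shows "\<exists>y \<in> carrier_vec M. y \<noteq> 0\<^sub>v M \<and> K *\<^sub>v y = 0\<^sub>v M \<and> q \<bullet> y = 0"
proof -
  have Kij: "K $$ (j, i) = - K $$ (i, j)" if "i < M" "j < M" for i j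
    using arg_cong[OF K(2), of "\<lambda>A. A $$ (i, j)"] K(1) that by simp
  define W where "W = mat (Suc M) (Suc M) (\<lambda>(i, j). if i < M then if j < M then K $$ (i, j) else q $ i
    else if j < M then - (q $ j) else 0)"
  have W: "W \<in> carrier_mat (Suc M) (Suc M)" by (simp add: W_def)
  have "transpose_mat W = - W"
  proof (rule eq_matI)
    fix i j assume "i < dim_row (- W)" "j < dim_col (- W)"
    then show "transpose_mat W $$ (i, j) = (- W) $$ (i, j)"
      using Kij[of i j] by (simp add: W_def)
  qed (simp_all add: W_def)
  then have "det W = 0" using skew_odd_det[OF W] M by simp
  then obtain v where v: "v \<in> carrier_vec (Suc M)" "v \<noteq> 0\<^sub>v (Suc M)" "W *\<^sub>v v = 0\<^sub>v (Suc M)"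
    using det_0_iff_vec_prod_zero_field[OF W] by blast
  define y where "y = vec M (\<lambda>i. v $ i)"
  have y: "y \<in> carrier_vec M" by (simp add: y_def)
  have row: "(\<Sum>l<M. W $$ (i, l) * v $ l) + W $$ (i, M) * v $ M = 0" if "i < Suc M" for i
    using mult_vec_entry[OF W v(1) that] v(3) that by simp
  have Ky: "(K *\<^sub>v y) $ i + v $ M * q $ i = 0" if i: "i < M" for i
  proof -
    have "(K *\<^sub>v y) $ i = (\<Sum>l<M. W $$ (i, l) * v $ l)"
      unfolding mult_vec_entry[OF K(1) y i] by (rule sum.cong) (use i in \<open>auto simp: W_def y_def\<close>)
    then show ?thesis using row[of i] i by (simp add: W_def algebra_simps del: index_mult_mat_vec)
  qed
  have "q \<bullet> y = - (\<Sum>l<M. W $$ (M, l) * v $ l)"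
    unfolding scalar_prod_sum[OF y] sum_negf[symmetric] by (rule sum.cong) (auto simp: W_def y_def)
  then have qy: "q \<bullet> y = 0" using row[of M] by (simp add: W_def)
  show ?thesis
  proof (cases "v $ M = 0")
    case True
    have "y \<noteq> 0\<^sub>v M"
    proof
      assume y0: "y = 0\<^sub>v M"
      have "v $ i = 0" if "i < Suc M" for i
        using arg_cong[OF y0, of "\<lambda>u. u $ i"] that True by (cases "i < M") (auto simp: y_def less_Suc_eq)
      then have "v = 0\<^sub>v (Suc M)" using v(1) by (intro eq_vecI) auto
      then show False using v(2) by simp
    qed
    moreover have "K *\<^sub>v y = 0\<^sub>v M"
    proof (rule eq_vecI)
      fix i assume "i < dim_vec (0\<^sub>v M :: complex vec)"
      then show "(K *\<^sub>v y) $ i = 0\<^sub>v M $ i" using Ky[of i] True by (simp del: index_mult_mat_vec)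
    qed (use K in simp)
    ultimately show ?thesis using y qy by blast
  next
    case False
    obtain k where k: "k \<in> carrier_vec M" "k \<noteq> 0\<^sub>v M" "K *\<^sub>v k = 0\<^sub>v M"
      using det_0_iff_vec_prod_zero_field[OF K(1)] d by blast
    have "(K *\<^sub>v y) \<bullet> k = - (v $ M * (q \<bullet> k))"
    proof -
      have "(K *\<^sub>v y) \<bullet> k = (\<Sum>l<M. (K *\<^sub>v y) $ l * k $ l)" by (rule scalar_prod_sum[OF k(1)])
      also have "\<dots> = (\<Sum>l<M. - (v $ M) * (q $ l * k $ l))"
        by (rule sum.cong) (use Ky in \<open>auto simp: add_eq_0_iff2 simp del: index_mult_mat_vec\<close>)
      finally show ?thesis by (simp add: scalar_prod_sum[OF k(1)] sum_distrib_left sum_negf)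
    qed
    moreover have "(K *\<^sub>v y) \<bullet> k = 0"
    proof -
      have "(K *\<^sub>v y) \<bullet> k = (transpose_mat (transpose_mat K) *\<^sub>v y) \<bullet> k" by simp
      also have "\<dots> = y \<bullet> (transpose_mat K *\<^sub>v k)" by (rule transpose_vec_mult_scalar) (use K k y in auto)
      also have "transpose_mat K *\<^sub>v k = - (K *\<^sub>v k)" unfolding K(2) using K(1) k(1) by (intro eq_vecI) auto
      finally show ?thesis using k(3) y by simp
    qed
    ultimately show ?thesis using False k by auto
  qed
qed

section \<open>Traces and the pairing with strictly triangular matrices\<close>

definition mtrace :: "nat \<Rightarrow> complex mat \<Rightarrow> complex" where
  "mtrace N A = (\<Sum>i<N. A $$ (i, i))"

lemma mtrace_mult:
  assumes "A \<in> carrier_mat N N" "B \<in> carrier_mat N N"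
  shows "mtrace N (A * B) = (\<Sum>i<N. \<Sum>l<N. A $$ (i, l) * B $$ (l, i))"
  unfolding mtrace_def using mult_entry[OF assms] by (intro sum.cong) auto

lemma mtrace_comm:
  assumes "A \<in> carrier_mat N N" "B \<in> carrier_mat N N"
  shows "mtrace N (A * B) = mtrace N (B * A)"
  unfolding mtrace_mult[OF assms] mtrace_mult[OF assms(2,1)]
  by (subst sum.swap) (simp add: mult.commute)

lemma mtrace_conj:
  assumes p: "inv_pair N g h" and A: "A \<in> carrier_mat N N"
  shows "mtrace N (h * A * g) = mtrace N A"
proof -
  note d = inv_pairD[OF p]
  have "mtrace N (h * A * g) = mtrace N (g * (h * A))" using d A by (intro mtrace_comm) auto
  then show ?thesis using inv_pair_cancel(1)[OF p A] by simp
qed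

lemma mtrace_nilpotent:
  assumes B: "B \<in> carrier_mat M M" and ev: "\<And>c. det (B - c \<cdot>\<^sub>m 1\<^sub>m M) = 0 \<Longrightarrow> c = 0"
  shows "mtrace M B = 0"
proof -
  obtain g h where p: "inv_pair M g h" and U: "h * B * g \<in> UT M" using exists_triangularization[OF B] by blast
  note d = inv_pairD[OF p]
  have "(h * B * g) $$ (i, i) = 0" if i: "i < M" for i
  proof (rule ev)
    define c where "c = (h * B * g) $$ (i, i)"
    have "h * (B - c \<cdot>\<^sub>m 1\<^sub>m M) * g = h * B * g - c \<cdot>\<^sub>m (h * g)"
      using d(1,2) B by (simp add: minus_mult_distrib_mat[of _ M M _ _ M] mult_minus_distrib_mat[of _ M M _ M]
        mult_smult_assoc_mat[of _ M M _ M] mult_smult_distrib[of _ M M _ M] right_mult_one_mat[of _ M M])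
    then have e: "h * (B - c \<cdot>\<^sub>m 1\<^sub>m M) * g = h * B * g - c \<cdot>\<^sub>m 1\<^sub>m M" using d(4) by simp
    have Uc: "h * B * g - c \<cdot>\<^sub>m 1\<^sub>m M \<in> UT M" by (intro UT_diff U UT_smult UT_one)
    have "(h * B * g - c \<cdot>\<^sub>m 1\<^sub>m M) $$ (i, i) = 0" using i d B by (simp add: c_def del: index_mult_mat(1))
    then have "det (h * B * g - c \<cdot>\<^sub>m 1\<^sub>m M) = 0" unfolding UT_det[OF Uc] using i by (intro prod_zero) auto
    then show "det (B - (h * B * g) $$ (i, i) \<cdot>\<^sub>m 1\<^sub>m M) = 0"
      using det_conj[OF p, of "B - c \<cdot>\<^sub>m 1\<^sub>m M"] B e by (simp add: c_def del: index_mult_mat(1))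
  qed
  then have "mtrace M (h * B * g) = 0" by (simp add: mtrace_def del: index_mult_mat(1))
  then show ?thesis using mtrace_conj[OF p B] by simp
qed

text \<open>The strictly lower part as a vector, row after row: being triangular becomes the
  vanishing of a vector, so that \<open>separating_functional\<close> applies to matrices.\<close>

definition low :: "nat \<Rightarrow> complex mat \<Rightarrow> complex vec" where
  "low N Y = vec (N * N) (\<lambda>k. if k mod N < k div N then Y $$ (k div N, k mod N) else 0)"

text \<open>Trace duality: the coefficients of \<open>f\<close> are rearranged into a strictly upper
  triangular matrix.\<close>

lemma low_pairing:
  assumes Y: "Y \<in> carrier_mat N N"
  shows "f \<bullet> low N Y = mtrace N (mat N N (\<lambda>(j, i). if j < i then f $ (j + i * N) else 0) * Y)"
proof -
  let ?F = "mat N N (\<lambda>(j, i). if j < i then f $ (j + i * N) else 0)"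
  have "f \<bullet> low N Y = (\<Sum>k<N * N. f $ k * low N Y $ k)" by (rule scalar_prod_sum) (simp add: low_def)
  also have "\<dots> = (\<Sum>i<N. \<Sum>k\<in>{i * N..<i * N + N}. f $ k * low N Y $ k)" by (rule sum.nat_group[symmetric])
  also have "\<dots> = (\<Sum>i<N. \<Sum>j<N. ?F $$ (j, i) * Y $$ (i, j))"
  proof (rule sum.cong[OF refl])
    fix i assume "i \<in> {..<N}"
    then have i: "i < N" by simp
    have "(\<Sum>k\<in>{i * N..<i * N + N}. f $ k * low N Y $ k) = (\<Sum>j\<in>{0..<N}. f $ (j + i * N) * low N Y $ (j + i * N))"
      using sum.shift_bounds_nat_ivl[of "\<lambda>k. f $ k * low N Y $ k" 0 "i * N" N] by (simp add: add.commute)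
    also have "\<dots> = (\<Sum>j\<in>{0..<N}. ?F $$ (j, i) * Y $$ (i, j))"
    proof (rule sum.cong[OF refl])
      fix j assume "j \<in> {0..<N}"
      then have j: "j < N" by simp
      have "j + i * N < N + i * N" using j by simp
      also have "\<dots> = Suc i * N" by simp
      also have "\<dots> \<le> N * N" using i by (intro mult_right_mono) auto
      finally have "j + i * N < N * N" .
      then show "f $ (j + i * N) * low N Y $ (j + i * N) = ?F $$ (j, i) * Y $$ (i, j)"
        using i j by (simp add: low_def)
    qed
    finally show "(\<Sum>k\<in>{i * N..<i * N + N}. f $ k * low N Y $ k) = (\<Sum>j<N. ?F $$ (j, i) * Y $$ (i, j))"
      by (simp add: atLeast0LessThan)
  qed
  also have "\<dots> = (\<Sum>j<N. \<Sum>i<N. ?F $$ (j, i) * Y $$ (i, j))" by (rule sum.swap)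
  also have "\<dots> = mtrace N (?F * Y)" by (rule mtrace_mult[symmetric]) (use Y in auto)
  finally show ?thesis .
qed

lemma low_add: "X \<in> carrier_mat N N \<Longrightarrow> Y \<in> carrier_mat N N \<Longrightarrow> low N (X + Y) = low N X + low N Y"
  and low_smult: "X \<in> carrier_mat N N \<Longrightarrow> low N (c \<cdot>\<^sub>m X) = c \<cdot>\<^sub>v low N X"
proof -
  have md: "k div N < N" "k mod N < N" if "k < N * N" for k
  proof -
    show "k div N < N" using that by (rule less_mult_imp_div_less)
    have "N > 0" using that by (cases N) auto
    then show "k mod N < N" by simp
  qed
  show "X \<in> carrier_mat N N \<Longrightarrow> Y \<in> carrier_mat N N \<Longrightarrow> low N (X + Y) = low N X + low N Y"
    using md by (auto simp: low_def intro!: eq_vecI)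
  show "X \<in> carrier_mat N N \<Longrightarrow> low N (c \<cdot>\<^sub>m X) = c \<cdot>\<^sub>v low N X"
    using md by (auto simp: low_def intro!: eq_vecI)
qed

lemma low_UT:
  assumes X: "X \<in> carrier_mat N N" and z: "low N X = 0\<^sub>v (N * N)"
  shows "X \<in> UT N"
proof -
  have "X $$ (i, l) = 0" if "l < i" "i < N" for i l
  proof -
    have "l + i * N < N + i * N" using that by simp
    also have "\<dots> = Suc i * N" by simp
    also have "\<dots> \<le> N * N" using that by (intro mult_right_mono) auto
    finally have "l + i * N < N * N" .
    then show ?thesis using arg_cong[OF z, of "\<lambda>v. v $ (l + i * N)"] that by (simp add: low_def)
  qed
  then show ?thesis using X by (auto simp: UTc_def)
qed

text \<open>Extended by 0 on the line, unlike in \<open>Sp_ext_isom\<close>, where the extension is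
  by 1: a similitude multiplies the form by \<open>l^2\<close> but acts on the line by another power
  of \<open>l\<close>.\<close>

definition blkU :: "nat \<Rightarrow> complex mat \<Rightarrow> complex mat" where
  "blkU M \<Omega> = blockdiag \<Omega> (0\<^sub>m 1 1)"

definition prjL :: "nat \<Rightarrow> complex mat" where
  "prjL M = blockdiag (0\<^sub>m M M) (1\<^sub>m 1)"

text \<open>The Lie algebra of the embedded symplectic group.\<close>

definition inf_sp :: "nat \<Rightarrow> complex mat \<Rightarrow> complex mat set" where
  "inf_sp M \<Omega> = {X \<in> carrier_mat (M + 1) (M + 1). transpose_mat X * blkU M \<Omega> = - (blkU M \<Omega> * X) \<and>
     X * prjL M = 0\<^sub>m (M + 1) (M + 1) \<and> prjL M * X = 0\<^sub>m (M + 1) (M + 1)}"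

text \<open>If no \<open>X\<close> existed, some strictly upper triangular matrix would be orthogonal, for the trace form, to
  the symplectic algebra but not to \<open>prjL M\<close>. Its block on the symplectic space is then a product of two
  skew matrices, so its eigenvectors come in planes, and each plane contains an eigenvector of the whole
  matrix; hence the block is nilpotent, contradicting its trace \<open>- 1\<close>.\<close>

lemma exists_triangular_inf_sp:
  assumes \<Omega>: "\<Omega> \<in> carrier_mat M M" "transpose_mat \<Omega> = - \<Omega>" "det \<Omega> \<noteq> 0" and M: "even M"
    and p: "inv_pair (M + 1) g h"
  shows "\<exists>X \<in> inf_sp M \<Omega>. h * (prjL M - X) * g \<in> UT (M + 1)"
proof (rule ccontr)
  assume no: "\<not> ?thesis"
  define N where "N = M + 1"
  define C where "C = prjL M"
  define \<Omega>' where "\<Omega>' = blkU M \<Omega>"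
  have p: "inv_pair N g h" using p by (simp add: N_def)
  note d = inv_pairD[OF p]
  have C: "C \<in> carrier_mat N N" unfolding C_def prjL_def N_def by (rule blockdiag_carrier) auto
  have \<Omega>': "\<Omega>' \<in> carrier_mat N N" unfolding \<Omega>'_def blkU_def N_def using \<Omega> by (intro blockdiag_carrier) auto
  let ?S = "inf_sp M \<Omega>"
  have S: "X \<in> ?S \<longleftrightarrow> X \<in> carrier_mat N N \<and> transpose_mat X * \<Omega>' = - (\<Omega>' * X) \<and> X * C = 0\<^sub>m N N \<and> C * X = 0\<^sub>m N N" for X
    by (simp add: inf_sp_def N_def C_def \<Omega>'_def)
  \<comment> \<open>Triangularity of \<open>h * (C - X) * g\<close> means \<open>T C = T X\<close>,
    so the negated claim says that \<open>T C\<close> lies outside the image of the symplectic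
    algebra.\<close>
  define T where "T X = low N (h * X * g)" for X
  have T: "T X \<in> carrier_vec (N * N)" for X by (simp add: T_def low_def)
  have Tadd: "T (X + Y) = T X + T Y" if "X \<in> carrier_mat N N" "Y \<in> carrier_mat N N" for X Y
  proof -
    have "h * (X + Y) * g = h * X * g + h * Y * g"
      using d(1,2) that by (simp add: add_mult_distrib_mat[of _ N N _ _ N] mult_add_distrib_mat[of _ N N _ N])
    then show ?thesis unfolding T_def using low_add[of "h * X * g" N "h * Y * g"] d(1,2) that by simp
  qed
  have Tsm: "T (c \<cdot>\<^sub>m X) = c \<cdot>\<^sub>v T X" if "X \<in> carrier_mat N N" for c X
  proof -
    have "h * (c \<cdot>\<^sub>m X) * g = c \<cdot>\<^sub>m (h * X * g)"
      using d(1,2) that by (simp add: mult_smult_assoc_mat[of _ N N _ N] mult_smult_distrib[of _ N N _ N])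
    then show ?thesis unfolding T_def using low_smult[of "h * X * g" N c] d(1,2) that by simp
  qed
  have Sadd: "X + Y \<in> ?S" if X: "X \<in> ?S" and Y: "Y \<in> ?S" for X Y
  proof -
    have k: "X \<in> carrier_mat N N" "Y \<in> carrier_mat N N" using X Y S by auto
    have "transpose_mat (X + Y) * \<Omega>' = - (\<Omega>' * X) + - (\<Omega>' * Y)"
      using X Y k \<Omega>' by (simp add: S transpose_add[of _ N N] add_mult_distrib_mat[of _ N N _ _ N])
    also have "\<dots> = - (\<Omega>' * (X + Y))"
      using k \<Omega>' by (auto simp: mult_add_distrib_mat[of _ N N _ N] intro!: eq_matI simp del: index_mult_mat(1))
    finally show ?thesis using X Y k C by (simp add: S add_mult_distrib_mat[of _ N N _ _ N] mult_add_distrib_mat[of _ N N _ N])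
  qed
  have Ssm: "c \<cdot>\<^sub>m X \<in> ?S" if X: "X \<in> ?S" for c X
  proof -
    have k: "X \<in> carrier_mat N N" using X S by auto
    have "transpose_mat (c \<cdot>\<^sub>m X) = c \<cdot>\<^sub>m transpose_mat X" by (auto intro!: eq_matI)
    then have "transpose_mat (c \<cdot>\<^sub>m X) * \<Omega>' = c \<cdot>\<^sub>m - (\<Omega>' * X)"
      using X k \<Omega>' by (simp add: S mult_smult_assoc_mat[of _ N N _ N])
    also have "\<dots> = - (\<Omega>' * (c \<cdot>\<^sub>m X))"
      using k \<Omega>' by (auto simp: mult_smult_distrib[of _ N N _ N] intro!: eq_matI simp del: index_mult_mat(1))
    finally show ?thesis using X k C
      by (auto simp: S mult_smult_assoc_mat[of _ N N _ N] mult_smult_distrib[of _ N N _ N])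
  qed
  have S0: "0\<^sub>m N N \<in> ?S" using C \<Omega>' by (auto simp: S intro!: eq_matI)
  have "lin_sub (N * N) (T ` ?S)"
    unfolding lin_sub_def
  proof (intro conjI ballI allI)
    show "T ` ?S \<subseteq> carrier_vec (N * N)" using T by blast
    have "T (0\<^sub>m N N) = 0\<^sub>v (N * N)"
    proof -
      have "T (0 \<cdot>\<^sub>m 0\<^sub>m N N) = 0\<^sub>v (N * N)" unfolding Tsm[OF zero_carrier_mat] by (auto simp: T_def low_def intro!: eq_vecI)
      moreover have "0 \<cdot>\<^sub>m 0\<^sub>m N N = (0\<^sub>m N N :: complex mat)" by (auto intro!: eq_matI)
      ultimately show ?thesis by simp
    qed
    then show "0\<^sub>v (N * N) \<in> T ` ?S" using S0 by force
    fix u v assume "u \<in> T ` ?S" "v \<in> T ` ?S"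
    then obtain X Y where k: "u = T X" "v = T Y" "X \<in> ?S" "Y \<in> ?S" by blast
    then have "u + v = T (X + Y)" using Tadd[of X Y] S by simp
    then show "u + v \<in> T ` ?S" using Sadd k by blast
  next
    fix c u assume "u \<in> T ` ?S"
    then obtain X where k: "u = T X" "X \<in> ?S" by blast
    then have "c \<cdot>\<^sub>v u = T (c \<cdot>\<^sub>m X)" using Tsm[of X c] S by simp
    then show "c \<cdot>\<^sub>v u \<in> T ` ?S" using Ssm k by blast
  qed
  moreover have "T C \<notin> T ` ?S"
  proof
    assume "T C \<in> T ` ?S"
    then obtain X where X: "X \<in> ?S" "T C = T X" by blast
    have k: "X \<in> carrier_mat N N" using X S by auto
    have m: "C - X = C + (- 1) \<cdot>\<^sub>m X" using C k by (auto intro!: eq_matI)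
    have "T (C - X) = T X + (- 1) \<cdot>\<^sub>v T X" unfolding m using Tadd[of C "(- 1) \<cdot>\<^sub>m X"] Tsm[OF k] C k X(2) by simp
    then have "low N (h * (C - X) * g) = 0\<^sub>v (N * N)" using T[of X] by (auto simp: T_def intro!: eq_vecI)
    then have "h * (C - X) * g \<in> UT N" using d C k by (intro low_UT) auto
    then show False using no X(1) by (auto simp: N_def C_def)
  qed
  ultimately obtain f where f: "f \<bullet> T C = 1" "\<And>X. X \<in> ?S \<Longrightarrow> f \<bullet> T X = 0"
    by (rule separating_functional[OF _ T]) (metis imageI)
  \<comment> \<open>The separating functional becomes the trace pairing with \<open>Y\<close>, a
    conjugate of this strictly upper triangular matrix.\<close>
  define R where "R = mat N N (\<lambda>(j, i). if j < i then f $ (j + i * N) else 0)"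
  have R: "R \<in> carrier_mat N N" by (simp add: R_def)
  define Y where "Y = g * R * h"
  have Y: "Y \<in> carrier_mat N N" using d R by (simp add: Y_def)
  have fT: "f \<bullet> T X = mtrace N (Y * X)" if X: "X \<in> carrier_mat N N" for X
  proof -
    have "f \<bullet> T X = mtrace N (R * (h * X * g))"
      unfolding T_def R_def by (rule low_pairing) (use d X in simp)
    also have "R * (h * X * g) = (R * h * X) * g" using d(1,2) R X by (simp add: assoc_mult_mat[of _ N N _ N _ N])
    also have "mtrace N \<dots> = mtrace N (g * (R * h * X))" using d(1,2) R X by (intro mtrace_comm) auto
    also have "g * (R * h * X) = Y * X" unfolding Y_def using d(1,2) R X by (simp add: assoc_mult_mat[of _ N N _ N _ N])
    finally show ?thesis .
  qed
  have Cij: "C $$ (i, j) = (if i = M \<and> j = M then 1 else 0)" if "i < N" "j < N" for i j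
    unfolding C_def prjL_def using that N_def by (simp add: blockdiag_index[of _ M _ 1])
  have "mtrace N (Y * C) = (\<Sum>i<N. \<Sum>l<N. if l = M then if i = M then Y $$ (M, M) else 0 else 0)"
    unfolding mtrace_mult[OF Y C] by (intro sum.cong) (auto simp: Cij)
  then have YM: "Y $$ (M, M) = 1" using f(1) fT[OF C] by (simp add: N_def)
  obtain \<Psi> where \<Psi>: "inv_pair M \<Omega> \<Psi>" using inv_pair_adj[OF \<Omega>(1,3)] by blast
  note o = inv_pairD[OF \<Psi>]
  have "transpose_mat (\<Psi> * \<Omega>) = 1\<^sub>m M" unfolding o(4) by simp
  then have "- \<Omega> * transpose_mat \<Psi> = 1\<^sub>m M" using o(1,2) \<Omega>(2) by (simp add: transpose_mult[of _ M M _ M])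
  then have "\<Omega> * (- transpose_mat \<Psi>) = 1\<^sub>m M" using o(1,2) by simp
  then have "- transpose_mat \<Psi> = \<Psi>" using inv_pair_unique[OF \<Psi>, of "- transpose_mat \<Psi>"] o(1,2) by simp
  then have \<Psi>t: "transpose_mat \<Psi> = - \<Psi>" by (metis uminus_uminus_mat)
  define B where "B = ul M Y"
  have B: "B \<in> carrier_mat M M" by (simp add: B_def)
  have Bij: "B $$ (i, j) = Y $$ (i, j)" if "i < M" "j < M" for i j using that by (simp add: B_def ul_def)
  \<comment> \<open>Products of \<Psi>, the inverse of \<Omega>, with symmetric matrices
    \<open>Z\<close> are infinitesimal symplectic transformations.\<close>
  have trBZ: "mtrace M (B * \<Psi> * Z) = 0" if Z: "Z \<in> carrier_mat M M" "transpose_mat Z = Z" for Z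
  proof -
    define X where "X = blockdiag (\<Psi> * Z) (0\<^sub>m 1 1)"
    have X: "X \<in> carrier_mat N N" unfolding X_def N_def using o Z by (intro blockdiag_carrier) auto
    have "transpose_mat (\<Psi> * Z) * \<Omega> = Z * (- (\<Psi> * \<Omega>))"
      using o(1,2) Z by (simp add: transpose_mult[of _ M M _ M] \<Psi>t)
    also have "\<dots> = - Z" unfolding o(4) using Z by simp
    finally have 1: "transpose_mat (\<Psi> * Z) * \<Omega> = - Z" .
    have 2: "\<Omega> * (\<Psi> * Z) = Z" by (rule inv_pair_cancel(1)[OF \<Psi> Z(1)])
    have PZ: "\<Psi> * Z \<in> carrier_mat M M" using o Z by simp
    have "transpose_mat X * \<Omega>' = blockdiag (- Z) (0\<^sub>m 1 1)"
      unfolding X_def \<Omega>'_def blkU_def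
      using blockdiag_transpose[OF PZ zero_carrier_mat[of 1 1]] blockdiag_mult[of "transpose_mat (\<Psi> * Z)" M "0\<^sub>m 1 1" 1 \<Omega> "0\<^sub>m 1 1"]
        PZ o(1) 1 by simp
    also have "\<dots> = - blockdiag Z (0\<^sub>m 1 1)" using Z by (auto simp: blockdiag_def intro!: eq_matI)
    also have "blockdiag Z (0\<^sub>m 1 1) = \<Omega>' * X"
      unfolding X_def \<Omega>'_def blkU_def using blockdiag_mult[OF o(1) zero_carrier_mat PZ zero_carrier_mat, of 1] 2 by simp
    finally have 3: "transpose_mat X * \<Omega>' = - (\<Omega>' * X)" .
    have z: "blockdiag (0\<^sub>m M M) (0\<^sub>m 1 1) = (0\<^sub>m N N)" unfolding N_def by (auto simp: blockdiag_def intro!: eq_matI)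
    have "X * C = 0\<^sub>m N N" "C * X = 0\<^sub>m N N"
      unfolding X_def C_def prjL_def
      using blockdiag_mult[OF PZ zero_carrier_mat[of 1 1] zero_carrier_mat one_carrier_mat]
        blockdiag_mult[OF zero_carrier_mat one_carrier_mat PZ zero_carrier_mat[of 1 1]] 
        right_mult_zero_mat[OF PZ, of M] left_mult_zero_mat[OF PZ, of M] z by simp_all
    with 3 X have "X \<in> ?S" by (simp add: S)
    then have "mtrace N (Y * X) = 0" using f(2) fT[OF X] by simp
    moreover have Xij: "X $$ (i, j) = (if i < M \<and> j < M then (\<Psi> * Z) $$ (i, j) else 0)" if "i < Suc M" "j < Suc M" for i j
      unfolding X_def using blockdiag_index[OF PZ zero_carrier_mat[of 1 1], of i j] that by (simp del: index_mult_mat(1))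
    have "mtrace N (Y * X) = mtrace M (B * (\<Psi> * Z))"
      unfolding mtrace_mult[OF Y X] mtrace_mult[OF B PZ]
      using Xij by (simp add: N_def Bij del: index_mult_mat(1))
    ultimately show ?thesis using B o Z by (simp add: assoc_mult_mat[of _ M M _ M _ M])
  qed
  \<comment> \<open>Orthogonality to the symmetric matrices with ones at \<open>(a, b)\<close> and
    \<open>(b, a)\<close> makes this product skew.\<close>
  define P where "P = B * \<Psi>"
  have P: "P \<in> carrier_mat M M" using B o by (simp add: P_def)
  have Pskew: "P $$ (b, a) = - P $$ (a, b)" if ab: "a < M" "b < M" for a b
  proof -
    define Z where "Z = mat M M (\<lambda>(i, j). (if i = a \<and> j = b then 1 else 0) + (if i = b \<and> j = a then 1 else (0 :: complex)))"
    have Zc: "Z \<in> carrier_mat M M" by (simp add: Z_def)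
    have "transpose_mat Z = Z"
      by (rule eq_matI) (simp_all add: Z_def add.commute conj_commute)
    note Z = Zc this
    have "0 = mtrace M (P * Z)" using trBZ[OF Z] by (simp add: P_def)
    also have "\<dots> = (\<Sum>i<M. \<Sum>l<M. (if l = a then if i = b then P $$ (b, a) else 0 else 0) + (if l = b then if i = a then P $$ (a, b) else 0 else 0))"
      unfolding mtrace_mult[OF P Z(1)] by (intro sum.cong refl) (auto simp: Z_def)
    also have "\<dots> = P $$ (b, a) + P $$ (a, b)" using ab by (simp add: sum.distrib)
    finally show ?thesis by (simp add: eq_neg_iff_add_eq_0)
  qed
  have Nd: "det (R - c \<cdot>\<^sub>m 1\<^sub>m N) \<noteq> 0" if "c \<noteq> 0" for c
  proof -
    have U: "R - c \<cdot>\<^sub>m 1\<^sub>m N \<in> UT N" by (intro UT_diff UT_smult UT_one) (auto simp: R_def UTc_def)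
    have "det (R - c \<cdot>\<^sub>m 1\<^sub>m N) = (\<Prod>i<N. - c)" unfolding UT_det[OF U] by (rule prod.cong) (auto simp: R_def)
    then show ?thesis using that by simp
  qed
  have "mtrace M B = 0"
  proof (rule mtrace_nilpotent[OF B], rule ccontr)
    fix c assume c: "det (B - c \<cdot>\<^sub>m 1\<^sub>m M) = 0" "c \<noteq> 0"
    \<comment> \<open>Both \<open>B * \<Psi>\<close> and \<Psi> are skew, so for an eigenvalue
      \<open>c\<close> of \<open>B\<close> this is a singular skew matrix of even size.\<close>
    define K where "K = P - c \<cdot>\<^sub>m \<Psi>"
    have K: "K \<in> carrier_mat M M" using P o by (simp add: K_def)
    have Ke: "K = (B - c \<cdot>\<^sub>m 1\<^sub>m M) * \<Psi>"
      unfolding K_def P_def using B o(1,2) by (simp add: minus_mult_distrib_mat[of _ M M _ _ M] mult_smult_assoc_mat[of _ M M _ M] left_mult_one_mat[of _ M M])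
    have "det K = 0" unfolding Ke using c(1) B o(2) by (simp add: det_mult[of _ M])
    moreover have "transpose_mat K = - K"
    proof (rule eq_matI)
      fix i j assume "i < dim_row (- K)" "j < dim_col (- K)"
      then have ij: "i < M" "j < M" using K by auto
      have "\<Psi> $$ (j, i) = - \<Psi> $$ (i, j)" using arg_cong[OF \<Psi>t, of "\<lambda>A. A $$ (i, j)"] o ij by simp
      then show "transpose_mat K $$ (i, j) = (- K) $$ (i, j)" using ij K P o Pskew[of i j] by (simp add: K_def)
    qed (use K in auto)
    \<comment> \<open>The last row of \<open>Y\<close> on the symplectic space. An eigenvector of
      \<open>B\<close> annihilated by it becomes an eigenvector of \<open>Y\<close> after extension
      by zero, impossible for nilpotent \<open>Y\<close> and nonzero \<open>c\<close>.\<close>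
    moreover define q where "q = vec M (\<lambda>j. Y $$ (M, j))"
    have q: "q \<in> carrier_vec M" by (simp add: q_def)
    moreover have "transpose_mat \<Psi> *\<^sub>v q \<in> carrier_vec M" using o q by (intro mult_mat_vec_carrier[of _ M M]) auto
    ultimately obtain y where y: "y \<in> carrier_vec M" "y \<noteq> 0\<^sub>v M" "K *\<^sub>v y = 0\<^sub>v M" "(transpose_mat \<Psi> *\<^sub>v q) \<bullet> y = 0"
      using skew_kernel[OF K _ M, of "transpose_mat \<Psi> *\<^sub>v q"] by blast
    define w where "w = \<Psi> *\<^sub>v y"
    have w: "w \<in> carrier_vec M" unfolding w_def using o y by (intro mult_mat_vec_carrier) auto
    have w0: "w \<noteq> 0\<^sub>v M"
    proof
      assume "w = 0\<^sub>v M"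
      then have "\<Omega> *\<^sub>v w = 0\<^sub>v M" using mult_zero_vec[OF o(1)] by simp
      then show False using inv_pair_cancel_vec(1)[OF \<Psi> y(1)] y(2) by (simp add: w_def)
    qed
    have qw: "q \<bullet> w = 0" using y(4) transpose_vec_mult_scalar[OF o(2) y(1) q] by (simp add: w_def)
    have "(B - c \<cdot>\<^sub>m 1\<^sub>m M) *\<^sub>v w = 0\<^sub>v M"
      using y(3) B o y(1) unfolding Ke w_def by (simp add: assoc_mult_mat_vec[of _ M M _ M])
    then have Bw: "(B *\<^sub>v w) $ i = c * w $ i" if "i < M" for i
    proof -
      have "((B - c \<cdot>\<^sub>m 1\<^sub>m M) *\<^sub>v w) = B *\<^sub>v w - c \<cdot>\<^sub>v w"
        using B w by (simp add: minus_mult_distrib_mat_vec[of _ M M] smult_mat_vec[of _ M M])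
      then have "(B *\<^sub>v w - c \<cdot>\<^sub>v w) $ i = 0\<^sub>v M $ i" using \<open>(B - c \<cdot>\<^sub>m 1\<^sub>m M) *\<^sub>v w = 0\<^sub>v M\<close> by simp
      then show ?thesis using that w B by (simp del: index_mult_mat_vec)
    qed
    define v where "v = vec N (\<lambda>i. if i < M then w $ i else 0)"
    have v: "v \<in> carrier_vec N" by (simp add: v_def)
    have Yv: "Y *\<^sub>v v = c \<cdot>\<^sub>v v"
    proof (rule eq_vecI)
      fix i assume "i < dim_vec (c \<cdot>\<^sub>v v)"
      then have i: "i < N" using v by simp
      have "(Y *\<^sub>v v) $ i = (\<Sum>l<N. Y $$ (i, l) * v $ l)" by (rule mult_vec_entry[OF Y v i])
      also have "\<dots> = (\<Sum>l<M. Y $$ (i, l) * w $ l)" by (simp add: N_def v_def)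
      also have "\<dots> = c * v $ i"
      proof (cases "i < M")
        case True
        then have "(\<Sum>l<M. Y $$ (i, l) * w $ l) = (B *\<^sub>v w) $ i"
          unfolding mult_vec_entry[OF B w True] by (intro sum.cong) (auto simp: Bij)
        then show ?thesis using Bw[OF True] True by (simp add: v_def N_def)
      next
        case False
        then have "i = M" using i by (simp add: N_def)
        then have "(\<Sum>l<M. Y $$ (i, l) * w $ l) = q \<bullet> w"
          unfolding scalar_prod_sum[OF w] by (intro sum.cong) (auto simp: q_def)
        then show ?thesis using qw \<open>i = M\<close> by (simp add: v_def N_def)
      qed
      finally show "(Y *\<^sub>v v) $ i = (c \<cdot>\<^sub>v v) $ i" using i v by simp
    qed (use Y v in auto)
    define u where "u = h *\<^sub>v v"
    have u: "u \<in> carrier_vec N" unfolding u_def using d v by (intro mult_mat_vec_carrier) auto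
    have gu: "g *\<^sub>v u = v" unfolding u_def by (rule inv_pair_cancel_vec(1)[OF p v])
    have u0: "u \<noteq> 0\<^sub>v N"
    proof
      assume "u = 0\<^sub>v N"
      then have v0: "v = 0\<^sub>v N" using gu mult_zero_vec[OF d(1)] by simp
      have "w $ i = 0" if "i < M" for i using arg_cong[OF v0, of "\<lambda>x. x $ i"] that by (simp add: v_def N_def)
      then have "w = 0\<^sub>v M" using w by (intro eq_vecI) auto
      then show False using w0 by simp
    qed
    have hYg: "h * Y * g = R" unfolding Y_def by (rule conj_conj[OF inv_pair_sym[OF p] R])
    have "R *\<^sub>v u = h *\<^sub>v (Y *\<^sub>v (g *\<^sub>v u))"
      unfolding hYg[symmetric] using d(1,2) Y u by (simp add: assoc_mult_mat_vec[of _ N N _ N])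
    also have "\<dots> = c \<cdot>\<^sub>v u" unfolding gu Yv using mult_mat_vec[OF d(2) v, of c] by (simp add: u_def)
    finally have "(R - c \<cdot>\<^sub>m 1\<^sub>m N) *\<^sub>v u = 0\<^sub>v N"
      using R u by (auto simp: minus_mult_distrib_mat_vec[of _ N N] smult_mat_vec[of _ N N] intro!: eq_vecI)
    moreover have "R - c \<cdot>\<^sub>m 1\<^sub>m N \<in> carrier_mat N N" using R by simp
    ultimately have "det (R - c \<cdot>\<^sub>m 1\<^sub>m N) = 0" using det_0_iff_vec_prod_zero_field u u0 by blast
    then show False using Nd c(2) by blast
  qed
  moreover have "mtrace N Y = 0"
  proof -
    have "mtrace N Y = mtrace N R" unfolding Y_def by (rule mtrace_conj[OF inv_pair_sym[OF p] R])
    then show ?thesis by (simp add: mtrace_def R_def)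
  qed
  moreover have "mtrace N Y = mtrace M B + Y $$ (M, M)" by (simp add: mtrace_def N_def Bij)
  ultimately show False using YM by simp
qed

section \<open>Symplectic similitudes of determinant one\<close>

lemma parabolically_connected_link:
  assumes H: "parabolically_connected N (SL N) H" and p: "inv_pair N g h" and x: "x \<in> H" "h * x * g \<in> UT N"
  shows "zlink N {x \<in> H. h * x * g \<in> UT N} (1\<^sub>m N) x"
proof -
  have m: "mgroup N H" using H by (simp add: parabolically_connected_def closed_subgroup_iff)
  have "parabolic_subgroup N (SL N) (Bor N g h)"
    using borel_subgroup_Bor[OF p] Bor_closed_subgroup[OF p] by (auto simp: parabolic_subgroup_def)
  then have "zariski_connected N (Bor N g h \<inter> H)" using H by (simp add: parabolically_connected_def)
  moreover have "1\<^sub>m N \<in> Bor N g h \<inter> H" using mgroupD(3)[OF m] mgroupD(3)[OF Bor_mgroup[OF p]] by simp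
  moreover have "x \<in> Bor N g h \<inter> H" using mgroupD(1,2)[OF m x(1)] x by (simp add: Bor_def SL_def)
  ultimately have "zlink N (Bor N g h \<inter> H) (1\<^sub>m N) x" by (rule zariski_connected_imp_zlink)
  then show ?thesis by (rule zlink_mono) (auto simp: Bor_def)
qed

text \<open>For even \<open>M\<close> and nonzero \<open>l\<close>, the coset of the symplectic
  group containing the torus element with parameter \<open>l\<close>: the multiplier is
  \<open>l^2\<close>, and the action on the line makes the determinant 1. The cosets of
  \<open>l\<close> and \<open>-l\<close> coincide.\<close>

definition sim :: "nat \<Rightarrow> complex mat \<Rightarrow> complex \<Rightarrow> complex mat set" where
  "sim M \<Omega> l = {x \<in> carrier_mat (M + 1) (M + 1). transpose_mat x * blkU M \<Omega> * x = (l * l) \<cdot>\<^sub>m blkU M \<Omega> \<and>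
     x * prjL M = inverse l ^ M \<cdot>\<^sub>m prjL M \<and> prjL M * x = inverse l ^ M \<cdot>\<^sub>m prjL M}"

lemma blkU_carrier: "\<Omega> \<in> carrier_mat M M \<Longrightarrow> blkU M \<Omega> \<in> carrier_mat (M + 1) (M + 1)"
  unfolding blkU_def by (rule blockdiag_carrier) auto

lemma prjL_carrier: "prjL M \<in> carrier_mat (M + 1) (M + 1)"
  unfolding prjL_def by (rule blockdiag_carrier) auto

lemma prjL_idem: "prjL M * prjL M = prjL M"
  unfolding prjL_def by (simp add: blockdiag_mult[of _ M _ 1])

lemma prjL_blkU: "\<Omega> \<in> carrier_mat M M \<Longrightarrow> blkU M \<Omega> * prjL M = 0\<^sub>m (M + 1) (M + 1)"
  "\<Omega> \<in> carrier_mat M M \<Longrightarrow> transpose_mat (prjL M) * blkU M \<Omega> = 0\<^sub>m (M + 1) (M + 1)"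
proof -
  assume \<Omega>: "\<Omega> \<in> carrier_mat M M"
  have z: "blockdiag (0\<^sub>m M M) (0\<^sub>m 1 1) = 0\<^sub>m (M + 1) (M + 1)" by (auto simp: blockdiag_def intro!: eq_matI)
  show "blkU M \<Omega> * prjL M = 0\<^sub>m (M + 1) (M + 1)"
    unfolding prjL_def blkU_def z[symmetric] using \<Omega> by (simp add: blockdiag_mult[of _ M _ 1])
  show "transpose_mat (prjL M) * blkU M \<Omega> = 0\<^sub>m (M + 1) (M + 1)"
    unfolding prjL_def blkU_def z[symmetric] using \<Omega>
    by (simp add: blockdiag_mult[of _ M _ 1] blockdiag_transpose[of _ M _ 1])
qed

lemma sim_mult:
  assumes \<Omega>: "\<Omega> \<in> carrier_mat M M" and x: "x \<in> sim M \<Omega> l" and y: "y \<in> sim M \<Omega> k"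
  shows "x * y \<in> sim M \<Omega> (l * k)"
proof -
  define N where "N = M + 1"
  define C F where "C = prjL M" and "F = blkU M \<Omega>"
  have c: "C \<in> carrier_mat N N" "F \<in> carrier_mat N N" using prjL_carrier blkU_carrier[OF \<Omega>] by (auto simp: C_def F_def N_def)
  have X: "x \<in> carrier_mat N N" "transpose_mat x * F * x = (l * l) \<cdot>\<^sub>m F" "x * C = inverse l ^ M \<cdot>\<^sub>m C" "C * x = inverse l ^ M \<cdot>\<^sub>m C"
    and Y: "y \<in> carrier_mat N N" "transpose_mat y * F * y = (k * k) \<cdot>\<^sub>m F" "y * C = inverse k ^ M \<cdot>\<^sub>m C" "C * y = inverse k ^ M \<cdot>\<^sub>m C"
    using x y by (auto simp: sim_def C_def F_def N_def)
  have "transpose_mat (x * y) * F * (x * y) = transpose_mat y * (transpose_mat x * F * x) * y"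
    using c X(1) Y(1) by (simp add: transpose_mult[of _ N N _ N] assoc_mult_mat[of _ N N _ N _ N])
  also have "\<dots> = (l * l) \<cdot>\<^sub>m (transpose_mat y * F * y)"
    unfolding X(2) using c Y(1) by (simp add: mult_smult_assoc_mat[of _ N N _ N] mult_smult_distrib[of _ N N _ N])
  finally have 1: "transpose_mat (x * y) * F * (x * y) = (l * k * (l * k)) \<cdot>\<^sub>m F"
    unfolding Y(2) smult_smult_mat by (simp add: ac_simps)
  have "x * y * C = x * (y * C)" using c X(1) Y(1) by (simp add: assoc_mult_mat[of _ N N _ N _ N])
  also have "\<dots> = inverse (l * k) ^ M \<cdot>\<^sub>m C"
    unfolding Y(3) using c X(1) by (simp add: mult_smult_distrib[of _ N N _ N] X(3) smult_smult_mat power_mult_distrib ac_simps)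
  finally have 2: "x * y * C = inverse (l * k) ^ M \<cdot>\<^sub>m C" .
  have "C * (x * y) = C * x * y" using c X(1) Y(1) by (simp add: assoc_mult_mat[of _ N N _ N _ N])
  also have "\<dots> = inverse (l * k) ^ M \<cdot>\<^sub>m C"
    unfolding X(4) using c Y(1) by (simp add: mult_smult_assoc_mat[of _ N N _ N] Y(4) smult_smult_mat power_mult_distrib ac_simps)
  finally have 3: "C * (x * y) = inverse (l * k) ^ M \<cdot>\<^sub>m C" .
  show ?thesis using 1 2 3 X(1) Y(1) by (simp add: sim_def C_def F_def N_def del: assoc_mult_mat)
qed

lemma sim_iff:
  assumes \<Omega>: "\<Omega> \<in> carrier_mat M M"
  shows "x \<in> sim M \<Omega> l \<longleftrightarrow> (\<exists>A \<in> carrier_mat M M. x = blockdiag A (mat 1 1 (\<lambda>_. inverse l ^ M)) \<and>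
    transpose_mat A * \<Omega> * A = (l * l) \<cdot>\<^sub>m \<Omega>)"
proof -
  have c1: "mat 1 1 f \<in> carrier_mat 1 1" for f :: "nat \<times> nat \<Rightarrow> complex" by simp
  have sm: "k \<cdot>\<^sub>m blkU M \<Omega> = blockdiag (k \<cdot>\<^sub>m \<Omega>) (0\<^sub>m 1 1)" "k \<cdot>\<^sub>m prjL M = blockdiag (0\<^sub>m M M) (mat 1 1 (\<lambda>_. k))" for k
    using \<Omega> by (auto simp: blkU_def prjL_def blockdiag_def intro!: eq_matI)
  have bl: "transpose_mat (blockdiag A B) * blkU M \<Omega> * blockdiag A B = blockdiag (transpose_mat A * \<Omega> * A) (0\<^sub>m 1 1)"
    "blockdiag A B * prjL M = blockdiag (0\<^sub>m M M) B" "prjL M * blockdiag A B = blockdiag (0\<^sub>m M M) B"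
    if "A \<in> carrier_mat M M" "B \<in> carrier_mat 1 1" for A B
    using that \<Omega> by (simp_all add: blkU_def prjL_def blockdiag_mult[of _ M _ 1] blockdiag_transpose[of _ M _ 1])
  show ?thesis
  proof
    assume x: "x \<in> sim M \<Omega> l"
    have xc: "x \<in> carrier_mat (M + 1) (M + 1)" and xC: "x * prjL M = prjL M * x" using x by (auto simp: sim_def)
    have D: "1\<^sub>m (M + 1) - prjL M = blockdiag (1\<^sub>m M) (0\<^sub>m 1 1)" by (auto simp: prjL_def blockdiag_def intro!: eq_matI)
    have "x \<in> levi (M + 1) (blockdiag (1\<^sub>m M) (0\<^sub>m 1 1)) (\<lambda>_ _. True)"
      using compl_commute[OF prjL_carrier xc xC] xc unfolding D levi_def by blast
    then obtain A B where AB: "x = blockdiag A B" "A \<in> carrier_mat M M" "B \<in> carrier_mat 1 1"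
      unfolding levi_blockdiag by auto
    have "blockdiag (0\<^sub>m M M) B = blockdiag (0\<^sub>m M M) (mat 1 1 (\<lambda>_. inverse l ^ M))"
      using x bl(2)[OF AB(2,3)] unfolding AB(1) sim_def sm by simp
    then have B: "B = mat 1 1 (\<lambda>_. inverse l ^ M)" using blockdiag_inject(2)[OF zero_carrier_mat AB(3) zero_carrier_mat c1] by blast
    have "blockdiag (transpose_mat A * \<Omega> * A) (0\<^sub>m 1 1) = blockdiag ((l * l) \<cdot>\<^sub>m \<Omega>) (0\<^sub>m 1 1)"
      using x bl(1)[OF AB(2,3)] unfolding AB(1) sim_def sm by simp
    then have "transpose_mat A * \<Omega> * A = (l * l) \<cdot>\<^sub>m \<Omega>"
      using blockdiag_inject(1)[of "transpose_mat A * \<Omega> * A" M "0\<^sub>m 1 1" 1 "(l * l) \<cdot>\<^sub>m \<Omega>" "0\<^sub>m 1 1"] AB(2) \<Omega> by simp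
    then show "\<exists>A \<in> carrier_mat M M. x = blockdiag A (mat 1 1 (\<lambda>_. inverse l ^ M)) \<and>
      transpose_mat A * \<Omega> * A = (l * l) \<cdot>\<^sub>m \<Omega>" using AB B by blast
  next
    assume "\<exists>A \<in> carrier_mat M M. x = blockdiag A (mat 1 1 (\<lambda>_. inverse l ^ M)) \<and>
      transpose_mat A * \<Omega> * A = (l * l) \<cdot>\<^sub>m \<Omega>"
    then obtain A where A: "A \<in> carrier_mat M M" "x = blockdiag A (mat 1 1 (\<lambda>_. inverse l ^ M))"
      "transpose_mat A * \<Omega> * A = (l * l) \<cdot>\<^sub>m \<Omega>" by blast
    have "x \<in> carrier_mat (M + 1) (M + 1)" unfolding A(2) by (rule blockdiag_carrier[OF A(1) c1])
    then show "x \<in> sim M \<Omega> l"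
      unfolding sim_def sm A(2) using bl[OF A(1) c1] A(3) by simp
  qed
qed

definition tor :: "nat \<Rightarrow> complex \<Rightarrow> complex mat" where
  "tor M l = blockdiag (l \<cdot>\<^sub>m 1\<^sub>m M) (mat 1 1 (\<lambda>_. inverse l ^ M))"

lemma tor_sim: "\<Omega> \<in> carrier_mat M M \<Longrightarrow> tor M l \<in> sim M \<Omega> l"
proof -
  assume \<Omega>: "\<Omega> \<in> carrier_mat M M"
  have "transpose_mat (l \<cdot>\<^sub>m 1\<^sub>m M) = l \<cdot>\<^sub>m 1\<^sub>m M" by (auto intro!: eq_matI)
  then have "transpose_mat (l \<cdot>\<^sub>m 1\<^sub>m M) * \<Omega> * (l \<cdot>\<^sub>m 1\<^sub>m M) = (l * l) \<cdot>\<^sub>m \<Omega>"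
    using \<Omega> by (simp add: mult_smult_assoc_mat[of _ M M _ M] mult_smult_distrib[of _ M M _ M] left_mult_one_mat[of _ M M]
      right_mult_one_mat[of _ M M] smult_smult_mat)
  then show ?thesis unfolding sim_iff[OF \<Omega>] tor_def by (intro bexI[of _ "l \<cdot>\<^sub>m 1\<^sub>m M"]) auto
qed

lemma tor_inverse: "l \<noteq> 0 \<Longrightarrow> tor M l * tor M (inverse l) = 1\<^sub>m (M + 1)"
proof -
  assume l: "l \<noteq> 0"
  have "tor M l * tor M (inverse l) =
      blockdiag ((l \<cdot>\<^sub>m 1\<^sub>m M) * (inverse l \<cdot>\<^sub>m 1\<^sub>m M)) (mat 1 1 (\<lambda>_. inverse l ^ M) * mat 1 1 (\<lambda>_. inverse (inverse l) ^ M))"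
    unfolding tor_def by (rule blockdiag_mult) auto
  also have "(l \<cdot>\<^sub>m 1\<^sub>m M) * (inverse l \<cdot>\<^sub>m 1\<^sub>m M) = 1\<^sub>m M"
    using l by (simp add: mult_smult_assoc_mat[of _ M M _ M] mult_smult_distrib[of _ M M _ M] smult_smult_mat)
       (auto intro!: eq_matI)
  also have "mat 1 1 (\<lambda>_. inverse l ^ M) * mat 1 1 (\<lambda>_. inverse (inverse l) ^ M) = 1\<^sub>m 1"
    using l by (auto simp: scalar_prod_def power_inverse intro!: eq_matI)
  finally show ?thesis by (simp add: blockdiag_one)
qed

lemma T1_tor: "T1 n = tor (2 * n) ` (- {0})"
  by (auto simp: T1_def tor_def)

lemma Sp_ext_sim:
  assumes \<Omega>: "skew_nondeg (2 * n) \<Omega>" shows "Sp_ext n \<Omega> = sim (2 * n) \<Omega> 1"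
proof -
  note o = skew_nondegD[OF \<Omega>]
  have i: "mat 1 1 (\<lambda>_. inverse 1 ^ (2 * n)) = (1\<^sub>m 1 :: complex mat)" by (auto intro!: eq_matI)
  have s: "(1 * 1) \<cdot>\<^sub>m \<Omega> = \<Omega>" by (auto intro!: eq_matI)
  show ?thesis
    unfolding set_eq_iff sim_iff[OF o(1)] i s Sp_ext_def Sp_def by blast
qed

lemma SpxT1_sim:
  assumes \<Omega>: "skew_nondeg (2 * n) \<Omega>" shows "SpxT1 n \<Omega> = (\<Union>l\<in>- {0}. sim (2 * n) \<Omega> l)"
proof (intro equalityI subsetI)
  note o = skew_nondegD[OF \<Omega>]
  fix x assume "x \<in> SpxT1 n \<Omega>"
  then obtain S l where "x = S * tor (2 * n) l" "S \<in> sim (2 * n) \<Omega> 1" "l \<noteq> 0"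
    by (auto simp: SpxT1_def T1_tor Sp_ext_sim[OF \<Omega>])
  then show "x \<in> (\<Union>l\<in>- {0}. sim (2 * n) \<Omega> l)" using sim_mult[OF o(1) _ tor_sim[OF o(1)], of S 1 l] by auto
next
  note o = skew_nondegD[OF \<Omega>]
  fix x assume "x \<in> (\<Union>l\<in>- {0}. sim (2 * n) \<Omega> l)"
  then obtain l where l: "l \<noteq> 0" "x \<in> sim (2 * n) \<Omega> l" by blast
  have "x * tor (2 * n) (inverse l) \<in> sim (2 * n) \<Omega> (l * inverse l)" by (rule sim_mult[OF o(1) l(2) tor_sim[OF o(1)]])
  then have 1: "x * tor (2 * n) (inverse l) \<in> Sp_ext n \<Omega>" using l(1) by (simp add: Sp_ext_sim[OF \<Omega>])
  have c: "x \<in> carrier_mat (2 * n + 1) (2 * n + 1)" "tor (2 * n) k \<in> carrier_mat (2 * n + 1) (2 * n + 1)" for k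
    using l(2) tor_sim[OF o(1), of k] unfolding sim_def by blast+
  have "x * tor (2 * n) (inverse l) * tor (2 * n) l = x * (tor (2 * n) (inverse l) * tor (2 * n) l)"
    by (rule assoc_mult_mat[OF c(1) c(2) c(2)])
  also have "\<dots> = x" using tor_inverse[of "inverse l" "2 * n"] l(1) right_mult_one_mat[OF c(1)] by simp
  finally have "x = x * tor (2 * n) (inverse l) * tor (2 * n) l" by simp
  then show "x \<in> SpxT1 n \<Omega>" unfolding SpxT1_def T1_tor using 1 l(1) by blast
qed

text \<open>Closedness needs equations for a union over \<open>l\<close>: besides being
  block-diagonal of determinant 1, the matrix has to pull the form back to a multiple of itself,
  which is expressed by 2 by 2 minors.\<close>

lemma SpxT1_closed_subgroup:
  assumes \<Omega>: "skew_nondeg (2 * n) \<Omega>" and n: "n \<ge> 1"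
  shows "closed_subgroup (2 * n + 1) (SpxT1 n \<Omega>) (SL (2 * n + 1))"
proof -
  note o = skew_nondegD[OF \<Omega>]
  define M where "M = 2 * n"
  have M: "M > 0" using n by (simp add: M_def)
  note o = o[folded M_def] and sim_SpxT1 = SpxT1_sim[OF \<Omega>, folded M_def] and sim_Sp = Sp_ext_sim[OF \<Omega>, folded M_def]
  have mS: "mgroup (M + 1) (Sp_ext n \<Omega>)" using Sp_ext_parabolically_connected(2)[OF \<Omega>] by (simp add: M_def)
  have fac: "\<exists>S l. S \<in> Sp_ext n \<Omega> \<and> l \<noteq> 0 \<and> x = S * tor M l" if "x \<in> SpxT1 n \<Omega>" for x
    using that by (auto simp: SpxT1_def T1_tor M_def)
  have tc: "tor M l \<in> carrier_mat (M + 1) (M + 1)" for l using tor_sim[OF o(1), of l] by (simp add: sim_def)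
  have sub: "SpxT1 n \<Omega> \<subseteq> SL (M + 1)"
  proof
    fix x assume "x \<in> SpxT1 n \<Omega>"
    then obtain S l where S: "S \<in> Sp_ext n \<Omega>" "l \<noteq> 0" "x = S * tor M l" using fac by blast
    have "det (tor M l) = 1" unfolding tor_def using S(2)
      by (subst blockdiag_det[of _ M _ 1]) (auto simp: det_single power_inverse)
    then have "det x = 1" unfolding S(3) using det_mult[OF mgroupD(1)[OF mS S(1)] tc] mgroupD(2)[OF mS S(1)] by simp
    then show "x \<in> SL (M + 1)" unfolding S(3) SL_def using mult_carrier_sq[OF mgroupD(1)[OF mS S(1)] tc] by blast
  qed
  have "mgroup (M + 1) (SpxT1 n \<Omega>)"
  proof (rule mgroupI[OF sub])
    show "1\<^sub>m (M + 1) \<in> SpxT1 n \<Omega>" using mgroupD(3)[OF mS] sim_Sp sim_SpxT1 by auto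
  next
    fix x y assume "x \<in> SpxT1 n \<Omega>" "y \<in> SpxT1 n \<Omega>"
    then obtain k l where "k \<noteq> 0" "l \<noteq> 0" "x \<in> sim M \<Omega> k" "y \<in> sim M \<Omega> l" unfolding sim_SpxT1 by blast
    then have "x * y \<in> sim M \<Omega> (k * l)" "k * l \<noteq> 0" using sim_mult[OF o(1)] by auto
    then show "x * y \<in> SpxT1 n \<Omega>" unfolding sim_SpxT1 by blast
  next
    fix x assume "x \<in> SpxT1 n \<Omega>"
    then obtain S l where S: "S \<in> Sp_ext n \<Omega>" "l \<noteq> 0" "x = S * tor M l" using fac by blast
    define R where "R = adj_mat S"
    have p: "inv_pair (M + 1) S R" unfolding R_def by (rule mgroupD(6)[OF mS S(1)])
    note d = inv_pairD[OF p]
    have R: "R \<in> sim M \<Omega> 1" using mgroupD(5)[OF mS S(1)] by (simp add: R_def sim_Sp)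
    have q: "inv_pair (M + 1) (tor M l) (tor M (inverse l))"
      using tor_inverse[OF S(2)] tc by (intro inv_pair_of_one_sided) auto
    have "tor M (inverse l) * R \<in> sim M \<Omega> (inverse l * 1)" by (rule sim_mult[OF o(1) tor_sim[OF o(1)] R])
    then have "tor M (inverse l) * R \<in> SpxT1 n \<Omega>" unfolding sim_SpxT1 using S(2) by auto
    moreover have "x * (tor M (inverse l) * R) = 1\<^sub>m (M + 1)"
      unfolding S(3) using inv_pairD(3)[OF inv_pair_mult[OF p q]] by simp
    ultimately show "\<exists>y \<in> SpxT1 n \<Omega>. x * y = 1\<^sub>m (M + 1)" by blast
  qed
  moreover have "zariski_closed (M + 1) (SpxT1 n \<Omega>)"
  proof -
    define N where "N = M + 1"
    define F where "F = blkU M \<Omega>"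
    define D :: "complex mat" where "D = blockdiag (1\<^sub>m M) (0\<^sub>m 1 1)"
    define I where "I = ({..<N} \<times> {..<N}) \<times> ({..<N} \<times> {..<N})"
    define f where "f = (\<lambda>(a, b) x. (transpose_mat x * F * x) $$ a * F $$ b - (transpose_mat x * F * x) $$ b * F $$ a)"
    have F: "F \<in> carrier_mat N N" unfolding F_def N_def by (rule blkU_carrier[OF o(1)])
    have D: "D \<in> carrier_mat N N" unfolding D_def N_def by (rule blockdiag_carrier) auto
    have rm: "regular_map N N (\<lambda>x. transpose_mat x * F * x)"
      by (intro regular_map_mult regular_map_const regular_map_id regular_map_transpose F)
    have rf: "regular_fun N (f t)" if t: "t \<in> I" for t
    proof -
      obtain i j k l where ij: "t = ((i, j), (k, l))" "i < N" "j < N" "k < N" "l < N" using t by (auto simp: I_def)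
      show ?thesis unfolding ij(1) f_def prod.case
        by (intro regular_fun_diff regular_fun_mult regular_fun_const regular_map_entry[OF rm] ij)
    qed
    have "SpxT1 n \<Omega> = {x \<in> carrier_mat N N. x * D = D * x} \<inter> ({x \<in> carrier_mat N N. det x - 1 = 0} \<inter>
      {x \<in> carrier_mat N N. \<forall>t\<in>I. f t x = 0})"
    proof (intro equalityI subsetI)
      fix x assume x: "x \<in> SpxT1 n \<Omega>"
      then obtain l where l: "x \<in> sim M \<Omega> l" unfolding sim_SpxT1 by blast
      have xc: "x \<in> carrier_mat N N" "det x = 1" using x sub by (auto simp: SL_def N_def)
      have Dp: "D = 1\<^sub>m N - prjL M" unfolding D_def N_def prjL_def by (auto simp: blockdiag_def intro!: eq_matI)
      have "x * D = D * x" unfolding Dp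
        by (rule compl_commute) (use l xc prjL_carrier in \<open>auto simp: sim_def N_def\<close>)
      moreover have "f t x = 0" if t: "t \<in> I" for t
      proof -
        obtain i j a b where ij: "t = ((i, j), (a, b))" "i < N" "j < N" "a < N" "b < N" using t by (auto simp: I_def)
        have "transpose_mat x * F * x = (l * l) \<cdot>\<^sub>m F" using l by (simp add: sim_def F_def)
        then show ?thesis unfolding ij(1) f_def prod.case using ij(2-) F by simp
      qed
      ultimately show "x \<in> {x \<in> carrier_mat N N. x * D = D * x} \<inter> ({x \<in> carrier_mat N N. det x - 1 = 0} \<inter>
        {x \<in> carrier_mat N N. \<forall>t\<in>I. f t x = 0})" using xc by simp
    next
      fix x assume x0: "x \<in> {x \<in> carrier_mat N N. x * D = D * x} \<inter> ({x \<in> carrier_mat N N. det x - 1 = 0} \<inter>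
        {x \<in> carrier_mat N N. \<forall>t\<in>I. f t x = 0})"
      then have x: "x \<in> carrier_mat N N" "x * D = D * x" "det x = 1" "\<And>t. t \<in> I \<Longrightarrow> f t x = 0" by auto
      have "x \<in> levi (M + 1) (blockdiag (1\<^sub>m M) (0\<^sub>m 1 1)) (\<lambda>_ _. True)" using x(1,2) by (simp add: levi_def N_def D_def)
      then obtain A B where AB: "x = blockdiag A B" "A \<in> carrier_mat M M" "B \<in> carrier_mat 1 1" unfolding levi_blockdiag by auto
      have dAB: "det A * det B = 1" using x(3) unfolding AB(1) blockdiag_det[OF AB(2,3)] .
      have AtA: "transpose_mat A * \<Omega> * A \<in> carrier_mat M M" using AB(2) o(1) by simp
      have xF: "transpose_mat x * F * x = blockdiag (transpose_mat A * \<Omega> * A) (0\<^sub>m 1 1)"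
        unfolding AB(1) F_def blkU_def using AB(2,3) o(1) by (simp add: blockdiag_mult[of _ M _ 1] blockdiag_transpose[of _ M _ 1])
      have "\<exists>k<M. \<exists>l<M. \<Omega> $$ (k, l) \<noteq> 0"
      proof (rule ccontr)
        assume "\<not> ?thesis"
        then have "\<Omega> = 0\<^sub>m M M" using o(1) by (auto intro!: eq_matI)
        then show False using o(3) M by (simp add: det_zero)
      qed
      then obtain k l where kl: "k < M" "l < M" "\<Omega> $$ (k, l) \<noteq> 0" by blast
      define \<kappa> where "\<kappa> = (transpose_mat A * \<Omega> * A) $$ (k, l) / \<Omega> $$ (k, l)"
      have AA: "transpose_mat A * \<Omega> * A = \<kappa> \<cdot>\<^sub>m \<Omega>"
      proof (rule eq_matI)
        fix i j assume "i < dim_row (\<kappa> \<cdot>\<^sub>m \<Omega>)" "j < dim_col (\<kappa> \<cdot>\<^sub>m \<Omega>)"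
        then have ij: "i < M" "j < M" using o(1) by auto
        then have "((i, j), (k, l)) \<in> I" using kl by (simp add: I_def N_def)
        then have "f ((i, j), (k, l)) x = 0" by (rule x(4))
        then have "(transpose_mat A * \<Omega> * A) $$ (i, j) * \<Omega> $$ (k, l) = (transpose_mat A * \<Omega> * A) $$ (k, l) * \<Omega> $$ (i, j)"
          unfolding f_def prod.case xF unfolding F_def blkU_def
          using blockdiag_index[OF AtA zero_carrier_mat[of 1 1]] blockdiag_index[OF o(1) zero_carrier_mat[of 1 1]] ij kl
          by (simp del: assoc_mult_mat index_mult_mat(1))
        then show "(transpose_mat A * \<Omega> * A) $$ (i, j) = (\<kappa> \<cdot>\<^sub>m \<Omega>) $$ (i, j)"
          using kl(3) ij o(1) by (simp add: \<kappa>_def field_simps del: assoc_mult_mat index_mult_mat(1))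
      qed (use AtA o(1) in auto)
      have "\<kappa> \<noteq> 0"
      proof
        assume k0: "\<kappa> = 0"
        have "det (transpose_mat A * \<Omega> * A) = det A * det \<Omega> * det A"
          using AB(2) o(1) by (simp add: det_mult[of _ M] det_transpose[of _ M])
        moreover have "det A \<noteq> 0" using dAB by auto
        ultimately have "det (transpose_mat A * \<Omega> * A) \<noteq> 0" using o(3) by simp
        then show False unfolding AA k0 using M o(1) by simp
      qed
      \<comment> \<open>A square root of the multiplier recovers the torus parameter: dividing
        \<open>A\<close> by it gives a symplectic matrix, of determinant 1, so
        \<open>det A = r^M\<close> and the last entry must be \<open>r^(-M)\<close>.\<close>
      define r where "r = csqrt \<kappa>"
      have r: "r * r = \<kappa>" "r \<noteq> 0" using \<open>\<kappa> \<noteq> 0\<close> power2_csqrt[of \<kappa>] by (auto simp: r_def power2_eq_square)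
      define A' where "A' = inverse r \<cdot>\<^sub>m A"
      have "transpose_mat A' = inverse r \<cdot>\<^sub>m transpose_mat A" by (auto simp: A'_def intro!: eq_matI)
      then have "transpose_mat A' * \<Omega> * A' = (inverse r * inverse r) \<cdot>\<^sub>m (transpose_mat A * \<Omega> * A)"
        unfolding A'_def using AB(2) o(1)
        by (simp add: mult_smult_assoc_mat[of _ M M _ M] mult_smult_distrib[of _ M M _ M] smult_smult_mat)
      also have "inverse r * inverse r = inverse \<kappa>" unfolding r(1)[symmetric] by simp
      also have "inverse \<kappa> \<cdot>\<^sub>m (transpose_mat A * \<Omega> * A) = \<Omega>"
        unfolding AA smult_smult_mat using \<open>\<kappa> \<noteq> 0\<close> by (auto intro!: eq_matI)
      finally have "A' \<in> Sp M \<Omega>" using AB(2) by (simp add: Sp_def A'_def)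
      then have "det A' = 1" using Sp_det[OF \<Omega>] by (simp add: M_def)
      then have "inverse r ^ M * det A = 1" using AB(2) by (simp add: A'_def)
      then have "det B = inverse r ^ M" using dAB by (metis mult.commute mult.left_commute mult_1_right)
      then have "B = mat 1 1 (\<lambda>_. inverse r ^ M)" using AB(3) det_single[of B] by (auto intro!: eq_matI)
      then have "x \<in> sim M \<Omega> r" unfolding sim_iff[OF o(1)] using AB AA r(1) by blast
      then show "x \<in> SpxT1 n \<Omega>" unfolding sim_SpxT1 using r(2) by blast
    qed
    moreover have "zariski_closed N {x \<in> carrier_mat N N. x * D = D * x}"
      by (intro zariski_closed_mat_eq[of N N] regular_map_mult regular_map_id regular_map_const D)
    moreover have "zariski_closed N {x \<in> carrier_mat N N. det x - 1 = 0}"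
      by (intro zariski_closed_zeros regular_fun_diff regular_fun_const regular_fun_det[OF regular_map_id])
    moreover have "zariski_closed N {x \<in> carrier_mat N N. \<forall>t\<in>I. f t x = 0}" by (rule zariski_closed_Collect[OF rf])
    ultimately show ?thesis by (simp add: zariski_closed_Int N_def)
  qed
  ultimately show ?thesis by (simp add: closed_subgroup_iff M_def)
qed

text \<open>\<open>P\<close> and \<open>Q\<close> are the spectral projections of \<open>Y\<close>
  for 1 and -1, the latter computed as that of \<open>- Y\<close> for 1. As \<open>- Y\<close> is
  adjoint to \<open>Y\<close>, the two projections are adjoint to each other.\<close>

lemma adjoint_idempotents:
  assumes Y: "Y \<in> UT N" and c: "F \<in> carrier_mat N N" "\<Phi> \<in> carrier_mat N N"
    and YF: "Y * F = F" "F * Y = F" and skew: "transpose_mat Y * \<Phi> = - (\<Phi> * Y)"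
  shows "\<exists>P Q. P \<in> UT N \<and> Q \<in> UT N \<and> P * P = P \<and> Q * Q = Q \<and> P * Q = 0\<^sub>m N N \<and> Q * P = 0\<^sub>m N N \<and>
    P * F = F \<and> F * P = F \<and> Q * F = 0\<^sub>m N N \<and> F * Q = 0\<^sub>m N N \<and>
    transpose_mat P * \<Phi> = \<Phi> * Q \<and> transpose_mat Q * \<Phi> = \<Phi> * P"
proof -
  \<comment> \<open>Both signs of the diagonal entries are included so that one polynomial serves
    \<open>Y\<close> and \<open>- Y\<close>; the value -1 is included to make \<open>P * Q\<close>
    and \<open>Q * F\<close> vanish.\<close>
  define S where "S = ((\<lambda>i. Y $$ (i, i)) ` {..<N} \<union> (\<lambda>i. - Y $$ (i, i)) ` {..<N} \<union> {-1}) - {1 :: complex}"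
  have S: "finite S" "1 \<notin> S" "-1 \<in> S" by (auto simp: S_def)
  obtain p where p: "poly p 1 = 1" "\<And>s. s \<in> S \<Longrightarrow> poly p s = 0"
    and idem: "\<And>y. y \<in> UT N \<Longrightarrow> (\<And>i. i < N \<Longrightarrow> y $$ (i, i) = 1 \<or> y $$ (i, i) \<in> S) \<Longrightarrow> mpe N p y * mpe N p y = mpe N p y"
    using spectral_poly[OF S(1,2), of N] by blast
  note Yc = UTc_carrier[OF Y]
  define Z where "Z = - Y"
  have Zc: "Z \<in> carrier_mat N N" using Yc by (simp add: Z_def)
  have Z: "Z \<in> UT N" using Y by (auto simp: Z_def UTc_def)
  have Zd: "Z $$ (i, i) = - Y $$ (i, i)" if "i < N" for i using that Yc by (simp add: Z_def)
  define P Q where "P = mpe N p Y" and "Q = mpe N p Z"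
  have PQU: "P \<in> UT N" "Q \<in> UT N" unfolding P_def Q_def using mpe_UT(1) Y Z by blast+
  have PQc: "P \<in> carrier_mat N N" "Q \<in> carrier_mat N N" using PQU UTc_carrier by blast+
  have PP: "P * P = P" unfolding P_def by (rule idem[OF Y]) (auto simp: S_def)
  have QQ: "Q * Q = Q" unfolding Q_def by (rule idem[OF Z]) (auto simp: S_def Zd)
  have ZY: "Z * Y = Y * Z" unfolding Z_def using Yc by simp
  have QY: "Q * Y = Y * Q" unfolding Q_def by (rule mpe_commute[OF Zc Yc ZY])
  have PQ: "P * Q = Q * P" unfolding P_def by (rule mpe_commute[OF Yc PQc(2) QY[symmetric]])
  have "(P * Q) * (P * Q) = P * (Q * P) * Q" using PQc by (simp only: assoc_mult_mat[of _ N N _ N _ N] mult_carrier_sq)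
  also have "\<dots> = (P * P) * (Q * Q)" unfolding PQ[symmetric] using PQc by (simp only: assoc_mult_mat[of _ N N _ N _ N] mult_carrier_sq)
  finally have i: "(P * Q) * (P * Q) = P * Q" unfolding PP QQ .
  have PQ0: "P * Q = 0\<^sub>m N N"
  proof (rule UT_idempotent_zero[OF UT_mult[OF PQU] i])
    fix i assume i: "i < N"
    have "(P * Q) $$ (i, i) = poly p (Y $$ (i, i)) * poly p (- Y $$ (i, i))"
      using UT_mult_diag[OF PQU i] mpe_UT(2)[OF Y i, of p] mpe_UT(2)[OF Z i, of p] Zd[OF i] by (simp add: P_def Q_def)
    also have "\<dots> = 0"
    proof (cases "Y $$ (i, i) = 1")
      case True
      then show ?thesis using p(2)[OF S(3)] by simp
    next
      case False
      then have "Y $$ (i, i) \<in> S" using i by (auto simp: S_def)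
      then show ?thesis using p(2) by simp
    qed
    finally show "(P * Q) $$ (i, i) = 0" .
  qed
  have s1: "1 \<cdot>\<^sub>m F = F" "0 \<cdot>\<^sub>m F = 0\<^sub>m N N" using c(1) by (auto intro!: eq_matI)
  have ZF: "Z * F = (-1) \<cdot>\<^sub>m F" "F * Z = (-1) \<cdot>\<^sub>m F"
  proof -
    have "Z * F = - (Y * F)" "F * Z = - (F * Y)" unfolding Z_def using Yc c(1) by simp_all
    then show "Z * F = (-1) \<cdot>\<^sub>m F" "F * Z = (-1) \<cdot>\<^sub>m F" unfolding YF by (auto intro!: eq_matI)
  qed
  have "P * F = F" unfolding P_def using mpe_right_eigen[OF Yc c(1), of 1 p] YF(1) p(1) s1 by simp
  moreover have "F * P = F" unfolding P_def using mpe_left_eigen[OF Yc c(1), of 1 p] YF(2) p(1) s1 by simp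
  moreover have "Q * F = 0\<^sub>m N N" unfolding Q_def using mpe_right_eigen[OF Zc c(1) ZF(1), of p] p(2)[OF S(3)] s1 by simp
  moreover have "F * Q = 0\<^sub>m N N" unfolding Q_def using mpe_left_eigen[OF Zc c(1) ZF(2), of p] p(2)[OF S(3)] s1 by simp
  moreover have "transpose_mat P * \<Phi> = \<Phi> * Q"
    unfolding P_def Q_def by (rule mpe_adjoint[OF Yc Zc c(2)]) (use skew Yc c(2) in \<open>simp add: Z_def\<close>)
  moreover have "transpose_mat Q * \<Phi> = \<Phi> * P"
  proof -
    have "transpose_mat Z = - transpose_mat Y" by (auto simp: Z_def intro!: eq_matI)
    then have "transpose_mat Z * \<Phi> = - (transpose_mat Y * \<Phi>)" using Yc c(2) by simp
    then have "transpose_mat Z * \<Phi> = \<Phi> * Y" unfolding skew by simp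
    then show ?thesis unfolding P_def Q_def by (rule mpe_adjoint[OF Zc Yc c(2)])
  qed
  ultimately show ?thesis using PQU PP QQ PQ0 PQ by metis
qed

text \<open>Multiplication by the triangular elements \<open>w r\<close> changes the similitude
  parameter of \<open>x\<close> from \<open>l\<close> to \<open>l / r\<close>. Letting
  \<open>r\<close> run from \<open>l\<close> to 1 joins an element of the embedded symplectic group
  to \<open>x\<close>, and for that group parabolic connectedness is known.\<close>

lemma SpxT1_link:
  assumes \<Omega>: "skew_nondeg (2 * n) \<Omega>"
    and p: "inv_pair (2 * n + 1) g h" and x: "x \<in> SpxT1 n \<Omega>" and xU: "h * x * g \<in> UT (2 * n + 1)"
  shows "zlink (2 * n + 1) {x \<in> SpxT1 n \<Omega>. h * x * g \<in> UT (2 * n + 1)} (1\<^sub>m (2 * n + 1)) x"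
proof -
  note o = skew_nondegD[OF \<Omega>]
  define M N where "M = 2 * n" and "N = M + 1"
  have NM: "2 * n + 1 = N" by (simp add: N_def M_def)
  note o = o[folded M_def] and sim_SpxT1 = SpxT1_sim[OF \<Omega>, folded M_def] and sim_Sp = Sp_ext_sim[OF \<Omega>, folded M_def]
  have M: "even M" by (simp add: M_def)
  note p = p[unfolded NM] and xU = xU[unfolded NM]
  note d = inv_pairD[OF p]
  define C W where "C = prjL M" and "W = blkU M \<Omega>"
  have c: "C \<in> carrier_mat N N" "W \<in> carrier_mat N N" using prjL_carrier blkU_carrier[OF o(1)] by (auto simp: C_def W_def N_def)
  obtain X where X: "X \<in> inf_sp M \<Omega>" and Y: "h * (C - X) * g \<in> UT N"
    using exists_triangular_inf_sp[OF o M, of g h] p by (auto simp: N_def C_def)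
  have X': "X \<in> carrier_mat N N" "transpose_mat X * W = - (W * X)" "X * C = 0\<^sub>m N N" "C * X = 0\<^sub>m N N"
    using X by (auto simp: inf_sp_def N_def C_def W_def)
  \<comment> \<open>Skew for the form and the identity on the line: the infinitesimal version of the
    torus sought.\<close>
  define Z where "Z = C - X"
  have Z: "Z \<in> carrier_mat N N" using X' c by (simp add: Z_def)
  have CC: "C * C = C" unfolding C_def by (rule prjL_idem)
  have WC: "W * C = 0\<^sub>m N N" "transpose_mat C * W = 0\<^sub>m N N" using prjL_blkU[OF o(1)] by (simp_all add: C_def W_def N_def)
  have ZC: "Z * C = C" "C * Z = C"
    unfolding Z_def using c X' CC by (auto simp: minus_mult_distrib_mat[of _ N N _ _ N] mult_minus_distrib_mat[of _ N N _ N]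
      intro!: eq_matI simp del: index_mult_mat(1))
  have ZW: "transpose_mat Z * W = - (W * Z)"
  proof -
    have "transpose_mat Z = transpose_mat C - transpose_mat X" using c X' by (auto simp: Z_def intro!: eq_matI)
    then have "transpose_mat Z * W = 0\<^sub>m N N - - (W * X)" using c X' WC by (simp add: minus_mult_distrib_mat[of _ N N _ _ N])
    also have "\<dots> = - (0\<^sub>m N N - W * X)" using c X' by (auto intro!: eq_matI simp del: index_mult_mat(1))
    also have "0\<^sub>m N N - W * X = W * Z" unfolding Z_def using c X' WC by (simp add: mult_minus_distrib_mat[of _ N N _ N])
    finally show ?thesis .
  qed
  define F \<Phi> Y where "F = h * C * g" and "\<Phi> = transpose_mat g * W * g" and "Y = h * Z * g"
  have fc: "F \<in> carrier_mat N N" "\<Phi> \<in> carrier_mat N N" "Y \<in> carrier_mat N N" using c d Z by (simp_all add: F_def \<Phi>_def Y_def)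
  have tgh: "transpose_mat h * transpose_mat g = 1\<^sub>m N" using transpose_mult[of g N N h N] d by simp
  have YF: "Y * F = F" "F * Y = F"
    unfolding Y_def F_def using conj_mult[OF p Z c(1)] conj_mult[OF p c(1) Z] ZC by simp_all
  have skew: "transpose_mat Y * \<Phi> = - (\<Phi> * Y)"
  proof -
    have "transpose_mat Y * \<Phi> = transpose_mat g * transpose_mat Z * (transpose_mat h * transpose_mat g) * W * g"
      unfolding Y_def \<Phi>_def using c d(1,2) Z by (simp add: transpose_mult[of _ N N _ N] assoc_mult_mat[of _ N N _ N _ N])
    also have "\<dots> = transpose_mat g * (transpose_mat Z * W) * g"
      unfolding tgh using c d(1,2) Z by (simp add: assoc_mult_mat[of _ N N _ N _ N] right_mult_one_mat[of _ N N])
    also have "\<dots> = - (transpose_mat g * (W * Z) * g)" unfolding ZW using c d(1,2) Z by simp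
    also have "transpose_mat g * (W * Z) * g = transpose_mat g * W * (g * h) * (Z * g)"
      unfolding d(3) using c d(1,2) Z by (simp add: assoc_mult_mat[of _ N N _ N _ N] right_mult_one_mat[of _ N N])
    also have "\<dots> = \<Phi> * Y" unfolding \<Phi>_def Y_def using c d(1,2) Z by (simp add: assoc_mult_mat[of _ N N _ N _ N])
    finally show ?thesis .
  qed
  have YU: "Y \<in> UT N" using \<open>h * (C - X) * g \<in> UT N\<close> by (simp add: Y_def Z_def)
  obtain P Q where PQ: "P \<in> UT N" "Q \<in> UT N" "P * P = P" "Q * Q = Q" "P * Q = 0\<^sub>m N N" "Q * P = 0\<^sub>m N N"
    "P * F = F" "F * P = F" "Q * F = 0\<^sub>m N N" "F * Q = 0\<^sub>m N N" "transpose_mat P * \<Phi> = \<Phi> * Q" "transpose_mat Q * \<Phi> = \<Phi> * P"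
    using adjoint_idempotents[OF YU fc(1,2) YF skew] by blast
  have pc: "P \<in> carrier_mat N N" "Q \<in> carrier_mat N N" using PQ(1,2) UTc_carrier by blast+
  \<comment> \<open>The torus with weight 1 on the image of \<open>P\<close>, -1 on that of
    \<open>Q\<close> and 0 elsewhere; it preserves the form and acts on the line by
    \<open>s\<close>.\<close>
  define \<tau> where "\<tau> s = 1\<^sub>m N + (s - 1) \<cdot>\<^sub>m P + (inverse s - 1) \<cdot>\<^sub>m Q" for s
  have \<tau>U: "\<tau> s \<in> UT N" for s unfolding \<tau>_def by (intro UT_add UT_smult UT_one PQ)
  have \<tau>c: "\<tau> s \<in> carrier_mat N N" for s using \<tau>U UTc_carrier by blast
  have \<tau>F: "\<tau> s * F = s \<cdot>\<^sub>m F" "F * \<tau> s = s \<cdot>\<^sub>m F" for s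
    unfolding \<tau>_def using pc fc(1) PQ(7-10)
    by (auto simp: add_mult_distrib_mat[of _ N N _ _ N] mult_add_distrib_mat[of _ N N _ N] mult_smult_assoc_mat[of _ N N _ N]
      mult_smult_distrib[of _ N N _ N] left_mult_one_mat[of _ N N] right_mult_one_mat[of _ N N] algebra_simps intro!: eq_matI)
  have \<tau>\<Phi>: "transpose_mat (\<tau> s) * \<Phi> * \<tau> s = \<Phi>" if s: "s \<noteq> 0" for s
  proof -
    define a b where "a = s - 1" and "b = inverse s - 1"
    have ab: "a + b + a * b = 0" using s by (simp add: a_def b_def field_simps)
    define \<sigma> where "\<sigma> = 1\<^sub>m N + a \<cdot>\<^sub>m Q + b \<cdot>\<^sub>m P"
    have \<sigma>c: "\<sigma> \<in> carrier_mat N N" using pc by (simp add: \<sigma>_def)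
    have \<tau>e: "\<tau> s = 1\<^sub>m N + a \<cdot>\<^sub>m P + b \<cdot>\<^sub>m Q" by (simp add: \<tau>_def a_def b_def)
    have "transpose_mat (\<tau> s) = 1\<^sub>m N + a \<cdot>\<^sub>m transpose_mat P + b \<cdot>\<^sub>m transpose_mat Q"
      unfolding \<tau>e using pc by (auto intro!: eq_matI)
    then have 1: "transpose_mat (\<tau> s) * \<Phi> = \<Phi> * \<sigma>"
      unfolding \<sigma>_def using pc fc(2) PQ(11,12)
      by (simp add: add_mult_distrib_mat[of _ N N _ _ N] mult_add_distrib_mat[of _ N N _ N] mult_smult_assoc_mat[of _ N N _ N]
        mult_smult_distrib[of _ N N _ N] left_mult_one_mat[of _ N N] right_mult_one_mat[of _ N N])
    have "\<sigma> * \<tau> s = 1\<^sub>m N + a \<cdot>\<^sub>m Q + b \<cdot>\<^sub>m P + a \<cdot>\<^sub>m (P + b \<cdot>\<^sub>m P) + b \<cdot>\<^sub>m (Q + a \<cdot>\<^sub>m Q)"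
      unfolding \<sigma>_def \<tau>e using pc PQ(3-6)
      by (simp add: add_mult_distrib_mat[of _ N N _ _ N] mult_add_distrib_mat[of _ N N _ N] mult_smult_assoc_mat[of _ N N _ N]
        mult_smult_distrib[of _ N N _ N] left_mult_one_mat[of _ N N] right_mult_one_mat[of _ N N])
    also have "\<dots> = 1\<^sub>m N + (a + b + a * b) \<cdot>\<^sub>m (P + Q)" using pc by (auto simp: algebra_simps intro!: eq_matI)
    also have "\<dots> = 1\<^sub>m N" unfolding ab using pc by (auto intro!: eq_matI)
    finally have 2: "\<sigma> * \<tau> s = 1\<^sub>m N" .
    have "transpose_mat (\<tau> s) * \<Phi> * \<tau> s = \<Phi> * (\<sigma> * \<tau> s)" unfolding 1 by (rule assoc_mult_mat[OF fc(2) \<sigma>c \<tau>c])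
    then show ?thesis unfolding 2 using fc(2) by (simp add: right_mult_one_mat[of _ N N])
  qed
  \<comment> \<open>The exponent \<open>N = M + 1\<close> compensates the scalar: on the line the
    factor is \<open>r^(-1) r^N = r^M\<close>, as required of a similitude with parameter
    \<open>1/r\<close>.\<close>
  define w where "w r = g * (inverse r \<cdot>\<^sub>m \<tau> (r ^ N)) * h" for r
  have wc: "w r \<in> carrier_mat N N" for r using d \<tau>c by (simp add: w_def)
  have wv: "w r = inverse r \<cdot>\<^sub>m (g * \<tau> (r ^ N) * h)" for r
    unfolding w_def using d(1,2) \<tau>c by (simp add: mult_smult_assoc_mat[of _ N N _ N] mult_smult_distrib[of _ N N _ N])
  have wsim: "w r \<in> sim M \<Omega> (inverse r)" if r: "r \<noteq> 0" for r
  proof -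
    define s where "s = r ^ N"
    have s: "s \<noteq> 0" using r by (simp add: s_def)
    define v where "v = g * \<tau> s * h"
    have v: "v \<in> carrier_mat N N" using d \<tau>c by (simp add: v_def)
    have hv: "v = g * \<tau> s * h" "C = g * F * h" "W = transpose_mat h * \<Phi> * h"
    proof -
      show "C = g * F * h" unfolding F_def using conj_conj[OF p c(1)] by simp
      have "transpose_mat h * \<Phi> * h = (transpose_mat h * transpose_mat g) * W * (g * h)"
        unfolding \<Phi>_def using c d(1,2) by (simp add: assoc_mult_mat[of _ N N _ N _ N])
      then show "W = transpose_mat h * \<Phi> * h" unfolding tgh d(3) using c by (simp add: left_mult_one_mat[of _ N N] right_mult_one_mat[of _ N N])
    qed (simp add: v_def)
    have sF: "g * (s \<cdot>\<^sub>m F) * h = s \<cdot>\<^sub>m C"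
      unfolding hv(2) using fc d(1,2) by (simp add: mult_smult_assoc_mat[of _ N N _ N] mult_smult_distrib[of _ N N _ N])
    have vC: "v * C = s \<cdot>\<^sub>m C" "C * v = s \<cdot>\<^sub>m C"
      using conj_mult[OF inv_pair_sym[OF p] \<tau>c fc(1), of s] conj_mult[OF inv_pair_sym[OF p] fc(1) \<tau>c, of s] \<tau>F[of s] sF
      unfolding hv(1) by (simp_all add: hv(2)[symmetric] del: assoc_mult_mat)
    have tg: "transpose_mat g * transpose_mat h = 1\<^sub>m N" using transpose_mult[of h N N g N] d by simp
    have "transpose_mat v * W * v = transpose_mat h * transpose_mat (\<tau> s) * (transpose_mat g * transpose_mat h) * \<Phi> * (h * g) * \<tau> s * h"
      unfolding hv(1,3) using fc d(1,2) \<tau>c[of s] by (simp add: transpose_mult[of _ N N _ N] assoc_mult_mat[of _ N N _ N _ N])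
    also have "\<dots> = transpose_mat h * (transpose_mat (\<tau> s) * \<Phi> * \<tau> s) * h"
      unfolding tg d(4) using fc d(1,2) \<tau>c[of s]
      by (simp add: assoc_mult_mat[of _ N N _ N _ N] right_mult_one_mat[of _ N N] left_mult_one_mat[of _ N N])
    also have "\<dots> = W" unfolding \<tau>\<Phi>[OF s] hv(3) ..
    finally have vW: "transpose_mat v * W * v = W" .
    have wv': "w r = inverse r \<cdot>\<^sub>m v" by (simp add: wv v_def s_def)
    have "transpose_mat (w r) = inverse r \<cdot>\<^sub>m transpose_mat v" unfolding wv' by (auto intro!: eq_matI)
    then have "transpose_mat (w r) * W * w r = (inverse r * inverse r) \<cdot>\<^sub>m (transpose_mat v * W * v)"
      unfolding wv' using v c by (simp add: mult_smult_assoc_mat[of _ N N _ N] mult_smult_distrib[of _ N N _ N] smult_smult_mat)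
    then have 1: "transpose_mat (w r) * W * w r = (inverse r * inverse r) \<cdot>\<^sub>m W" unfolding vW .
    have e: "inverse r * s = inverse (inverse r) ^ M" using r by (simp add: s_def N_def)
    have 2: "w r * C = inverse (inverse r) ^ M \<cdot>\<^sub>m C" "C * w r = inverse (inverse r) ^ M \<cdot>\<^sub>m C"
      unfolding wv' e[symmetric] using v c vC by (simp_all add: mult_smult_assoc_mat[of _ N N _ N] mult_smult_distrib[of _ N N _ N] smult_smult_mat)
    show ?thesis using 1 2 wc[of r] by (simp add: sim_def C_def W_def N_def del: assoc_mult_mat)
  qed
  have wU: "h * w r * g \<in> UT N" for r
  proof -
    have "h * w r * g = inverse r \<cdot>\<^sub>m \<tau> (r ^ N)"
      unfolding w_def by (rule conj_conj[OF inv_pair_sym[OF p]]) (use \<tau>c in simp)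
    then show ?thesis using UT_smult \<tau>U by simp
  qed
  have w1: "w 1 = 1\<^sub>m N"
  proof -
    have "inverse 1 \<cdot>\<^sub>m \<tau> (1 ^ N) = 1\<^sub>m N" using pc by (auto simp: \<tau>_def intro!: eq_matI)
    then show ?thesis unfolding w_def using d by (simp add: right_mult_one_mat[of _ N N])
  qed
  obtain l where l: "l \<noteq> 0" "x \<in> sim M \<Omega> l" using x unfolding sim_SpxT1 by blast
  have xc: "x \<in> carrier_mat N N" using l(2) by (simp add: sim_def N_def)
  let ?X = "{x \<in> SpxT1 n \<Omega>. h * x * g \<in> UT N}"
  have xw: "x * w r \<in> sim M \<Omega> (l * inverse r)" "h * (x * w r) * g \<in> UT N" if "r \<noteq> 0" for r
    using sim_mult[OF o(1) l(2) wsim[OF that]] conj_mult[OF p xc wc] UT_mult[OF xU wU] by simp_all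
  have Xc: "?X \<subseteq> carrier_mat N N" unfolding sim_SpxT1 by (auto simp: sim_def N_def)
  have "zlink N ?X (x * w l) (x * w 1)"
  proof (rule zlink_path[where p = "\<lambda>r. x * w r", OF connected_cofinite[of "{0}"]])
    fix r :: complex assume r: "r \<in> - {0}"
    then have "l * inverse r \<noteq> 0" using l(1) by simp
    then show "x * w r \<in> ?X" using xw[of r] r unfolding sim_SpxT1 by blast
  next
    have ct: "continuous_on (- {0}) (\<lambda>r. (inverse r \<cdot>\<^sub>m \<tau> (r ^ N)) $$ (i, j))" if "i < N" "j < N" for i j
      using that pc by (cases "i = j") (auto simp: \<tau>_def intro!: continuous_intros)
    show "continuous_on (- {0}) (\<lambda>r. (x * w r) $$ (i, j))" if "i < N" "j < N" for i j
      unfolding w_def using xc d(1,2) \<tau>c that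
      by (intro continuous_on_mat_mult[of _ _ N] ct continuous_on_const mult_carrier_sq smult_carrier_mat) auto
  qed (use l Xc in auto)
  then have "zlink N ?X (x * w l) x" using w1 xc by (simp add: right_mult_one_mat[of _ N N])
  moreover have "zlink N ?X (1\<^sub>m N) (x * w l)"
  proof -
    have "parabolically_connected N (SL N) (Sp_ext n \<Omega>)" using Sp_ext_parabolically_connected(1)[OF \<Omega>] unfolding NM .
    moreover have "x * w l \<in> Sp_ext n \<Omega>" unfolding sim_Sp using xw(1)[OF l(1)] l(1) by simp
    ultimately have "zlink N {x \<in> Sp_ext n \<Omega>. h * x * g \<in> UT N} (1\<^sub>m N) (x * w l)"
      using parabolically_connected_link p xw(2)[OF l(1)] by blast
    then show ?thesis by (rule zlink_mono) (auto simp: sim_Sp sim_SpxT1)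
  qed
  ultimately show ?thesis unfolding NM using zlink_trans by blast
qed

lemma SpxT1_parabolically_connected:
  assumes "skew_nondeg (2 * n) \<Omega>" "n \<ge> 1"
  shows "parabolically_connected (2 * n + 1) (SL (2 * n + 1)) (SpxT1 n \<Omega>)"
  by (rule parabolically_connectedI[OF SpxT1_closed_subgroup[OF assms]]) (rule SpxT1_link[OF assms(1)])

section \<open>Disconnected intersections\<close>

text \<open>By \<open>regular_fun_finite_const\<close>, a regular function with finitely many values
  on the stabilizer of one flag, not all equal, disconnects it.\<close>

lemma not_parabolically_connected_separated:
  assumes p: "inv_pair N g h" and f: "regular_fun N f" and S: "finite S"
    and fS: "\<And>y. y \<in> H \<Longrightarrow> y \<in> SL N \<Longrightarrow> h * y * g \<in> UT N \<Longrightarrow> f y \<in> S"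
    and x: "x \<in> H" "x \<in> SL N" "h * x * g \<in> UT N" and one: "1\<^sub>m N \<in> H" and ne: "f x \<noteq> f (1\<^sub>m N)"
  shows "\<not> parabolically_connected N (SL N) H"
proof (rule not_parabolically_connectedI[OF p], rule notI)
  assume "zariski_connected N (Bor N g h \<inter> H)"
  moreover have "1\<^sub>m N \<in> Bor N g h \<inter> H" using mgroupD(3)[OF Bor_mgroup[OF p]] one by simp
  moreover have "x \<in> Bor N g h \<inter> H" using x by (simp add: Bor_def)
  ultimately have "zlink N (Bor N g h \<inter> H) (1\<^sub>m N) x" by (rule zariski_connected_imp_zlink)
  moreover have "Bor N g h \<inter> H \<subseteq> carrier_mat N N" by (auto simp: Bor_def SL_def)
  moreover have "f ` (Bor N g h \<inter> H) \<subseteq> S" using fS by (auto simp: Bor_def)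
  ultimately have "f x = f (1\<^sub>m N)" using regular_fun_finite_const f S by blast
  then show False using ne by simp
qed

text \<open>The flag runs through the diagonal copy of the \<open>n\<close>-dimensional space.
  Block-diagonal matrices preserving it have equal blocks, whose determinant has square 1; both
  signs occur.\<close>

lemma SGLxGL_not_parabolically_connected:
  assumes n: "n \<ge> 1"
  shows "\<not> parabolically_connected (2 * n) (SL (2 * n)) (SGLxGL n n)"
proof -
  define N where "N = n + n"
  \<comment> \<open>The first \<open>n\<close> columns of \<open>g\<close> span the diagonal, the
    remaining ones the first summand.\<close>
  define g h :: "complex mat" where "g = four_block_mat (1\<^sub>m n) (1\<^sub>m n) (1\<^sub>m n) (0\<^sub>m n n)"
    and "h = four_block_mat (0\<^sub>m n n) (1\<^sub>m n) (1\<^sub>m n) (- 1\<^sub>m n)"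
  have c: "g \<in> carrier_mat N N" "h \<in> carrier_mat N N" by (simp_all add: g_def h_def N_def)
  have "four_block_mat (1\<^sub>m n) (0\<^sub>m n n) (0\<^sub>m n n) (1\<^sub>m n) = (1\<^sub>m N :: complex mat)"
    by (auto simp: N_def intro!: eq_matI)
  moreover have "h * g = four_block_mat (1\<^sub>m n) (0\<^sub>m n n) (0\<^sub>m n n) (1\<^sub>m n)"
    unfolding g_def h_def
    by (subst mult_four_block_mat[of _ n n _ n _ n _ _ n _ n])
      (auto simp: left_mult_one_mat[of _ n n] intro!: eq_matI)
  ultimately have "h * g = 1\<^sub>m N" by simp
  then have p: "inv_pair N g h" using inv_pair_of_one_sided[OF c(2,1)] inv_pair_sym by blast
  have conj: "h * blockdiag A B * g = four_block_mat B (0\<^sub>m n n) (A - B) A"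
    if "A \<in> carrier_mat n n" "B \<in> carrier_mat n n" for A B :: "complex mat"
  proof -
    have "h * blockdiag A B = four_block_mat (0\<^sub>m n n) B A (- B)"
      unfolding h_def blockdiag_def using that
      by (subst mult_four_block_mat[of _ n n _ n _ n _ _ n _ n]) (auto simp: left_mult_one_mat[of _ n n])
    also have "\<dots> * g = four_block_mat B (0\<^sub>m n n) (A - B) A"
      unfolding g_def using that
      by (subst mult_four_block_mat[of _ n n _ n _ n _ _ n _ n]) (auto simp: right_mult_one_mat[of _ n n] intro!: arg_cong2[where f = "four_block_mat _ _"])
    finally show ?thesis .
  qed
  define f where "f x = det (ul n x)" for x
  have f: "regular_fun N f"
    unfolding f_def ul_def by (intro regular_fun_det[of N n] regular_map_mat regular_fun_coord) (auto simp: N_def)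
  have fb: "f (blockdiag A B) = det A" if "A \<in> carrier_mat n n" "B \<in> carrier_mat n n" for A B
    unfolding f_def using ul_lr_blockdiag(1)[OF that] by simp
  define A where "A = mat n n (\<lambda>(i, j). if i = j then if i = 0 then - 1 else 1 else (0 :: complex))"
  have A: "A \<in> carrier_mat n n" by (simp add: A_def)
  have AU: "A \<in> UT n" by (auto simp: A_def UTc_def)
  have "det A = (\<Prod>i<n. if i = 0 then - 1 else 1)"
    unfolding UT_det[OF AU] by (rule prod.cong) (auto simp: A_def)
  then have dA: "det A = - 1" using n by (simp add: prod.If_cases)
  have "\<not> parabolically_connected N (SL N) (SGLxGL n n)"
  proof (rule not_parabolically_connected_separated[OF p f, of "{1, -1}"])
    fix y assume y: "y \<in> SGLxGL n n" "h * y * g \<in> UT N"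
    obtain B D where BD: "y = blockdiag B D" "B \<in> carrier_mat n n" "D \<in> carrier_mat n n" "det B * det D = 1"
      using y(1) by (auto simp: SGLxGL_def)
    have U: "four_block_mat D (0\<^sub>m n n) (B - D) B \<in> UT N" using y(2) conj[OF BD(2,3)] BD(1) by simp
    have "B = D"
    proof (rule eq_matI)
      fix i j assume "i < dim_row D" "j < dim_col D"
      then have ij: "i < n" "j < n" using BD by auto
      have "four_block_mat D (0\<^sub>m n n) (B - D) B $$ (i + n, j) = 0"
        by (rule UTc_zero[OF U]) (use ij in \<open>auto simp: N_def\<close>)
      then show "B $$ (i, j) = D $$ (i, j)" using ij BD by simp
    qed (use BD in auto)
    then have "det B * det B = 1" using BD(4) by simp
    then have "det B = 1 \<or> det B = - 1" by (simp add: square_eq_1_iff)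
    then show "f y \<in> {1, - 1}" using fb[OF BD(2,3)] BD(1) by simp
  next
    show x: "blockdiag A A \<in> SGLxGL n n" unfolding SGLxGL_def
      by (rule CollectI, rule exI[of _ A], rule exI[of _ A]) (simp add: A dA)
    show "blockdiag A A \<in> SL N" using blockdiag_det[OF A A] blockdiag_carrier[OF A A] dA by (simp add: SL_def N_def)
    have z: "A - A = 0\<^sub>m n n" using A by simp
    show "h * blockdiag A A * g \<in> UT N"
      unfolding conj[OF A A] z using A by (auto simp: UTc_def N_def A_def)
    show "1\<^sub>m N \<in> SGLxGL n n" unfolding SGLxGL_def N_def
      by (rule CollectI, rule exI[of _ "1\<^sub>m n"], rule exI[of _ "1\<^sub>m n"]) (simp add: blockdiag_one)
    have "f (1\<^sub>m N) = 1" using fb[of "1\<^sub>m n" "1\<^sub>m n"] by (simp add: blockdiag_one N_def)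
    then show "f (blockdiag A A) \<noteq> f (1\<^sub>m N)" using fb[OF A A] dA by simp
  qed simp
  then show ?thesis by (simp add: N_def mult_2)
qed

section \<open>Reflections and special orthogonal groups\<close>

lemma outer_mult_vec:
  assumes "u \<in> carrier_vec N" "x \<in> carrier_vec N"
  shows "outer N u w *\<^sub>v x = (w \<bullet> x) \<cdot>\<^sub>v u"
proof (rule eq_vecI)
  fix i assume "i < dim_vec ((w \<bullet> x) \<cdot>\<^sub>v u)"
  then have i: "i < N" using assms by simp
  have "(outer N u w *\<^sub>v x) $ i = (\<Sum>l<N. outer N u w $$ (i, l) * x $ l)" by (rule mult_vec_entry[OF outer_carrier assms(2) i])
  also have "\<dots> = u $ i * (\<Sum>l<N. w $ l * x $ l)"
    unfolding sum_distrib_left by (rule sum.cong) (use i in \<open>auto simp: outer_def\<close>)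
  finally show "(outer N u w *\<^sub>v x) $ i = ((w \<bullet> x) \<cdot>\<^sub>v u) $ i"
    using i assms scalar_prod_sum[OF assms(2), of w] by (simp del: index_mult_mat_vec)
qed (use assms in \<open>simp add: outer_def\<close>)

text \<open>Polarization: if the quadratic form vanishes, so does the sum of an entry and its mirror
  image, which by symmetry is twice the entry.\<close>

lemma exists_anisotropic:
  assumes F: "F \<in> carrier_mat N N" "transpose_mat F = F" "F \<noteq> (0\<^sub>m N N :: complex mat)"
  shows "\<exists>x \<in> carrier_vec N. x \<bullet> (F *\<^sub>v x) \<noteq> 0"
proof (rule ccontr)
  assume "\<not> ?thesis"
  then have z: "x \<bullet> (F *\<^sub>v x) = 0" if "x \<in> carrier_vec N" for x using that by blast
  have "F $$ (i, j) = 0" if ij: "i < N" "j < N" for i j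
  proof -
    let ?a = "unit_vec N i :: complex vec" and ?b = "unit_vec N j :: complex vec"
    have e: "unit_vec N k \<bullet> (F *\<^sub>v unit_vec N l) = F $$ (k, l)" if "k < N" "l < N" for k l using F that by simp
    have c: "F *\<^sub>v ?a \<in> carrier_vec N" "F *\<^sub>v ?b \<in> carrier_vec N" using F by (auto intro!: mult_mat_vec_carrier)
    have "(?a + ?b) \<bullet> (F *\<^sub>v (?a + ?b)) = ?a \<bullet> (F *\<^sub>v ?a) + ?a \<bullet> (F *\<^sub>v ?b) + (?b \<bullet> (F *\<^sub>v ?a) + ?b \<bullet> (F *\<^sub>v ?b))"
      using F(1) c by (simp add: mult_add_distrib_mat_vec[of _ N N] scalar_prod_add_distrib[of _ N] add_scalar_prod_distrib[of _ N]
        del: scalar_prod_left_unit scalar_prod_right_unit)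
    then have "F $$ (i, j) + F $$ (j, i) = 0"
      using z[of "?a + ?b"] z[of ?a] z[of ?b] e[OF ij] e[OF ij(2,1)] by simp
    moreover have "F $$ (j, i) = F $$ (i, j)" using arg_cong[OF F(2), of "\<lambda>A. A $$ (i, j)"] F(1) ij by simp
    ultimately show ?thesis by simp
  qed
  then have "F = 0\<^sub>m N N" using F(1) by (intro eq_matI) auto
  then show False using F(3) by simp
qed

text \<open>The factor -2 of the reflection along \<open>u\<close> cancels the correction to the
  form, and \<open>det_one_plus_outer\<close> turns it into determinant -1.\<close>

lemma reflection:
  assumes Q: "Q \<in> carrier_mat N N" "transpose_mat Q = Q" and u: "u \<in> carrier_vec N" "u \<bullet> (Q *\<^sub>v u) \<noteq> (0 :: complex)"
    and s: "s = 1\<^sub>m N + (- 2 / (u \<bullet> (Q *\<^sub>v u))) \<cdot>\<^sub>m outer N u (Q *\<^sub>v u)"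
  shows "s \<in> carrier_mat N N" "transpose_mat s * Q * s = Q" "det s = - 1"
proof -
  define b k a where "b = u \<bullet> (Q *\<^sub>v u)" and "k = - 2 / b" and "a = Q *\<^sub>v u"
  have s: "s = 1\<^sub>m N + k \<cdot>\<^sub>m outer N u a" using s by (simp add: b_def k_def a_def)
  have a: "a \<in> carrier_vec N" unfolding a_def using Q(1) u(1) by (rule mult_mat_vec_carrier)
  have b: "u \<bullet> a = b" "a \<bullet> u = b" "b \<noteq> 0" using u(2) comm_scalar_prod[OF a u(1)] by (simp_all add: b_def a_def)
  show "s \<in> carrier_mat N N" by (simp add: s)
  have st: "transpose_mat s = 1\<^sub>m N + k \<cdot>\<^sub>m outer N a u" unfolding s by (auto simp: outer_def intro!: eq_matI)
  have stQ: "transpose_mat s * Q = Q + k \<cdot>\<^sub>m outer N a a"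
    unfolding st using Q u by (simp add: add_mult_distrib_mat[of _ N N _ _ N] mult_smult_assoc_mat[of _ N N _ N] left_mult_one_mat[of _ N N]
      outer_mult a_def)
  have "transpose_mat s * Q * s = (Q + k \<cdot>\<^sub>m outer N a a) + k \<cdot>\<^sub>m (outer N a a + k \<cdot>\<^sub>m (b \<cdot>\<^sub>m outer N a a))"
    unfolding stQ using Q(1) u(1) b(2) mult_outer[OF Q(1) u(1), of a] outer_outer[OF u(1), where v = a and w = a and b = a]
    by (simp add: s add_mult_distrib_mat[of _ N N _ _ N] mult_add_distrib_mat[of _ N N _ N] mult_smult_assoc_mat[of _ N N _ N]
      mult_smult_distrib[of _ N N _ N] right_mult_one_mat[of _ N N] a_def[symmetric])
  also have "\<dots> = Q + (k * (2 + k * b)) \<cdot>\<^sub>m outer N a a" using Q(1) by (auto simp: algebra_simps intro!: eq_matI)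
  also have "k * (2 + k * b) = 0" using b(3) by (simp add: k_def)
  also have "Q + 0 \<cdot>\<^sub>m outer N a a = Q" using Q(1) by (auto simp: outer_def intro!: eq_matI)
  finally show "transpose_mat s * Q * s = Q" .
  have "u \<noteq> 0\<^sub>v N" using b(1,3) a by auto
  then show "det s = - 1" unfolding s using det_one_plus_outer[OF u(1) _ a] b by (simp add: k_def)
qed

text \<open>The flag starts with an anisotropic line. An isometry stabilizing that line acts on it
  by 1 or -1, and -1 is attained with determinant 1 by composing the reflection along the line with
  one along an anisotropic vector orthogonal to it.\<close>

lemma SO_not_parabolically_connected:
  assumes Q: "sym_nondeg N Q" and N: "N \<ge> 2"
  shows "\<not> parabolically_connected N (SL N) (SO N Q)"
proof -
  have Q: "Q \<in> carrier_mat N N" "transpose_mat Q = Q" "det Q \<noteq> 0" using Q by (auto simp: sym_nondeg_def)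
  have Q0: "Q \<noteq> 0\<^sub>m N N" using Q(3) N by (auto simp: det_zero)
  obtain w where w: "w \<in> carrier_vec N" "w \<bullet> (Q *\<^sub>v w) \<noteq> 0" using exists_anisotropic[OF Q(1,2) Q0] by blast
  define a b where "a = Q *\<^sub>v w" and "b = w \<bullet> a"
  have a: "a \<in> carrier_vec N" unfolding a_def using Q(1) w(1) by (rule mult_mat_vec_carrier)
  have b: "b \<noteq> 0" "a \<bullet> w = b" using w comm_scalar_prod[OF a w(1)] by (simp_all add: b_def a_def)
  have sym: "x \<bullet> (Q *\<^sub>v y) = (Q *\<^sub>v x) \<bullet> y" if "x \<in> carrier_vec N" "y \<in> carrier_vec N" for x y
    using transpose_vec_mult_scalar[OF Q(1) that(2,1)] Q(2) by simp
  \<comment> \<open>The restriction of the form to the orthogonal complement of \<open>w\<close>,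
    extended by zero. It is nonzero because \<open>Q\<close>, nondegenerate of size at least 2, does
    not have rank one.\<close>
  define F where "F = Q - inverse b \<cdot>\<^sub>m outer N a a"
  have F: "F \<in> carrier_mat N N" "transpose_mat F = F"
  proof -
    show "F \<in> carrier_mat N N" using Q(1) by (simp add: F_def)
    have "Q $$ (j, i) = Q $$ (i, j)" if "i < N" "j < N" for i j
      using arg_cong[OF Q(2), of "\<lambda>A. A $$ (i, j)"] Q(1) that by simp
    then show "transpose_mat F = F" using Q(1) by (auto simp: F_def outer_def intro!: eq_matI)
  qed
  have "F \<noteq> 0\<^sub>m N N"
  proof
    assume "F = 0\<^sub>m N N"
    then have F0: "F $$ (i, j) = 0" if "i < N" "j < N" for i j using that by simp
    have "Q = inverse b \<cdot>\<^sub>m outer N a a"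
      by (rule eq_matI) (use F0 Q(1) in \<open>auto simp: F_def outer_def\<close>)
    moreover obtain \<Psi> where \<Psi>: "inv_pair N Q \<Psi>" using inv_pair_adj[OF Q(1,3)] by blast
    ultimately have "1\<^sub>m N = \<Psi> * (inverse b \<cdot>\<^sub>m outer N a a)" using inv_pairD(4)[OF \<Psi>] by simp
    also have "\<dots> = inverse b \<cdot>\<^sub>m outer N (\<Psi> *\<^sub>v a) a"
      using inv_pairD(2)[OF \<Psi>] a by (simp add: mult_smult_distrib[of _ N N _ N] mult_outer)
    finally have e: "(1\<^sub>m N :: complex mat) $$ (i, j) = inverse b * ((\<Psi> *\<^sub>v a) $ i * a $ j)" if "i < N" "j < N" for i j
      using that by (simp add: outer_def del: index_mult_mat_vec index_one_mat)
    have "inverse b * ((\<Psi> *\<^sub>v a) $ 0 * a $ 0) = 1" "inverse b * ((\<Psi> *\<^sub>v a) $ 1 * a $ 1) = 1" "inverse b * ((\<Psi> *\<^sub>v a) $ 0 * a $ 1) = 0"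
      using e[of 0 0] e[of 1 1] e[of 0 1] N by (simp_all del: index_mult_mat_vec)
    then show False by (metis mult_zero_left mult_zero_right mult_eq_0_iff zero_neq_one)
  qed
  then obtain x where x: "x \<in> carrier_vec N" "x \<bullet> (F *\<^sub>v x) \<noteq> 0" using exists_anisotropic[OF F] by blast
  \<comment> \<open>The orthogonal projection of \<open>x\<close> to the complement of
    \<open>w\<close>; its value under \<open>Q\<close> is that of \<open>x\<close> under
    \<open>F\<close>.\<close>
  define v where "v = x - (inverse b * (a \<bullet> x)) \<cdot>\<^sub>v w"
  have v: "v \<in> carrier_vec N" using x w by (simp add: v_def)
  have av: "a \<bullet> v = 0"
    unfolding v_def using a x w b by (simp add: scalar_prod_minus_distrib[of _ N])
  have Qv: "Q *\<^sub>v v = F *\<^sub>v x"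
  proof -
    have "Q *\<^sub>v v = Q *\<^sub>v x - (inverse b * (a \<bullet> x)) \<cdot>\<^sub>v a"
      unfolding v_def a_def using Q(1) x w by (simp add: mult_minus_distrib_mat_vec[of _ N N] mult_mat_vec[of _ N N])
    moreover have "F *\<^sub>v x = Q *\<^sub>v x - inverse b \<cdot>\<^sub>v ((a \<bullet> x) \<cdot>\<^sub>v a)"
      unfolding F_def using Q(1) x a by (simp add: minus_mult_distrib_mat_vec[of _ N N] smult_mat_vec[of _ N N] outer_mult_vec)
    ultimately show ?thesis by (simp add: smult_smult_assoc)
  qed
  have "w \<bullet> (F *\<^sub>v x) = 0" using sym[OF w(1) v] av unfolding Qv by (simp add: a_def)
  then have vv: "v \<bullet> (Q *\<^sub>v v) \<noteq> 0"
  proof -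
    assume z: "w \<bullet> (F *\<^sub>v x) = 0"
    have "F *\<^sub>v x \<in> carrier_vec N" using F(1) x(1) by (rule mult_mat_vec_carrier)
    then have "v \<bullet> (F *\<^sub>v x) = x \<bullet> (F *\<^sub>v x)"
      unfolding v_def using x(1) w(1) z by (simp add: minus_scalar_prod_distrib[of _ N])
    then show ?thesis unfolding Qv using x(2) by simp
  qed
  have N0: "0 < N" "1 < N" using N by auto
  have w0: "w \<noteq> 0\<^sub>v N" using b a by (auto simp: b_def)
  obtain i where i: "i < N" "w $ i \<noteq> 0" using w0 w(1) by (metis carrier_vecD eq_vecI index_zero_vec(1,2))
  obtain q q' where q: "inv_pair N q q'" "col q 0 = w"
    using exists_column_change[OF w(1), of 0 i] i by blast
  note dq = inv_pairD[OF q(1)]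
  define t where "t = q' *\<^sub>v v"
  have t: "t \<in> carrier_vec N" unfolding t_def using dq(2) v by (rule mult_mat_vec_carrier)
  have qt: "q *\<^sub>v t = v" unfolding t_def by (rule inv_pair_cancel_vec(1)[OF q(1) v])
  have qe: "q *\<^sub>v unit_vec N 0 = w" using q(2) dq(1) N0 by (intro eq_vecI) auto
  have "\<exists>i. 1 \<le> i \<and> i < N \<and> t $ i \<noteq> 0"
  proof (rule ccontr)
    assume "\<not> ?thesis"
    then have z: "t $ i = 0" if "1 \<le> i" "i < N" for i using that by blast
    have "t = t $ 0 \<cdot>\<^sub>v unit_vec N 0"
    proof (rule eq_vecI)
      fix i assume "i < dim_vec (t $ 0 \<cdot>\<^sub>v unit_vec N 0)"
      then show "t $ i = (t $ 0 \<cdot>\<^sub>v unit_vec N 0) $ i" using z[of i] by (cases "i = 0") auto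
    qed (use t in simp)
    then have "v = t $ 0 \<cdot>\<^sub>v w" using qt qe mult_mat_vec[OF dq(1) unit_vec_carrier, of "t $ 0" 0] by metis
    moreover from this have "t $ 0 * b = 0" using av a w(1) b(2) by simp
    ultimately have "v = 0 \<cdot>\<^sub>v w" using b(1) by simp
    also have "0 \<cdot>\<^sub>v w = 0\<^sub>v N" using w(1) by (intro eq_vecI) auto
    finally show False using vv mult_zero_vec[OF Q(1)] by simp
  qed
  then obtain i' where i': "1 \<le> i'" "i' < N" "t $ i' \<noteq> 0" by blast
  obtain r r' where r: "inv_pair N r r'" "col r 1 = t" "\<And>l. l < 1 \<Longrightarrow> col r l = unit_vec N l"
    using exists_column_change[OF t i'] by blast
  \<comment> \<open>The first two basis vectors of the flag are \<open>w\<close> and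
    \<open>v\<close>, so that both reflections are triangular.\<close>
  define g h where "g = q * r" and "h = r' * q'"
  have p: "inv_pair N g h" unfolding g_def h_def by (rule inv_pair_mult[OF q(1) r(1)])
  note d = inv_pairD[OF p]
  have g0: "g *\<^sub>v unit_vec N 0 = w" "g *\<^sub>v unit_vec N 1 = v"
  proof -
    have "r *\<^sub>v unit_vec N l = col r l" if "l < N" for l using inv_pairD(1)[OF r(1)] that by (intro eq_vecI) auto
    then show "g *\<^sub>v unit_vec N 0 = w" "g *\<^sub>v unit_vec N 1 = v"
      unfolding g_def using dq(1) inv_pairD(1)[OF r(1)] r(2) r(3)[of 0] N0 qe qt by (simp_all add: assoc_mult_mat_vec[of _ N N _ N])
  qed
  have hw: "h *\<^sub>v w = unit_vec N 0" "h *\<^sub>v v = unit_vec N 1"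
    using inv_pair_cancel_vec(2)[OF p, of "unit_vec N 0"] inv_pair_cancel_vec(2)[OF p, of "unit_vec N 1"] g0 by simp_all
  define refl where "refl u = 1\<^sub>m N + (- 2 / (u \<bullet> (Q *\<^sub>v u))) \<cdot>\<^sub>m outer N u (Q *\<^sub>v u)" for u
  note sw = reflection[OF Q(1,2) w refl_def] and sv = reflection[OF Q(1,2) v vv refl_def]
  have hsg: "h * refl u * g = 1\<^sub>m N + (- 2 / (u \<bullet> (Q *\<^sub>v u))) \<cdot>\<^sub>m outer N (h *\<^sub>v u) (transpose_mat g *\<^sub>v (Q *\<^sub>v u))"
    if u: "u \<in> carrier_vec N" for u
  proof -
    have Qu: "Q *\<^sub>v u \<in> carrier_vec N" using Q(1) u by (rule mult_mat_vec_carrier)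
    have "h * refl u * g = h * g + (- 2 / (u \<bullet> (Q *\<^sub>v u))) \<cdot>\<^sub>m (h * outer N u (Q *\<^sub>v u) * g)"
      unfolding refl_def using d(1,2) by (simp add: add_mult_distrib_mat[of _ N N _ _ N] mult_add_distrib_mat[of _ N N _ N]
        mult_smult_assoc_mat[of _ N N _ N] mult_smult_distrib[of _ N N _ N] right_mult_one_mat[of _ N N])
    also have "h * outer N u (Q *\<^sub>v u) * g = outer N (h *\<^sub>v u) (transpose_mat g *\<^sub>v (Q *\<^sub>v u))"
      unfolding mult_outer[OF d(2) u] by (rule outer_mult[OF d(1) Qu])
    finally show ?thesis unfolding d(4) .
  qed
  have tg: "(transpose_mat g *\<^sub>v (Q *\<^sub>v u)) $ 0 = (Q *\<^sub>v u) \<bullet> w" if u: "u \<in> carrier_vec N" for u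
  proof -
    have Qu: "Q *\<^sub>v u \<in> carrier_vec N" using Q(1) u by (rule mult_mat_vec_carrier)
    have "transpose_mat g *\<^sub>v (Q *\<^sub>v u) \<in> carrier_vec N" by (rule mult_mat_vec_carrier[OF _ Qu]) (use d in simp)
    moreover have "(transpose_mat g *\<^sub>v (Q *\<^sub>v u)) \<bullet> unit_vec N 0 = (Q *\<^sub>v u) \<bullet> w"
      using transpose_vec_mult_scalar[OF d(1) _ Qu, of "unit_vec N 0"] g0 by simp
    ultimately show ?thesis using N0 by (simp del: index_mult_mat_vec)
  qed
  have Uw: "h * refl w * g \<in> UT N" "(h * refl w * g) $$ (0, 0) = - 1"
    unfolding hsg[OF w(1)] hw using N0 tg[OF w(1)] b by (auto simp: UTc_def outer_def unit_vec_def a_def b_def simp del: index_mult_mat_vec)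
  have "(transpose_mat g *\<^sub>v (Q *\<^sub>v v)) $ 0 = 0"
    using tg[OF v] sym[OF v w(1)] comm_scalar_prod[OF v a] av by (simp add: a_def del: index_mult_mat_vec)
  then have Uv: "h * refl v * g \<in> UT N" "(h * refl v * g) $$ (0, 0) = 1"
    unfolding hsg[OF v] hw using N0 by (auto simp: UTc_def outer_def unit_vec_def less_Suc_eq simp del: index_mult_mat_vec)
  define X where "X = refl w * refl v"
  have Xc: "X \<in> carrier_mat N N" using sw sv by (simp add: X_def)
  have hXg: "h * X * g = (h * refl w * g) * (h * refl v * g)" unfolding X_def by (rule conj_mult[OF p sw(1) sv(1)])
  \<comment> \<open>On the stabilizer of the flag this is the eigenvalue on the line of
    \<open>w\<close>.\<close>
  define f where "f y = (h * y * g) $$ (0, 0)" for y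
  show ?thesis
  proof (rule not_parabolically_connected_separated[OF p, of f "{1, - 1}" _ X])
    show "regular_fun N f" unfolding f_def by (rule regular_map_entry[OF conj_regular[OF p]]) (use N0 in simp_all)
    fix y assume y: "y \<in> SO N Q" "h * y * g \<in> UT N"
    have yc: "y \<in> carrier_mat N N" and yQ: "transpose_mat y * Q * y = Q" using y(1) by (auto simp: SO_def)
    have "(h * y * g) *\<^sub>v unit_vec N 0 = f y \<cdot>\<^sub>v unit_vec N 0"
    proof (rule eq_vecI)
      fix i assume "i < dim_vec (f y \<cdot>\<^sub>v unit_vec N 0)"
      then have i: "i < N" by simp
      have "((h * y * g) *\<^sub>v unit_vec N 0) $ i = (h * y * g) $$ (i, 0)"
        using i N0 d yc by (simp add: index_row del: assoc_mult_mat index_mult_mat(1))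
      then show "((h * y * g) *\<^sub>v unit_vec N 0) $ i = (f y \<cdot>\<^sub>v unit_vec N 0) $ i"
        using UTc_zero[OF y(2), of 0 i] i N0 by (cases "i = 0") (simp_all add: f_def del: assoc_mult_mat index_mult_mat(1) index_mult_mat_vec)
    qed (use d in simp)
    then have "g *\<^sub>v ((h * y * g) *\<^sub>v unit_vec N 0) = g *\<^sub>v (f y \<cdot>\<^sub>v unit_vec N 0)" by simp
    moreover have "g *\<^sub>v ((h * y * g) *\<^sub>v unit_vec N 0) = (g * h) *\<^sub>v (y *\<^sub>v (g *\<^sub>v unit_vec N 0))"
      using d(1,2) yc by (simp add: assoc_mult_mat_vec[of _ N N _ N])
    moreover have "y *\<^sub>v w \<in> carrier_vec N" using yc w(1) by (rule mult_mat_vec_carrier)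
    ultimately have yw: "y *\<^sub>v w = f y \<cdot>\<^sub>v w"
      using g0 d(3) mult_mat_vec[OF d(1) unit_vec_carrier, of "f y" 0] by simp
    have Qyw: "Q *\<^sub>v (y *\<^sub>v w) = f y \<cdot>\<^sub>v a" unfolding yw a_def by (rule mult_mat_vec[OF Q(1) w(1)])
    have "b = w \<bullet> ((transpose_mat y * Q * y) *\<^sub>v w)" unfolding yQ by (simp add: b_def a_def)
    also have "(transpose_mat y * Q * y) *\<^sub>v w = transpose_mat y *\<^sub>v (Q *\<^sub>v (y *\<^sub>v w))"
      using yc Q(1) w(1) by (simp add: assoc_mult_mat_vec[of _ N N _ N])
    also have "w \<bullet> \<dots> = (transpose_mat (transpose_mat y) *\<^sub>v w) \<bullet> (Q *\<^sub>v (y *\<^sub>v w))"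
      unfolding Qyw by (rule transpose_vec_mult_scalar[symmetric]) (use yc w(1) a in auto)
    also have "\<dots> = f y * f y * b" unfolding Qyw using w(1) a by (simp add: yw b_def)
    finally have "f y * f y = 1" using b(1) by simp
    then show "f y \<in> {1, - 1}" by (simp add: square_eq_1_iff)
  next
    have "transpose_mat X * Q * X = transpose_mat (refl v) * (transpose_mat (refl w) * Q * refl w) * refl v"
      unfolding X_def using Q(1) sw(1) sv(1) by (simp add: transpose_mult[of _ N N _ N] assoc_mult_mat[of _ N N _ N _ N])
    then have "transpose_mat X * Q * X = Q" unfolding sw(2) sv(2) .
    moreover have dX: "det X = 1" unfolding X_def using det_mult[OF sw(1) sv(1)] sw(3) sv(3) by simp
    ultimately show "X \<in> SO N Q" using Xc by (simp add: SO_def)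
    show "X \<in> SL N" using Xc dX by (simp add: SL_def)
    show "h * X * g \<in> UT N" unfolding hXg by (rule UT_mult[OF Uw(1) Uv(1)])
    show "1\<^sub>m N \<in> SO N Q" using Q(1) by (simp add: SO_def left_mult_one_mat[of _ N N] right_mult_one_mat[of _ N N])
    have "f X = - 1" unfolding f_def hXg UT_mult_diag[OF Uw(1) Uv(1) N0(1)] Uw(2) Uv(2) by simp
    moreover have "f (1\<^sub>m N) = 1" unfolding f_def using d N0 by (simp add: right_mult_one_mat[of _ N N])
    ultimately show "f X \<noteq> f (1\<^sub>m N)" by simp
  qed simp
qed

theorem theorem1:
  fixes m n :: nat
  assumes "m \<ge> 1" and "n \<ge> 1"
  shows
    "parabolically_connected (m + n) (SL (m + n)) (SLxSL m n)
   \<and> (m \<noteq> n \<longrightarrow> parabolically_connected (m + n) (SL (m + n)) (SGLxGL m n))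
   \<and> (\<forall>\<Omega>. skew_nondeg (2*n) \<Omega> \<longrightarrow>
          parabolically_connected (2*n) (SL (2*n)) (Sp (2*n) \<Omega>))
   \<and> (\<forall>\<Omega>. skew_nondeg (2*n) \<Omega> \<longrightarrow>
          parabolically_connected (2*n+1) (SL (2*n+1)) (Sp_ext n \<Omega>))
   \<and> (\<forall>\<Omega>. skew_nondeg (2*n) \<Omega> \<longrightarrow>
          parabolically_connected (2*n+1) (SL (2*n+1)) (SpxT1 n \<Omega>))
   \<and> (n \<ge> 2 \<longrightarrow> (\<forall>Q. sym_nondeg n Q \<longrightarrow>
          \<not> parabolically_connected n (SL n) (SO n Q)))
   \<and> \<not> parabolically_connected (2*n) (SL (2*n)) (SGLxGL n n)"
proof (intro conjI impI allI)
  show "parabolically_connected (m + n) (SL (m + n)) (SLxSL m n)"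
    by (rule SLxSL_parabolically_connected[OF assms])
  show "parabolically_connected (m + n) (SL (m + n)) (SGLxGL m n)" if "m \<noteq> n"
    by (rule SGLxGL_parabolically_connected[OF that])
  fix \<Omega> assume \<Omega>: "skew_nondeg (2 * n) \<Omega>"
  show "parabolically_connected (2 * n) (SL (2 * n)) (Sp (2 * n) \<Omega>)"
    by (rule Sp_parabolically_connected(1)[OF \<Omega>])
  show "parabolically_connected (2 * n + 1) (SL (2 * n + 1)) (Sp_ext n \<Omega>)"
    by (rule Sp_ext_parabolically_connected(1)[OF \<Omega>])
  show "parabolically_connected (2 * n + 1) (SL (2 * n + 1)) (SpxT1 n \<Omega>)"
    by (rule SpxT1_parabolically_connected[OF \<Omega> assms(2)])
next
  show "\<not> parabolically_connected n (SL n) (SO n Q)" if "n \<ge> 2" "sym_nondeg n Q" for Q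
    by (rule SO_not_parabolically_connected[OF that(2,1)])
  show "\<not> parabolically_connected (2 * n) (SL (2 * n)) (SGLxGL n n)"
    by (rule SGLxGL_not_parabolically_connected[OF assms(2)])
qed

end
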